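(* Let $0<C_\tau<C_\nu$, let $\rho>0$ and let $\chi_{\mathrm{in}},\chi_{\mathrm{fin}}\in H^2(0,L;\mathbb{R}^2)$ with $|\chi_{\mathrm{in}}'(s)|=|\chi_{\mathrm{fin}}'(s)|=1$ for every $s\in[0,L]$. Assume that $\chi_{\mathrm{in}}$ and $\chi_{\mathrm{fin}}$ satisfy the two disks condition with radius $\rho$. Then there exists $\chi\in X_1$ satisfying the force and torque balance $$\int_0^L K_\chi(s,t)\dot\chi(s,t)\,ds=0,\qquad \int_0^L\langle K_\chi(s,t)\dot\chi(s,t),J\chi(s,t)\rangle\,ds=0\qquad\text{for a.e. }t\in[0,T],$$ such that $\chi(s,0)=\chi_{\mathrm{in}}(s)$ and $\chi(s,T)=\chi_{\mathrm{fin}}(s)$ for every $s\in[0,L]$, and such that for every $t\in[0,T]$ the curve $\chi(\cdot,t)$ satisfies the two disks condition with radius $\rho$.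
   Context: $L>0$, $T>0$ and the constants $C_\tau$, $C_\nu$ are fixed. A prime denotes $\partial/\partial s$ and a dot denotes the (distributional) derivative $\partial/\partial t$. $J=\begin{pmatrix}0&-1\\1&0\end{pmatrix}$, and $(a\otimes b)_{ij}=a_ib_j$. $X$ is the space of functions $\chi:[0,L]\times[0,T]\to\mathbb{R}^2$ with $\chi\in L^\infty(0,T;H^2(0,L))$ and $\dot\chi\in L^2(0,T;L^2(0,L))$. Each $\chi\in X$ belongs to $H^1(0,T;L^2(0,L))$ and is always identified with its representative for which $t\mapsto\chi(\cdot,t)$ is continuous from $[0,T]$ into $L^2(0,L)$; with this convention $\chi$ and $\chi'$ are continuous on $[0,L]\times[0,T]$ and $\chi(\cdot,t)\in H^2(0,L)$ for every $t$. $X_1:=\{\chi\in X: |\chi'|=1\text{ in }[0,L]\times[0,T]\}$. For $\chi\in X_1$, $$K_\chi(s,t):=C_\tau\,\chi'(s,t)\otimes\chi'(s,t)+C_\nu\,(J\chi'(s,t))\otimes(J\chi'(s,t)).$$ Two disks condition: a curve $\xi\in H^2(0,L;\mathbb{R}^2)$ with $|\xi'(s)|=1$ for every $s\in[0,L]$ satisfies the two disks condition with radius $\rho>0$ if (a) for every $s\in[0,L]$ there exist open disks $B^1(s),B^2(s)$ of radius $\rho$ such that $B^1(s)\cap B^2(s)=\emptyset$, $\xi(s)\in\overline{B^1(s)}\cap\overline{B^2(s)}$, and $\xi(\sigma)\notin B^1(s)\cup B^2(s)$ for every $\sigma\in[0,L]$; (b) there exist open half disks $B^-,B^+$ of radius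 $2\rho$ centered at $\xi(0)$ and $\xi(L)$, respectively, with diameters normal to $\xi'(0)$ and $\xi'(L)$, respectively, such that $\xi(\sigma)\notin B^-\cup B^+$ for every $\sigma\in[0,L]$. *)

theory Defs
  imports "HOL-Analysis.Analysis"
begin

subsection \<open>Test functions, weak derivatives, Lebesgue and Sobolev spaces\<close>

fun C_k :: "nat \<Rightarrow> ('a::euclidean_space \<Rightarrow> real) \<Rightarrow> bool" where
  "C_k 0 f \<longleftrightarrow> continuous_on UNIV f"
| "C_k (Suc k) f \<longleftrightarrow>
     (\<forall>x. f differentiable at x) \<and> (\<forall>v. C_k k (\<lambda>x. frechet_derivative f (at x) v))"

definition test_function :: "'a::euclidean_space set \<Rightarrow> ('a \<Rightarrow> real) \<Rightarrow> bool" where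
  "test_function U \<phi> \<longleftrightarrow>
     (\<forall>k. C_k k \<phi>) \<and> compact (closure {x. \<phi> x \<noteq> 0}) \<and> closure {x. \<phi> x \<noteq> 0} \<subseteq> U"

definition locally_integrable :: "'a::euclidean_space set \<Rightarrow> ('a \<Rightarrow> 'b::euclidean_space) \<Rightarrow> bool" where
  "locally_integrable U f \<longleftrightarrow> (\<forall>K. compact K \<and> K \<subseteq> U \<longrightarrow> f absolutely_integrable_on K)"

text \<open>\<open>g\<close> is the distributional derivative of \<open>f\<close> in the direction \<open>v\<close> on the open set \<open>U\<close>.\<close>

definition has_weak_deriv ::
  "'a::euclidean_space set \<Rightarrow> 'a \<Rightarrow> ('a \<Rightarrow> 'b::euclidean_space) \<Rightarrow> ('a \<Rightarrow> 'b) \<Rightarrow> bool" where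
  "has_weak_deriv U v f g \<longleftrightarrow>
     locally_integrable U f \<and> locally_integrable U g \<and>
     (\<forall>\<phi>. test_function U \<phi> \<longrightarrow>
        (LINT x:U|lebesgue. frechet_derivative \<phi> (at x) v *\<^sub>R f x) =
        - (LINT x:U|lebesgue. \<phi> x *\<^sub>R g x))"

definition L2 :: "'a::euclidean_space set \<Rightarrow> ('a \<Rightarrow> 'b::euclidean_space) set" where
  "L2 U = {f \<in> borel_measurable (lebesgue_on U). integrable (lebesgue_on U) (\<lambda>x. (norm (f x))\<^sup>2)}"

definition L2_norm :: "'a::euclidean_space set \<Rightarrow> ('a \<Rightarrow> 'b::euclidean_space) \<Rightarrow> real" where
  "L2_norm U f = sqrt (LINT x|lebesgue_on U. (norm (f x))\<^sup>2)"

definition H2 :: "real \<Rightarrow> (real \<Rightarrow> real^2) set" where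
  "H2 L = {f \<in> L2 {0<..<L}. \<exists>g \<in> L2 {0<..<L}. \<exists>h \<in> L2 {0<..<L}.
             has_weak_deriv {0<..<L} 1 f g \<and> has_weak_deriv {0<..<L} 1 g h}"

text \<open>Weak derivatives are unique up to null sets, so that the norm below does not depend on
  the choice.\<close>

definition weak_deriv :: "real \<Rightarrow> (real \<Rightarrow> real^2) \<Rightarrow> real \<Rightarrow> real^2" where
  "weak_deriv L f = (SOME g. has_weak_deriv {0<..<L} 1 f g)"

definition H2_norm :: "real \<Rightarrow> (real \<Rightarrow> real^2) \<Rightarrow> real" where
  "H2_norm L f = sqrt ((L2_norm {0<..<L} f)\<^sup>2 + (L2_norm {0<..<L} (weak_deriv L f))\<^sup>2
                       + (L2_norm {0<..<L} (weak_deriv L (weak_deriv L f)))\<^sup>2)"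

text \<open>Curves of class \<open>H\<^sup>2\<close> on the closed interval: the continuous representative, which
  is automatically continuously differentiable up to the end points. The derivative with respect
  to arc length is therefore the classical one, one-sided at \<open>0\<close> and \<open>L\<close>.\<close>

definition H2_curves :: "real \<Rightarrow> (real \<Rightarrow> real^2) set" where
  "H2_curves L = {\<xi> \<in> H2 L. continuous_on {0..L} \<xi>}"

definition sderiv :: "real \<Rightarrow> (real \<Rightarrow> real^2) \<Rightarrow> real \<Rightarrow> real^2" where
  "sderiv L \<xi> s = vector_derivative \<xi> (at s within {0..L})"

subsection \<open>The spaces \<open>X\<close> and \<open>X\<^sub>1\<close>\<close>

text \<open>Motions are called \<open>\<eta>\<close>, since the letter chi is the binder for vectors. A motion takes the arguments \<open>s\<close> and \<open>t\<close> in this order; only its values on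
  \<open>[0,L] \<times> [0,T]\<close> matter. Strong (Bochner) measurability of \<open>t \<mapsto> \<eta>(\<cdot>,t) \<in> H\<^sup>2(0,L)\<close>: it is
  almost everywhere the limit in \<open>H\<^sup>2(0,L)\<close> of simple functions \<open>S n\<close>.\<close>

definition strongly_measurable_H2 :: "real \<Rightarrow> real \<Rightarrow> (real \<Rightarrow> real \<Rightarrow> real^2) \<Rightarrow> bool" where
  "strongly_measurable_H2 L T \<eta> \<longleftrightarrow>
     (\<exists>S :: nat \<Rightarrow> real \<Rightarrow> (real \<Rightarrow> real^2).
        (\<forall>n. finite (S n ` {0<..<T}) \<and> S n ` {0<..<T} \<subseteq> H2 L \<and>
             (\<forall>u. {t \<in> {0<..<T}. S n t = u} \<in> sets lebesgue)) \<and>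
        (AE t in lebesgue_on {0<..<T}.
           (\<lambda>n. H2_norm L (\<lambda>s. S n t s - \<eta> s t)) \<longlonglongrightarrow> 0))"

definition Linfty_H2 :: "real \<Rightarrow> real \<Rightarrow> (real \<Rightarrow> real \<Rightarrow> real^2) set" where
  "Linfty_H2 L T = {\<eta>. (AE t in lebesgue_on {0<..<T}. (\<lambda>s. \<eta> s t) \<in> H2 L) \<and>
     strongly_measurable_H2 L T \<eta> \<and>
     (\<exists>M. AE t in lebesgue_on {0<..<T}. H2_norm L (\<lambda>s. \<eta> s t) \<le> M)}"

text \<open>\<open>\<omega>\<close> is the distributional time derivative of \<open>\<eta>\<close> and belongs to \<open>L\<^sup>2(0,T;L\<^sup>2(0,L))\<close>,
  which is identified as usual with \<open>L\<^sup>2\<close> of the rectangle.\<close>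

definition has_L2_time_deriv ::
  "real \<Rightarrow> real \<Rightarrow> (real \<Rightarrow> real \<Rightarrow> real^2) \<Rightarrow> (real \<Rightarrow> real \<Rightarrow> real^2) \<Rightarrow> bool" where
  "has_L2_time_deriv L T \<eta> \<omega> \<longleftrightarrow>
     (\<lambda>(s,t). \<omega> s t) \<in> L2 ({0<..<L} \<times> {0<..<T}) \<and>
     has_weak_deriv ({0<..<L} \<times> {0<..<T}) (0, 1) (\<lambda>(s,t). \<eta> s t) (\<lambda>(s,t). \<omega> s t)"

text \<open>The last two conditions fix the representative: \<open>t \<mapsto> \<eta>(\<cdot>,t)\<close> is continuous from
  \<open>[0,T]\<close> into \<open>L\<^sup>2(0,L)\<close>, and each \<open>\<eta>(\<cdot>,t)\<close>, which then lies in \<open>H\<^sup>2(0,L)\<close>, is continuous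
  on \<open>[0,L]\<close>.\<close>

definition X_space :: "real \<Rightarrow> real \<Rightarrow> (real \<Rightarrow> real \<Rightarrow> real^2) set" where
  "X_space L T = {\<eta> \<in> Linfty_H2 L T. (\<exists>\<omega>. has_L2_time_deriv L T \<eta> \<omega>) \<and>
     (\<forall>t\<^sub>0\<in>{0..T}. ((\<lambda>t. L2_norm {0<..<L} (\<lambda>s. \<eta> s t - \<eta> s t\<^sub>0)) \<longlongrightarrow> 0) (at t\<^sub>0 within {0..T})) \<and>
     (\<forall>t\<in>{0..T}. (\<lambda>s. \<eta> s t) \<in> H2_curves L)}"

definition X1_space :: "real \<Rightarrow> real \<Rightarrow> (real \<Rightarrow> real \<Rightarrow> real^2) set" where
  "X1_space L T =
     {\<eta> \<in> X_space L T. \<forall>s\<in>{0..L}. \<forall>t\<in>{0..T}. norm (sderiv L (\<lambda>\<sigma>. \<eta> \<sigma> t) s) = 1}"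

subsection \<open>The resistance matrix\<close>

definition J :: "real^2^2" where
  "J = vector [vector [0, -1], vector [1, 0]]"

definition outer :: "real^2 \<Rightarrow> real^2 \<Rightarrow> real^2^2" where
  "outer a b = (\<chi> i j. a $ i * b $ j)"

definition K_mat :: "real \<Rightarrow> real \<Rightarrow> real \<Rightarrow> (real \<Rightarrow> real \<Rightarrow> real^2) \<Rightarrow> real \<Rightarrow> real \<Rightarrow> real^2^2" where
  "K_mat C\<^sub>\<tau> C\<^sub>\<nu> L \<eta> s t =
     (let \<tau> = sderiv L (\<lambda>\<sigma>. \<eta> \<sigma> t) s
      in C\<^sub>\<tau> *\<^sub>R outer \<tau> \<tau> + C\<^sub>\<nu> *\<^sub>R outer (J *v \<tau>) (J *v \<tau>))"

subsection \<open>The two disks condition\<close>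

text \<open>The open half disk with center \<open>p\<close> and radius \<open>r\<close>, with diameter normal to \<open>n\<close>, on the side
  into which \<open>n\<close> points. For a nonzero vector \<open>v\<close>, the half disks with diameter normal to \<open>v\<close> are
  the two given by \<open>n = v\<close> and \<open>n = -v\<close>.\<close>

definition half_disk :: "real^2 \<Rightarrow> real \<Rightarrow> real^2 \<Rightarrow> (real^2) set" where
  "half_disk p r n = {x \<in> ball p r. (x - p) \<bullet> n > 0}"

definition two_disks :: "real \<Rightarrow> real \<Rightarrow> (real \<Rightarrow> real^2) \<Rightarrow> bool" where
  "two_disks L \<rho> \<xi> \<longleftrightarrow>
     (\<forall>s\<in>{0..L}. \<exists>c\<^sub>1 c\<^sub>2.
        ball c\<^sub>1 \<rho> \<inter> ball c\<^sub>2 \<rho> = {} \<and>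
        \<xi> s \<in> closure (ball c\<^sub>1 \<rho>) \<inter> closure (ball c\<^sub>2 \<rho>) \<and>
        (\<forall>\<sigma>\<in>{0..L}. \<xi> \<sigma> \<notin> ball c\<^sub>1 \<rho> \<union> ball c\<^sub>2 \<rho>)) \<and>
     (\<exists>n\<^sub>0\<in>{sderiv L \<xi> 0, - sderiv L \<xi> 0}. \<exists>n\<^sub>L\<in>{sderiv L \<xi> L, - sderiv L \<xi> L}.
        \<forall>\<sigma>\<in>{0..L}. \<xi> \<sigma> \<notin> half_disk (\<xi> 0) (2 * \<rho>) n\<^sub>0 \<union> half_disk (\<xi> L) (2 * \<rho>) n\<^sub>L)"

end

theory Submission
  imports Defs
begin

text \<open>For a curve of class \<open>H\<^sup>2\<close> with unit speed the two disks condition says that the curve avoids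
  the two tangent disks at each of its points and the half disks behind its ends (\<open>thick\<close>). Thickness is inherited by
  initial arcs and by enlargements, so zooming in on an end point is a path of thick curves that ends at a
  straight segment. Any path of shapes becomes a motion in balance after superposing a suitable path of
  rigid motions, because the \<open>3 \<times> 3\<close> resistance matrix is invertible; as the balance is invariant under
  reversal, concatenation and rigid motions, it remains to connect the segment with its rigid copies. Loops of
  small shapes with central symmetry can only rotate the segment about its midpoint, and loops of small
  shapes with mirror symmetry can only translate it along its normal. Since \<open>C\<^sub>\<tau> < C\<^sub>\<nu>\<close>, the resistance depends on
  the shape, so the net displacement of some loop is not zero. By continuity the displacements fill an
  interval, and hence by iteration the whole line; rotations and normal translations generate all rigid motions.\<close>

section \<open>Plane geometry\<close>

text \<open>Nothing says that a thick curve is simple, yet an initial arc keeps clear of the half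
  disk at its new end only because it does not meet the removed piece. Injectivity therefore has to
  be extracted from the disks and the end conditions. The curvature of an \<open>H2\<close> curve is
  merely square integrable, so that a zoom at constant rate may have unbounded velocity near the
  straight end; a clock that is slow there makes all motions continuously differentiable in time,
  and the frame is then found by quadrature alone. For the loops, the drift has to be known to the
  order at which it first appears. Bending the middle half and bending the outer quarters act on
  disjoint parts of the curve. This makes the forcing by the first mode constant along the
  unperturbed loop, and lets the remaining coefficients depend on its amplitude only to second
  order. Since the spaces are defined by weak derivatives, \<open>H2\<close> curves must be turned
  into classical data at the start, and a classical motion into a member of \<open>X1_space\<close>
  at the end.\<close>

lemma J_comp [simp]: "(J *v x) $ 1 = - x $ 2" "(J *v x) $ 2 = x $ 1"
  by (simp_all add: J_def matrix_vector_mult_def sum_2)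

lemma inner_2: "(x::real^2) \<bullet> y = x $ 1 * y $ 1 + x $ 2 * y $ 2"
  by (simp add: inner_vec_def sum_2)

lemma vec2_eq_iff: "(x::real^2) = y \<longleftrightarrow> x $ 1 = y $ 1 \<and> x $ 2 = y $ 2"
  by (simp add: vec_eq_iff forall_2)

lemma norm2_sq: "(norm (x::real^2))\<^sup>2 = (x $ 1)\<^sup>2 + (x $ 2)\<^sup>2"
  by (metis power2_norm_eq_inner inner_2 power2_eq_square)

lemma bounded_linear_J: "bounded_linear (\<lambda>x. J *v x)"
  by (rule matrix_vector_mul_bounded_linear)

lemmas J_linear_simps = linear_add[OF bounded_linear.linear[OF bounded_linear_J]]
  linear_diff[OF bounded_linear.linear[OF bounded_linear_J]]
  linear_neg[OF bounded_linear.linear[OF bounded_linear_J]]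
  linear_scale[OF bounded_linear.linear[OF bounded_linear_J]]

lemmas continuous_on_J [continuous_intros] = bounded_linear.continuous_on[OF bounded_linear_J]

lemma J_J [simp]: "J *v (J *v x) = - x"
  by (simp add: vec2_eq_iff)

lemma J_inner_J [simp]: "(J *v x) \<bullet> (J *v y) = x \<bullet> y"
  by (simp add: inner_2)

lemma norm_J [simp]: "norm (J *v x) = norm x"
  by (simp add: norm_eq_sqrt_inner)

lemma J_inner_self [simp]: "(J *v x) \<bullet> x = 0" "x \<bullet> (J *v x) = 0"
  by (simp_all add: inner_2)

lemma orthonormal_expansion:
  assumes "norm \<tau> = 1"
  shows "v = (\<tau> \<bullet> v) *\<^sub>R \<tau> + ((J *v \<tau>) \<bullet> v) *\<^sub>R (J *v \<tau>)"
proof -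
  have "(\<tau> $ 1)\<^sup>2 + (\<tau> $ 2)\<^sup>2 = 1"
    using assms norm2_sq[of \<tau>] by simp
  then have "((\<tau> $ 1)\<^sup>2 + (\<tau> $ 2)\<^sup>2) *\<^sub>R v = v"
    by simp
  moreover have "(\<tau> \<bullet> v) *\<^sub>R \<tau> + ((J *v \<tau>) \<bullet> v) *\<^sub>R (J *v \<tau>) = ((\<tau> $ 1)\<^sup>2 + (\<tau> $ 2)\<^sup>2) *\<^sub>R v"
    by (simp add: vec2_eq_iff inner_2 power2_eq_square algebra_simps)
  ultimately show ?thesis by simp
qed

lemma norm_sq_orthonormal:
  assumes "norm \<tau> = 1"
  shows "(norm v)\<^sup>2 = (\<tau> \<bullet> v)\<^sup>2 + ((J *v \<tau>) \<bullet> v)\<^sup>2"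
proof -
  have "(\<tau> $ 1)\<^sup>2 + (\<tau> $ 2)\<^sup>2 = 1"
    using assms norm2_sq[of \<tau>] by simp
  then have "((\<tau> $ 1)\<^sup>2 + (\<tau> $ 2)\<^sup>2) * (norm v)\<^sup>2 = (norm v)\<^sup>2"
    by simp
  moreover have "(\<tau> \<bullet> v)\<^sup>2 + ((J *v \<tau>) \<bullet> v)\<^sup>2 = ((\<tau> $ 1)\<^sup>2 + (\<tau> $ 2)\<^sup>2) * (norm v)\<^sup>2"
    unfolding norm2_sq by (simp add: inner_2 power2_eq_square algebra_simps)
  ultimately show ?thesis by simp
qed

lemma unit_orthogonal_J:
  assumes "norm (a::real^2) = 1" "norm b = 1" "a \<bullet> (J *v b) = 0"
  shows "a = b \<or> a = - b"
proof -
  have a: "a = (b \<bullet> a) *\<^sub>R b"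
    using orthonormal_expansion[OF assms(2), of a] assms(3) by (simp add: inner_commute)
  then have "norm a = \<bar>b \<bullet> a\<bar> * norm b"
    by (metis norm_scaleR)
  then have "\<bar>b \<bullet> a\<bar> = 1"
    using assms by simp
  then have "b \<bullet> a = 1 \<or> b \<bullet> a = - 1"
    by linarith
  then show ?thesis
    using a by (metis scaleR_minus1_left scaleR_one)
qed

definition rot :: "real \<Rightarrow> real^2 \<Rightarrow> real^2" where
  "rot \<theta> x = cos \<theta> *\<^sub>R x + sin \<theta> *\<^sub>R (J *v x)"

lemma rot_comp: "rot \<theta> x $ 1 = cos \<theta> * x $ 1 - sin \<theta> * x $ 2"
  "rot \<theta> x $ 2 = cos \<theta> * x $ 2 + sin \<theta> * x $ 1"
  by (simp_all add: rot_def)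

lemma bounded_linear_rot: "bounded_linear (rot \<theta>)"
  unfolding rot_def
  by (intro bounded_linear_add bounded_linear_const_scaleR bounded_linear_ident bounded_linear_J)

lemma rot_linear_simps:
  "rot \<theta> (x + y) = rot \<theta> x + rot \<theta> y" "rot \<theta> (x - y) = rot \<theta> x - rot \<theta> y"
  "rot \<theta> (- x) = - rot \<theta> x" "rot \<theta> (c *\<^sub>R x) = c *\<^sub>R rot \<theta> x" "rot \<theta> 0 = 0"
  by (simp_all add: vec2_eq_iff rot_comp algebra_simps)

lemma rot_0 [simp]: "rot 0 x = x"
  by (simp add: rot_def)

lemma rot_rot [simp]: "rot \<alpha> (rot \<beta> x) = rot (\<alpha> + \<beta>) x"
  by (simp add: vec2_eq_iff rot_comp cos_add sin_add algebra_simps)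

lemma J_rot: "J *v rot \<theta> x = rot \<theta> (J *v x)"
  by (simp add: vec2_eq_iff rot_comp algebra_simps)

lemma rot_inner [simp]: "rot \<theta> x \<bullet> rot \<theta> y = x \<bullet> y"
proof -
  have "rot \<theta> x \<bullet> rot \<theta> y = ((cos \<theta>)\<^sup>2 + (sin \<theta>)\<^sup>2) * (x \<bullet> y)"
    unfolding inner_2 rot_comp by (simp add: power2_eq_square algebra_simps del: sin_cos_squared_add3 sin_cos_squared_add sin_cos_squared_add2)
  also have "\<dots> = x \<bullet> y"
    by simp
  finally show ?thesis .
qed

lemma norm_rot [simp]: "norm (rot \<theta> x) = norm x"
  by (simp add: norm_eq_sqrt_inner)

lemma continuous_on_rot [continuous_intros]:
  fixes S :: "'a::t2_space set"
  shows "continuous_on S f \<Longrightarrow> continuous_on S g \<Longrightarrow> continuous_on S (\<lambda>x. rot (f x) (g x))"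
  unfolding rot_def by (auto intro!: continuous_intros)

text \<open>\<open>J\<close> commutes with \<open>rot\<close>, so the derivative of the rotation can
  be kept inside it. The result is the velocity of a moving frame written in body
  coordinates.\<close>

lemma rot_has_vector_derivative:
  assumes "(f has_real_derivative f') (at x within S)" "(g has_vector_derivative g') (at x within S)"
  shows "((\<lambda>x. rot (f x) (g x)) has_vector_derivative rot (f x) (g' + f' *\<^sub>R (J *v g x))) (at x within S)"
proof -
  have c: "((\<lambda>x. cos (f x)) has_real_derivative - sin (f x) * f') (at x within S)"
    "((\<lambda>x. sin (f x)) has_real_derivative cos (f x) * f') (at x within S)"
    using assms(1) by (auto intro!: derivative_eq_intros)
  have "((\<lambda>x. rot (f x) (g x)) has_vector_derivative
      (cos (f x) *\<^sub>R g' + (- sin (f x) * f') *\<^sub>R g x) +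
      (sin (f x) *\<^sub>R (J *v g') + (cos (f x) * f') *\<^sub>R (J *v g x))) (at x within S)"
    unfolding rot_def
    by (intro has_vector_derivative_add has_vector_derivative_scaleR c assms(2)
        bounded_linear.has_vector_derivative[OF bounded_linear_J])
  also have "(cos (f x) *\<^sub>R g' + (- sin (f x) * f') *\<^sub>R g x) +
      (sin (f x) *\<^sub>R (J *v g') + (cos (f x) * f') *\<^sub>R (J *v g x)) =
      rot (f x) (g' + f' *\<^sub>R (J *v g x))"
    by (simp add: vec2_eq_iff rot_comp algebra_simps)
  finally show ?thesis .
qed

text \<open>Polar coordinates are based on the second axis because it is the normal of
  \<open>segment\<close>, the direction in which straight segments will be translated.\<close>

lemma polar_e2: "\<exists>\<alpha>. (v::real^2) = norm v *\<^sub>R rot \<alpha> (axis 2 1)"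
proof (cases "v = 0")
  case False
  have "(v $ 2 / norm v)\<^sup>2 + (- v $ 1 / norm v)\<^sup>2 = ((v $ 1)\<^sup>2 + (v $ 2)\<^sup>2) / (norm v)\<^sup>2"
    by (simp add: power_divide add_divide_distrib)
  also have "\<dots> = 1"
    using False by (simp flip: norm2_sq)
  finally obtain \<alpha> where "v $ 2 / norm v = cos \<alpha>" "- v $ 1 / norm v = sin \<alpha>"
    using sincos_total_2pi by metis
  then have "v $ 2 = norm v * cos \<alpha>" "v $ 1 = - (norm v * sin \<alpha>)"
    using False by (auto simp: field_simps)
  then show ?thesis
    by (intro exI[of _ \<alpha>]) (simp add: vec2_eq_iff rot_comp axis_def)
qed (auto simp: rot_linear_simps)

section \<open>The two disks condition in terms of the tangent\<close>

text \<open>For a chord v, staying outside both disks of radius \<open>\<rho>\<close> that touch the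
  tangent line squares out to \<open>2 * \<rho> * \<bar>v \<bullet> (J *v \<tau> s)\<bar> \<le>
  (norm v)\<^sup>2\<close>. The end clauses are the half disks behind the start and ahead of the
  end. No choice of centres or sides is left, so that the condition is easy to scale.\<close>

definition thick :: "real \<Rightarrow> real \<Rightarrow> (real \<Rightarrow> real^2) \<Rightarrow> (real \<Rightarrow> real^2) \<Rightarrow> bool" where
  "thick L \<rho> \<xi> \<tau> \<longleftrightarrow>
     (\<forall>s\<in>{0..L}. \<forall>\<sigma>\<in>{0..L}.
        2 * \<rho> * \<bar>(\<xi> \<sigma> - \<xi> s) \<bullet> (J *v \<tau> s)\<bar> \<le> (norm (\<xi> \<sigma> - \<xi> s))\<^sup>2) \<and>
     (\<forall>\<sigma>\<in>{0..L}. norm (\<xi> \<sigma> - \<xi> 0) < 2 * \<rho> \<longrightarrow> (\<xi> \<sigma> - \<xi> 0) \<bullet> \<tau> 0 \<ge> 0) \<and>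
     (\<forall>\<sigma>\<in>{0..L}. norm (\<xi> \<sigma> - \<xi> L) < 2 * \<rho> \<longrightarrow> (\<xi> \<sigma> - \<xi> L) \<bullet> \<tau> L \<le> 0)"

text \<open>The tangent is carried as an explicit function instead of through \<open>sderiv\<close>,
  so that it can be rotated, rescaled and integrated.\<close>

definition unit_speed :: "real \<Rightarrow> (real \<Rightarrow> real^2) \<Rightarrow> (real \<Rightarrow> real^2) \<Rightarrow> bool" where
  "unit_speed L \<xi> \<tau> \<longleftrightarrow> continuous_on {0..L} \<tau> \<and>
     (\<forall>s\<in>{0..L}. (\<xi> has_vector_derivative \<tau> s) (at s within {0..L}) \<and> norm (\<tau> s) = 1)"

lemma thick_rigid:
  assumes "thick L \<rho> \<xi> \<tau>"
  shows "thick L \<rho> (\<lambda>s. p + rot \<theta> (\<xi> s)) (\<lambda>s. rot \<theta> (\<tau> s))"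
proof -
  have "(p + rot \<theta> x) - (p + rot \<theta> y) = rot \<theta> (x - y)" for x y
    by (simp add: rot_linear_simps)
  then show ?thesis
    using assms unfolding thick_def by (simp add: J_rot)
qed

lemma sderiv_eq:
  assumes "0 < L" "s \<in> {0..L}" "(\<xi> has_vector_derivative \<tau>) (at s within {0..L})"
  shows "sderiv L \<xi> s = \<tau>"
  unfolding sderiv_def
  using assms by (intro vector_derivative_within_cbox[of 0 L, simplified]) auto

lemma first_order:
  assumes "unit_speed L \<xi> \<tau>" "s \<in> {0..L}" "0 < e"
  obtains d where "0 < d"
    "\<And>\<sigma>. \<sigma> \<in> {0..L} \<Longrightarrow> \<bar>\<sigma> - s\<bar> < d \<Longrightarrow> norm (\<xi> \<sigma> - \<xi> s - (\<sigma> - s) *\<^sub>R \<tau> s) \<le> e * \<bar>\<sigma> - s\<bar>"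
proof -
  have "(\<xi> has_derivative (\<lambda>h. h *\<^sub>R \<tau> s)) (at s within {0..L})"
    using assms unfolding unit_speed_def has_vector_derivative_def by blast
  then have "\<exists>d>0. \<forall>y\<in>{0..L}. norm (y - s) < d \<longrightarrow>
      norm (\<xi> y - \<xi> s - (y - s) *\<^sub>R \<tau> s) \<le> e * norm (y - s)"
    using \<open>0 < e\<close> unfolding has_derivative_within_alt by blast
  then show ?thesis
    using that by (auto simp: real_norm_def)
qed

text \<open>A step of length x along the curve moves the component along n by about
  \<open>\<bar>\<tau> s \<bullet> n\<bar> * x\<close>, whereas the assumption allows only a multiple
  of \<open>x\<^sup>2 / \<rho>\<close>.\<close>

lemma tangent_of_disks:
  assumes c: "unit_speed L \<xi> \<tau>" and "0 < L" and s: "s \<in> {0..L}" and "0 < \<rho>"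
    and dk: "\<And>\<sigma>. \<sigma> \<in> {0..L} \<Longrightarrow> 2 * \<rho> * \<bar>(\<xi> \<sigma> - \<xi> s) \<bullet> n\<bar> \<le> (norm (\<xi> \<sigma> - \<xi> s))\<^sup>2"
  shows "\<tau> s \<bullet> n = 0"
proof (rule ccontr)
  assume nz: "\<tau> s \<bullet> n \<noteq> 0"
  define k where "k = \<bar>\<tau> s \<bullet> n\<bar>"
  have k: "k > 0" using nz k_def by simp
  have n0: "norm n > 0" using nz by auto
  obtain d where d: "0 < d" "\<And>\<sigma>. \<sigma> \<in> {0..L} \<Longrightarrow> \<bar>\<sigma> - s\<bar> < d \<Longrightarrow>
      norm (\<xi> \<sigma> - \<xi> s - (\<sigma> - s) *\<^sub>R \<tau> s) \<le> min 1 (k / (2 * norm n)) * \<bar>\<sigma> - s\<bar>"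
    using first_order[OF c s, of "min 1 (k / (2 * norm n))"] k n0 by auto
  \<comment> \<open>\<open>L / 2\<close> leaves room for a step of length x to at least one side of
    s, and \<open>\<rho> * k / 8\<close> contradicts the final
    \<open>\<rho> * k \<le> 4 * x\<close>.\<close>
  define x where "x = Min {d / 2, \<rho> * k / 8, L / 2}"
  have x: "0 < x" "x < d" "x \<le> \<rho> * k / 8" "x \<le> L / 2"
    unfolding x_def using d k \<open>0 < L\<close> \<open>0 < \<rho>\<close> by (auto simp: min_less_iff_disj)
  obtain \<sigma> where \<sigma>: "\<sigma> \<in> {0..L}" "\<bar>\<sigma> - s\<bar> = x"
  proof (cases "s \<le> L / 2")
    case True
    with that[of "s + x"] x s show ?thesis by auto
  next
    case False
    with that[of "s - x"] x s show ?thesis by auto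
  qed
  define r where "r = \<xi> \<sigma> - \<xi> s - (\<sigma> - s) *\<^sub>R \<tau> s"
  have r: "norm r \<le> min 1 (k / (2 * norm n)) * x"
    using d(2)[OF \<sigma>(1)] \<sigma> x r_def by auto
  have D: "\<xi> \<sigma> - \<xi> s = (\<sigma> - s) *\<^sub>R \<tau> s + r" by (simp add: r_def)
  have "min 1 (k / (2 * norm n)) * x \<le> 1 * x"
    using x by (intro mult_right_mono) auto
  then have r1: "norm r \<le> x" using r by simp
  have "norm (\<xi> \<sigma> - \<xi> s) \<le> \<bar>\<sigma> - s\<bar> * norm (\<tau> s) + norm r"
    unfolding D using norm_triangle_ineq[of "(\<sigma> - s) *\<^sub>R \<tau> s" r] by simp
  also have "\<dots> \<le> 2 * x"
    using c s \<sigma> r1 unfolding unit_speed_def by auto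
  finally have up: "(norm (\<xi> \<sigma> - \<xi> s))\<^sup>2 \<le> (2 * x)\<^sup>2"
    by (intro power_mono) auto
  have "\<bar>r \<bullet> n\<bar> \<le> norm r * norm n" by (rule Cauchy_Schwarz_ineq2)
  also have "\<dots> \<le> (k / (2 * norm n) * x) * norm n"
    using r x n0 by (intro mult_right_mono order_trans[OF r]) auto
  also have "\<dots> = k * x / 2" using n0 by simp
  finally have rn: "\<bar>r \<bullet> n\<bar> \<le> k * x / 2" .
  have "\<bar>((\<sigma> - s) *\<^sub>R \<tau> s) \<bullet> n\<bar> = k * x"
    using \<sigma> by (simp add: abs_mult k_def)
  then have "\<bar>(\<xi> \<sigma> - \<xi> s) \<bullet> n\<bar> \<ge> k * x / 2"
    unfolding D inner_add_left using rn by arith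
  then have "2 * \<rho> * (k * x / 2) \<le> 2 * \<rho> * \<bar>(\<xi> \<sigma> - \<xi> s) \<bullet> n\<bar>"
    using \<open>0 < \<rho>\<close> by simp
  also have "\<dots> \<le> (2 * x)\<^sup>2" using dk[OF \<sigma>(1)] up by linarith
  finally have "\<rho> * k * x \<le> 4 * x * x" by (simp add: power2_eq_square)
  then have "\<rho> * k \<le> 4 * x" using x by simp
  moreover have "0 < \<rho> * k" using k \<open>0 < \<rho>\<close> by simp
  ultimately show False using x by linarith
qed

text \<open>Two disjoint disks of equal radius whose closures share a point touch there, so their
  centres lie opposite each other, and \<open>tangent_of_disks\<close> puts them on the normal. The
  sides of the half disks are forced because the curve itself enters the other ones.\<close>

lemma two_disks_imp_thick:
  assumes "0 < L" "0 < \<rho>" and c: "unit_speed L \<xi> \<tau>" and td: "two_disks L \<rho> \<xi>"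
  shows "thick L \<rho> \<xi> \<tau>"
proof -
  have sd: "sderiv L \<xi> s = \<tau> s" if "s \<in> {0..L}" for s
    using sderiv_eq[OF \<open>0 < L\<close> that] c that unfolding unit_speed_def by blast
  have A: "2 * \<rho> * \<bar>(\<xi> \<sigma> - \<xi> s) \<bullet> (J *v \<tau> s)\<bar> \<le> (norm (\<xi> \<sigma> - \<xi> s))\<^sup>2"
    if s: "s \<in> {0..L}" and \<sigma>: "\<sigma> \<in> {0..L}" for s \<sigma>
  proof -
    obtain c1 c2 where dis: "ball c1 \<rho> \<inter> ball c2 \<rho> = {}"
      and cl: "\<xi> s \<in> closure (ball c1 \<rho>) \<inter> closure (ball c2 \<rho>)"
      and av: "\<And>\<sigma>. \<sigma> \<in> {0..L} \<Longrightarrow> \<xi> \<sigma> \<notin> ball c1 \<rho> \<union> ball c2 \<rho>"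
      using td s unfolding two_disks_def by blast
    have n1: "norm (c1 - \<xi> s) \<le> \<rho>" "norm (c2 - \<xi> s) \<le> \<rho>"
      using cl \<open>0 < \<rho>\<close> by (auto simp: dist_norm)
    \<comment> \<open>The midpoint of the centres cannot lie in both balls. As it is equidistant
      from the centres, these are at least \<open>2 * \<rho>\<close> apart.\<close>
    define m where "m = (1/2) *\<^sub>R (c1 + c2)"
    have "m \<notin> ball c1 \<rho> \<or> m \<notin> ball c2 \<rho>" using dis by blast
    moreover have "c1 - m = (1/2) *\<^sub>R (c1 - c2)" "c2 - m = - ((1/2) *\<^sub>R (c1 - c2))"
      by (simp_all add: m_def vec2_eq_iff field_simps)
    ultimately have far: "norm (c1 - c2) \<ge> 2 * \<rho>"
      by (auto simp: dist_norm)
    define a where "a = c1 - \<xi> s"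
    define b where "b = c2 - \<xi> s"
    have ab: "norm a \<le> \<rho>" "norm b \<le> \<rho>" "norm (a - b) \<ge> 2 * \<rho>"
      using n1 far by (simp_all add: a_def b_def)
    have sq: "(norm a)\<^sup>2 \<le> \<rho>\<^sup>2" "(norm b)\<^sup>2 \<le> \<rho>\<^sup>2" "(norm (a - b))\<^sup>2 \<ge> (2 * \<rho>)\<^sup>2"
      using ab \<open>0 < \<rho>\<close> by (intro power_mono; simp)+
    \<comment> \<open>By the parallelogram law, two vectors of length at most \<open>\<rho>\<close>
      whose difference has length at least \<open>2 * \<rho>\<close> are opposite.\<close>
    have "(norm (a + b))\<^sup>2 + (norm (a - b))\<^sup>2 = 2 * (norm a)\<^sup>2 + 2 * (norm b)\<^sup>2"
      unfolding power2_norm_eq_inner by (simp add: inner_simps inner_commute)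
    moreover have "(2 * \<rho>)\<^sup>2 = 4 * \<rho>\<^sup>2" by simp
    ultimately have "(norm (a + b))\<^sup>2 \<le> 0" using sq by linarith
    then have "a + b = 0" by simp
    then have ba: "b = - a" by (simp add: add_eq_0_iff)
    then have na: "norm a = \<rho>" using ab by (simp flip: scaleR_2)
    have dk: "2 * \<bar>(\<xi> u - \<xi> s) \<bullet> a\<bar> \<le> (norm (\<xi> u - \<xi> s))\<^sup>2" if "u \<in> {0..L}" for u
    proof -
      define v where "v = \<xi> u - \<xi> s"
      have "norm (a - v) \<ge> \<rho>" "norm (b - v) \<ge> \<rho>"
        using av[OF that] by (auto simp: a_def b_def v_def dist_norm)
      then have "(norm (a - v))\<^sup>2 \<ge> \<rho>\<^sup>2" "(norm (- a - v))\<^sup>2 \<ge> \<rho>\<^sup>2"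
        using \<open>0 < \<rho>\<close> ba by (auto intro!: power_mono)
      moreover have "(norm (a - v))\<^sup>2 = \<rho>\<^sup>2 - 2 * (v \<bullet> a) + (norm v)\<^sup>2"
        "(norm (- a - v))\<^sup>2 = \<rho>\<^sup>2 + 2 * (v \<bullet> a) + (norm v)\<^sup>2"
        unfolding na[symmetric] power2_norm_eq_inner by (simp_all add: inner_simps inner_commute)
      ultimately show ?thesis unfolding v_def[symmetric] by linarith
    qed
    define n where "n = (1 / \<rho>) *\<^sub>R a"
    have nn: "norm n = 1" using na \<open>0 < \<rho>\<close> by (simp add: n_def)
    have dn: "2 * \<rho> * \<bar>(\<xi> u - \<xi> s) \<bullet> n\<bar> \<le> (norm (\<xi> u - \<xi> s))\<^sup>2" if "u \<in> {0..L}" for u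
      using dk[OF that] \<open>0 < \<rho>\<close> by (simp add: n_def abs_mult)
    have "\<tau> s \<bullet> n = 0"
      by (rule tangent_of_disks[OF c \<open>0 < L\<close> s \<open>0 < \<rho>\<close> dn])
    then have "n \<bullet> (J *v (J *v \<tau> s)) = 0" by (simp add: inner_commute)
    then have "n = J *v \<tau> s \<or> n = - (J *v \<tau> s)"
      using unit_orthogonal_J[OF nn, of "J *v \<tau> s"] c s unfolding unit_speed_def by simp
    then show ?thesis using dn[OF \<sigma>] by auto
  qed
  obtain n0 nL where n: "n0 \<in> {\<tau> 0, - \<tau> 0}" "nL \<in> {\<tau> L, - \<tau> L}"
    and av: "\<And>\<sigma>. \<sigma> \<in> {0..L} \<Longrightarrow> \<xi> \<sigma> \<notin> half_disk (\<xi> 0) (2 * \<rho>) n0 \<union> half_disk (\<xi> L) (2 * \<rho>) nL"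
  proof -
    have "sderiv L \<xi> 0 = \<tau> 0" "sderiv L \<xi> L = \<tau> L"
      using sd \<open>0 < L\<close> by auto
    then show ?thesis
      using td that unfolding two_disks_def by (simp only: ) blast
  qed
  \<comment> \<open>Just beside an end s the curve lies in the half disk on the side into which it
    runs, \<open>e\<close> being the sign of that direction. This excludes
    \<open>n0 = \<tau> 0\<close> and \<open>nL = - \<tau> L\<close>.\<close>
  have near: "\<exists>\<sigma>\<in>{0..L}. \<xi> \<sigma> \<in> half_disk (\<xi> s) (2 * \<rho>) (e *\<^sub>R \<tau> s)"
    if s: "s \<in> {0..L}" and e: "\<bar>e\<bar> = 1" and dir: "s + e * L / 2 \<in> {0..L}" for s e
  proof -
    obtain d where d: "0 < d" "\<And>\<sigma>. \<sigma> \<in> {0..L} \<Longrightarrow> \<bar>\<sigma> - s\<bar> < d \<Longrightarrow>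
        norm (\<xi> \<sigma> - \<xi> s - (\<sigma> - s) *\<^sub>R \<tau> s) \<le> (1/2) * \<bar>\<sigma> - s\<bar>"
      using first_order[OF c s, of "1/2"] by auto
    define x where "x = Min {d / 2, \<rho> / 2, L / 2}"
    have x: "0 < x" "x < d" "x \<le> \<rho> / 2" "x \<le> L / 2"
      unfolding x_def using d \<open>0 < L\<close> \<open>0 < \<rho>\<close> by (auto simp: min_less_iff_disj)
    have e': "e = 1 \<or> e = -1" using e by linarith
    have \<sigma>: "s + e * x \<in> {0..L}" using e' dir x s by auto
    define r where "r = \<xi> (s + e * x) - \<xi> s - (e * x) *\<^sub>R \<tau> s"
    have "\<bar>e * x\<bar> = x" using e x by (simp add: abs_mult)
    then have r: "norm r \<le> x / 2"
      using d(2)[OF \<sigma>] x by (simp add: r_def)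
    have D: "\<xi> (s + e * x) - \<xi> s = (e * x) *\<^sub>R \<tau> s + r" by (simp add: r_def)
    have nt: "norm (\<tau> s) = 1" using c s unfolding unit_speed_def by auto
    have "norm (\<xi> (s + e * x) - \<xi> s) \<le> x + x / 2"
      unfolding D using norm_triangle_ineq[of "(e * x) *\<^sub>R \<tau> s" r] r nt \<open>\<bar>e * x\<bar> = x\<close> by simp
    then have "norm (\<xi> (s + e * x) - \<xi> s) < 2 * \<rho>" using x \<open>0 < \<rho>\<close> by linarith
    moreover have "(\<xi> (s + e * x) - \<xi> s) \<bullet> (e *\<^sub>R \<tau> s) > 0"
    proof -
      have "\<bar>r \<bullet> (e *\<^sub>R \<tau> s)\<bar> \<le> norm r * norm (e *\<^sub>R \<tau> s)" by (rule Cauchy_Schwarz_ineq2)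
      then have "\<bar>r \<bullet> (e *\<^sub>R \<tau> s)\<bar> \<le> x / 2" using r nt e by simp
      moreover have "((e * x) *\<^sub>R \<tau> s) \<bullet> (e *\<^sub>R \<tau> s) = x"
        using nt e' by (auto simp: dot_square_norm)
      ultimately show ?thesis unfolding D inner_add_left using x by linarith
    qed
    ultimately show ?thesis
      using \<sigma> unfolding half_disk_def by (auto simp: dist_norm norm_minus_commute)
  qed
  have "n0 \<noteq> \<tau> 0" using near[of 0 1] av \<open>0 < L\<close> by auto
  then have "n0 = - \<tau> 0" using n by auto
  moreover have "nL \<noteq> - \<tau> L" using near[of L "-1"] av \<open>0 < L\<close> by auto
  then have "nL = \<tau> L" using n by auto
  ultimately have nd: "\<xi> \<sigma> \<notin> half_disk (\<xi> 0) (2 * \<rho>) (- \<tau> 0)" "\<xi> \<sigma> \<notin> half_disk (\<xi> L) (2 * \<rho>) (\<tau> L)"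
    if "\<sigma> \<in> {0..L}" for \<sigma>
    using av[OF that] by auto
  have "norm (\<xi> \<sigma> - \<xi> 0) < 2 * \<rho> \<longrightarrow> (\<xi> \<sigma> - \<xi> 0) \<bullet> \<tau> 0 \<ge> 0"
    "norm (\<xi> \<sigma> - \<xi> L) < 2 * \<rho> \<longrightarrow> (\<xi> \<sigma> - \<xi> L) \<bullet> \<tau> L \<le> 0"
    if "\<sigma> \<in> {0..L}" for \<sigma>
    using nd[OF that] norm_minus_commute[of "\<xi> \<sigma>"] by (auto simp: half_disk_def dist_norm not_less)
  then show ?thesis
    unfolding thick_def using A by blast
qed

lemma thick_imp_two_disks:
  assumes "0 < L" "0 < \<rho>" and c: "unit_speed L \<xi> \<tau>" and th: "thick L \<rho> \<xi> \<tau>"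
  shows "two_disks L \<rho> \<xi>"
proof -
  have sd: "sderiv L \<xi> s = \<tau> s" if "s \<in> {0..L}" for s
    using sderiv_eq[OF \<open>0 < L\<close> that] c that unfolding unit_speed_def by blast
  have A: "\<exists>c\<^sub>1 c\<^sub>2. ball c\<^sub>1 \<rho> \<inter> ball c\<^sub>2 \<rho> = {} \<and> \<xi> s \<in> closure (ball c\<^sub>1 \<rho>) \<inter> closure (ball c\<^sub>2 \<rho>) \<and>
        (\<forall>\<sigma>\<in>{0..L}. \<xi> \<sigma> \<notin> ball c\<^sub>1 \<rho> \<union> ball c\<^sub>2 \<rho>)" if s: "s \<in> {0..L}" for s
  proof -
    define a where "a = \<rho> *\<^sub>R (J *v \<tau> s)"
    have na: "norm a = \<rho>"
      using c s \<open>0 < \<rho>\<close> unfolding unit_speed_def a_def by simp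
    have "\<xi> \<sigma> \<notin> ball (\<xi> s + a) \<rho> \<union> ball (\<xi> s - a) \<rho>" if "\<sigma> \<in> {0..L}" for \<sigma>
    proof -
      define v where "v = \<xi> \<sigma> - \<xi> s"
      have "2 * \<bar>v \<bullet> a\<bar> \<le> (norm v)\<^sup>2"
        using th s that \<open>0 < \<rho>\<close> unfolding thick_def v_def a_def
        by (simp add: abs_mult mult.assoc del: atLeastAtMost_iff)
      moreover have "(norm (a - v))\<^sup>2 = \<rho>\<^sup>2 - 2 * (v \<bullet> a) + (norm v)\<^sup>2"
        "(norm (- a - v))\<^sup>2 = \<rho>\<^sup>2 + 2 * (v \<bullet> a) + (norm v)\<^sup>2"
        unfolding na[symmetric] power2_norm_eq_inner by (simp_all add: inner_simps inner_commute)
      ultimately have "(norm (a - v))\<^sup>2 \<ge> \<rho>\<^sup>2" "(norm (- a - v))\<^sup>2 \<ge> \<rho>\<^sup>2" by linarith+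
      then have "norm (a - v) \<ge> \<rho>" "norm (- a - v) \<ge> \<rho>"
        by (auto intro: power2_le_imp_le)
      moreover have eq: "\<xi> s + a - \<xi> \<sigma> = a - v" "\<xi> s - a - \<xi> \<sigma> = - a - v" by (simp_all add: v_def)
      ultimately show ?thesis by (simp only: Un_iff mem_ball dist_norm eq) simp
    qed
    moreover have "ball (\<xi> s + a) \<rho> \<inter> ball (\<xi> s - a) \<rho> = {}"
    proof (rule disjoint_ballI)
      have "\<xi> s + a - (\<xi> s - a) = 2 *\<^sub>R a" by (simp add: scaleR_2)
      then show "dist (\<xi> s + a) (\<xi> s - a) \<ge> \<rho> + \<rho>" by (simp add: dist_norm na)
    qed
    ultimately show ?thesis
      using \<open>0 < \<rho>\<close> na by (intro exI[of _ "\<xi> s + a"] exI[of _ "\<xi> s - a"]) (auto simp: dist_norm)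
  qed
  have "\<forall>\<sigma>\<in>{0..L}. \<xi> \<sigma> \<notin> half_disk (\<xi> 0) (2 * \<rho>) (- \<tau> 0) \<union> half_disk (\<xi> L) (2 * \<rho>) (\<tau> L)"
    using th unfolding thick_def half_disk_def by (force simp: dist_norm norm_minus_commute)
  then show ?thesis
    using A sd[of 0] sd[of L] \<open>0 < L\<close> unfolding two_disks_def by auto
qed

section \<open>Initial arcs of thick curves\<close>

lemma unit_speed_continuous: "unit_speed L \<xi> \<tau> \<Longrightarrow> continuous_on {0..L} \<xi>"
  unfolding unit_speed_def
  by (meson continuous_on_eq_continuous_within has_vector_derivative_continuous)

lemma dist_sq_derivative:
  assumes "unit_speed L \<xi> \<tau>" "y \<in> {0..L}"
  shows "((\<lambda>z. (norm (\<xi> z - p))\<^sup>2) has_real_derivative 2 * ((\<xi> y - p) \<bullet> \<tau> y)) (at y within {0..L})"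
proof -
  have d: "(\<xi> has_derivative (\<lambda>h. h *\<^sub>R \<tau> y)) (at y within {0..L})"
    using assms unfolding unit_speed_def has_vector_derivative_def by blast
  have "((\<lambda>z. (\<xi> z - p) \<bullet> (\<xi> z - p)) has_derivative (\<lambda>h. h * (2 * ((\<xi> y - p) \<bullet> \<tau> y)))) (at y within {0..L})"
    by (auto intro!: derivative_eq_intros d simp: inner_commute algebra_simps)
  then show ?thesis
    by (simp add: power2_norm_eq_inner has_field_derivative_def mult_commute_abs)
qed

text \<open>These are one-sided derivative tests for the squared distance to p. At an interior
  minimiser both apply, so that p lies on the normal there; at an end of the arc only one sign is
  available.\<close>

lemma nearest_point:
  assumes c: "unit_speed L \<xi> \<tau>" and sub: "0 \<le> \<alpha>" "\<beta> \<le> L" and y: "\<alpha> \<le> y" "y \<le> \<beta>"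
    and min: "\<And>z. \<alpha> \<le> z \<Longrightarrow> z \<le> \<beta> \<Longrightarrow> norm (\<xi> y - p) \<le> norm (\<xi> z - p)"
  shows "y < \<beta> \<Longrightarrow> (\<xi> y - p) \<bullet> \<tau> y \<ge> 0" "\<alpha> < y \<Longrightarrow> (\<xi> y - p) \<bullet> \<tau> y \<le> 0"
proof -
  have yL: "y \<in> {0..L}" using sub y by auto
  have min': "\<not> (norm (\<xi> z - p))\<^sup>2 < (norm (\<xi> y - p))\<^sup>2" if "\<alpha> \<le> z" "z \<le> \<beta>" for z
    using power_mono[OF min[OF that] norm_ge_zero, of 2] by linarith
  note D = dist_sq_derivative[OF c yL, of p]
  show "(\<xi> y - p) \<bullet> \<tau> y \<ge> 0" if "y < \<beta>"
  proof (rule ccontr)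
    assume "\<not> ?thesis"
    then obtain d where d: "d > 0" "\<And>h. h > 0 \<Longrightarrow> y + h \<in> {0..L} \<Longrightarrow> h < d \<Longrightarrow>
        (norm (\<xi> (y + h) - p))\<^sup>2 < (norm (\<xi> y - p))\<^sup>2"
      using has_real_derivative_neg_dec_right[OF D] by force
    define h where "h = min (d / 2) (\<beta> - y)"
    have "h > 0" "h < d" "y + h \<le> \<beta>" using d that by (auto simp: h_def)
    then show False using d(2)[of h] min'[of "y + h"] sub y by auto
  qed
  show "(\<xi> y - p) \<bullet> \<tau> y \<le> 0" if "\<alpha> < y"
  proof (rule ccontr)
    assume "\<not> ?thesis"
    then obtain d where d: "d > 0" "\<And>h. h > 0 \<Longrightarrow> y - h \<in> {0..L} \<Longrightarrow> h < d \<Longrightarrow>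
        (norm (\<xi> (y - h) - p))\<^sup>2 < (norm (\<xi> y - p))\<^sup>2"
      using has_real_derivative_pos_inc_left[OF D] by force
    define h where "h = min (d / 2) (y - \<alpha>)"
    have "h > 0" "h < d" "y - h \<ge> \<alpha>" using d that by (auto simp: h_def)
    then show False using d(2)[of h] min'[of "y - h"] sub y by auto
  qed
qed

text \<open>A nonzero chord that leaves y along the normal must have length at least
  \<open>2 * \<rho>\<close> to avoid the tangent disks. Together with \<open>nearest_point\<close>
  this turns nearness into coincidence.\<close>

lemma thick_normal_foot:
  assumes c: "unit_speed L \<xi> \<tau>" and th: "thick L \<rho> \<xi> \<tau>"
    and y: "y \<in> {0..L}" and \<sigma>: "\<sigma> \<in> {0..L}"
    and perp: "(\<xi> y - \<xi> \<sigma>) \<bullet> \<tau> y = 0" and near: "norm (\<xi> y - \<xi> \<sigma>) < 2 * \<rho>"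
  shows "\<xi> y = \<xi> \<sigma>"
proof (rule ccontr)
  assume "\<xi> y \<noteq> \<xi> \<sigma>"
  define v where "v = \<xi> \<sigma> - \<xi> y"
  have v: "norm v > 0" "norm v < 2 * \<rho>"
    using \<open>\<xi> y \<noteq> \<xi> \<sigma>\<close> near by (auto simp: v_def norm_minus_commute)
  have "\<tau> y \<bullet> v = 0" using perp by (simp add: v_def inner_simps inner_commute)
  then have "(norm v)\<^sup>2 = (v \<bullet> (J *v \<tau> y))\<^sup>2"
    using norm_sq_orthonormal[of "\<tau> y" v] c y unfolding unit_speed_def by (simp add: inner_commute)
  then have "norm v = \<bar>v \<bullet> (J *v \<tau> y)\<bar>"
    by (metis abs_norm_cancel power2_eq_iff_nonneg abs_ge_zero norm_ge_zero power2_abs)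
  moreover have "2 * \<rho> * \<bar>v \<bullet> (J *v \<tau> y)\<bar> \<le> (norm v)\<^sup>2"
    using th y \<sigma> unfolding thick_def v_def by blast
  ultimately have "2 * \<rho> * norm v \<le> norm v * norm v" by (simp add: power2_eq_square)
  then show False using v by simp
qed

text \<open>Two strands that meet with parallel (\<open>e = 1\<close>) or antiparallel (\<open>e = -1\<close>) tangents cannot
  separate: a point of the second strand just after the meeting has its nearest point in the interior of
  a short arc of the first one, hence lies on it.\<close>

lemma meeting_continues:
  assumes "0 < \<rho>" and c: "unit_speed L \<xi> \<tau>" and th: "thick L \<rho> \<xi> \<tau>"
    and \<sigma>: "0 \<le> \<sigma>" "\<sigma> < L" and u: "u \<in> {0..L}" and meet: "\<xi> u = \<xi> \<sigma>"
    and e: "e = 1 \<or> e = - 1" and par: "\<tau> u = e *\<^sub>R \<tau> \<sigma>"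
    and room: "0 < c0" "u + e * c0 \<in> {0..L}" and "0 < \<epsilon>"
  obtains x y where "0 < x" "x < \<epsilon>" "0 < y" "y < \<epsilon>" "u + e * x \<in> {0..L}" "\<sigma> + y \<in> {0..L}"
    "\<xi> (u + e * x) = \<xi> (\<sigma> + y)" "norm (\<tau> (u + e * x) - e *\<^sub>R \<tau> (\<sigma> + y)) < 1"
proof -
  have tc: "continuous_on {0..L} \<tau>" using c unfolding unit_speed_def by blast
  have \<sigma>L: "\<sigma> \<in> {0..L}" using \<sigma> by auto
  obtain e1 where e1: "0 < e1" "\<And>z. z \<in> {0..L} \<Longrightarrow> dist z \<sigma> < e1 \<Longrightarrow> dist (\<tau> z) (\<tau> \<sigma>) < 1/2"
    using tc \<sigma>L unfolding continuous_on_iff by (meson half_gt_zero zero_less_one)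
  obtain e2 where e2: "0 < e2" "\<And>z. z \<in> {0..L} \<Longrightarrow> dist z u < e2 \<Longrightarrow> dist (\<tau> z) (\<tau> u) < 1/2"
    using tc u unfolding continuous_on_iff by (meson half_gt_zero zero_less_one)
  obtain d1 where d1: "0 < d1" "\<And>z. z \<in> {0..L} \<Longrightarrow> \<bar>z - \<sigma>\<bar> < d1 \<Longrightarrow>
      norm (\<xi> z - \<xi> \<sigma> - (z - \<sigma>) *\<^sub>R \<tau> \<sigma>) \<le> (1/4) * \<bar>z - \<sigma>\<bar>"
    using first_order[OF c \<sigma>L, of "1/4"] by auto
  obtain d2 where d2: "0 < d2" "\<And>z. z \<in> {0..L} \<Longrightarrow> \<bar>z - u\<bar> < d2 \<Longrightarrow>
      norm (\<xi> z - \<xi> u - (z - u) *\<^sub>R \<tau> u) \<le> (1/4) * \<bar>z - u\<bar>"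
    using first_order[OF c u, of "1/4"] by auto
  \<comment> \<open>\<open>E\<close> is the length of the arc of the first strand that is searched,
    and x is the step on the second strand. The bound \<open>x \<le> E / 8\<close> keeps the nearest
    point away from the far end of the arc, and \<open>x \<le> \<rho> / 2\<close> keeps the distance
    below \<open>2 * \<rho>\<close>.\<close>
  define E where "E = Min {\<epsilon> / 2, e1 / 2, d1 / 2, L - \<sigma>}"
  have E: "0 < E" "E < \<epsilon>" "E < e1" "E < d1" "E \<le> L - \<sigma>"
    unfolding E_def using \<open>0 < \<epsilon>\<close> e1 d1 \<sigma> by (auto simp: min_less_iff_disj)
  define x where "x = Min {E / 8, c0, \<rho> / 2, d2 / 2, e2 / 2}"
  have x: "0 < x" "x \<le> E / 8" "x \<le> c0" "x \<le> \<rho> / 2" "x < d2" "x < e2"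
    unfolding x_def using E room \<open>0 < \<rho>\<close> d2 e2 by (auto simp: min_less_iff_disj)
  have ux: "u + e * x \<in> {0..L}" using e room x u by auto
  have ex: "\<bar>e * x\<bar> = x" "\<bar>e\<bar> = 1" "e * e = 1" using e x by auto
  define p where "p = \<xi> (u + e * x)"
  define r where "r = p - \<xi> \<sigma> - x *\<^sub>R \<tau> \<sigma>"
  have "r = \<xi> (u + e * x) - \<xi> u - (u + e * x - u) *\<^sub>R \<tau> u"
    using e by (auto simp: r_def p_def par meet)
  then have r: "norm r \<le> x / 4"
    using d2(2)[OF ux] x ex by simp
  have P: "p - \<xi> \<sigma> = x *\<^sub>R \<tau> \<sigma> + r" by (simp add: r_def)
  have nt: "norm (\<tau> z) = 1" if "z \<in> {0..L}" for z using c that unfolding unit_speed_def by blast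
  have np: "norm (p - \<xi> \<sigma>) \<le> 5 * x / 4"
    unfolding P using norm_triangle_ineq[of "x *\<^sub>R \<tau> \<sigma>" r] r nt[OF \<sigma>L] x by simp
  have "continuous_on {\<sigma>..\<sigma> + E} (\<lambda>z. norm (\<xi> z - p))"
    using unit_speed_continuous[OF c] E \<sigma>
    by (intro continuous_intros) (auto elim!: continuous_on_subset)
  then obtain z where z: "\<sigma> \<le> z" "z \<le> \<sigma> + E"
    and zmin: "\<And>w. \<sigma> \<le> w \<Longrightarrow> w \<le> \<sigma> + E \<Longrightarrow> norm (\<xi> z - p) \<le> norm (\<xi> w - p)"
    using continuous_attains_inf[of "{\<sigma>..\<sigma> + E}" "\<lambda>z. norm (\<xi> z - p)"] E by force
  have zL: "z \<in> {0..L}" using z E \<sigma> by auto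
  have near: "norm (\<xi> z - p) \<le> 5 * x / 4"
    using zmin[of \<sigma>] np E by (simp add: norm_minus_commute)
  have "z \<noteq> \<sigma>"
  proof
    assume "z = \<sigma>"
    then have "(\<xi> \<sigma> - p) \<bullet> \<tau> \<sigma> \<ge> 0"
      using nearest_point(1)[OF c, of \<sigma> "\<sigma> + E" z p] zmin E \<sigma> by auto
    moreover have "(\<xi> \<sigma> - p) \<bullet> \<tau> \<sigma> = - ((p - \<xi> \<sigma>) \<bullet> \<tau> \<sigma>)" by (simp add: inner_diff_left)
    moreover have "(p - \<xi> \<sigma>) \<bullet> \<tau> \<sigma> = x + r \<bullet> \<tau> \<sigma>"
      unfolding P inner_add_left using nt[OF \<sigma>L] by (simp add: dot_square_norm)
    moreover have "\<bar>r \<bullet> \<tau> \<sigma>\<bar> \<le> x / 4"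
      using Cauchy_Schwarz_ineq2[of r "\<tau> \<sigma>"] r nt[OF \<sigma>L] by simp
    ultimately show False using x by linarith
  qed
  moreover have "z \<noteq> \<sigma> + E"
  proof
    assume zE: "z = \<sigma> + E"
    have "norm (\<xi> z - \<xi> \<sigma> - E *\<^sub>R \<tau> \<sigma>) \<le> E / 4"
      using d1(2)[OF zL] E zE by simp
    moreover have "norm (E *\<^sub>R \<tau> \<sigma>) = E" using nt[OF \<sigma>L] E by simp
    moreover have "norm (E *\<^sub>R \<tau> \<sigma>) \<le> norm (\<xi> z - \<xi> \<sigma>) + norm (\<xi> z - \<xi> \<sigma> - E *\<^sub>R \<tau> \<sigma>)"
      using norm_triangle_ineq4[of "\<xi> z - \<xi> \<sigma>" "\<xi> z - \<xi> \<sigma> - E *\<^sub>R \<tau> \<sigma>"] by simp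
    moreover have "norm (\<xi> z - \<xi> \<sigma>) \<le> norm (\<xi> z - p) + norm (p - \<xi> \<sigma>)"
      using norm_triangle_ineq[of "\<xi> z - p" "p - \<xi> \<sigma>"] by simp
    ultimately show False using near np x by linarith
  qed
  ultimately have z': "\<sigma> < z" "z < \<sigma> + E" using z by auto
  have "(\<xi> z - p) \<bullet> \<tau> z = 0"
    using nearest_point[OF c, of \<sigma> "\<sigma> + E" z p] zmin E \<sigma> z z' by force
  moreover have "norm (\<xi> z - p) < 2 * \<rho>" using near x \<open>0 < \<rho>\<close> by linarith
  ultimately have eq: "\<xi> z = p"
    using thick_normal_foot[OF c th zL ux] by (simp add: p_def)
  \<comment> \<open>The tangents at the new meeting are within distance 1 of being related by the
    sign \<open>e\<close>. Since tangents at a meeting can only be equal or opposite, the type of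
    the meeting is preserved.\<close>
  have "dist (\<tau> z) (\<tau> \<sigma>) < 1/2" using e1(2)[OF zL] z z' E by (simp add: dist_real_def)
  moreover have "dist (\<tau> (u + e * x)) (\<tau> u) < 1/2" using e2(2)[OF ux] x ex by (simp add: dist_real_def)
  moreover have "norm (\<tau> (u + e * x) - e *\<^sub>R \<tau> z) \<le> norm (\<tau> (u + e * x) - \<tau> u) + norm (\<tau> u - e *\<^sub>R \<tau> z)"
    using norm_triangle_ineq[of "\<tau> (u + e * x) - \<tau> u" "\<tau> u - e *\<^sub>R \<tau> z"] by simp
  moreover have "norm (\<tau> u - e *\<^sub>R \<tau> z) = norm (\<tau> \<sigma> - \<tau> z)"
    unfolding par using ex by (simp flip: scaleR_diff_right)
  ultimately have "norm (\<tau> (u + e * x) - e *\<^sub>R \<tau> z) < 1"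
    by (simp add: dist_norm norm_minus_commute)
  then show ?thesis
    using that[of x "z - \<sigma>"] x E z' ux zL eq by (simp add: p_def)
qed

text \<open>The disks tangent at \<open>\<sigma>\<close> touch the curve at the same point as the
  strand through \<open>u\<close>, which has to avoid them as well; so \<open>\<tau> u\<close> is
  tangent to them.\<close>

lemma meeting_tangents:
  assumes "0 < L" "0 < \<rho>" and c: "unit_speed L \<xi> \<tau>" and th: "thick L \<rho> \<xi> \<tau>"
    and \<sigma>: "\<sigma> \<in> {0..L}" and u: "u \<in> {0..L}" and meet: "\<xi> u = \<xi> \<sigma>"
  shows "\<tau> u = \<tau> \<sigma> \<or> \<tau> u = - \<tau> \<sigma>"
proof -
  have "\<tau> u \<bullet> (J *v \<tau> \<sigma>) = 0"
    using tangent_of_disks[OF c \<open>0 < L\<close> u \<open>0 < \<rho>\<close>, of "J *v \<tau> \<sigma>"] th \<sigma> meet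
    unfolding thick_def by auto
  then show ?thesis
    using unit_orthogonal_J c \<sigma> u unfolding unit_speed_def by blast
qed

text \<open>Over parameter distances below d the tangent turns by less than 60 degrees, so the
  component along \<open>\<tau> \<sigma>\<close> strictly increases. This keeps the two parameters
  of a meeting a fixed distance apart.\<close>

lemma locally_injective:
  assumes c: "unit_speed L \<xi> \<tau>"
  obtains d where "0 < d" "\<And>\<sigma> u. 0 \<le> \<sigma> \<Longrightarrow> \<sigma> < u \<Longrightarrow> u \<le> L \<Longrightarrow> u < \<sigma> + d \<Longrightarrow> \<xi> u \<noteq> \<xi> \<sigma>"
proof -
  have "uniformly_continuous_on {0..L} \<tau>"
    using c unfolding unit_speed_def by (blast intro: compact_uniformly_continuous compact_Icc)
  then obtain d where d: "0 < d" "\<And>x y. x \<in> {0..L} \<Longrightarrow> y \<in> {0..L} \<Longrightarrow> dist x y < d \<Longrightarrow> dist (\<tau> x) (\<tau> y) < 1"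
    unfolding uniformly_continuous_on_def by (metis zero_less_one)
  have "\<xi> u \<noteq> \<xi> \<sigma>" if h: "0 \<le> \<sigma>" "\<sigma> < u" "u \<le> L" "u < \<sigma> + d" for \<sigma> u
  proof -
    have der: "((\<lambda>r. \<xi> r \<bullet> \<tau> \<sigma>) has_derivative (\<lambda>y. y * (\<tau> x \<bullet> \<tau> \<sigma>))) (at x within {\<sigma>..u})"
      if "x \<in> {\<sigma>..u}" for x
    proof -
      have "(\<xi> has_derivative (\<lambda>y. y *\<^sub>R \<tau> x)) (at x within {0..L})"
        using c that h unfolding unit_speed_def has_vector_derivative_def by auto
      then have "(\<xi> has_derivative (\<lambda>y. y *\<^sub>R \<tau> x)) (at x within {\<sigma>..u})"
        by (rule has_derivative_subset) (use h in auto)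
      then show ?thesis by (auto intro!: derivative_eq_intros)
    qed
    have "\<exists>x\<in>{\<sigma><..<u}. \<xi> u \<bullet> \<tau> \<sigma> - \<xi> \<sigma> \<bullet> \<tau> \<sigma> = (u - \<sigma>) * (\<tau> x \<bullet> \<tau> \<sigma>)"
      by (rule mvt_simple[OF \<open>\<sigma> < u\<close> der]) auto
    then obtain x where x: "\<sigma> < x" "x < u" "\<xi> u \<bullet> \<tau> \<sigma> - \<xi> \<sigma> \<bullet> \<tau> \<sigma> = (u - \<sigma>) * (\<tau> x \<bullet> \<tau> \<sigma>)" by auto
    have "dist (\<tau> x) (\<tau> \<sigma>) < 1" using d(2)[of x \<sigma>] x h by (auto simp: dist_real_def)
    moreover have "norm (\<tau> x) = 1" "norm (\<tau> \<sigma>) = 1" using c x h unfolding unit_speed_def by auto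
    moreover have "(norm (\<tau> x - \<tau> \<sigma>))\<^sup>2 = (norm (\<tau> x))\<^sup>2 + (norm (\<tau> \<sigma>))\<^sup>2 - 2 * (\<tau> x \<bullet> \<tau> \<sigma>)"
      unfolding power2_norm_eq_inner by (simp add: inner_simps inner_commute)
    moreover have "(norm (\<tau> x - \<tau> \<sigma>))\<^sup>2 \<le> 1"
      using \<open>dist (\<tau> x) (\<tau> \<sigma>) < 1\<close> by (simp add: dist_norm abs_square_le_1)
    ultimately have "\<tau> x \<bullet> \<tau> \<sigma> > 0" by simp
    then show ?thesis using x h by auto
  qed
  then show ?thesis using that d by blast
qed

text \<open>The gap d removes the diagonal, where the equations with \<open>e = 1\<close> hold
  trivially. With \<open>e = -1\<close> the value \<open>d = 0\<close> will do, because no unit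
  tangent is opposite to itself.\<close>

lemma compact_meetings:
  assumes c: "unit_speed L \<xi> \<tau>"
  shows "compact {(\<sigma>, u). 0 \<le> \<sigma> \<and> \<sigma> + d \<le> u \<and> u \<le> L \<and> \<sigma> \<le> L \<and> 0 \<le> u \<and> \<xi> u = \<xi> \<sigma> \<and> \<tau> u = e *\<^sub>R \<tau> \<sigma>}"
proof -
  define S where "S = {p \<in> {0..L} \<times> {0..L}. fst p + d \<le> snd p}"
  have S: "compact S"
  proof -
    have "S = ({0..L} \<times> {0..L}) \<inter> {p. fst p + d \<le> snd p}" by (auto simp: S_def)
    moreover have "closed {p::real\<times>real. fst p + d \<le> snd p}"
      by (intro closed_Collect_le continuous_intros)
    ultimately show ?thesis by (simp add: compact_Int_closed compact_Times)
  qed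
  define G where "G p = (\<xi> (snd p) - \<xi> (fst p), \<tau> (snd p) - e *\<^sub>R \<tau> (fst p))" for p
  have "continuous_on S (\<lambda>p. f (snd p))" "continuous_on S (\<lambda>p. f (fst p))"
    if "continuous_on {0..L} f" for f :: "real \<Rightarrow> real^2"
    by (rule continuous_on_compose2[OF that]; (intro continuous_intros)?; auto simp: S_def)+
  moreover have "continuous_on {0..L} \<xi>" "continuous_on {0..L} \<tau>"
    using c unit_speed_continuous[OF c] unfolding unit_speed_def by auto
  ultimately have "continuous_on S G"
    unfolding G_def by (intro continuous_on_Pair continuous_on_diff continuous_on_scaleR continuous_on_const) auto
  then have "closed {p \<in> S. G p = 0}"
    by (rule continuous_closed_preimage_constant) (use S compact_imp_closed in blast)
  then have "compact (S \<inter> {p \<in> S. G p = 0})" using S by blast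
  also have "S \<inter> {p \<in> S. G p = 0} = {(\<sigma>, u). 0 \<le> \<sigma> \<and> \<sigma> + d \<le> u \<and> u \<le> L \<and> \<sigma> \<le> L \<and> 0 \<le> u \<and> \<xi> u = \<xi> \<sigma> \<and> \<tau> u = e *\<^sub>R \<tau> \<sigma>}"
    by (simp add: S_def G_def zero_prod_def set_eq_iff) auto
  finally show ?thesis .
qed

text \<open>Consider the parallel meeting with the largest second parameter. If that parameter is
  below \<open>L\<close>, the strands run on together and give a later one. If it is
  \<open>L\<close>, the strand continuing from the first parameter enters the half disk ahead of the
  end.\<close>

lemma thick_no_parallel_meeting:
  assumes "0 < L" "0 < \<rho>" and c: "unit_speed L \<xi> \<tau>" and th: "thick L \<rho> \<xi> \<tau>"
    and h: "0 \<le> \<sigma>" "\<sigma> < u" "u \<le> L" "\<xi> u = \<xi> \<sigma>"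
  shows "\<tau> u \<noteq> \<tau> \<sigma>"
proof
  assume par: "\<tau> u = \<tau> \<sigma>"
  obtain d where d: "0 < d" "\<And>\<sigma> u. 0 \<le> \<sigma> \<Longrightarrow> \<sigma> < u \<Longrightarrow> u \<le> L \<Longrightarrow> u < \<sigma> + d \<Longrightarrow> \<xi> u \<noteq> \<xi> \<sigma>"
    using locally_injective[OF c] by blast
  define P where "P = {(\<sigma>, u). 0 \<le> \<sigma> \<and> \<sigma> + d \<le> u \<and> u \<le> L \<and> \<sigma> \<le> L \<and> 0 \<le> u \<and> \<xi> u = \<xi> \<sigma> \<and> \<tau> u = 1 *\<^sub>R \<tau> \<sigma>}"
  have inP: "(\<sigma>, u) \<in> P" if "0 \<le> \<sigma>" "\<sigma> < u" "u \<le> L" "\<xi> u = \<xi> \<sigma>" "\<tau> u = \<tau> \<sigma>" for \<sigma> u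
  proof -
    have "\<sigma> + d \<le> u" using d(2)[of \<sigma> u] that not_le by blast
    then show ?thesis using that d(1) unfolding P_def by auto
  qed
  have "compact P" unfolding P_def by (rule compact_meetings[OF c])
  moreover have "P \<noteq> {}" using inP[OF h par] by auto
  moreover have "continuous_on P snd" by (intro continuous_intros)
  ultimately obtain q where q: "q \<in> P" "\<And>y. y \<in> P \<Longrightarrow> snd y \<le> snd q"
    using continuous_attains_sup[of P snd] by auto
  obtain a b where ab: "q = (a, b)" by fastforce
  have q': "0 \<le> a" "a + d \<le> b" "b \<le> L" "\<xi> b = \<xi> a" "\<tau> b = \<tau> a" using q(1) ab unfolding P_def by auto
  have nt: "norm (\<tau> z) = 1" if "z \<in> {0..L}" for z using c that unfolding unit_speed_def by blast
  show False
  proof (cases "b = L")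
    case True
    have aL: "a \<in> {0..L}" using q' d by auto
    obtain d1 where d1: "0 < d1" "\<And>z. z \<in> {0..L} \<Longrightarrow> \<bar>z - a\<bar> < d1 \<Longrightarrow>
        norm (\<xi> z - \<xi> a - (z - a) *\<^sub>R \<tau> a) \<le> (1/2) * \<bar>z - a\<bar>"
      using first_order[OF c aL, of "1/2"] by auto
    define x where "x = Min {d1 / 2, d, \<rho> / 2}"
    have x: "0 < x" "x < d1" "x \<le> d" "x \<le> \<rho> / 2"
      unfolding x_def using d1 d \<open>0 < \<rho>\<close> by (auto simp: min_less_iff_disj)
    have axL: "a + x \<in> {0..L}" using x q' by auto
    define r where "r = \<xi> (a + x) - \<xi> L - x *\<^sub>R \<tau> L"
    have r: "norm r \<le> x / 2" using d1(2)[OF axL] x q' True by (simp add: r_def)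
    have D: "\<xi> (a + x) - \<xi> L = x *\<^sub>R \<tau> L + r" by (simp add: r_def)
    have ntL: "norm (\<tau> L) = 1" using nt \<open>0 < L\<close> by auto
    have "norm (\<xi> (a + x) - \<xi> L) < 2 * \<rho>"
      unfolding D using norm_triangle_ineq[of "x *\<^sub>R \<tau> L" r] r ntL x \<open>0 < \<rho>\<close> by simp
    then have "(\<xi> (a + x) - \<xi> L) \<bullet> \<tau> L \<le> 0" using th axL unfolding thick_def by blast
    moreover have "(\<xi> (a + x) - \<xi> L) \<bullet> \<tau> L = x + r \<bullet> \<tau> L"
      unfolding D inner_add_left using ntL by (simp add: dot_square_norm)
    moreover have "\<bar>r \<bullet> \<tau> L\<bar> \<le> x / 2"
      using Cauchy_Schwarz_ineq2[of r "\<tau> L"] r ntL by simp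
    ultimately show False using x by linarith
  next
    case False
    obtain x y where xy: "0 < x" "x < d / 2" "0 < y" "y < d / 2" "b + 1 * x \<in> {0..L}" "a + y \<in> {0..L}"
        "\<xi> (b + 1 * x) = \<xi> (a + y)" "norm (\<tau> (b + 1 * x) - 1 *\<^sub>R \<tau> (a + y)) < 1"
      by (rule meeting_continues[OF \<open>0 < \<rho>\<close> c th, of a b 1 "L - b" "d / 2"]) (use q' False d in auto)
    have "\<tau> (b + x) = \<tau> (a + y) \<or> \<tau> (b + x) = - \<tau> (a + y)"
      using meeting_tangents[OF \<open>0 < L\<close> \<open>0 < \<rho>\<close> c th, of "a + y" "b + x"] xy by auto
    moreover have "\<tau> (b + x) \<noteq> - \<tau> (a + y)"
    proof
      assume "\<tau> (b + x) = - \<tau> (a + y)"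
      then have "norm (2 *\<^sub>R \<tau> (a + y)) < 1" using xy(8) by (simp add: scaleR_2 norm_minus_commute)
      then show False using nt xy by auto
    qed
    ultimately have "(a + y, b + x) \<in> P" using xy q' d by (intro inP) auto
    then show False using q(2)[of "(a + y, b + x)"] ab xy by auto
  qed
qed

text \<open>Antiparallel strands that coincide force the parameters towards each other, and a
  meeting with smallest second parameter would have to be on the diagonal. There the tangent would
  be its own negative.\<close>

lemma thick_no_antiparallel_meeting:
  assumes "0 < L" "0 < \<rho>" and c: "unit_speed L \<xi> \<tau>" and th: "thick L \<rho> \<xi> \<tau>"
    and h: "0 \<le> \<sigma>" "\<sigma> < u" "u \<le> L" "\<xi> u = \<xi> \<sigma>"
  shows "\<tau> u \<noteq> - \<tau> \<sigma>"
proof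
  assume par: "\<tau> u = - \<tau> \<sigma>"
  define P where "P = {(\<sigma>, u). 0 \<le> \<sigma> \<and> \<sigma> + 0 \<le> u \<and> u \<le> L \<and> \<sigma> \<le> L \<and> 0 \<le> u \<and> \<xi> u = \<xi> \<sigma> \<and> \<tau> u = (-1) *\<^sub>R \<tau> \<sigma>}"
  have inP: "(\<sigma>, u) \<in> P" if "0 \<le> \<sigma>" "\<sigma> < u" "u \<le> L" "\<xi> u = \<xi> \<sigma>" "\<tau> u = - \<tau> \<sigma>" for \<sigma> u
    using that unfolding P_def by auto
  have "compact P" unfolding P_def by (rule compact_meetings[OF c])
  moreover have "P \<noteq> {}" using inP[OF h par] by auto
  moreover have "continuous_on P snd" by (intro continuous_intros)
  ultimately obtain q where q: "q \<in> P" "\<And>y. y \<in> P \<Longrightarrow> snd y \<ge> snd q"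
    using continuous_attains_inf[of P snd] by auto
  obtain a b where ab: "q = (a, b)" by fastforce
  have q': "0 \<le> a" "a \<le> b" "b \<le> L" "\<xi> b = \<xi> a" "\<tau> b = - \<tau> a" using q(1) ab unfolding P_def by auto
  have nt: "norm (\<tau> z) = 1" if "z \<in> {0..L}" for z using c that unfolding unit_speed_def by blast
  have "a \<noteq> b"
  proof
    assume "a = b"
    then have "\<tau> b = - \<tau> b" using q' by metis
    then have "\<tau> b = 0" by (simp add: eq_neg_iff_add_eq_0 flip: scaleR_2)
    then show False using nt[of b] q' by auto
  qed
  then have lt: "a < b" using q' by simp
  obtain x y where xy: "0 < x" "x < (b - a) / 2" "0 < y" "y < (b - a) / 2" "b + (-1) * x \<in> {0..L}" "a + y \<in> {0..L}"
      "\<xi> (b + (-1) * x) = \<xi> (a + y)" "norm (\<tau> (b + (-1) * x) - (-1) *\<^sub>R \<tau> (a + y)) < 1"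
    by (rule meeting_continues[OF \<open>0 < \<rho>\<close> c th, of a b "-1" "b - a" "(b - a) / 2"]) (use q' lt in auto)
  have "\<tau> (b - x) = \<tau> (a + y) \<or> \<tau> (b - x) = - \<tau> (a + y)"
    using meeting_tangents[OF \<open>0 < L\<close> \<open>0 < \<rho>\<close> c th, of "a + y" "b - x"] xy by auto
  moreover have "\<tau> (b - x) \<noteq> \<tau> (a + y)"
  proof
    assume "\<tau> (b - x) = \<tau> (a + y)"
    then have "norm (2 *\<^sub>R \<tau> (a + y)) < 1" using xy(8) by (simp add: scaleR_2)
    then show False using nt xy by auto
  qed
  ultimately have "(a + y, b - x) \<in> P" using xy q' lt by (intro inP) auto
  then show False using q(2)[of "(a + y, b - x)"] ab xy by auto
qed

lemma thick_inj:
  assumes "0 < L" "0 < \<rho>" "unit_speed L \<xi> \<tau>" "thick L \<rho> \<xi> \<tau>" "0 \<le> \<sigma>" "\<sigma> < u" "u \<le> L"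
  shows "\<xi> u \<noteq> \<xi> \<sigma>"
  using thick_no_parallel_meeting[OF assms(1-7)] thick_no_antiparallel_meeting[OF assms(1-7)]
    meeting_tangents[OF assms(1-4), of \<sigma> u] assms(5-7) by auto

text \<open>For the half disk at the new end point \<open>\<xi> l\<close>, a point of the initial arc inside it has its
  nearest point on the removed arc at distance less than \<open>2 * \<rho>\<close>, hence lies on the removed arc.\<close>

lemma thick_initial_arc:
  assumes "0 < \<rho>" and c: "unit_speed L \<xi> \<tau>" and th: "thick L \<rho> \<xi> \<tau>" and l: "0 < l" "l \<le> L"
  shows "thick l \<rho> \<xi> \<tau>"
proof -
  have "0 < L" using l by simp
  have "(\<xi> \<sigma> - \<xi> l) \<bullet> \<tau> l \<le> 0" if \<sigma>: "\<sigma> \<in> {0..l}" and near: "norm (\<xi> \<sigma> - \<xi> l) < 2 * \<rho>" for \<sigma>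
  proof (rule ccontr)
    assume pos: "\<not> (\<xi> \<sigma> - \<xi> l) \<bullet> \<tau> l \<le> 0"
    define p where "p = \<xi> \<sigma>"
    have \<sigma>L: "\<sigma> \<in> {0..L}" using \<sigma> l by auto
    have "continuous_on {l..L} (\<lambda>z. norm (\<xi> z - p))"
      using unit_speed_continuous[OF c] l by (intro continuous_intros) (auto elim!: continuous_on_subset)
    then obtain z where z: "l \<le> z" "z \<le> L"
      and zmin: "\<And>w. l \<le> w \<Longrightarrow> w \<le> L \<Longrightarrow> norm (\<xi> z - p) \<le> norm (\<xi> w - p)"
      using continuous_attains_inf[of "{l..L}" "\<lambda>z. norm (\<xi> z - p)"] l by force
    have zL: "z \<in> {0..L}" using z l by auto
    have "norm (\<xi> z - p) \<le> norm (\<xi> l - p)" using zmin[of l] l by simp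
    then have nz: "norm (\<xi> z - p) < 2 * \<rho>" using near by (simp add: p_def norm_minus_commute)
    note np = nearest_point[OF c, of l L z p]
    have sym: "(\<xi> w - p) \<bullet> v = - ((p - \<xi> w) \<bullet> v)" for w v by (simp add: inner_diff_left)
    have "z \<noteq> l \<or> l = L"
      using np(1) zmin z l pos sym[of l "\<tau> l"] by (force simp: p_def)
    moreover have "\<not> l = L"
      using th \<sigma>L near pos unfolding thick_def by auto
    ultimately have lz: "l < z" using z by auto
    have le: "(\<xi> z - p) \<bullet> \<tau> z \<le> 0" using np(2) zmin z l lz by auto
    \<comment> \<open>If the nearest point is the old end, the derivative test gives no sign from
      the right; the original half disk at \<open>L\<close> supplies it.\<close>
    have ge: "(\<xi> z - p) \<bullet> \<tau> z \<ge> 0"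
    proof (cases "z = L")
      case True
      then have "(p - \<xi> L) \<bullet> \<tau> L \<le> 0"
        using th \<sigma>L nz unfolding thick_def p_def by (auto simp: norm_minus_commute)
      then show ?thesis using True sym by simp
    qed (use np(1) zmin z l in auto)
    have "\<xi> z = \<xi> \<sigma>"
      using thick_normal_foot[OF c th zL \<sigma>L] le ge nz by (simp add: p_def)
    then show False
      using thick_inj[OF \<open>0 < L\<close> \<open>0 < \<rho>\<close> c th, of \<sigma> z] \<sigma> lz z by auto
  qed
  then show ?thesis using th l unfolding thick_def by auto
qed

text \<open>Under enlargement by \<open>1 / \<mu> \<ge> 1\<close> the linear side of the disk
  inequality grows by \<open>1 / \<mu>\<close> and the quadratic side by its square, while fewer
  points lie within distance \<open>2 * \<rho>\<close> of the ends.\<close>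

lemma thick_zoom:
  assumes "0 < \<rho>" and c: "unit_speed L \<xi> \<tau>" and th: "thick L \<rho> \<xi> \<tau>" and "0 < L" and \<mu>: "0 < \<mu>" "\<mu> \<le> 1"
  shows "thick L \<rho> (\<lambda>s. (1 / \<mu>) *\<^sub>R (\<xi> (\<mu> * s) - \<xi> 0)) (\<lambda>s. \<tau> (\<mu> * s))"
proof -
  have "thick (\<mu> * L) \<rho> \<xi> \<tau>"
    using thick_initial_arc[OF \<open>0 < \<rho>\<close> c th, of "\<mu> * L"] \<mu> \<open>0 < L\<close> by (simp add: mult_left_le_one_le)
  then have A: "\<And>s \<sigma>. s \<in> {0..L} \<Longrightarrow> \<sigma> \<in> {0..L} \<Longrightarrow>
      2 * \<rho> * \<bar>(\<xi> (\<mu> * \<sigma>) - \<xi> (\<mu> * s)) \<bullet> (J *v \<tau> (\<mu> * s))\<bar> \<le> (norm (\<xi> (\<mu> * \<sigma>) - \<xi> (\<mu> * s)))\<^sup>2"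
    and B: "\<And>\<sigma>. \<sigma> \<in> {0..L} \<Longrightarrow> norm (\<xi> (\<mu> * \<sigma>) - \<xi> 0) < 2 * \<rho> \<Longrightarrow> (\<xi> (\<mu> * \<sigma>) - \<xi> 0) \<bullet> \<tau> 0 \<ge> 0"
    and C: "\<And>\<sigma>. \<sigma> \<in> {0..L} \<Longrightarrow> norm (\<xi> (\<mu> * \<sigma>) - \<xi> (\<mu> * L)) < 2 * \<rho> \<Longrightarrow> (\<xi> (\<mu> * \<sigma>) - \<xi> (\<mu> * L)) \<bullet> \<tau> (\<mu> * L) \<le> 0"
    unfolding thick_def using \<mu> by (auto simp: mult_left_mono)
  have D: "(1 / \<mu>) *\<^sub>R (\<xi> (\<mu> * \<sigma>) - \<xi> 0) - (1 / \<mu>) *\<^sub>R (\<xi> (\<mu> * s) - \<xi> 0) = (1 / \<mu>) *\<^sub>R (\<xi> (\<mu> * \<sigma>) - \<xi> (\<mu> * s))" for \<sigma> s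
    by (simp add: algebra_simps)
  have i\<mu>: "1 / \<mu> \<ge> 1" using \<mu> by simp
  have sm: "norm v < 2 * \<rho>" if "norm ((1 / \<mu>) *\<^sub>R v) < 2 * \<rho>" for v :: "real^2"
  proof -
    have "norm v \<le> (1 / \<mu>) * norm v" using i\<mu> by (metis mult_right_mono mult_1 norm_ge_zero)
    then show ?thesis using that \<mu> by simp
  qed
  have scale: "2 * \<rho> * \<bar>((1 / \<mu>) *\<^sub>R v) \<bullet> w\<bar> \<le> (norm ((1 / \<mu>) *\<^sub>R v))\<^sup>2"
    if "2 * \<rho> * \<bar>v \<bullet> w\<bar> \<le> (norm v)\<^sup>2" for v w :: "real^2"
  proof -
    have "2 * \<rho> * \<bar>((1 / \<mu>) *\<^sub>R v) \<bullet> w\<bar> = (1 / \<mu>) * (2 * \<rho> * \<bar>v \<bullet> w\<bar>)"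
      using \<mu> by (simp add: abs_mult)
    also have "\<dots> \<le> (1 / \<mu>) * (norm v)\<^sup>2" using that \<mu> by (intro mult_left_mono) auto
    also have "\<dots> \<le> (1 / \<mu>) * ((1 / \<mu>) * (norm v)\<^sup>2)"
      using \<mu> mult_right_mono[OF i\<mu>, of "(norm v)\<^sup>2"] by (intro mult_left_mono) auto
    also have "\<dots> = (norm ((1 / \<mu>) *\<^sub>R v))\<^sup>2"
      by (simp add: power_divide power2_eq_square)
    finally show ?thesis .
  qed
  show ?thesis
    unfolding thick_def D
  proof (intro conjI ballI impI)
    fix \<sigma> assume \<sigma>: "\<sigma> \<in> {0..L}"
    { assume "norm ((1 / \<mu>) *\<^sub>R (\<xi> (\<mu> * \<sigma>) - \<xi> (\<mu> * 0))) < 2 * \<rho>"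
      then show "0 \<le> ((1 / \<mu>) *\<^sub>R (\<xi> (\<mu> * \<sigma>) - \<xi> (\<mu> * 0))) \<bullet> \<tau> (\<mu> * 0)"
        using B[OF \<sigma>] sm \<mu> by simp }
    { assume "norm ((1 / \<mu>) *\<^sub>R (\<xi> (\<mu> * \<sigma>) - \<xi> (\<mu> * L))) < 2 * \<rho>"
      then have "(\<xi> (\<mu> * \<sigma>) - \<xi> (\<mu> * L)) \<bullet> \<tau> (\<mu> * L) \<le> 0" using C[OF \<sigma>] sm by blast
      then show "((1 / \<mu>) *\<^sub>R (\<xi> (\<mu> * \<sigma>) - \<xi> (\<mu> * L))) \<bullet> \<tau> (\<mu> * L) \<le> 0"
        using \<mu> by (simp add: divide_nonpos_pos) }
  qed (use A scale in blast)
qed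

lemma thick_straight:
  assumes "norm v = 1"
  shows "thick L \<rho> (\<lambda>s. s *\<^sub>R v) (\<lambda>s. v)"
  using assms unfolding thick_def
  by (auto simp flip: scaleR_diff_left simp: dot_square_norm mult_nonpos_nonneg)

text \<open>The tangent turns so slowly that the chords stay close to the tangent.\<close>

lemma thick_slowly_turning:
  assumes "0 < \<rho>" and c: "unit_speed L \<xi> \<tau>"
    and lip: "\<And>s \<sigma>. s \<in> {0..L} \<Longrightarrow> \<sigma> \<in> {0..L} \<Longrightarrow> norm (\<tau> s - \<tau> \<sigma>) \<le> \<kappa> * \<bar>s - \<sigma>\<bar>"
    and \<kappa>: "0 \<le> \<kappa>" "\<kappa> * L \<le> 1/2" "4 * \<rho> * \<kappa> \<le> 1"
  shows "thick L \<rho> \<xi> \<tau>"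
proof -
  have nt: "norm (\<tau> z) = 1" if "z \<in> {0..L}" for z using c that unfolding unit_speed_def by blast
  have der: "((\<lambda>r. \<xi> r \<bullet> v) has_derivative (\<lambda>y. y * (\<tau> x \<bullet> v))) (at x within {\<sigma>..u})"
    if "x \<in> {\<sigma>..u}" "0 \<le> \<sigma>" "u \<le> L" for x v \<sigma> u
  proof -
    have "(\<xi> has_derivative (\<lambda>y. y *\<^sub>R \<tau> x)) (at x within {0..L})"
      using c that unfolding unit_speed_def has_vector_derivative_def by auto
    then have "(\<xi> has_derivative (\<lambda>y. y *\<^sub>R \<tau> x)) (at x within {\<sigma>..u})"
      by (rule has_derivative_subset) (use that in auto)
    then show ?thesis by (auto intro!: derivative_eq_intros)
  qed
  have mv: "\<exists>x\<in>{0..L}. \<bar>x - s\<bar> \<le> \<bar>\<sigma> - s\<bar> \<and> (\<xi> \<sigma> - \<xi> s) \<bullet> v = (\<sigma> - s) * (\<tau> x \<bullet> v)"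
    if s: "s \<in> {0..L}" and \<sigma>: "\<sigma> \<in> {0..L}" for s \<sigma> v
  proof -
    consider "s < \<sigma>" | "\<sigma> < s" | "s = \<sigma>" by linarith
    then show ?thesis
    proof cases
      case 1
      have "\<exists>x\<in>{s<..<\<sigma>}. \<xi> \<sigma> \<bullet> v - \<xi> s \<bullet> v = (\<sigma> - s) * (\<tau> x \<bullet> v)"
        by (rule mvt_simple[OF 1 der]) (use s \<sigma> in auto)
      then show ?thesis using s \<sigma> by (force simp: inner_diff_left)
    next
      case 2
      have "\<exists>x\<in>{\<sigma><..<s}. \<xi> s \<bullet> v - \<xi> \<sigma> \<bullet> v = (s - \<sigma>) * (\<tau> x \<bullet> v)"
        by (rule mvt_simple[OF 2 der]) (use s \<sigma> in auto)
      then obtain x where "x \<in> {\<sigma><..<s}" "\<xi> s \<bullet> v - \<xi> \<sigma> \<bullet> v = (s - \<sigma>) * (\<tau> x \<bullet> v)" by blast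
      then show ?thesis using s \<sigma> by (intro bexI[of _ x]) (auto simp: inner_diff_left algebra_simps)
    qed (use s in auto)
  qed
  \<comment> \<open>Unit vectors at distance at most 1/2 have inner product at least 1 -
    1/8.\<close>
  have dots: "\<tau> x \<bullet> \<tau> s \<ge> 7/8" if "x \<in> {0..L}" "s \<in> {0..L}" for x s
  proof -
    have "\<kappa> * \<bar>x - s\<bar> \<le> \<kappa> * L" using that \<kappa> by (intro mult_left_mono) auto
    then have "norm (\<tau> x - \<tau> s) \<le> 1/2" using lip[OF that] \<kappa> by linarith
    then have "(norm (\<tau> x - \<tau> s))\<^sup>2 \<le> (1/2)\<^sup>2" by (intro power_mono) auto
    moreover have "(norm (\<tau> x - \<tau> s))\<^sup>2 = (norm (\<tau> x))\<^sup>2 + (norm (\<tau> s))\<^sup>2 - 2 * (\<tau> x \<bullet> \<tau> s)"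
      unfolding power2_norm_eq_inner by (simp add: inner_simps inner_commute)
    ultimately show ?thesis using nt that by (simp add: power2_eq_square)
  qed
  have A: "2 * \<rho> * \<bar>(\<xi> \<sigma> - \<xi> s) \<bullet> (J *v \<tau> s)\<bar> \<le> (norm (\<xi> \<sigma> - \<xi> s))\<^sup>2"
    if s: "s \<in> {0..L}" and \<sigma>: "\<sigma> \<in> {0..L}" for s \<sigma>
  proof -
    obtain x where x: "x \<in> {0..L}" "\<bar>x - s\<bar> \<le> \<bar>\<sigma> - s\<bar>" "(\<xi> \<sigma> - \<xi> s) \<bullet> (J *v \<tau> s) = (\<sigma> - s) * (\<tau> x \<bullet> (J *v \<tau> s))"
      using mv[OF s \<sigma>] by blast
    obtain y where y: "y \<in> {0..L}" "(\<xi> \<sigma> - \<xi> s) \<bullet> \<tau> s = (\<sigma> - s) * (\<tau> y \<bullet> \<tau> s)"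
      using mv[OF s \<sigma>] by blast
    have "\<tau> x \<bullet> (J *v \<tau> s) = (\<tau> x - \<tau> s) \<bullet> (J *v \<tau> s)" by (simp add: inner_diff_left)
    then have "\<bar>\<tau> x \<bullet> (J *v \<tau> s)\<bar> \<le> norm (\<tau> x - \<tau> s)"
      using Cauchy_Schwarz_ineq2[of "\<tau> x - \<tau> s" "J *v \<tau> s"] nt[OF s] by simp
    also have "\<dots> \<le> \<kappa> * \<bar>x - s\<bar>" by (rule lip[OF x(1) s])
    also have "\<dots> \<le> \<kappa> * \<bar>\<sigma> - s\<bar>" using x \<kappa> by (intro mult_left_mono) auto
    finally have "\<bar>(\<xi> \<sigma> - \<xi> s) \<bullet> (J *v \<tau> s)\<bar> \<le> \<bar>\<sigma> - s\<bar> * (\<kappa> * \<bar>\<sigma> - s\<bar>)"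
      unfolding x(3) abs_mult by (intro mult_left_mono) auto
    then have "2 * \<rho> * \<bar>(\<xi> \<sigma> - \<xi> s) \<bullet> (J *v \<tau> s)\<bar> \<le> 2 * \<rho> * (\<bar>\<sigma> - s\<bar> * (\<kappa> * \<bar>\<sigma> - s\<bar>))"
      using \<open>0 < \<rho>\<close> by (intro mult_left_mono) auto
    \<comment> \<open>The normal part of a chord is at most
      \<open>\<kappa> * (\<sigma> - s)\<^sup>2\<close>, and its tangential part is at least 7/8 of
      \<open>\<bar>\<sigma> - s\<bar>\<close>. The comparison closes because 1/2 is at most
      49/64.\<close>
    also have "\<dots> = (4 * \<rho> * \<kappa>) * ((\<sigma> - s)\<^sup>2 / 2)" by (simp add: power2_eq_square algebra_simps flip: abs_mult)
    also have "\<dots> \<le> 1 * ((\<sigma> - s)\<^sup>2 / 2)" using \<kappa> by (intro mult_right_mono) auto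
    also have "\<dots> \<le> (\<sigma> - s)\<^sup>2 * (7/8)\<^sup>2" by (simp add: power2_eq_square)
    also have "\<dots> \<le> (\<sigma> - s)\<^sup>2 * (\<tau> y \<bullet> \<tau> s)\<^sup>2"
      using dots[OF y(1) s] by (intro mult_left_mono power_mono) auto
    also have "\<dots> = ((\<xi> \<sigma> - \<xi> s) \<bullet> \<tau> s)\<^sup>2" unfolding y(2) by (simp add: power_mult_distrib)
    also have "\<dots> \<le> (norm (\<xi> \<sigma> - \<xi> s))\<^sup>2"
      using norm_sq_orthonormal[OF nt[OF s], of "\<xi> \<sigma> - \<xi> s"] by (simp add: inner_commute)
    finally show ?thesis .
  qed
  have pos: "(\<sigma> - s) * ((\<xi> \<sigma> - \<xi> s) \<bullet> \<tau> s) \<ge> 0" if s: "s \<in> {0..L}" and \<sigma>: "\<sigma> \<in> {0..L}" for s \<sigma>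
  proof -
    obtain y where y: "y \<in> {0..L}" "(\<xi> \<sigma> - \<xi> s) \<bullet> \<tau> s = (\<sigma> - s) * (\<tau> y \<bullet> \<tau> s)"
      using mv[OF s \<sigma>] by blast
    then show ?thesis using dots[OF y(1) s] by (simp add: flip: mult.assoc)
  qed
  have E: "(\<xi> \<sigma> - \<xi> 0) \<bullet> \<tau> 0 \<ge> 0" "(\<xi> \<sigma> - \<xi> L) \<bullet> \<tau> L \<le> 0" if \<sigma>: "\<sigma> \<in> {0..L}" for \<sigma>
  proof -
    show "(\<xi> \<sigma> - \<xi> 0) \<bullet> \<tau> 0 \<ge> 0"
      using pos[of 0 \<sigma>] \<sigma> by (cases "\<sigma> = 0") (auto simp: zero_le_mult_iff)
    show "(\<xi> \<sigma> - \<xi> L) \<bullet> \<tau> L \<le> 0"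
      using pos[of L \<sigma>] \<sigma> by (cases "\<sigma> = L") (auto simp: zero_le_mult_iff)
  qed
  show ?thesis unfolding thick_def using A E by blast
qed

section \<open>Square integrable functions on an interval\<close>

text \<open>This passes from the Lebesgue integral over the open interval to the gauge integral over
  the closed one, in which all later estimates are carried out.\<close>

lemma L2_iff:
  fixes f :: "real \<Rightarrow> real^2"
  shows "f \<in> L2 {0<..<L} \<longleftrightarrow>
    f \<in> borel_measurable (lebesgue_on {0<..<L}) \<and> (\<lambda>x. (norm (f x))\<^sup>2) integrable_on {0..L}"
proof -
  have "integrable (lebesgue_on {0<..<L}) (\<lambda>x. (norm (f x))\<^sup>2) \<longleftrightarrow>
      (\<lambda>x. (norm (f x))\<^sup>2) absolutely_integrable_on {0<..<L}"
    by (simp add: integrable_restrict_space set_integrable_def)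
  also have "\<dots> \<longleftrightarrow> (\<lambda>x. (norm (f x))\<^sup>2) integrable_on {0<..<L}"
    by (rule absolutely_integrable_on_iff_nonneg) simp
  finally show ?thesis unfolding L2_def by (simp add: integrable_on_Icc_iff_Ioo)
qed

lemma L2_measurable: "f \<in> L2 S \<Longrightarrow> f \<in> borel_measurable (lebesgue_on S)"
  by (simp add: L2_def)

lemma L2_sq_integrable:
  fixes f :: "real \<Rightarrow> real^2"
  shows "f \<in> L2 {0<..<L} \<Longrightarrow> (\<lambda>x. (norm (f x))\<^sup>2) integrable_on {0..L}"
  by (simp add: L2_iff)

lemma L2_norm_sq:
  fixes f :: "real \<Rightarrow> real^2"
  assumes "f \<in> L2 {0<..<L}"
  shows "(L2_norm {0<..<L} f)\<^sup>2 = integral {0..L} (\<lambda>x. (norm (f x))\<^sup>2)"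
proof -
  have "integrable (lebesgue_on {0<..<L}) (\<lambda>x. (norm (f x))\<^sup>2)"
    using assms by (simp add: L2_def)
  then have "(LINT x|lebesgue_on {0<..<L}. (norm (f x))\<^sup>2) = integral {0<..<L} (\<lambda>x. (norm (f x))\<^sup>2)"
    by (intro lebesgue_integral_eq_integral) auto
  moreover have "0 \<le> (LINT x|lebesgue_on {0<..<L}. (norm (f x))\<^sup>2)" by simp
  ultimately show ?thesis
    unfolding L2_norm_def by (simp add: integral_open_interval_real)
qed

lemma L2_bound:
  fixes f :: "real \<Rightarrow> real^2"
  assumes m: "f \<in> borel_measurable (lebesgue_on {0<..<L})" and g: "g integrable_on {0..L}"
    and le: "\<And>x. x \<in> {0<..<L} \<Longrightarrow> (norm (f x))\<^sup>2 \<le> g x"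
  shows "f \<in> L2 {0<..<L}"
proof -
  have "(\<lambda>x. (norm (f x))\<^sup>2) absolutely_integrable_on {0<..<L}"
  proof (rule measurable_bounded_by_integrable_imp_absolutely_integrable)
    show "(\<lambda>x. (norm (f x))\<^sup>2) \<in> borel_measurable (lebesgue_on {0<..<L})"
      using m by measurable
    show "g integrable_on {0<..<L}" using g by (simp add: integrable_on_Icc_iff_Ioo)
  qed (use le in auto)
  then show ?thesis
    using m unfolding L2_iff by (simp add: integrable_on_Icc_iff_Ioo set_lebesgue_integral_eq_integral(1))
qed

lemma L2_absolutely_integrable:
  fixes f :: "real \<Rightarrow> real^2"
  assumes "f \<in> L2 {0<..<L}"
  shows "f absolutely_integrable_on {0..L}"
proof -
  have "f absolutely_integrable_on {0<..<L}"
  proof (rule measurable_bounded_by_integrable_imp_absolutely_integrable[where g = "\<lambda>x. 1 + (norm (f x))\<^sup>2"])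
    show "(\<lambda>x. 1 + (norm (f x))\<^sup>2) integrable_on {0<..<L}"
      using L2_sq_integrable[OF assms] unfolding integrable_on_Icc_iff_Ioo[symmetric]
      by (intro integrable_add) auto
    show "norm (f x) \<le> 1 + (norm (f x))\<^sup>2" for x
      using sum_squares_bound[of "norm (f x)" 1] by (simp add: power2_eq_square) (smt (verit) norm_ge_zero)
  qed (use assms in \<open>auto simp: L2_def\<close>)
  then show ?thesis by (simp add: absolutely_integrable_on_Icc_iff_Ioo)
qed

lemma norm_add_sq_le: "(norm (a + b))\<^sup>2 \<le> 2 * (norm a)\<^sup>2 + 2 * (norm (b::'a::real_inner))\<^sup>2"
proof -
  have "(norm (a + b))\<^sup>2 + (norm (a - b))\<^sup>2 = 2 * (norm a)\<^sup>2 + 2 * (norm b)\<^sup>2"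
    unfolding power2_norm_eq_inner by (simp add: inner_simps inner_commute)
  then show ?thesis using zero_le_power2[of "norm (a - b)"] by linarith
qed

lemma L2_add:
  fixes f :: "real \<Rightarrow> real^2"
  assumes "f \<in> L2 {0<..<L}" "g \<in> L2 {0<..<L}"
  shows "(\<lambda>x. f x + g x) \<in> L2 {0<..<L}"
proof (rule L2_bound)
  show "(\<lambda>x. f x + g x) \<in> borel_measurable (lebesgue_on {0<..<L})"
    using assms by (intro borel_measurable_add) (auto simp: L2_def)
  show "(\<lambda>x. 2 * (norm (f x))\<^sup>2 + 2 * (norm (g x))\<^sup>2) integrable_on {0..L}"
    using assms by (intro integrable_add integrable_on_mult_right L2_sq_integrable)
qed (rule norm_add_sq_le)

lemma L2_linear:
  fixes f :: "real \<Rightarrow> real^2"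
  assumes A: "bounded_linear A" and f: "f \<in> L2 {0<..<L}"
  shows "(\<lambda>x. A (f x) :: real^2) \<in> L2 {0<..<L}"
proof -
  obtain K where K: "\<And>x. norm (A x) \<le> norm x * K" "0 \<le> K"
    using bounded_linear.nonneg_bounded[OF A] by blast
  show ?thesis
  proof (rule L2_bound)
    have "A \<in> borel_measurable borel"
      using A by (intro borel_measurable_continuous_onI linear_continuous_on)
    then show "(\<lambda>x. A (f x)) \<in> borel_measurable (lebesgue_on {0<..<L})"
      using L2_measurable[OF f] by (rule measurable_compose_rev)
    show "(\<lambda>x. (norm (f x))\<^sup>2 * K\<^sup>2) integrable_on {0..L}"
      using f by (intro integrable_on_mult_left L2_sq_integrable)
    show "(norm (A (f x)))\<^sup>2 \<le> (norm (f x))\<^sup>2 * K\<^sup>2" for x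
      using power_mono[OF K(1)[of "f x"] norm_ge_zero, of 2] by (simp add: power_mult_distrib)
  qed
qed

lemma L2_scaleR:
  fixes f :: "real \<Rightarrow> real^2"
  shows "f \<in> L2 {0<..<L} \<Longrightarrow> (\<lambda>x. c *\<^sub>R f x) \<in> L2 {0<..<L}"
  using L2_linear[OF bounded_linear_scaleR_right[of c]] by blast

lemma L2_diff:
  fixes f :: "real \<Rightarrow> real^2"
  assumes "f \<in> L2 {0<..<L}" "g \<in> L2 {0<..<L}"
  shows "(\<lambda>x. f x - g x) \<in> L2 {0<..<L}"
  using L2_add[OF assms(1) L2_scaleR[OF assms(2), of "-1"]] by simp

lemma L2_rot:
  fixes f :: "real \<Rightarrow> real^2"
  shows "f \<in> L2 {0<..<L} \<Longrightarrow> (\<lambda>x. rot \<theta> (f x)) \<in> L2 {0<..<L}"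
  by (rule L2_linear[OF bounded_linear_rot])

lemma L2_continuous:
  fixes f :: "real \<Rightarrow> real^2"
  assumes "continuous_on {0..L} f"
  shows "f \<in> L2 {0<..<L}"
proof (rule L2_bound)
  have "continuous_on {0<..<L} f" using assms by (rule continuous_on_subset) auto
  then show "f \<in> borel_measurable (lebesgue_on {0<..<L})"
    by (rule continuous_imp_measurable_on_sets_lebesgue) simp
  show "(\<lambda>x. (norm (f x))\<^sup>2) integrable_on {0..L}"
    by (intro integrable_continuous_real continuous_intros assms)
qed simp

lemma L2_integrable_on:
  fixes f :: "real \<Rightarrow> real^2"
  assumes "f \<in> L2 {0<..<L}" "0 \<le> s" "s \<le> L"
  shows "f integrable_on {0..s}"
  using L2_absolutely_integrable[OF assms(1)] assms(2,3)
  by (auto intro: integrable_subinterval_real dest: set_lebesgue_integral_eq_integral(1))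

section \<open>Paths of shapes and self-propelled motions\<close>

text \<open>All derivatives are carried as witnesses: \<open>\<omega>\<close> is the velocity,
  \<open>\<tau>\<close> the tangent, and \<open>h\<close> the curvature vector, which is only square
  integrable in s. The last clause is continuity of \<open>h\<close> in time with values in L2; it
  is what later yields boundedness and strong measurability in \<open>H2\<close>.\<close>

definition shape_path ::
  "real \<Rightarrow> real \<Rightarrow> real \<Rightarrow> (real \<Rightarrow> real \<Rightarrow> real^2) \<Rightarrow> (real \<Rightarrow> real \<Rightarrow> real^2) \<Rightarrow>
   (real \<Rightarrow> real \<Rightarrow> real^2) \<Rightarrow> (real \<Rightarrow> real \<Rightarrow> real^2) \<Rightarrow> bool" where
  "shape_path L T \<rho> \<eta> \<omega> \<tau> h \<longleftrightarrow>
     continuous_on ({0..L} \<times> {0..T}) (\<lambda>p. \<eta> (fst p) (snd p)) \<and>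
     continuous_on ({0..L} \<times> {0..T}) (\<lambda>p. \<omega> (fst p) (snd p)) \<and>
     continuous_on ({0..L} \<times> {0..T}) (\<lambda>p. \<tau> (fst p) (snd p)) \<and>
     (\<forall>s\<in>{0..L}. \<forall>t\<in>{0..T}.
        ((\<lambda>\<sigma>. \<eta> \<sigma> t) has_vector_derivative \<tau> s t) (at s within {0..L}) \<and>
        ((\<lambda>u. \<eta> s u) has_vector_derivative \<omega> s t) (at t within {0..T}) \<and>
        norm (\<tau> s t) = 1 \<and>
        \<tau> s t = \<tau> 0 t + integral {0..s} (\<lambda>r. h r t)) \<and>
     (\<forall>t\<in>{0..T}. (\<lambda>s. h s t) \<in> L2 {0<..<L} \<and> thick L \<rho> (\<lambda>s. \<eta> s t) (\<lambda>s. \<tau> s t) \<and>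
        ((\<lambda>u. integral {0..L} (\<lambda>s. (norm (h s u - h s t))\<^sup>2)) \<longlongrightarrow> 0) (at t within {0..T}))"

text \<open>For a unit tangent this is the action of \<open>K_mat\<close>: the two projections add
  up to the identity, so the tangential one can be written as a correction to \<open>Cn\<close>
  times the identity.\<close>

definition drag :: "real \<Rightarrow> real \<Rightarrow> real^2 \<Rightarrow> real^2 \<Rightarrow> real^2" where
  "drag Ct Cn \<tau> v = Cn *\<^sub>R v - ((Cn - Ct) * (\<tau> \<bullet> v)) *\<^sub>R \<tau>"

definition balanced ::
  "real \<Rightarrow> real \<Rightarrow> real \<Rightarrow> (real \<Rightarrow> real^2) \<Rightarrow> (real \<Rightarrow> real^2) \<Rightarrow> (real \<Rightarrow> real^2) \<Rightarrow> bool" where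
  "balanced L Ct Cn \<xi> \<tau> \<omega> \<longleftrightarrow>
     integral {0..L} (\<lambda>s. drag Ct Cn (\<tau> s) (\<omega> s)) = 0 \<and>
     integral {0..L} (\<lambda>s. drag Ct Cn (\<tau> s) (\<omega> s) \<bullet> (J *v \<xi> s)) = 0"

definition motion ::
  "real \<Rightarrow> real \<Rightarrow> real \<Rightarrow> real \<Rightarrow> real \<Rightarrow> (real \<Rightarrow> real \<Rightarrow> real^2) \<Rightarrow> (real \<Rightarrow> real \<Rightarrow> real^2) \<Rightarrow>
   (real \<Rightarrow> real \<Rightarrow> real^2) \<Rightarrow> (real \<Rightarrow> real \<Rightarrow> real^2) \<Rightarrow> bool" where
  "motion L T \<rho> Ct Cn \<eta> \<omega> \<tau> h \<longleftrightarrow> shape_path L T \<rho> \<eta> \<omega> \<tau> h \<and>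
     (\<forall>t\<in>{0..T}. balanced L Ct Cn (\<lambda>s. \<eta> s t) (\<lambda>s. \<tau> s t) (\<lambda>s. \<omega> s t))"

section \<open>Transformations of paths and invariance of the balance\<close>

lemma thick_cong:
  assumes "0 \<le> L" "\<And>s. s \<in> {0..L} \<Longrightarrow> \<xi> s = \<xi>' s" "\<And>s. s \<in> {0..L} \<Longrightarrow> \<tau> s = \<tau>' s"
  shows "thick L \<rho> \<xi> \<tau> \<longleftrightarrow> thick L \<rho> \<xi>' \<tau>'"
  using assms unfolding thick_def by simp

lemma balanced_cong:
  assumes "\<And>s. s \<in> {0..L} \<Longrightarrow> \<xi> s = \<xi>' s" "\<And>s. s \<in> {0..L} \<Longrightarrow> \<tau> s = \<tau>' s"
    "\<And>s. s \<in> {0..L} \<Longrightarrow> \<omega> s = \<omega>' s"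
  shows "balanced L Ct Cn \<xi> \<tau> \<omega> \<longleftrightarrow> balanced L Ct Cn \<xi>' \<tau>' \<omega>'"
proof -
  have "integral {0..L} (\<lambda>s. drag Ct Cn (\<tau> s) (\<omega> s)) = integral {0..L} (\<lambda>s. drag Ct Cn (\<tau>' s) (\<omega>' s))"
    "integral {0..L} (\<lambda>s. drag Ct Cn (\<tau> s) (\<omega> s) \<bullet> (J *v \<xi> s)) =
     integral {0..L} (\<lambda>s. drag Ct Cn (\<tau>' s) (\<omega>' s) \<bullet> (J *v \<xi>' s))"
    using assms by (auto intro!: integral_cong)
  then show ?thesis unfolding balanced_def by simp
qed

lemma drag_scaleR: "drag Ct Cn \<tau> (c *\<^sub>R v) = c *\<^sub>R drag Ct Cn \<tau> v"
  by (simp add: drag_def algebra_simps)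

lemma drag_add: "drag Ct Cn \<tau> (v + w) = drag Ct Cn \<tau> v + drag Ct Cn \<tau> w"
  by (simp add: drag_def algebra_simps inner_simps)

lemma drag_rot: "drag Ct Cn (rot \<theta> \<tau>) (rot \<theta> v) = rot \<theta> (drag Ct Cn \<tau> v)"
  by (simp add: drag_def rot_linear_simps)

lemma continuous_on_drag [continuous_intros]:
  "continuous_on S f \<Longrightarrow> continuous_on S g \<Longrightarrow> continuous_on S (\<lambda>x. drag Ct Cn (f x) (g x))"
  unfolding drag_def by (intro continuous_intros)

lemma balanced_scaleR:
  "balanced L Ct Cn \<xi> \<tau> \<omega> \<Longrightarrow> balanced L Ct Cn \<xi> \<tau> (\<lambda>s. c *\<^sub>R \<omega> s)"
  unfolding balanced_def by (simp add: drag_scaleR)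

lemma continuous_on_slice:
  assumes "continuous_on (A \<times> B) (\<lambda>p. f (fst p) (snd p))" "t \<in> B"
  shows "continuous_on A (\<lambda>s. f s t)"
proof -
  have "continuous_on A (\<lambda>s. (s, t))" by (intro continuous_intros)
  from continuous_on_compose2[OF assms(1) this] assms(2) show ?thesis by auto
qed

lemma continuous_on_slice2:
  assumes "continuous_on (A \<times> B) (\<lambda>p. f (fst p) (snd p))" "s \<in> A"
  shows "continuous_on B (\<lambda>t. f s t)"
proof -
  have "continuous_on B (\<lambda>t. (s, t))" by (intro continuous_intros)
  from continuous_on_compose2[OF assms(1) this] assms(2) show ?thesis by auto
qed

lemma continuous_on_reparam:
  assumes "continuous_on (A \<times> B) (\<lambda>p. f (fst p) (snd p))" "continuous_on B' \<theta>" "\<And>t. t \<in> B' \<Longrightarrow> \<theta> t \<in> B"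
  shows "continuous_on (A \<times> B') (\<lambda>p. f (fst p) (\<theta> (snd p)))"
proof -
  have "continuous_on (A \<times> B') (\<lambda>p. \<theta> (snd p))"
    by (rule continuous_on_compose2[OF assms(2)]) (auto intro: continuous_intros)
  then have "continuous_on (A \<times> B') (\<lambda>p. (fst p, \<theta> (snd p)))"
    by (intro continuous_intros)
  from continuous_on_compose2[OF assms(1) this] show ?thesis
    using assms(3) by force
qed

lemma continuous_on_snd_comp:
  "continuous_on B f \<Longrightarrow> continuous_on (A \<times> B) (\<lambda>p. f (snd p))"
  by (rule continuous_on_compose2[of B f]) (auto intro: continuous_intros)

lemma shape_path_unit_speed:
  "shape_path L T \<rho> \<eta> \<omega> \<tau> h \<Longrightarrow> t \<in> {0..T} \<Longrightarrow> unit_speed L (\<lambda>s. \<eta> s t) (\<lambda>s. \<tau> s t)"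
  unfolding shape_path_def unit_speed_def by (blast intro: continuous_on_slice)

text \<open>The clock \<open>\<theta>\<close> is neither monotone nor onto in general. The same
  lemma serves time reversal, clocks that stop, and the change of the time interval.\<close>

lemma shape_path_reparam:
  assumes sp: "shape_path L T \<rho> \<eta> \<omega> \<tau> h"
    and \<theta>: "\<And>t. t \<in> {0..T'} \<Longrightarrow> \<theta> t \<in> {0..T}"
    and d\<theta>: "\<And>t. t \<in> {0..T'} \<Longrightarrow> (\<theta> has_vector_derivative \<theta>' t) (at t within {0..T'})"
    and c\<theta>: "continuous_on {0..T'} \<theta>'"
  shows "shape_path L T' \<rho> (\<lambda>s t. \<eta> s (\<theta> t)) (\<lambda>s t. \<theta>' t *\<^sub>R \<omega> s (\<theta> t)) (\<lambda>s t. \<tau> s (\<theta> t)) (\<lambda>s t. h s (\<theta> t))"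
proof -
  have c: "continuous_on {0..T'} \<theta>"
    using d\<theta> by (meson continuous_on_eq_continuous_within has_vector_derivative_continuous)
  note rp = continuous_on_reparam[OF _ c \<theta>]
  have 1: "((\<lambda>u. \<eta> s (\<theta> u)) has_vector_derivative \<theta>' t *\<^sub>R \<omega> s (\<theta> t)) (at t within {0..T'})"
    if "s \<in> {0..L}" "t \<in> {0..T'}" for s t
  proof -
    have "((\<lambda>u. \<eta> s u) has_vector_derivative \<omega> s (\<theta> t)) (at (\<theta> t) within {0..T})"
      using sp that \<theta> unfolding shape_path_def by blast
    then have "((\<lambda>u. \<eta> s u) has_vector_derivative \<omega> s (\<theta> t)) (at (\<theta> t) within \<theta> ` {0..T'})"
      by (rule has_vector_derivative_within_subset) (use \<theta> in auto)
    from vector_diff_chain_within[OF d\<theta>[OF that(2)] this] show ?thesis by (simp add: o_def)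
  qed
  have 2: "((\<lambda>u. integral {0..L} (\<lambda>s. (norm (h s (\<theta> u) - h s (\<theta> t)))\<^sup>2)) \<longlongrightarrow> 0) (at t within {0..T'})"
    if t: "t \<in> {0..T'}" for t
  proof -
    define I where "I u = integral {0..L} (\<lambda>s. (norm (h s u - h s (\<theta> t)))\<^sup>2)" for u
    have I0: "I (\<theta> t) = 0" unfolding I_def by simp
    have "(I \<longlongrightarrow> 0) (at (\<theta> t) within {0..T})"
      using sp \<theta>[OF t] unfolding I_def shape_path_def by blast
    then have "continuous (at (\<theta> t) within {0..T}) I"
      unfolding continuous_within I0 .
    then have "continuous (at (\<theta> t) within \<theta> ` {0..T'}) I"
      by (rule continuous_within_subset) (use \<theta> in auto)
    moreover have "continuous (at t within {0..T'}) \<theta>"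
      using c t by (simp add: continuous_on_eq_continuous_within)
    ultimately have "continuous (at t within {0..T'}) (\<lambda>u. I (\<theta> u))"
      by (intro continuous_within_compose2[of t "{0..T'}" \<theta> I])
    then show ?thesis unfolding continuous_within I0 by (simp add: I_def)
  qed
  note A = sp[unfolded shape_path_def]
  have "continuous_on ({0..L} \<times> {0..T'}) (\<lambda>p. \<eta> (fst p) (\<theta> (snd p)))"
    "continuous_on ({0..L} \<times> {0..T'}) (\<lambda>p. \<omega> (fst p) (\<theta> (snd p)))"
    "continuous_on ({0..L} \<times> {0..T'}) (\<lambda>p. \<tau> (fst p) (\<theta> (snd p)))"
    using A by (blast intro: rp)+
  moreover from this(2) have "continuous_on ({0..L} \<times> {0..T'}) (\<lambda>p. \<theta>' (snd p) *\<^sub>R \<omega> (fst p) (\<theta> (snd p)))"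
    by (intro continuous_on_scaleR continuous_on_snd_comp[OF c\<theta>])
  ultimately show ?thesis
    unfolding shape_path_def using A \<theta> 1 2 by blast
qed

text \<open>The balance is homogeneous in the velocity and does not contain time, so the factor
  \<open>\<theta>'\<close> drops out.\<close>

lemma motion_reparam:
  assumes m: "motion L T \<rho> Ct Cn \<eta> \<omega> \<tau> h"
    and \<theta>: "\<And>t. t \<in> {0..T'} \<Longrightarrow> \<theta> t \<in> {0..T}"
    and d\<theta>: "\<And>t. t \<in> {0..T'} \<Longrightarrow> (\<theta> has_vector_derivative \<theta>' t) (at t within {0..T'})"
    and c\<theta>: "continuous_on {0..T'} \<theta>'"
  shows "motion L T' \<rho> Ct Cn (\<lambda>s t. \<eta> s (\<theta> t)) (\<lambda>s t. \<theta>' t *\<^sub>R \<omega> s (\<theta> t)) (\<lambda>s t. \<tau> s (\<theta> t)) (\<lambda>s t. h s (\<theta> t))"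
proof -
  have "shape_path L T \<rho> \<eta> \<omega> \<tau> h" using m unfolding motion_def by blast
  from shape_path_reparam[OF this \<theta> d\<theta> c\<theta>] show ?thesis
    using m \<theta> unfolding motion_def by (simp add: balanced_scaleR)
qed

lemma rot_diff_le: "norm (rot \<alpha> x - rot \<beta> x) \<le> (\<bar>cos \<alpha> - cos \<beta>\<bar> + \<bar>sin \<alpha> - sin \<beta>\<bar>) * norm x"
proof -
  have "rot \<alpha> x - rot \<beta> x = (cos \<alpha> - cos \<beta>) *\<^sub>R x + (sin \<alpha> - sin \<beta>) *\<^sub>R (J *v x)"
    by (simp add: rot_def algebra_simps)
  also have "norm \<dots> \<le> norm ((cos \<alpha> - cos \<beta>) *\<^sub>R x) + norm ((sin \<alpha> - sin \<beta>) *\<^sub>R (J *v x))"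
    by (rule norm_triangle_ineq)
  finally show ?thesis by (simp add: distrib_right)
qed

lemma shape_path_moving_frame:
  assumes sp: "shape_path L T \<rho> \<eta> \<omega> \<tau> h"
    and dp: "\<And>t. t \<in> {0..T} \<Longrightarrow> (p has_vector_derivative p' t) (at t within {0..T})"
    and cp: "continuous_on {0..T} p'"
    and d\<theta>: "\<And>t. t \<in> {0..T} \<Longrightarrow> (\<theta> has_real_derivative w t) (at t within {0..T})"
    and cw: "continuous_on {0..T} w"
  shows "shape_path L T \<rho> (\<lambda>s t. p t + rot (\<theta> t) (\<eta> s t))
    (\<lambda>s t. p' t + rot (\<theta> t) (\<omega> s t + w t *\<^sub>R (J *v \<eta> s t)))
    (\<lambda>s t. rot (\<theta> t) (\<tau> s t)) (\<lambda>s t. rot (\<theta> t) (h s t))"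
proof -
  have c: "continuous_on {0..T} p"
    using dp by (meson continuous_on_eq_continuous_within has_vector_derivative_continuous)
  have c\<theta>: "continuous_on {0..T} \<theta>"
    using d\<theta> by (meson continuous_on_eq_continuous_within DERIV_continuous)
  note ci = continuous_on_snd_comp[OF c] continuous_on_snd_comp[OF cp]
    continuous_on_snd_comp[OF c\<theta>] continuous_on_snd_comp[OF cw]
  note A = sp[unfolded shape_path_def]
  have 1: "((\<lambda>u. p u + rot (\<theta> u) (\<eta> s u)) has_vector_derivative
      p' t + rot (\<theta> t) (\<omega> s t + w t *\<^sub>R (J *v \<eta> s t))) (at t within {0..T})"
    if "s \<in> {0..L}" "t \<in> {0..T}" for s t
    using A that by (intro has_vector_derivative_add dp rot_has_vector_derivative d\<theta>) blast+
  have 2: "((\<lambda>\<sigma>. p t + rot (\<theta> t) (\<eta> \<sigma> t)) has_vector_derivative rot (\<theta> t) (\<tau> s t)) (at s within {0..L})"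
    if "s \<in> {0..L}" "t \<in> {0..T}" for s t
  proof -
    have "((\<lambda>\<sigma>. \<eta> \<sigma> t) has_vector_derivative \<tau> s t) (at s within {0..L})" using A that by blast
    from has_vector_derivative_add[OF has_vector_derivative_const
        bounded_linear.has_vector_derivative[OF bounded_linear_rot this]]
    show ?thesis by simp
  qed
  have 3: "rot (\<theta> t) (\<tau> s t) = rot (\<theta> t) (\<tau> 0 t) + integral {0..s} (\<lambda>r. rot (\<theta> t) (h r t))"
    if "s \<in> {0..L}" "t \<in> {0..T}" for s t
  proof -
    have "(\<lambda>r. h r t) integrable_on {0..s}"
      using A that by (intro L2_integrable_on[of _ L]) auto
    from integral_linear[OF this bounded_linear_rot, of "\<theta> t"]
    have "integral {0..s} (\<lambda>r. rot (\<theta> t) (h r t)) = rot (\<theta> t) (integral {0..s} (\<lambda>r. h r t))"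
      by (simp add: o_def)
    moreover have "\<tau> s t = \<tau> 0 t + integral {0..s} (\<lambda>r. h r t)" using A that by blast
    ultimately show ?thesis by (simp flip: rot_linear_simps(1))
  qed
  \<comment> \<open>The difference is split into the rotated increment of \<open>h\<close> and the
    change of the rotation applied to the fixed function \<open>h s t\<close>; the second part is
    small because cosine and sine of the angle are continuous.\<close>
  have 4: "((\<lambda>u. integral {0..L} (\<lambda>s. (norm (rot (\<theta> u) (h s u) - rot (\<theta> t) (h s t)))\<^sup>2)) \<longlongrightarrow> 0) (at t within {0..T})"
    if t: "t \<in> {0..T}" for t
  proof -
    define k where "k u = \<bar>cos (\<theta> u) - cos (\<theta> t)\<bar> + \<bar>sin (\<theta> u) - sin (\<theta> t)\<bar>" for u
    define I where "I u = integral {0..L} (\<lambda>s. (norm (h s u - h s t))\<^sup>2)" for u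
    define N where "N = integral {0..L} (\<lambda>s. (norm (h s t))\<^sup>2)"
    have hL: "(\<lambda>s. h s u) \<in> L2 {0<..<L}" if "u \<in> {0..T}" for u using A that by blast
    have "(\<theta> \<longlongrightarrow> \<theta> t) (at t within {0..T})" using c\<theta> t by (simp add: continuous_on_def)
    then have "(k \<longlongrightarrow> \<bar>cos (\<theta> t) - cos (\<theta> t)\<bar> + \<bar>sin (\<theta> t) - sin (\<theta> t)\<bar>) (at t within {0..T})"
      unfolding k_def by (intro tendsto_intros)
    then have k0: "(k \<longlongrightarrow> 0) (at t within {0..T})" by simp
    have "(I \<longlongrightarrow> 0) (at t within {0..T})" using A t unfolding I_def by blast
    then have lim: "((\<lambda>u. 2 * I u + 2 * (k u)\<^sup>2 * N) \<longlongrightarrow> 2 * 0 + 2 * 0\<^sup>2 * N) (at t within {0..T})"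
      using k0 by (intro tendsto_intros)
    have le: "integral {0..L} (\<lambda>s. (norm (rot (\<theta> u) (h s u) - rot (\<theta> t) (h s t)))\<^sup>2) \<le> 2 * I u + 2 * (k u)\<^sup>2 * N"
      if u: "u \<in> {0..T}" for u
    proof -
      have i1: "(\<lambda>s. (norm (h s u - h s t))\<^sup>2) integrable_on {0..L}"
        by (intro L2_sq_integrable L2_diff hL u t)
      have i2: "(\<lambda>s. (norm (h s t))\<^sup>2) integrable_on {0..L}"
        by (intro L2_sq_integrable hL t)
      have "integral {0..L} (\<lambda>s. (norm (rot (\<theta> u) (h s u) - rot (\<theta> t) (h s t)))\<^sup>2)
          \<le> integral {0..L} (\<lambda>s. 2 * (norm (h s u - h s t))\<^sup>2 + 2 * (k u)\<^sup>2 * (norm (h s t))\<^sup>2)"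
      proof (rule integral_le)
        show "(\<lambda>s. (norm (rot (\<theta> u) (h s u) - rot (\<theta> t) (h s t)))\<^sup>2) integrable_on {0..L}"
          by (intro L2_sq_integrable L2_diff L2_rot hL u t)
        show "(\<lambda>s. 2 * (norm (h s u - h s t))\<^sup>2 + 2 * (k u)\<^sup>2 * (norm (h s t))\<^sup>2) integrable_on {0..L}"
          by (intro integrable_add integrable_on_mult_right i1 i2)
        fix s
        have eq: "rot (\<theta> u) (h s u) - rot (\<theta> t) (h s t) =
            rot (\<theta> u) (h s u - h s t) + (rot (\<theta> u) (h s t) - rot (\<theta> t) (h s t))"
          unfolding rot_linear_simps by simp
        have "(norm (rot (\<theta> u) (h s u) - rot (\<theta> t) (h s t)))\<^sup>2 \<le>
            2 * (norm (h s u - h s t))\<^sup>2 + 2 * (norm (rot (\<theta> u) (h s t) - rot (\<theta> t) (h s t)))\<^sup>2"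
          unfolding eq
          using norm_add_sq_le[of "rot (\<theta> u) (h s u - h s t)" "rot (\<theta> u) (h s t) - rot (\<theta> t) (h s t)"]
          by (simp only: norm_rot)
        also have "(norm (rot (\<theta> u) (h s t) - rot (\<theta> t) (h s t)))\<^sup>2 \<le> (k u * norm (h s t))\<^sup>2"
          unfolding k_def by (intro power_mono rot_diff_le) auto
        finally show "(norm (rot (\<theta> u) (h s u) - rot (\<theta> t) (h s t)))\<^sup>2 \<le>
            2 * (norm (h s u - h s t))\<^sup>2 + 2 * (k u)\<^sup>2 * (norm (h s t))\<^sup>2"
          by (simp add: power_mult_distrib)
      qed
      also have "\<dots> = 2 * I u + 2 * (k u)\<^sup>2 * N"
        unfolding I_def N_def using i1 i2 by (simp add: integral_add integrable_on_mult_right)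
      finally show ?thesis .
    qed
    show ?thesis
    proof (rule tendsto_sandwich[OF _ _ tendsto_const])
      have "0 \<le> integral {0..L} (\<lambda>s. (norm (rot (\<theta> u) (h s u) - rot (\<theta> t) (h s t)))\<^sup>2)" if "u \<in> {0..T}" for u
        using that t by (intro integral_nonneg L2_sq_integrable L2_diff L2_rot hL) auto
      then show "\<forall>\<^sub>F u in at t within {0..T}. 0 \<le> integral {0..L} (\<lambda>s. (norm (rot (\<theta> u) (h s u) - rot (\<theta> t) (h s t)))\<^sup>2)"
        unfolding eventually_at_filter by (intro always_eventually) auto
      show "\<forall>\<^sub>F u in at t within {0..T}. integral {0..L} (\<lambda>s. (norm (rot (\<theta> u) (h s u) - rot (\<theta> t) (h s t)))\<^sup>2) \<le> 2 * I u + 2 * (k u)\<^sup>2 * N"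
        unfolding eventually_at_filter by (intro always_eventually allI impI le)
      show "((\<lambda>u. 2 * I u + 2 * (k u)\<^sup>2 * N) \<longlongrightarrow> 0) (at t within {0..T})" using lim by simp
    qed
  qed
  have "continuous_on ({0..L} \<times> {0..T}) (\<lambda>q. p (snd q) + rot (\<theta> (snd q)) (\<eta> (fst q) (snd q)))"
    "continuous_on ({0..L} \<times> {0..T}) (\<lambda>q. rot (\<theta> (snd q)) (\<tau> (fst q) (snd q)))"
    "continuous_on ({0..L} \<times> {0..T}) (\<lambda>q. p' (snd q) +
       rot (\<theta> (snd q)) (\<omega> (fst q) (snd q) + w (snd q) *\<^sub>R (J *v \<eta> (fst q) (snd q))))"
    using A by (intro continuous_intros ci; blast)+
  moreover have "thick L \<rho> (\<lambda>s. p t + rot (\<theta> t) (\<eta> s t)) (\<lambda>s. rot (\<theta> t) (\<tau> s t))"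
    "(\<lambda>s. rot (\<theta> t) (h s t)) \<in> L2 {0<..<L}" "norm (rot (\<theta> t) (\<tau> s t)) = 1 \<longleftrightarrow> norm (\<tau> s t) = 1"
    if "t \<in> {0..T}" for t s
    using A that by (auto intro: thick_rigid L2_rot)
  ultimately show ?thesis
    unfolding shape_path_def using A 1 2 3 4 by blast
qed

lemma continuous_on_integral_slice:
  fixes f :: "real \<Rightarrow> 'b::t2_space \<Rightarrow> 'a::euclidean_space"
  assumes "continuous_on ({0..L} \<times> B) (\<lambda>p. f (fst p) (snd p))"
  shows "continuous_on B (\<lambda>t. integral {0..L} (\<lambda>s. f s t))"
proof -
  have "continuous_on (B \<times> cbox 0 L) (\<lambda>p. (snd p, fst p))" by (intro continuous_intros)
  moreover have "(\<lambda>p. (snd p, fst p)) ` (B \<times> cbox 0 L) \<subseteq> {0..L} \<times> B" by auto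
  ultimately have "continuous_on (B \<times> cbox 0 L) (\<lambda>(t, s). f s t)"
    using continuous_on_compose2[OF assms] by (fastforce simp: case_prod_unfold)
  from integral_continuous_on_param[OF this] show ?thesis by simp
qed

text \<open>Drag is equivariant under rotations. Moving the origin by p changes the torque by the
  total force paired with \<open>J *v p\<close>, and the total force is zero.\<close>

lemma balanced_frame:
  assumes b: "balanced L Ct Cn \<xi> \<tau> \<omega>"
    and c: "continuous_on {0..L} \<xi>" "continuous_on {0..L} \<tau>" "continuous_on {0..L} \<omega>"
  shows "balanced L Ct Cn (\<lambda>s. p + rot \<theta> (\<xi> s)) (\<lambda>s. rot \<theta> (\<tau> s)) (\<lambda>s. rot \<theta> (\<omega> s))"
proof -
  define F where "F s = drag Ct Cn (\<tau> s) (\<omega> s)" for s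
  have cF: "continuous_on {0..L} F" unfolding F_def using c by (intro continuous_intros)
  have iF: "F integrable_on {0..L}" by (rule integrable_continuous_real[OF cF])
  have b': "integral {0..L} F = 0" "integral {0..L} (\<lambda>s. F s \<bullet> (J *v \<xi> s)) = 0"
    using b unfolding balanced_def F_def by auto
  have 1: "integral {0..L} (\<lambda>s. rot \<theta> (F s)) = 0"
    using integral_linear[OF iF bounded_linear_rot, of \<theta>] b' by (simp add: o_def rot_linear_simps)
  have "integral {0..L} (\<lambda>s. rot \<theta> (F s) \<bullet> (J *v p)) = integral {0..L} (\<lambda>s. rot \<theta> (F s)) \<bullet> (J *v p)"
    using integral_linear[OF integrable_continuous_real bounded_linear_inner_left, of 0 L "\<lambda>s. rot \<theta> (F s)" "J *v p"]
      cF by (simp add: o_def continuous_on_rot)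
  then have 2: "integral {0..L} (\<lambda>s. rot \<theta> (F s) \<bullet> (J *v p)) = 0" using 1 by simp
  have "integral {0..L} (\<lambda>s. rot \<theta> (F s) \<bullet> (J *v (p + rot \<theta> (\<xi> s)))) =
      integral {0..L} (\<lambda>s. rot \<theta> (F s) \<bullet> (J *v p) + F s \<bullet> (J *v \<xi> s))"
    by (simp add: J_linear_simps inner_add_right J_rot)
  also have "\<dots> = 0"
    using 2 b' cF c
    by (subst integral_add) (auto intro!: integrable_continuous_real continuous_intros)
  finally show ?thesis
    using 1 unfolding balanced_def drag_rot F_def by blast
qed

text \<open>In a body frame the balance equations determine the rigid velocity \<open>(v, w)\<close>
  from the shape alone; the frame is then recovered by two integrations.\<close>

lemma motion_of_body_velocity:
  assumes sp: "shape_path L T \<rho> \<xi> \<xi>' \<tau> h" and "0 \<le> T"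
    and cv: "continuous_on {0..T} v" and cw: "continuous_on {0..T} w"
    and bal: "\<And>t. t \<in> {0..T} \<Longrightarrow>
      balanced L Ct Cn (\<lambda>s. \<xi> s t) (\<lambda>s. \<tau> s t) (\<lambda>s. v t + \<xi>' s t + w t *\<^sub>R (J *v \<xi> s t))"
  defines "\<theta> \<equiv> \<lambda>t. integral {0..t} w"
  defines "p \<equiv> \<lambda>t. integral {0..t} (\<lambda>u. rot (\<theta> u) (v u))"
  shows "\<exists>\<omega> \<tau>' h'. motion L T \<rho> Ct Cn (\<lambda>s t. p t + rot (\<theta> t) (\<xi> s t)) \<omega> \<tau>' h'"
proof -
  have d\<theta>: "(\<theta> has_real_derivative w t) (at t within {0..T})" if "t \<in> {0..T}" for t
    using integral_has_vector_derivative[OF cw that]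
    unfolding \<theta>_def has_real_derivative_iff_has_vector_derivative .
  then have c\<theta>: "continuous_on {0..T} \<theta>"
    by (meson continuous_on_eq_continuous_within DERIV_continuous)
  have cr: "continuous_on {0..T} (\<lambda>u. rot (\<theta> u) (v u))"
    by (intro continuous_intros c\<theta> cv)
  have dp: "(p has_vector_derivative rot (\<theta> t) (v t)) (at t within {0..T})" if "t \<in> {0..T}" for t
    using integral_has_vector_derivative[OF cr that] unfolding p_def .
  note mf = shape_path_moving_frame[OF sp dp cr d\<theta> cw]
  have eq: "rot (\<theta> t) (v t) + rot (\<theta> t) (\<xi>' s t + w t *\<^sub>R (J *v \<xi> s t)) =
      rot (\<theta> t) (v t + \<xi>' s t + w t *\<^sub>R (J *v \<xi> s t))" for s t
    by (simp add: rot_linear_simps)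
  have "balanced L Ct Cn (\<lambda>s. p t + rot (\<theta> t) (\<xi> s t)) (\<lambda>s. rot (\<theta> t) (\<tau> s t))
      (\<lambda>s. rot (\<theta> t) (v t + \<xi>' s t + w t *\<^sub>R (J *v \<xi> s t)))" if t: "t \<in> {0..T}" for t
  proof (rule balanced_frame[OF bal[OF t]])
    have "continuous_on {0..L} (\<lambda>s. \<xi> s t)" "continuous_on {0..L} (\<lambda>s. \<tau> s t)" "continuous_on {0..L} (\<lambda>s. \<xi>' s t)"
      using sp t unfolding shape_path_def by (blast intro: continuous_on_slice)+
    then show "continuous_on {0..L} (\<lambda>s. \<xi> s t)" "continuous_on {0..L} (\<lambda>s. \<tau> s t)"
      "continuous_on {0..L} (\<lambda>s. v t + \<xi>' s t + w t *\<^sub>R (J *v \<xi> s t))"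
      by (auto intro!: continuous_intros)
  qed
  then show ?thesis
    using mf unfolding motion_def eq by blast
qed

section \<open>Rigid velocities and the resistance matrix\<close>

definition rigid_field :: "(real \<Rightarrow> real^2) \<Rightarrow> 3 \<Rightarrow> real \<Rightarrow> real^2" where
  "rigid_field \<xi> i s = (if i = 1 then axis 1 1 else if i = 2 then axis 2 1 else J *v \<xi> s)"

text \<open>This is the matrix of the drag form on the two translations and the rotation about the
  origin.\<close>

definition resistance :: "real \<Rightarrow> real \<Rightarrow> real \<Rightarrow> (real \<Rightarrow> real^2) \<Rightarrow> (real \<Rightarrow> real^2) \<Rightarrow> real^3^3" where
  "resistance L Ct Cn \<xi> \<tau> =
     (\<chi> i j. integral {0..L} (\<lambda>s. drag Ct Cn (\<tau> s) (rigid_field \<xi> j s) \<bullet> rigid_field \<xi> i s))"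

lemma continuous_on_rigid_field:
  "continuous_on S \<xi> \<Longrightarrow> continuous_on S (rigid_field \<xi> i)"
  unfolding rigid_field_def
  by (cases "i = 1"; cases "i = 2") (auto intro!: continuous_intros)

lemma resistance_mult:
  assumes "continuous_on {0..L} \<xi>" "continuous_on {0..L} \<tau>"
  shows "(resistance L Ct Cn \<xi> \<tau> *v x) $ i =
    integral {0..L} (\<lambda>s. drag Ct Cn (\<tau> s) (\<Sum>j\<in>UNIV. x $ j *\<^sub>R rigid_field \<xi> j s) \<bullet> rigid_field \<xi> i s)"
proof -
  note c = assms continuous_on_rigid_field[OF assms(1)]
  have "(resistance L Ct Cn \<xi> \<tau> *v x) $ i =
      (\<Sum>j\<in>UNIV. integral {0..L} (\<lambda>s. (drag Ct Cn (\<tau> s) (rigid_field \<xi> j s) \<bullet> rigid_field \<xi> i s) * x $ j))"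
    by (simp add: resistance_def matrix_vector_mult_def)
  also have "\<dots> = integral {0..L} (\<lambda>s. \<Sum>j\<in>UNIV. (drag Ct Cn (\<tau> s) (rigid_field \<xi> j s) \<bullet> rigid_field \<xi> i s) * x $ j)"
    by (rule integral_sum[symmetric]) (auto intro!: integrable_continuous_real continuous_intros c)
  also have "(\<lambda>s. \<Sum>j\<in>UNIV. (drag Ct Cn (\<tau> s) (rigid_field \<xi> j s) \<bullet> rigid_field \<xi> i s) * x $ j) =
      (\<lambda>s. drag Ct Cn (\<tau> s) (\<Sum>j\<in>UNIV. x $ j *\<^sub>R rigid_field \<xi> j s) \<bullet> rigid_field \<xi> i s)"
    by (simp add: sum_3 drag_add drag_scaleR inner_add_left fun_eq_iff)
  finally show ?thesis .
qed

lemma drag_coercive: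
  assumes "0 < Ct" "Ct \<le> Cn" "norm \<tau> = 1"
  shows "drag Ct Cn \<tau> v \<bullet> v \<ge> Ct * (norm v)\<^sup>2"
proof -
  have "(\<tau> \<bullet> v)\<^sup>2 \<le> (norm v)\<^sup>2"
    using norm_sq_orthonormal[OF assms(3), of v] by simp
  then have "(Cn - Ct) * (\<tau> \<bullet> v)\<^sup>2 \<le> (Cn - Ct) * (norm v)\<^sup>2"
    using assms by (intro mult_left_mono) auto
  moreover have "drag Ct Cn \<tau> v \<bullet> v = Cn * (norm v)\<^sup>2 - (Cn - Ct) * (\<tau> \<bullet> v)\<^sup>2"
    by (simp add: drag_def inner_diff_left power2_norm_eq_inner) (simp add: power2_eq_square)
  ultimately show ?thesis by (simp add: algebra_simps)
qed

text \<open>A kernel vector is a rigid velocity field \<open>V\<close> without dissipation, so it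
  vanishes along the whole curve by coercivity. Differentiating \<open>V\<close> along the curve
  gives the angular velocity times a unit vector, so there is no rotation, and then no translation
  either.\<close>

lemma resistance_det:
  assumes C: "0 < Ct" "Ct \<le> Cn" and "0 < L" and c: "unit_speed L \<xi> \<tau>"
  shows "det (resistance L Ct Cn \<xi> \<tau>) \<noteq> 0"
proof -
  have ct: "continuous_on {0..L} \<xi>" "continuous_on {0..L} \<tau>"
    using unit_speed_continuous[OF c] c unfolding unit_speed_def by auto
  have "x = 0" if x: "resistance L Ct Cn \<xi> \<tau> *v x = 0" for x
  proof -
    define V where "V s = (\<Sum>j\<in>UNIV. x $ j *\<^sub>R rigid_field \<xi> j s)" for s
    have cV: "continuous_on {0..L} V"
      unfolding V_def by (intro continuous_intros continuous_on_rigid_field ct)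
    have z: "integral {0..L} (\<lambda>s. drag Ct Cn (\<tau> s) (V s) \<bullet> rigid_field \<xi> i s) = 0" for i
      using resistance_mult[OF ct, of Ct Cn x i] x by (simp add: V_def)
    have e: "W \<bullet> V s = (\<Sum>i\<in>UNIV. x $ i * (W \<bullet> rigid_field \<xi> i s))" for W s
      by (simp add: V_def inner_sum_right)
    have "integral {0..L} (\<lambda>s. drag Ct Cn (\<tau> s) (V s) \<bullet> V s) =
        integral {0..L} (\<lambda>s. \<Sum>i\<in>UNIV. x $ i * (drag Ct Cn (\<tau> s) (V s) \<bullet> rigid_field \<xi> i s))"
      by (simp only: e)
    also have "\<dots> = (\<Sum>i\<in>UNIV. integral {0..L} (\<lambda>s. x $ i * (drag Ct Cn (\<tau> s) (V s) \<bullet> rigid_field \<xi> i s)))"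
      by (rule integral_sum)
        (auto intro!: integrable_continuous_real continuous_intros continuous_on_rigid_field ct cV)
    also have "\<dots> = 0" by (simp add: z)
    finally have "integral {0..L} (\<lambda>s. drag Ct Cn (\<tau> s) (V s) \<bullet> V s) = 0" .
    moreover have nn: "drag Ct Cn (\<tau> s) (V s) \<bullet> V s \<ge> Ct * (norm (V s))\<^sup>2" if "s \<in> {0..L}" for s
      using c that by (intro drag_coercive C) (auto simp: unit_speed_def)
    moreover have "drag Ct Cn (\<tau> s) (V s) \<bullet> V s \<ge> 0" if "s \<in> {0..L}" for s
      using nn[OF that] C by (smt (verit) mult_nonneg_nonneg zero_le_power2)
    moreover have "continuous_on {0..L} (\<lambda>s. drag Ct Cn (\<tau> s) (V s) \<bullet> V s)"
      by (intro continuous_intros ct cV)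
    ultimately have "\<forall>s\<in>{0..L}. drag Ct Cn (\<tau> s) (V s) \<bullet> V s = 0"
      using integral_eq_0_iff[of 0 L "\<lambda>s. drag Ct Cn (\<tau> s) (V s) \<bullet> V s"] \<open>0 < L\<close>
      by (auto simp del: J_comp)
    then have V0: "V s = 0" if "s \<in> {0..L}" for s
      using nn[OF that] that C by (auto simp: mult_le_0_iff)
    have Vs: "V s = vector [x $ 1, x $ 2] + x $ 3 *\<^sub>R (J *v \<xi> s)" for s
      by (simp add: V_def sum_3 rigid_field_def vec2_eq_iff axis_def)
    have "((\<lambda>s. x $ 3 *\<^sub>R (J *v \<xi> s)) has_vector_derivative x $ 3 *\<^sub>R (J *v \<tau> 0)) (at 0 within {0..L})"
      using c \<open>0 < L\<close> unfolding unit_speed_def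
      by (intro bounded_linear.has_vector_derivative[OF bounded_linear_scaleR_right]
          bounded_linear.has_vector_derivative[OF bounded_linear_J]) auto
    then have "(V has_vector_derivative 0 + x $ 3 *\<^sub>R (J *v \<tau> 0)) (at 0 within {0..L})"
      unfolding Vs[abs_def] by (intro has_vector_derivative_add has_vector_derivative_const)
    moreover have "(V has_vector_derivative 0) (at 0 within {0..L})"
      by (rule has_vector_derivative_transform[OF _ _ has_vector_derivative_const[of 0]])
        (use V0 \<open>0 < L\<close> in auto)
    ultimately have "0 + x $ 3 *\<^sub>R (J *v \<tau> 0) = 0"
      using vector_derivative_unique_within_closed_interval[of 0 L 0 V "0 + x $ 3 *\<^sub>R (J *v \<tau> 0)" 0] \<open>0 < L\<close>
      by simp
    moreover have "norm (J *v \<tau> 0) = 1" using c \<open>0 < L\<close> by (simp add: unit_speed_def)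
    then have "J *v \<tau> 0 \<noteq> 0" by (metis norm_zero zero_neq_one)
    ultimately have "x $ 3 = 0" by simp
    moreover from this have "vector [x $ 1, x $ 2] = (0 :: real^2)"
      using Vs[of 0] V0[of 0] \<open>0 < L\<close> by simp
    ultimately show "x = 0" by (simp add: vec_eq_iff forall_3 forall_2)
  qed
  then show ?thesis
    by (metis invertible_det_nz invertible_left_inverse matrix_left_invertible_ker)
qed

lemma continuous_on_det3:
  fixes A :: "'a::topological_space \<Rightarrow> real^3^3"
  assumes "\<And>i j. continuous_on S (\<lambda>t. A t $ i $ j)"
  shows "continuous_on S (\<lambda>t. det (A t))"
  unfolding det_3 by (intro continuous_on_add continuous_on_diff continuous_on_mult assms)

text \<open>The rigid velocity is given by Cramer's rule, so it inherits continuity in time from the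
  entries of the matrix and from the right-hand side.\<close>

lemma body_velocity_exists:
  assumes C: "0 < Ct" "Ct \<le> Cn" and "0 < L" and sp: "shape_path L T \<rho> \<xi> \<xi>' \<tau> h"
  obtains v w where "continuous_on {0..T} v" "continuous_on {0..T} w"
    "\<And>t. t \<in> {0..T} \<Longrightarrow>
      balanced L Ct Cn (\<lambda>s. \<xi> s t) (\<lambda>s. \<tau> s t) (\<lambda>s. v t + \<xi>' s t + w t *\<^sub>R (J *v \<xi> s t))"
proof -
  define M where "M t = resistance L Ct Cn (\<lambda>s. \<xi> s t) (\<lambda>s. \<tau> s t)" for t
  define b :: "real \<Rightarrow> real^3" where
    "b t = (\<chi> i. - integral {0..L} (\<lambda>s. drag Ct Cn (\<tau> s t) (\<xi>' s t) \<bullet> rigid_field (\<lambda>s. \<xi> s t) i s))" for t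
  define x :: "real \<Rightarrow> real^3" where
    "x t = (\<chi> k. det (\<chi> i j. if j = k then b t $ i else M t $ i $ j) / det (M t))" for t
  note A = sp[unfolded shape_path_def]
  have c2: "continuous_on ({0..L} \<times> {0..T}) (\<lambda>p. \<xi> (fst p) (snd p))"
    "continuous_on ({0..L} \<times> {0..T}) (\<lambda>p. \<xi>' (fst p) (snd p))"
    "continuous_on ({0..L} \<times> {0..T}) (\<lambda>p. \<tau> (fst p) (snd p))"
    using A by auto
  have cr: "continuous_on ({0..L} \<times> {0..T}) (\<lambda>p. rigid_field (\<lambda>s. \<xi> s (snd p)) i (fst p))" for i
    unfolding rigid_field_def
    by (cases "i = 1"; cases "i = 2") (auto intro!: continuous_intros c2)
  have cM: "continuous_on {0..T} (\<lambda>t. M t $ i $ j)" for i j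
    unfolding M_def resistance_def
    by (simp, intro continuous_on_integral_slice[where f = "\<lambda>s t. drag Ct Cn (\<tau> s t) (rigid_field (\<lambda>s. \<xi> s t) j s) \<bullet> rigid_field (\<lambda>s. \<xi> s t) i s"]
      continuous_intros c2 cr)
  have cb: "continuous_on {0..T} (\<lambda>t. b t $ i)" for i
    unfolding b_def
    by (simp, intro continuous_on_minus continuous_on_integral_slice[where f = "\<lambda>s t. drag Ct Cn (\<tau> s t) (\<xi>' s t) \<bullet> rigid_field (\<lambda>s. \<xi> s t) i s"]
      continuous_intros c2 cr)
  have dM: "det (M t) \<noteq> 0" if "t \<in> {0..T}" for t
    unfolding M_def by (rule resistance_det[OF C \<open>0 < L\<close> shape_path_unit_speed[OF sp that]])
  have cd: "continuous_on {0..T} (\<lambda>t. det (M t))"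
    by (rule continuous_on_det3[OF cM])
  have ce: "continuous_on {0..T} (\<lambda>t. (\<chi> i j. if j = k then b t $ i else M t $ i $ j) $ i $ j)" for k i j
    by (cases "j = k") (simp_all add: cM cb)
  have "continuous_on {0..T} (\<lambda>t. det (\<chi> i j. if j = k then b t $ i else M t $ i $ j))" for k
    by (rule continuous_on_det3[OF ce])
  then have cx: "continuous_on {0..T} (\<lambda>t. x t $ k)" for k
    unfolding x_def using dM by (auto intro!: continuous_on_divide cd)
  have Mx: "M t *v x t = b t" if "t \<in> {0..T}" for t
    using cramer[OF dM[OF that], of "x t" "b t"] by (simp add: x_def)
  define v :: "real \<Rightarrow> real^2" where "v t = x t $ 1 *\<^sub>R axis 1 1 + x t $ 2 *\<^sub>R axis 2 1" for t
  define w where "w t = x t $ 3" for t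
  show ?thesis
  proof
    show "continuous_on {0..T} v" "continuous_on {0..T} w"
      unfolding v_def w_def by (intro continuous_intros cx)+
    fix t assume t: "t \<in> {0..T}"
    have ct: "continuous_on {0..L} (\<lambda>s. \<xi> s t)" "continuous_on {0..L} (\<lambda>s. \<tau> s t)" "continuous_on {0..L} (\<lambda>s. \<xi>' s t)"
      using c2 t by (auto intro: continuous_on_slice)
    define V where "V s = v t + \<xi>' s t + w t *\<^sub>R (J *v \<xi> s t)" for s
    define R where "R s = (\<Sum>j\<in>UNIV. x t $ j *\<^sub>R rigid_field (\<lambda>s. \<xi> s t) j s)" for s
    have R: "V s = R s + \<xi>' s t" for s
      by (simp add: V_def R_def v_def w_def sum_3 rigid_field_def)
    have cR: "continuous_on {0..L} R"
      unfolding R_def by (intro continuous_intros continuous_on_rigid_field ct)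
    have z: "integral {0..L} (\<lambda>s. drag Ct Cn (\<tau> s t) (V s) \<bullet> rigid_field (\<lambda>s. \<xi> s t) i s) = 0" for i
    proof -
      have "integral {0..L} (\<lambda>s. drag Ct Cn (\<tau> s t) (V s) \<bullet> rigid_field (\<lambda>s. \<xi> s t) i s) =
        integral {0..L} (\<lambda>s. drag Ct Cn (\<tau> s t) (R s) \<bullet> rigid_field (\<lambda>s. \<xi> s t) i s) +
        integral {0..L} (\<lambda>s. drag Ct Cn (\<tau> s t) (\<xi>' s t) \<bullet> rigid_field (\<lambda>s. \<xi> s t) i s)"
        unfolding R drag_add inner_add_left
        by (intro integral_add integrable_continuous_real continuous_intros continuous_on_rigid_field ct cR)
      also have "integral {0..L} (\<lambda>s. drag Ct Cn (\<tau> s t) (R s) \<bullet> rigid_field (\<lambda>s. \<xi> s t) i s) = (M t *v x t) $ i"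
        unfolding M_def R_def by (rule resistance_mult[OF ct(1,2), symmetric])
      also have "\<dots> = - integral {0..L} (\<lambda>s. drag Ct Cn (\<tau> s t) (\<xi>' s t) \<bullet> rigid_field (\<lambda>s. \<xi> s t) i s)"
        unfolding Mx[OF t] b_def by simp
      finally show ?thesis by simp
    qed
    have cF: "continuous_on {0..L} (\<lambda>s. drag Ct Cn (\<tau> s t) (V s))"
      unfolding V_def by (intro continuous_intros ct)
    have "integral {0..L} (\<lambda>s. drag Ct Cn (\<tau> s t) (V s)) \<bullet> axis i 1 = 0" if i: "i = 1 \<or> i = 2" for i
    proof -
      have "integral {0..L} (\<lambda>s. drag Ct Cn (\<tau> s t) (V s)) \<bullet> axis i 1 =
          integral {0..L} (\<lambda>s. drag Ct Cn (\<tau> s t) (V s) \<bullet> axis i 1)"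
        using integral_linear[OF integrable_continuous_real[OF cF] bounded_linear_inner_left, of "axis i 1"]
        by (simp add: o_def)
      also have "\<dots> = 0"
        using i z[of 1] z[of 2] by (auto simp: rigid_field_def)
      finally show ?thesis .
    qed
    then have "integral {0..L} (\<lambda>s. drag Ct Cn (\<tau> s t) (V s)) = 0"
      by (simp add: vec2_eq_iff inner_axis)
    moreover have "integral {0..L} (\<lambda>s. drag Ct Cn (\<tau> s t) (V s) \<bullet> (J *v \<xi> s t)) = 0"
      using z[of 3] by (simp add: rigid_field_def)
    ultimately show "balanced L Ct Cn (\<lambda>s. \<xi> s t) (\<lambda>s. \<tau> s t) (\<lambda>s. v t + \<xi>' s t + w t *\<^sub>R (J *v \<xi> s t))"
      unfolding balanced_def V_def by blast
  qed
qed

section \<open>Reachability\<close>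

text \<open>The time interval is normalised to length 1; the prescribed duration enters only by a
  linear change of time at the very end.\<close>

definition reach :: "real \<Rightarrow> real \<Rightarrow> real \<Rightarrow> real \<Rightarrow> (real \<Rightarrow> real^2) \<Rightarrow> (real \<Rightarrow> real^2) \<Rightarrow> bool" where
  "reach L \<rho> Ct Cn A B \<longleftrightarrow> (\<exists>\<eta> \<omega> \<tau> h. motion L 1 \<rho> Ct Cn \<eta> \<omega> \<tau> h \<and>
     (\<forall>s\<in>{0..L}. \<eta> s 0 = A s \<and> \<eta> s 1 = B s))"

lemma reach_cong:
  assumes "reach L \<rho> Ct Cn A B" "\<And>s. s \<in> {0..L} \<Longrightarrow> A s = A' s" "\<And>s. s \<in> {0..L} \<Longrightarrow> B s = B' s"
  shows "reach L \<rho> Ct Cn A' B'"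
  using assms unfolding reach_def by metis

lemma reach_sym:
  assumes "reach L \<rho> Ct Cn A B"
  shows "reach L \<rho> Ct Cn B A"
proof -
  obtain \<eta> \<omega> \<tau> h where m: "motion L 1 \<rho> Ct Cn \<eta> \<omega> \<tau> h" "\<forall>s\<in>{0..L}. \<eta> s 0 = A s \<and> \<eta> s 1 = B s"
    using assms unfolding reach_def by blast
  have "((\<lambda>t. 1 - t) has_vector_derivative - 1) (at t within {0..1})" for t :: real
    by (auto intro!: derivative_eq_intros)
  from motion_reparam[OF m(1) _ this]
  have "motion L 1 \<rho> Ct Cn (\<lambda>s t. \<eta> s (1 - t)) (\<lambda>s t. (- 1) *\<^sub>R \<omega> s (1 - t))
      (\<lambda>s t. \<tau> s (1 - t)) (\<lambda>s t. h s (1 - t))" by auto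
  moreover have "\<forall>s\<in>{0..L}. \<eta> s (1 - 0) = B s \<and> \<eta> s (1 - 1) = A s" using m(2) by simp
  ultimately show ?thesis unfolding reach_def by blast
qed

lemma reach_rigid:
  assumes "reach L \<rho> Ct Cn A B"
  shows "reach L \<rho> Ct Cn (\<lambda>s. p + rot \<theta> (A s)) (\<lambda>s. p + rot \<theta> (B s))"
proof -
  obtain \<eta> \<omega> \<tau> h where m: "motion L 1 \<rho> Ct Cn \<eta> \<omega> \<tau> h" "\<forall>s\<in>{0..L}. \<eta> s 0 = A s \<and> \<eta> s 1 = B s"
    using assms unfolding reach_def by blast
  have sp: "shape_path L 1 \<rho> \<eta> \<omega> \<tau> h" using m unfolding motion_def by blast
  have "shape_path L 1 \<rho> (\<lambda>s t. p + rot \<theta> (\<eta> s t)) (\<lambda>s t. 0 + rot \<theta> (\<omega> s t + 0 *\<^sub>R (J *v \<eta> s t)))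
      (\<lambda>s t. rot \<theta> (\<tau> s t)) (\<lambda>s t. rot \<theta> (h s t))"
    by (rule shape_path_moving_frame[OF sp, where p = "\<lambda>_. p" and p' = "\<lambda>_. 0" and \<theta> = "\<lambda>_. \<theta>" and w = "\<lambda>_. 0"])
      (auto intro!: continuous_intros derivative_eq_intros)
  moreover have "balanced L Ct Cn (\<lambda>s. p + rot \<theta> (\<eta> s t)) (\<lambda>s. rot \<theta> (\<tau> s t)) (\<lambda>s. rot \<theta> (\<omega> s t))"
    if "t \<in> {0..1}" for t
    using m(1) that unfolding motion_def shape_path_def
    by (intro balanced_frame) (blast intro: continuous_on_slice)+
  ultimately have "motion L 1 \<rho> Ct Cn (\<lambda>s t. p + rot \<theta> (\<eta> s t)) (\<lambda>s t. rot \<theta> (\<omega> s t))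
      (\<lambda>s t. rot \<theta> (\<tau> s t)) (\<lambda>s t. rot \<theta> (h s t))"
    unfolding motion_def by simp
  then show ?thesis unfolding reach_def using m(2) by force
qed

text \<open>The square of a positive part is continuously differentiable. This is all the smoothness
  that a clock needs to come to rest in time.\<close>

lemma ramp_derivative:
  "((\<lambda>t. (max 0 (a + b * t))\<^sup>2) has_real_derivative 2 * b * max 0 (a + b * t)) (at t within S)"
proof -
  have sq: "((\<lambda>x. (max 0 x)\<^sup>2) has_real_derivative 2 * max 0 x) (at x)" for x :: real
  proof -
    consider "x > 0" | "x < 0" | "x = 0" by linarith
    then show ?thesis
    proof cases
      case 1
      have "((\<lambda>x. x\<^sup>2) has_real_derivative 2 * max 0 x) (at x)"
        using 1 by (auto intro!: derivative_eq_intros)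
      then show ?thesis
        by (rule DERIV_cong_ev[THEN iffD1, OF refl _ refl, rotated])
          (use eventually_gt_at_top eventually_nhds_in_open[of "{0<..}" x] 1 in \<open>auto elim!: eventually_mono\<close>)
    next
      case 2
      have "((\<lambda>x. 0) has_real_derivative 2 * max 0 x) (at x)"
        using 2 by auto
      then show ?thesis
        by (rule DERIV_cong_ev[THEN iffD1, OF refl _ refl, rotated])
          (use eventually_nhds_in_open[of "{..<0}" x] 2 in \<open>auto elim!: eventually_mono\<close>)
    next
      case 3
      have "((\<lambda>h. ((max 0 (0 + h))\<^sup>2 - (max 0 0)\<^sup>2) / h) \<longlongrightarrow> 0) (at (0::real))"
      proof (rule Lim_null_comparison)
        show "\<forall>\<^sub>F h in at (0::real). norm (((max 0 (0 + h))\<^sup>2 - (max 0 0)\<^sup>2) / h) \<le> \<bar>h\<bar>"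
          by (intro always_eventually) (auto simp: max_def power2_eq_square)
        show "((\<lambda>h. \<bar>h\<bar>) \<longlongrightarrow> 0) (at (0::real))" by (intro tendsto_rabs_zero tendsto_ident_at)
      qed
      then show ?thesis using 3 by (simp add: DERIV_def)
    qed
  qed
  have "((\<lambda>t. a + b * t) has_real_derivative b) (at t within S)"
    by (auto intro!: derivative_eq_intros)
  from DERIV_chain2[OF sq this] show ?thesis by (simp add: algebra_simps)
qed

text \<open>The two motions are run one after the other with clocks that stop smoothly; the formula
  \<open>\<eta>\<^sub>1 + \<eta>\<^sub>2 - M\<close>, where \<open>M\<close> is the common configuration, avoids a distinction of cases in time.\<close>

lemma reach_trans:
  assumes "reach L \<rho> Ct Cn A M" "reach L \<rho> Ct Cn M B" "0 < L"
  shows "reach L \<rho> Ct Cn A B"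
proof -
  obtain \<eta>1 \<omega>1 \<tau>1 h1 where m1: "motion L 1 \<rho> Ct Cn \<eta>1 \<omega>1 \<tau>1 h1" "\<forall>s\<in>{0..L}. \<eta>1 s 0 = A s \<and> \<eta>1 s 1 = M s"
    using assms unfolding reach_def by blast
  obtain \<eta>2 \<omega>2 \<tau>2 h2 where m2: "motion L 1 \<rho> Ct Cn \<eta>2 \<omega>2 \<tau>2 h2" "\<forall>s\<in>{0..L}. \<eta>2 s 0 = M s \<and> \<eta>2 s 1 = B s"
    using assms unfolding reach_def by blast
  \<comment> \<open>The clock \<open>f\<close> runs from 0 to 1 on the first half of the interval
    and then rests at 1; \<open>g\<close> rests at 0 and runs on the second half.\<close>
  define f where "f t = 1 - (max 0 (1 + (-2) * t))\<^sup>2" for t :: real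
  define f' where "f' t = 4 * max 0 (1 + (-2) * t)" for t :: real
  define g where "g t = (max 0 (-1 + 2 * t))\<^sup>2" for t :: real
  define g' where "g' t = 4 * max 0 (-1 + 2 * t)" for t :: real
  have fr: "f t \<in> {0..1}" "g t \<in> {0..1}" if "t \<in> {0..1}" for t
    using that unfolding f_def g_def by (auto simp: abs_square_le_1 max_def intro!: power_le_one)
  have df: "(f has_vector_derivative f' t) (at t within {0..1})" for t
    unfolding f_def f'_def has_real_derivative_iff_has_vector_derivative[symmetric]
    using DERIV_diff[OF DERIV_const[of 1] ramp_derivative[of 1 "-2" t "{0..1}"]] by simp
  have dg: "(g has_vector_derivative g' t) (at t within {0..1})" for t
    unfolding g_def g'_def has_real_derivative_iff_has_vector_derivative[symmetric]
    using ramp_derivative[of "-1" 2 t "{0..1}"] by simp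
  have cf: "continuous_on {0..1} f'" "continuous_on {0..1} g'"
    unfolding f'_def g'_def by (intro continuous_intros)+
  note n1 = motion_reparam[OF m1(1) fr(1) df cf(1)]
  note n2 = motion_reparam[OF m2(1) fr(2) dg cf(2)]
  define \<eta> where "\<eta> s t = \<eta>1 s (f t) + \<eta>2 s (g t) - \<eta>1 s 1" for s t
  define \<omega> where "\<omega> s t = f' t *\<^sub>R \<omega>1 s (f t) + g' t *\<^sub>R \<omega>2 s (g t)" for s t
  define \<tau> where "\<tau> s t = \<tau>1 s (f t) + \<tau>2 s (g t) - \<tau>1 s 1" for s t
  \<comment> \<open>The functions \<open>h1 s 1\<close> and \<open>h2 s 0\<close> are only known to
    have the same primitive. Only primitives and differences in time of \<open>h\<close> are used,
    for which their pointwise values are irrelevant.\<close>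
  define h where "h s t = h1 s (f t) + h2 s (g t) - h1 s 1" for s t
  have sp1: "shape_path L 1 \<rho> \<eta>1 \<omega>1 \<tau>1 h1" and sp2: "shape_path L 1 \<rho> \<eta>2 \<omega>2 \<tau>2 h2"
    using m1 m2 unfolding motion_def by auto
  have sn1: "shape_path L 1 \<rho> (\<lambda>s t. \<eta>1 s (f t)) (\<lambda>s t. f' t *\<^sub>R \<omega>1 s (f t)) (\<lambda>s t. \<tau>1 s (f t)) (\<lambda>s t. h1 s (f t))"
    and sn2: "shape_path L 1 \<rho> (\<lambda>s t. \<eta>2 s (g t)) (\<lambda>s t. g' t *\<^sub>R \<omega>2 s (g t)) (\<lambda>s t. \<tau>2 s (g t)) (\<lambda>s t. h2 s (g t))"
    using n1 n2 unfolding motion_def by auto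
  have mid: "\<eta>1 s 1 = \<eta>2 s 0" if "s \<in> {0..L}" for s using m1(2) m2(2) that by auto
  have one: "(1::real) \<in> {0..1}" and zero: "(0::real) \<in> {0..1}" by simp_all
  \<comment> \<open>A common configuration has a common tangent, so the formula for
    \<open>\<eta>\<close> is inherited by \<open>\<tau>\<close>.\<close>
  have mid\<tau>: "\<tau>1 s 1 = \<tau>2 s 0" if s: "s \<in> {0..L}" for s
  proof -
    have "((\<lambda>\<sigma>. \<eta>1 \<sigma> 1) has_vector_derivative \<tau>1 s 1) (at s within {0..L})"
      "((\<lambda>\<sigma>. \<eta>2 \<sigma> 0) has_vector_derivative \<tau>2 s 0) (at s within {0..L})"
      using sp1 sp2 s one zero unfolding shape_path_def by blast+
    moreover have "((\<lambda>\<sigma>. \<eta>2 \<sigma> 0) has_vector_derivative \<tau>1 s 1) (at s within {0..L})"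
      using calculation(1) by (rule has_vector_derivative_transform[OF s, rotated]) (use mid in auto)
    ultimately show ?thesis
      using vector_derivative_unique_within_closed_interval[of 0 L s] s \<open>0 < L\<close> by auto
  qed
  have cases: "(\<forall>s\<in>{0..L}. \<eta> s t = \<eta>1 s (f t) \<and> \<tau> s t = \<tau>1 s (f t) \<and> \<omega> s t = f' t *\<^sub>R \<omega>1 s (f t)) \<or>
      (\<forall>s\<in>{0..L}. \<eta> s t = \<eta>2 s (g t) \<and> \<tau> s t = \<tau>2 s (g t) \<and> \<omega> s t = g' t *\<^sub>R \<omega>2 s (g t))" for t
  proof (cases "t \<le> 1/2")
    case True
    then have "g t = 0" "g' t = 0" by (auto simp: g_def g'_def max_def)
    then show ?thesis using mid mid\<tau> by (auto simp: \<eta>_def \<tau>_def \<omega>_def)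
  next
    case False
    then have "f t = 1" "f' t = 0" by (auto simp: f_def f'_def max_def)
    then show ?thesis by (auto simp: \<eta>_def \<tau>_def \<omega>_def)
  qed
  note A1 = sn1[unfolded shape_path_def] and A2 = sn2[unfolded shape_path_def] and A0 = sp1[unfolded shape_path_def]
  have c: "continuous_on ({0..L} \<times> {0..1}) (\<lambda>p. \<eta> (fst p) (snd p))"
    "continuous_on ({0..L} \<times> {0..1}) (\<lambda>p. \<tau> (fst p) (snd p))"
    "continuous_on ({0..L} \<times> {0..1}) (\<lambda>p. \<omega> (fst p) (snd p))"
  proof -
    have "continuous_on ({0..L} \<times> {0..1}) (\<lambda>p. \<eta>1 (fst p) 1)" "continuous_on ({0..L} \<times> {0..1}) (\<lambda>p. \<tau>1 (fst p) 1)"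
      using A0 by (auto intro: continuous_on_reparam[where \<theta> = "\<lambda>_. 1" and B = "{0..1}"])
    then show "continuous_on ({0..L} \<times> {0..1}) (\<lambda>p. \<eta> (fst p) (snd p))"
      "continuous_on ({0..L} \<times> {0..1}) (\<lambda>p. \<tau> (fst p) (snd p))"
      "continuous_on ({0..L} \<times> {0..1}) (\<lambda>p. \<omega> (fst p) (snd p))"
      unfolding \<eta>_def \<tau>_def \<omega>_def using A1 A2 by (auto intro!: continuous_on_add continuous_on_diff)
  qed
  have ds: "((\<lambda>\<sigma>. \<eta> \<sigma> t) has_vector_derivative \<tau> s t) (at s within {0..L})"
    if "s \<in> {0..L}" "t \<in> {0..1}" for s t
    unfolding \<eta>_def \<tau>_def using A1 A2 A0 that one
    by (intro has_vector_derivative_diff has_vector_derivative_add) blast+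
  have dt: "((\<lambda>u. \<eta> s u) has_vector_derivative \<omega> s t) (at t within {0..1})"
    if "s \<in> {0..L}" "t \<in> {0..1}" for s t
  proof -
    have "((\<lambda>u. \<eta>1 s (f u) + \<eta>2 s (g u) - \<eta>1 s 1) has_vector_derivative
        f' t *\<^sub>R \<omega>1 s (f t) + g' t *\<^sub>R \<omega>2 s (g t) - 0) (at t within {0..1})"
      using A1 A2 that
      by (intro has_vector_derivative_diff has_vector_derivative_add has_vector_derivative_const) blast+
    then show ?thesis by (simp add: \<eta>_def \<omega>_def)
  qed
  have hL: "(\<lambda>s. h1 s (f t)) \<in> L2 {0<..<L}" "(\<lambda>s. h2 s (g t)) \<in> L2 {0<..<L}" "(\<lambda>s. h1 s 1) \<in> L2 {0<..<L}"
    if "t \<in> {0..1}" for t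
    using A1 A2 A0 that one by blast+
  have \<tau>h: "\<tau> s t = \<tau> 0 t + integral {0..s} (\<lambda>r. h r t)" if "s \<in> {0..L}" "t \<in> {0..1}" for s t
  proof -
    have i: "(\<lambda>r. h1 r (f t)) integrable_on {0..s}" "(\<lambda>r. h2 r (g t)) integrable_on {0..s}" "(\<lambda>r. h1 r 1) integrable_on {0..s}"
      using hL[OF that(2)] that by (auto intro: L2_integrable_on)
    have "integral {0..s} (\<lambda>r. h r t) = integral {0..s} (\<lambda>r. h1 r (f t)) + integral {0..s} (\<lambda>r. h2 r (g t)) - integral {0..s} (\<lambda>r. h1 r 1)"
      unfolding h_def using i by (simp add: integral_add integral_diff integrable_add)
    moreover have "\<tau>1 s (f t) = \<tau>1 0 (f t) + integral {0..s} (\<lambda>r. h1 r (f t))"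
      "\<tau>2 s (g t) = \<tau>2 0 (g t) + integral {0..s} (\<lambda>r. h2 r (g t))"
      "\<tau>1 s 1 = \<tau>1 0 1 + integral {0..s} (\<lambda>r. h1 r 1)"
      using A1 A2 A0 that one by blast+
    ultimately show ?thesis unfolding \<tau>_def by simp
  qed
  have hc: "((\<lambda>u. integral {0..L} (\<lambda>s. (norm (h s u - h s t))\<^sup>2)) \<longlongrightarrow> 0) (at t within {0..1})"
    if t: "t \<in> {0..1}" for t
  proof -
    define I1 where "I1 u = integral {0..L} (\<lambda>s. (norm (h1 s (f u) - h1 s (f t)))\<^sup>2)" for u
    define I2 where "I2 u = integral {0..L} (\<lambda>s. (norm (h2 s (g u) - h2 s (g t)))\<^sup>2)" for u
    have "(I1 \<longlongrightarrow> 0) (at t within {0..1})" "(I2 \<longlongrightarrow> 0) (at t within {0..1})"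
      using A1 A2 t unfolding I1_def I2_def by blast+
    then have "((\<lambda>u. 2 * I1 u + 2 * I2 u) \<longlongrightarrow> 2 * 0 + 2 * 0) (at t within {0..1})"
      by (intro tendsto_intros)
    then have lim: "((\<lambda>u. 2 * I1 u + 2 * I2 u) \<longlongrightarrow> 0) (at t within {0..1})" by simp
    have le: "0 \<le> integral {0..L} (\<lambda>s. (norm (h s u - h s t))\<^sup>2) \<and>
        integral {0..L} (\<lambda>s. (norm (h s u - h s t))\<^sup>2) \<le> 2 * I1 u + 2 * I2 u" if u: "u \<in> {0..1}" for u
    proof -
      have i: "(\<lambda>s. (norm (h1 s (f u) - h1 s (f t)))\<^sup>2) integrable_on {0..L}"
        "(\<lambda>s. (norm (h2 s (g u) - h2 s (g t)))\<^sup>2) integrable_on {0..L}"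
        by (intro L2_sq_integrable L2_diff hL u t)+
      have j: "(\<lambda>s. (norm (h s u - h s t))\<^sup>2) integrable_on {0..L}"
        unfolding h_def by (intro L2_sq_integrable L2_diff L2_add hL[OF u] hL[OF t])
      have e: "(norm (h s u - h s t))\<^sup>2 \<le> 2 * (norm (h1 s (f u) - h1 s (f t)))\<^sup>2 + 2 * (norm (h2 s (g u) - h2 s (g t)))\<^sup>2" for s
      proof -
        have eq: "h s u - h s t = (h1 s (f u) - h1 s (f t)) + (h2 s (g u) - h2 s (g t))" by (simp add: h_def)
        show ?thesis unfolding eq by (rule norm_add_sq_le)
      qed
      have "integral {0..L} (\<lambda>s. (norm (h s u - h s t))\<^sup>2) \<le>
          integral {0..L} (\<lambda>s. 2 * (norm (h1 s (f u) - h1 s (f t)))\<^sup>2 + 2 * (norm (h2 s (g u) - h2 s (g t)))\<^sup>2)"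
        using i j e by (intro integral_le integrable_add integrable_on_mult_right) auto
      also have "\<dots> = 2 * I1 u + 2 * I2 u"
        unfolding I1_def I2_def using i by (simp add: integral_add integrable_on_mult_right)
      finally show ?thesis using j by (auto intro: integral_nonneg)
    qed
    show ?thesis
      by (rule tendsto_sandwich[OF _ _ tendsto_const lim])
        (use le in \<open>auto simp: eventually_at_filter intro!: always_eventually\<close>)
  qed
  have pt: "norm (\<tau> s t) = 1" "thick L \<rho> (\<lambda>s. \<eta> s t) (\<lambda>s. \<tau> s t)"
    "balanced L Ct Cn (\<lambda>s. \<eta> s t) (\<lambda>s. \<tau> s t) (\<lambda>s. \<omega> s t)"
    if t: "t \<in> {0..1}" and s: "s \<in> {0..L}" for s t
  proof -
    have "norm (\<tau>1 s (f t)) = 1" "norm (\<tau>2 s (g t)) = 1" using A1 A2 t s by blast+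
    then show "norm (\<tau> s t) = 1" using cases[of t] s by auto
    have "thick L \<rho> (\<lambda>s. \<eta>1 s (f t)) (\<lambda>s. \<tau>1 s (f t))" "thick L \<rho> (\<lambda>s. \<eta>2 s (g t)) (\<lambda>s. \<tau>2 s (g t))"
      using A1 A2 t by blast+
    then show "thick L \<rho> (\<lambda>s. \<eta> s t) (\<lambda>s. \<tau> s t)"
      using cases[of t] \<open>0 < L\<close> thick_cong[of L "\<lambda>s. \<eta> s t" "\<lambda>s. \<eta>1 s (f t)" "\<lambda>s. \<tau> s t" "\<lambda>s. \<tau>1 s (f t)" \<rho>]
        thick_cong[of L "\<lambda>s. \<eta> s t" "\<lambda>s. \<eta>2 s (g t)" "\<lambda>s. \<tau> s t" "\<lambda>s. \<tau>2 s (g t)" \<rho>] by auto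
    have "balanced L Ct Cn (\<lambda>s. \<eta>1 s (f t)) (\<lambda>s. \<tau>1 s (f t)) (\<lambda>s. f' t *\<^sub>R \<omega>1 s (f t))"
      "balanced L Ct Cn (\<lambda>s. \<eta>2 s (g t)) (\<lambda>s. \<tau>2 s (g t)) (\<lambda>s. g' t *\<^sub>R \<omega>2 s (g t))"
      using n1 n2 t unfolding motion_def by blast+
    note b = this
    show "balanced L Ct Cn (\<lambda>s. \<eta> s t) (\<lambda>s. \<tau> s t) (\<lambda>s. \<omega> s t)"
      using cases[of t]
    proof
      assume "\<forall>s\<in>{0..L}. \<eta> s t = \<eta>1 s (f t) \<and> \<tau> s t = \<tau>1 s (f t) \<and> \<omega> s t = f' t *\<^sub>R \<omega>1 s (f t)"
      then show ?thesis by (intro iffD2[OF balanced_cong b(1)]) auto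
    next
      assume "\<forall>s\<in>{0..L}. \<eta> s t = \<eta>2 s (g t) \<and> \<tau> s t = \<tau>2 s (g t) \<and> \<omega> s t = g' t *\<^sub>R \<omega>2 s (g t)"
      then show ?thesis by (intro iffD2[OF balanced_cong b(2)]) auto
    qed
  qed
  have hL2: "(\<lambda>s. h s t) \<in> L2 {0<..<L}" if "t \<in> {0..1}" for t
    unfolding h_def by (intro L2_diff L2_add hL[OF that])
  have L0: "0 \<in> {0..L}" using \<open>0 < L\<close> by simp
  note pt' = pt(2,3)[OF _ L0]
  have "shape_path L 1 \<rho> \<eta> \<omega> \<tau> h"
    unfolding shape_path_def
  proof (intro conjI c; intro ballI conjI)
    fix s t :: real assume s: "s \<in> {0..L}" and t: "t \<in> {0..1}"
    show "((\<lambda>\<sigma>. \<eta> \<sigma> t) has_vector_derivative \<tau> s t) (at s within {0..L})" by (rule ds[OF s t])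
    show "((\<lambda>u. \<eta> s u) has_vector_derivative \<omega> s t) (at t within {0..1})" by (rule dt[OF s t])
    show "norm (\<tau> s t) = 1" by (rule pt(1)[OF t s])
    show "\<tau> s t = \<tau> 0 t + integral {0..s} (\<lambda>r. h r t)" by (rule \<tau>h[OF s t])
  next
    fix t :: real assume t: "t \<in> {0..1}"
    show "(\<lambda>s. h s t) \<in> L2 {0<..<L}" by (rule hL2[OF t])
    show "thick L \<rho> (\<lambda>s. \<eta> s t) (\<lambda>s. \<tau> s t)" by (rule pt'(1)[OF t])
    show "((\<lambda>u. integral {0..L} (\<lambda>s. (norm (h s u - h s t))\<^sup>2)) \<longlongrightarrow> 0) (at t within {0..1})"
      by (rule hc[OF t])
  qed
  then have "motion L 1 \<rho> Ct Cn \<eta> \<omega> \<tau> h"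
    unfolding motion_def using pt'(2) by blast
  moreover have "\<eta> s 0 = A s" "\<eta> s 1 = B s" if "s \<in> {0..L}" for s
    using that m1(2) m2(2) by (auto simp: \<eta>_def f_def g_def)
  ultimately show ?thesis unfolding reach_def by blast
qed

section \<open>Dilations of square integrable functions\<close>

lemma dominated_convergence_ae:
  fixes u :: "nat \<Rightarrow> real \<Rightarrow> 'a::euclidean_space"
  assumes "negligible N" and i: "\<And>n. u n integrable_on S" and g: "g integrable_on S"
    and le: "\<And>n x. x \<in> S - N \<Longrightarrow> norm (u n x) \<le> g x"
    and lim: "\<And>x. x \<in> S - N \<Longrightarrow> (\<lambda>n. u n x) \<longlonglongrightarrow> v x"
  shows "(\<lambda>n. integral S (u n)) \<longlonglongrightarrow> integral S v"
proof -
  define u' where "u' n x = (if x \<in> N then 0 else u n x)" for n x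
  define v' where "v' x = (if x \<in> N then 0 else v x)" for x
  define g' where "g' x = (if x \<in> N then 0 else g x)" for x
  have "(\<lambda>n. integral S (u' n)) \<longlonglongrightarrow> integral S v'"
  proof (rule dominated_convergence(2))
    show "u' n integrable_on S" for n
      by (rule integrable_spike[OF i \<open>negligible N\<close>]) (simp add: u'_def)
    show "g' integrable_on S"
      by (rule integrable_spike[OF g \<open>negligible N\<close>]) (simp add: g'_def)
  qed (use le lim in \<open>auto simp: u'_def v'_def g'_def\<close>)
  moreover have "integral S (u' n) = integral S (u n)" for n
    by (rule integral_spike[OF \<open>negligible N\<close>]) (simp add: u'_def)
  moreover have "integral S v' = integral S v"
    by (rule integral_spike[OF \<open>negligible N\<close>]) (simp add: v'_def)
  ultimately show ?thesis by simp
qed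

text \<open>This is the radial projection onto the ball of radius \<open>M\<close>.\<close>

definition trunc :: "real \<Rightarrow> real^2 \<Rightarrow> real^2" where
  "trunc M v = (M / max M (norm v)) *\<^sub>R v"

lemma trunc_eq: "0 < M \<Longrightarrow> norm v \<le> M \<Longrightarrow> trunc M v = v"
  by (simp add: trunc_def max_def)

lemma norm_trunc: "0 < M \<Longrightarrow> norm (trunc M v) \<le> M"
  by (simp add: trunc_def max_def divide_simps)

lemma norm_diff_trunc:
  assumes "0 < M"
  shows "norm (v - trunc M v) \<le> norm v"
proof -
  have "v - trunc M v = (1 - M / max M (norm v)) *\<^sub>R v" by (simp add: trunc_def algebra_simps)
  moreover have "0 \<le> 1 - M / max M (norm v)" "1 - M / max M (norm v) \<le> 1"
    using assms by (auto simp: divide_simps)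
  ultimately show ?thesis by (simp add: mult_left_le_one_le)
qed

lemma continuous_on_trunc:
  assumes "0 < M"
  shows "continuous_on UNIV (trunc M)"
  unfolding trunc_def using assms by (auto intro!: continuous_intros)

lemma L2_trunc:
  fixes f :: "real \<Rightarrow> real^2"
  assumes f: "f \<in> L2 {0<..<L}" and "0 < M"
  shows "(\<lambda>x. trunc M (f x)) \<in> L2 {0<..<L}"
proof (rule L2_bound)
  have "trunc M \<in> borel_measurable borel"
    by (intro borel_measurable_continuous_onI continuous_on_trunc \<open>0 < M\<close>)
  then show "(\<lambda>x. trunc M (f x)) \<in> borel_measurable (lebesgue_on {0<..<L})"
    using L2_measurable[OF f] by (rule measurable_compose_rev)
  show "(\<lambda>x. M\<^sup>2) integrable_on {0..L}" by (rule integrable_const_ivl)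
  show "(norm (trunc M (f x)))\<^sup>2 \<le> M\<^sup>2" for x
    using norm_trunc[OF \<open>0 < M\<close>] by (intro power_mono) auto
qed

text \<open>A truncation of f is close to f by dominated convergence. As a measurable function, f is
  almost everywhere a limit of continuous functions; truncating these at the same level provides a
  constant majorant for a second use of dominated convergence.\<close>

lemma L2_approx_continuous:
  fixes f :: "real \<Rightarrow> real^2"
  assumes f: "f \<in> L2 {0<..<L}" and "0 < e"
  obtains g where "continuous_on UNIV g" "integral {0..L} (\<lambda>x. (norm (f x - g x))\<^sup>2) < e"
proof -
  have "(\<lambda>n. integral {0..L} (\<lambda>x. (norm (f x - trunc (real (Suc n)) (f x)))\<^sup>2)) \<longlonglongrightarrow> integral {0..L} (\<lambda>x. 0::real)"
  proof (rule dominated_convergence_ae[OF negligible_empty])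
    show "(\<lambda>x. (norm (f x - trunc (real (Suc n)) (f x)))\<^sup>2) integrable_on {0..L}" for n
      by (intro L2_sq_integrable L2_diff f L2_trunc) auto
    show "(\<lambda>x. (norm (f x))\<^sup>2) integrable_on {0..L}" by (rule L2_sq_integrable[OF f])
    show "norm ((norm (f x - trunc (real (Suc n)) (f x)))\<^sup>2) \<le> (norm (f x))\<^sup>2" for n x
      using norm_diff_trunc[of "real (Suc n)" "f x"] by (simp add: power_mono)
    show "(\<lambda>n. (norm (f x - trunc (real (Suc n)) (f x)))\<^sup>2) \<longlonglongrightarrow> 0" for x
    proof (rule tendsto_eventually)
      obtain m :: nat where "norm (f x) \<le> real m" using real_arch_simple by blast
      then have "trunc (real (Suc n)) (f x) = f x" if "n \<ge> m" for n
        using that by (intro trunc_eq) auto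
      then show "\<forall>\<^sub>F n in sequentially. (norm (f x - trunc (real (Suc n)) (f x)))\<^sup>2 = 0"
        unfolding eventually_sequentially by (intro exI[of _ m]) (simp del: of_nat_Suc)
    qed
  qed
  then have "\<forall>\<^sub>F n in sequentially. integral {0..L} (\<lambda>x. (norm (f x - trunc (real (Suc n)) (f x)))\<^sup>2) < e / 4"
    using \<open>0 < e\<close> by (intro order_tendstoD(2)) auto
  then obtain n where n: "integral {0..L} (\<lambda>x. (norm (f x - trunc (real (Suc n)) (f x)))\<^sup>2) < e / 4"
    by (auto simp: eventually_sequentially)
  define M where "M = real (Suc n)"
  have M: "0 < M" by (simp add: M_def)
  define F where "F x = (if x \<in> {0<..<L} then f x else 0)" for x
  have "F \<in> borel_measurable lebesgue"
    using L2_measurable[OF f] unfolding F_def by (subst borel_measurable_if) auto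
  then have "F measurable_on UNIV"
    by (rule lebesgue_measurable_imp_measurable_on) auto
  then obtain N g where N: "negligible N" and cg: "\<And>n. continuous_on UNIV (g n)"
    and gl: "\<And>x. x \<notin> N \<Longrightarrow> (\<lambda>n. g n x) \<longlonglongrightarrow> F x"
    unfolding measurable_on_def by auto
  have cT: "continuous_on UNIV (\<lambda>x. trunc M (g n x))" for n
    by (rule continuous_on_compose2[OF continuous_on_trunc[OF M] cg]) auto
  have iT: "(\<lambda>x. trunc M (g n x)) \<in> L2 {0<..<L}" for n
    by (intro L2_continuous continuous_on_subset[OF cT]) auto
  have "(\<lambda>n. integral {0..L} (\<lambda>x. (norm (trunc M (f x) - trunc M (g n x)))\<^sup>2)) \<longlonglongrightarrow> integral {0..L} (\<lambda>x. 0::real)"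
  proof (rule dominated_convergence_ae[of "N \<union> {0, L}"])
    show "negligible (N \<union> {0, L})" using N by (simp add: negligible_Un)
    show "(\<lambda>x. (norm (trunc M (f x) - trunc M (g n x)))\<^sup>2) integrable_on {0..L}" for n
      by (intro L2_sq_integrable L2_diff L2_trunc f iT M)
    show "(\<lambda>x. (2 * M)\<^sup>2) integrable_on {0..L}" by (rule integrable_const_ivl)
    fix x assume x: "x \<in> {0..L} - (N \<union> {0, L})"
    have "norm (trunc M (f x) - trunc M (g n x)) \<le> 2 * M" for n
      using norm_triangle_ineq4[of "trunc M (f x)" "trunc M (g n x)"] norm_trunc[OF M, of "f x"] norm_trunc[OF M, of "g n x"]
      by linarith
    then show "norm ((norm (trunc M (f x) - trunc M (g n x)))\<^sup>2) \<le> (2 * M)\<^sup>2" for n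
      using power_mono[of "norm (trunc M (f x) - trunc M (g n x))" "2 * M" 2] by simp
    have Fx: "F x = f x" using x by (auto simp: F_def)
    have "(\<lambda>n. trunc M (g n x)) \<longlonglongrightarrow> trunc M (f x)"
      using continuous_on_tendsto_compose[OF continuous_on_trunc[OF M] gl, of x] x Fx by simp
    then have "(\<lambda>n. (norm (trunc M (f x) - trunc M (g n x)))\<^sup>2) \<longlonglongrightarrow> (norm (trunc M (f x) - trunc M (f x)))\<^sup>2"
      by (intro tendsto_intros)
    then show "(\<lambda>n. (norm (trunc M (f x) - trunc M (g n x)))\<^sup>2) \<longlonglongrightarrow> 0" by simp
  qed
  then have "\<forall>\<^sub>F n in sequentially. integral {0..L} (\<lambda>x. (norm (trunc M (f x) - trunc M (g n x)))\<^sup>2) < e / 4"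
    using \<open>0 < e\<close> by (intro order_tendstoD(2)) auto
  then obtain m where m: "integral {0..L} (\<lambda>x. (norm (trunc M (f x) - trunc M (g m x)))\<^sup>2) < e / 4"
    by (auto simp: eventually_sequentially)
  have i: "(\<lambda>x. (norm (f x - trunc M (f x)))\<^sup>2) integrable_on {0..L}"
    "(\<lambda>x. (norm (trunc M (f x) - trunc M (g m x)))\<^sup>2) integrable_on {0..L}"
    "(\<lambda>x. (norm (f x - trunc M (g m x)))\<^sup>2) integrable_on {0..L}"
    by (intro L2_sq_integrable L2_diff L2_trunc f iT M)+
  have "integral {0..L} (\<lambda>x. (norm (f x - trunc M (g m x)))\<^sup>2) \<le>
      integral {0..L} (\<lambda>x. 2 * (norm (f x - trunc M (f x)))\<^sup>2 + 2 * (norm (trunc M (f x) - trunc M (g m x)))\<^sup>2)"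
  proof (intro integral_le i integrable_add integrable_on_mult_right)
    show "(norm (f x - trunc M (g m x)))\<^sup>2 \<le> 2 * (norm (f x - trunc M (f x)))\<^sup>2 + 2 * (norm (trunc M (f x) - trunc M (g m x)))\<^sup>2" for x
      using norm_add_sq_le[of "f x - trunc M (f x)" "trunc M (f x) - trunc M (g m x)"] by simp
  qed
  also have "\<dots> < e"
    using i n m by (simp add: integral_add integrable_on_mult_right M_def)
  finally show ?thesis using that[OF cT] by blast
qed

lemma has_integral_dilation:
  fixes f :: "real \<Rightarrow> 'a::euclidean_space"
  assumes "0 < \<mu>" "(f has_integral i) {0..\<mu> * s}"
  shows "((\<lambda>x. f (\<mu> * x)) has_integral (1 / \<mu>) *\<^sub>R i) {0..s}"
proof -
  have "((\<lambda>x. f (\<mu> *\<^sub>R x + 0)) has_integral (1 / (\<bar>\<mu>\<bar> ^ DIM(real))) *\<^sub>R i)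
      ((\<lambda>x. (1 / \<mu>) *\<^sub>R x + - ((1 / \<mu>) *\<^sub>R 0)) ` cbox 0 (\<mu> * s))"
    using assms by (intro has_integral_affinity) auto
  moreover have "(\<lambda>x. (1 / \<mu>) *\<^sub>R x + - ((1 / \<mu>) *\<^sub>R 0)) ` cbox 0 (\<mu> * s) = {0..s}"
    using \<open>0 < \<mu>\<close> image_mult_atLeastAtMost[of "1 / \<mu>" 0 "\<mu> * s"] by simp
  ultimately show ?thesis using \<open>0 < \<mu>\<close> by simp
qed

text \<open>The factor \<open>\<mu>\<close> is the one produced by the chain rule on the tangent of
  a zoomed curve. In the squared norm it gives \<open>\<mu>\<^sup>2\<close> against a loss of
  \<open>1 / \<mu>\<close> from the substitution, so that dilation does not increase the norm,
  uniformly down to \<open>\<mu> = 0\<close>.\<close>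

lemma L2_dilation:
  fixes f :: "real \<Rightarrow> real^2"
  assumes f: "f \<in> L2 {0<..<L}" and \<mu>: "0 \<le> \<mu>" "\<mu> \<le> 1" and "0 < L"
  shows "(\<lambda>x. \<mu> *\<^sub>R f (\<mu> * x)) \<in> L2 {0<..<L}"
    and "integral {0..L} (\<lambda>x. (norm (\<mu> *\<^sub>R f (\<mu> * x)))\<^sup>2) \<le> integral {0..L} (\<lambda>x. (norm (f x))\<^sup>2)"
proof -
  have nn: "0 \<le> integral {0..L} (\<lambda>x. (norm (f x))\<^sup>2)"
    by (intro integral_nonneg L2_sq_integrable f) auto
  have "(\<lambda>x. \<mu> *\<^sub>R f (\<mu> * x)) \<in> L2 {0<..<L} \<and>
      integral {0..L} (\<lambda>x. (norm (\<mu> *\<^sub>R f (\<mu> * x)))\<^sup>2) \<le> integral {0..L} (\<lambda>x. (norm (f x))\<^sup>2)"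
  proof (cases "\<mu> = 0")
    case True
    then show ?thesis using nn by (auto intro: L2_continuous)
  next
    case False
    then have pos: "0 < \<mu>" using \<mu> by simp
    have \<mu>L: "0 \<le> \<mu> * L" "\<mu> * L \<le> L" using \<mu> \<open>0 < L\<close> by (auto intro: mult_left_le_one_le)
    define F where "F x = (if x \<in> {0<..<L} then f x else 0)" for x
    have "F \<in> borel_measurable lebesgue"
      using L2_measurable[OF f] unfolding F_def by (subst borel_measurable_if) auto
    then have "(\<lambda>x. F (\<mu> *\<^sub>R x)) \<in> borel_measurable lebesgue"
      by (rule measurable_compose[OF lebesgue_measurable_scaling])
    then have "(\<lambda>x. F (\<mu> *\<^sub>R x)) \<in> borel_measurable (lebesgue_on {0<..<L})"
      by (rule measurable_restrict_space1)
    moreover have "F (\<mu> *\<^sub>R x) = f (\<mu> * x)" if "x \<in> {0<..<L}" for x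
    proof -
      have "\<mu> * x < L" using that \<mu> pos by (smt (verit) mult_left_le_one_le greaterThanLessThan_iff)
      then show ?thesis using that pos by (simp add: F_def)
    qed
    ultimately have "(\<lambda>x. f (\<mu> * x)) \<in> borel_measurable (lebesgue_on {0<..<L})"
      by (subst measurable_cong[symmetric]) auto
    then have m: "(\<lambda>x. \<mu> *\<^sub>R f (\<mu> * x)) \<in> borel_measurable (lebesgue_on {0<..<L})"
      by (intro borel_measurable_scaleR) auto
    have i: "(\<lambda>x. (norm (f x))\<^sup>2) integrable_on {0..\<mu> * L}"
      using L2_sq_integrable[OF f] by (rule integrable_subinterval_real) (use \<mu>L in auto)
    from has_integral_dilation[OF pos integrable_integral[OF i]]
    have "((\<lambda>x. \<mu>\<^sup>2 * (norm (f (\<mu> * x)))\<^sup>2) has_integral \<mu>\<^sup>2 * ((1 / \<mu>) *\<^sub>R integral {0..\<mu> * L} (\<lambda>x. (norm (f x))\<^sup>2))) {0..L}"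
      by (rule has_integral_mult_right)
    then have hi: "((\<lambda>x. (norm (\<mu> *\<^sub>R f (\<mu> * x)))\<^sup>2) has_integral \<mu> * integral {0..\<mu> * L} (\<lambda>x. (norm (f x))\<^sup>2)) {0..L}"
    proof -
      have "\<mu>\<^sup>2 * ((1 / \<mu>) *\<^sub>R I) = \<mu> * I" for I
        using pos by (simp add: power2_eq_square)
      then show ?thesis
        using \<open>((\<lambda>x. \<mu>\<^sup>2 * (norm (f (\<mu> * x)))\<^sup>2) has_integral _) _\<close> by (simp add: power_mult_distrib)
    qed
    have "integral {0..\<mu> * L} (\<lambda>x. (norm (f x))\<^sup>2) \<le> integral {0..L} (\<lambda>x. (norm (f x))\<^sup>2)"
      by (intro integral_subset_le i L2_sq_integrable f) (use \<mu>L in auto)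
    moreover have "0 \<le> integral {0..\<mu> * L} (\<lambda>x. (norm (f x))\<^sup>2)" by (intro integral_nonneg i) auto
    ultimately have "\<mu> * integral {0..\<mu> * L} (\<lambda>x. (norm (f x))\<^sup>2) \<le> integral {0..L} (\<lambda>x. (norm (f x))\<^sup>2)"
      using \<mu> by (meson mult_left_le_one_le order_trans)
    then show ?thesis
      using m hi unfolding L2_iff by (auto simp: integral_unique has_integral_integrable)
  qed
  then show "(\<lambda>x. \<mu> *\<^sub>R f (\<mu> * x)) \<in> L2 {0<..<L}"
    "integral {0..L} (\<lambda>x. (norm (\<mu> *\<^sub>R f (\<mu> * x)))\<^sup>2) \<le> integral {0..L} (\<lambda>x. (norm (f x))\<^sup>2)" by auto
qed

lemma integral_linear_combination:
  fixes f g h :: "real \<Rightarrow> real"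
  assumes "f integrable_on S" "g integrable_on S" "h integrable_on S"
  shows "integral S (\<lambda>x. a * f x + b * g x + c * h x) = a * integral S f + b * integral S g + c * integral S h"
  using assms by (simp add: integral_add integrable_add integrable_on_mult_right)

text \<open>For a continuous function this is continuity of a parameter integral. The general case
  follows by density, because \<open>L2_dilation\<close> bounds the error of the approximation
  uniformly in time.\<close>

lemma dilation_continuous:
  fixes f :: "real \<Rightarrow> real^2" and \<mu> :: "real \<Rightarrow> real"
  assumes f: "f \<in> L2 {0<..<L}" and "0 < L" and c\<mu>: "continuous_on T \<mu>"
    and \<mu>: "\<And>t. t \<in> T \<Longrightarrow> \<mu> t \<in> {0..1}" and t: "t \<in> T"
  shows "((\<lambda>u. integral {0..L} (\<lambda>s. (norm (\<mu> u *\<^sub>R f (\<mu> u * s) - \<mu> t *\<^sub>R f (\<mu> t * s)))\<^sup>2)) \<longlongrightarrow> 0) (at t within T)"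
proof (rule tendstoI)
  fix e :: real assume "0 < e"
  then obtain g where cg: "continuous_on UNIV g" and g: "integral {0..L} (\<lambda>x. (norm (f x - g x))\<^sup>2) < e / 16"
    using L2_approx_continuous[OF f, of "e / 16"] by auto
  have gL: "g \<in> L2 {0<..<L}" by (intro L2_continuous continuous_on_subset[OF cg]) auto
  define d where "d x = f x - g x" for x
  have dL: "d \<in> L2 {0<..<L}" unfolding d_def by (intro L2_diff f gL)
  define G where "G u = integral {0..L} (\<lambda>s. (norm (\<mu> u *\<^sub>R g (\<mu> u * s) - \<mu> t *\<^sub>R g (\<mu> t * s)))\<^sup>2)" for u
  have c\<mu>2: "continuous_on ({0..L} \<times> T) (\<lambda>p. \<mu> (snd p))" by (rule continuous_on_snd_comp[OF c\<mu>])
  have "continuous_on ({0..L} \<times> T) (\<lambda>p. g (\<mu> (snd p) * fst p))" "continuous_on ({0..L} \<times> T) (\<lambda>p. g (\<mu> t * fst p))"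
    by (rule continuous_on_compose2[OF cg]; (intro continuous_intros c\<mu>2)?; simp)+
  then have "continuous_on T G"
    unfolding G_def
    by (intro continuous_on_integral_slice[where f = "\<lambda>s u. (norm (\<mu> u *\<^sub>R g (\<mu> u * s) - \<mu> t *\<^sub>R g (\<mu> t * s)))\<^sup>2"]
        continuous_intros c\<mu>2)
  moreover have "G t = 0" by (simp add: G_def)
  ultimately have "(G \<longlongrightarrow> 0) (at t within T)" using t by (auto simp: continuous_on_def)
  then have "\<forall>\<^sub>F u in at t within T. G u < e / 8" using \<open>0 < e\<close> by (intro order_tendstoD(2)) auto
  then have "\<forall>\<^sub>F u in at t within T. u \<in> T \<and> G u < e / 8"
    by (simp add: eventually_at_filter)
  then show "\<forall>\<^sub>F u in at t within T. dist (integral {0..L} (\<lambda>s. (norm (\<mu> u *\<^sub>R f (\<mu> u * s) - \<mu> t *\<^sub>R f (\<mu> t * s)))\<^sup>2)) 0 < e"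
  proof (rule eventually_mono)
    fix u assume u: "u \<in> T \<and> G u < e / 8"
    have du: "(\<lambda>x. \<mu> v *\<^sub>R d (\<mu> v * x)) \<in> L2 {0<..<L}"
      "integral {0..L} (\<lambda>x. (norm (\<mu> v *\<^sub>R d (\<mu> v * x)))\<^sup>2) < e / 16"
      "(\<lambda>x. \<mu> v *\<^sub>R g (\<mu> v * x)) \<in> L2 {0<..<L}" "(\<lambda>x. \<mu> v *\<^sub>R f (\<mu> v * x)) \<in> L2 {0<..<L}" if "v \<in> T" for v
      using L2_dilation[OF dL _ _ \<open>0 < L\<close>, of "\<mu> v"] L2_dilation[OF gL _ _ \<open>0 < L\<close>, of "\<mu> v"]
        L2_dilation[OF f _ _ \<open>0 < L\<close>, of "\<mu> v"] \<mu>[OF that] g by (auto simp: d_def)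
    have i: "(\<lambda>x. (norm (\<mu> u *\<^sub>R d (\<mu> u * x)))\<^sup>2) integrable_on {0..L}"
      "(\<lambda>x. (norm (\<mu> t *\<^sub>R d (\<mu> t * x)))\<^sup>2) integrable_on {0..L}"
      "(\<lambda>s. (norm (\<mu> u *\<^sub>R g (\<mu> u * s) - \<mu> t *\<^sub>R g (\<mu> t * s)))\<^sup>2) integrable_on {0..L}"
      "(\<lambda>s. (norm (\<mu> u *\<^sub>R f (\<mu> u * s) - \<mu> t *\<^sub>R f (\<mu> t * s)))\<^sup>2) integrable_on {0..L}"
      using u t by (intro L2_sq_integrable L2_diff du; simp)+
    \<comment> \<open>The inequality for the square of a sum is used twice, whence the weights 4, 4
      and 2. With the thresholds e/16 and e/8 the total is at most 3/4 of e.\<close>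
    have e: "(norm (\<mu> u *\<^sub>R f (\<mu> u * s) - \<mu> t *\<^sub>R f (\<mu> t * s)))\<^sup>2 \<le>
        4 * (norm (\<mu> u *\<^sub>R d (\<mu> u * s)))\<^sup>2 + 4 * (norm (\<mu> t *\<^sub>R d (\<mu> t * s)))\<^sup>2 +
        2 * (norm (\<mu> u *\<^sub>R g (\<mu> u * s) - \<mu> t *\<^sub>R g (\<mu> t * s)))\<^sup>2" for s
    proof -
      define a where "a = \<mu> u *\<^sub>R d (\<mu> u * s)"
      define b where "b = \<mu> t *\<^sub>R d (\<mu> t * s)"
      define c where "c = \<mu> u *\<^sub>R g (\<mu> u * s) - \<mu> t *\<^sub>R g (\<mu> t * s)"
      have "\<mu> u *\<^sub>R f (\<mu> u * s) - \<mu> t *\<^sub>R f (\<mu> t * s) = (a + - b) + c"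
        by (simp add: a_def b_def c_def d_def algebra_simps)
      then show ?thesis
        using norm_add_sq_le[of "a + - b" c] norm_add_sq_le[of a "- b"]
        unfolding a_def[symmetric] b_def[symmetric] c_def[symmetric] by (simp only: norm_minus_cancel)
    qed
    have "integral {0..L} (\<lambda>s. (norm (\<mu> u *\<^sub>R f (\<mu> u * s) - \<mu> t *\<^sub>R f (\<mu> t * s)))\<^sup>2) \<le>
        integral {0..L} (\<lambda>s. 4 * (norm (\<mu> u *\<^sub>R d (\<mu> u * s)))\<^sup>2 + 4 * (norm (\<mu> t *\<^sub>R d (\<mu> t * s)))\<^sup>2 +
        2 * (norm (\<mu> u *\<^sub>R g (\<mu> u * s) - \<mu> t *\<^sub>R g (\<mu> t * s)))\<^sup>2)"
      by (intro integral_le i integrable_add integrable_on_mult_right e)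
    also have "\<dots> = 4 * integral {0..L} (\<lambda>x. (norm (\<mu> u *\<^sub>R d (\<mu> u * x)))\<^sup>2) +
        4 * integral {0..L} (\<lambda>x. (norm (\<mu> t *\<^sub>R d (\<mu> t * x)))\<^sup>2) + 2 * G u"
      unfolding G_def by (rule integral_linear_combination[OF i(1-3)])
    also have "\<dots> < e" using du(2)[OF conjunct1[OF u]] du(2)[OF t] conjunct2[OF u] \<open>0 < e\<close> by linarith
    finally have "integral {0..L} (\<lambda>s. (norm (\<mu> u *\<^sub>R f (\<mu> u * s) - \<mu> t *\<^sub>R f (\<mu> t * s)))\<^sup>2) < e" .
    moreover have "0 \<le> integral {0..L} (\<lambda>s. (norm (\<mu> u *\<^sub>R f (\<mu> u * s) - \<mu> t *\<^sub>R f (\<mu> t * s)))\<^sup>2)"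
      by (intro integral_nonneg i) auto
    ultimately show "dist (integral {0..L} (\<lambda>s. (norm (\<mu> u *\<^sub>R f (\<mu> u * s) - \<mu> t *\<^sub>R f (\<mu> t * s)))\<^sup>2)) 0 < e"
      by (simp add: dist_real_def)
  qed
qed

section \<open>Straightening by zooming in on an end point\<close>

text \<open>This is the classical form of a unit speed curve in \<open>H2\<close>: the tangent is a
  primitive of a square integrable function.\<close>

definition curve_data :: "real \<Rightarrow> (real \<Rightarrow> real^2) \<Rightarrow> (real \<Rightarrow> real^2) \<Rightarrow> (real \<Rightarrow> real^2) \<Rightarrow> bool" where
  "curve_data L \<xi> \<tau> h \<longleftrightarrow> unit_speed L \<xi> \<tau> \<and> h \<in> L2 {0<..<L} \<and>
     (\<forall>s\<in>{0..L}. \<tau> s = \<tau> 0 + integral {0..s} h)"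

text \<open>The tangent is Hoelder continuous of exponent 1/2. Young's inequality with weight
  \<open>\<delta>\<close> replaces Cauchy-Schwarz: on an interval of length at most
  \<open>L * \<delta>\<^sup>2\<close> both resulting terms are of order
  \<open>\<delta>\<close>.\<close>

lemma tangent_modulus:
  assumes c: "curve_data L \<xi> \<tau> h" and "0 < L" and xy: "0 \<le> x" "x \<le> y" "y \<le> L" and \<delta>: "0 < \<delta>" "y - x \<le> L * \<delta>\<^sup>2"
  shows "norm (\<tau> y - \<tau> x) \<le> \<delta> * ((L + integral {0..L} (\<lambda>r. (norm (h r))\<^sup>2)) / 2)"
proof -
  have h: "h \<in> L2 {0<..<L}" and \<tau>: "\<And>s. s \<in> {0..L} \<Longrightarrow> \<tau> s = \<tau> 0 + integral {0..s} h"
    using c unfolding curve_data_def by blast+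
  have ih: "h integrable_on {0..y}" using xy by (intro L2_integrable_on[OF h]) auto
  have ih': "h integrable_on {x..y}" by (rule integrable_subinterval_real[OF ih]) (use xy in auto)
  have isq: "(\<lambda>r. (norm (h r))\<^sup>2) integrable_on {x..y}"
    by (rule integrable_subinterval_real[OF L2_sq_integrable[OF h]]) (use xy in auto)
  have "\<tau> y - \<tau> x = integral {x..y} h"
    using \<tau>[of x] \<tau>[of y] xy Henstock_Kurzweil_Integration.integral_combine[OF xy(1,2) ih] by (simp add: algebra_simps)
  also have "norm \<dots> \<le> integral {x..y} (\<lambda>r. 1 / (2 * \<delta>) + \<delta> / 2 * (norm (h r))\<^sup>2)"
  proof (rule integral_norm_bound_integral[OF ih'])
    show "(\<lambda>r. 1 / (2 * \<delta>) + \<delta> / 2 * (norm (h r))\<^sup>2) integrable_on {x..y}"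
      by (intro integrable_add integrable_const_ivl integrable_on_mult_right isq)
    fix r
    have "0 \<le> (\<delta> * norm (h r) - 1)\<^sup>2" by simp
    also have "(\<delta> * norm (h r) - 1)\<^sup>2 = \<delta>\<^sup>2 * (norm (h r))\<^sup>2 - 2 * \<delta> * norm (h r) + 1"
      by (simp add: power2_eq_square algebra_simps)
    finally show "norm (h r) \<le> 1 / (2 * \<delta>) + \<delta> / 2 * (norm (h r))\<^sup>2"
      using \<delta> by (simp add: field_simps power2_eq_square)
  qed
  also have "\<dots> = (y - x) / (2 * \<delta>) + \<delta> / 2 * integral {x..y} (\<lambda>r. (norm (h r))\<^sup>2)"
    using isq xy by (subst integral_add) (auto simp: integrable_on_mult_right)
  also have "(y - x) / (2 * \<delta>) \<le> L * \<delta>\<^sup>2 / (2 * \<delta>)"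
    using \<delta> by (intro divide_right_mono) auto
  also have "L * \<delta>\<^sup>2 / (2 * \<delta>) = \<delta> / 2 * L" using \<delta> by (simp add: power2_eq_square)
  also have "\<delta> / 2 * integral {x..y} (\<lambda>r. (norm (h r))\<^sup>2) \<le> \<delta> / 2 * integral {0..L} (\<lambda>r. (norm (h r))\<^sup>2)"
    using \<delta> xy by (intro mult_left_mono integral_subset_le isq L2_sq_integrable h) auto
  finally show ?thesis by (simp add: algebra_simps)
qed

text \<open>At \<open>t = 0\<close> the bound forces the value 0 and gives smallness nearby,
  uniformly in s. Elsewhere removing \<open>t = 0\<close> does not change the neighbourhood
  filter.\<close>

lemma continuous_on_extend_by_zero:
  fixes G :: "real \<Rightarrow> real \<Rightarrow> 'a::real_normed_vector"
  assumes c: "continuous_on (A \<times> {0<..1}) (\<lambda>p. G (fst p) (snd p))"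
    and b: "\<And>s t. s \<in> A \<Longrightarrow> t \<in> {0..1} \<Longrightarrow> norm (G s t) \<le> K * t"
  shows "continuous_on (A \<times> {0..1}) (\<lambda>p. G (fst p) (snd p))"
  unfolding continuous_on_eq_continuous_within
proof
  fix p assume p: "p \<in> A \<times> {0..1::real}"
  show "continuous (at p within A \<times> {0..1}) (\<lambda>p. G (fst p) (snd p))"
  proof (cases "snd p = 0")
    case False
    have "open {q::real\<times>real. snd q > 0}" by (intro open_Collect_less continuous_intros)
    then have "at p within A \<times> {0..1} = at p within A \<times> {0<..1}"
      by (rule at_within_nhd[rotated]) (use p False in auto)
    then show ?thesis using c p False by (auto simp: continuous_on_eq_continuous_within)
  next
    case True
    have G0: "G (fst p) (snd p) = 0" using b[of "fst p" "snd p"] p True by auto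
    have "((\<lambda>q. K * snd q) \<longlongrightarrow> K * snd p) (at p within A \<times> {0..1})"
      by (intro tendsto_intros)
    then have "((\<lambda>q. K * snd q) \<longlongrightarrow> 0) (at p within A \<times> {0..1})" using True by simp
    then have "((\<lambda>q. G (fst q) (snd q)) \<longlongrightarrow> 0) (at p within A \<times> {0..1})"
      by (rule Lim_null_comparison[rotated])
        (use b in \<open>auto simp: eventually_at_filter intro!: always_eventually\<close>)
    then show ?thesis unfolding continuous_within G0 .
  qed
qed

text \<open>The zoom factor at time t is \<open>t ^ 4\<close>. On that scale the Hoelder tangent
  oscillates by a multiple of \<open>t\<^sup>2\<close>, and the velocity contains one factor
  \<open>1 / t\<close>, so it tends to 0 linearly. With \<open>t\<^sup>2\<close> as zoom factor the
  same estimate would only give a bounded velocity.\<close>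

lemma zoom_shape_path:
  assumes "0 < L" "0 < \<rho>" and c: "curve_data L \<xi> \<tau> h" and th: "thick L \<rho> \<xi> \<tau>"
  shows "\<exists>\<omega>. shape_path L 1 \<rho> (\<lambda>s t. integral {0..s} (\<lambda>r. \<tau> (t ^ 4 * r))) \<omega>
    (\<lambda>s t. \<tau> (t ^ 4 * s)) (\<lambda>s t. t ^ 4 *\<^sub>R h (t ^ 4 * s))"
proof -
  define \<eta> where "\<eta> s t = integral {0..s} (\<lambda>r. \<tau> (t ^ 4 * r))" for s t
  \<comment> \<open>This comes from differentiating
    \<open>(1 / t ^ 4) *\<^sub>R (\<xi> (t ^ 4 * s) - \<xi> 0)\<close> in t. At \<open>t = 0\<close>
    the quotient \<open>4 / t\<close> is 0 by convention, which is the correct velocity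
    there.\<close>
  define \<omega> where "\<omega> s t = (4 / t) *\<^sub>R (s *\<^sub>R \<tau> (t ^ 4 * s) - \<eta> s t)" for s t
  have us: "unit_speed L \<xi> \<tau>" and hL: "h \<in> L2 {0<..<L}" and \<tau>h: "\<And>s. s \<in> {0..L} \<Longrightarrow> \<tau> s = \<tau> 0 + integral {0..s} h"
    using c unfolding curve_data_def by blast+
  have c\<tau>: "continuous_on {0..L} \<tau>" and nt: "\<And>s. s \<in> {0..L} \<Longrightarrow> norm (\<tau> s) = 1"
    and d\<xi>: "\<And>s. s \<in> {0..L} \<Longrightarrow> (\<xi> has_vector_derivative \<tau> s) (at s within {0..L})"
    using us unfolding unit_speed_def by auto
  have t4: "t ^ 4 * s \<in> {0..L}" "t ^ 4 \<in> {0..1}" "t ^ 4 * s \<le> s" if "s \<in> {0..L}" "t \<in> {0..1}" for s t :: real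
  proof -
    have "t ^ 4 \<le> 1" using that by (auto intro: power_le_one)
    then show "t ^ 4 * s \<le> s" using that by (auto intro: mult_left_le_one_le)
    then show "t ^ 4 * s \<in> {0..L}" "t ^ 4 \<in> {0..1}" using that \<open>t ^ 4 \<le> 1\<close> by auto
  qed
  have cT: "continuous_on ({0..L} \<times> {0..1}) (\<lambda>p. \<tau> (snd p ^ 4 * fst p))"
    by (rule continuous_on_compose2[OF c\<tau>]) (use t4 in \<open>auto intro!: continuous_intros\<close>)
  have cTs: "continuous_on {0..L} (\<lambda>r. \<tau> (t ^ 4 * r))" if "t \<in> {0..1}" for t
    using continuous_on_slice[of "{0..L}" "{0..1}" "\<lambda>s t. \<tau> (t ^ 4 * s)" t] cT that by auto
  have iT: "(\<lambda>r. \<tau> (t ^ 4 * r)) integrable_on {0..s}" if "t \<in> {0..1}" "s \<in> {0..L}" for t s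
    by (intro integrable_continuous_real continuous_on_subset[OF cTs[OF that(1)]]) (use that in auto)
  have ds: "((\<lambda>s. \<eta> s t) has_vector_derivative \<tau> (t ^ 4 * s)) (at s within {0..L})"
    if "s \<in> {0..L}" "t \<in> {0..1}" for s t
    unfolding \<eta>_def by (rule integral_has_vector_derivative[OF cTs[OF that(2)] that(1)])
  have \<eta>eq: "\<eta> s t = (1 / t ^ 4) *\<^sub>R (\<xi> (t ^ 4 * s) - \<xi> 0)" if "s \<in> {0..L}" "t \<in> {0<..1}" for s t
  proof -
    have r: "t ^ 4 * s \<in> {0..L}" using t4 that by auto
    have "(\<tau> has_integral \<xi> (t ^ 4 * s) - \<xi> 0) {0..t ^ 4 * s}"
    proof (rule fundamental_theorem_of_calculus)
      show "0 \<le> t ^ 4 * s" using r by simp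
      fix x assume "x \<in> {0..t ^ 4 * s}"
      then show "(\<xi> has_vector_derivative \<tau> x) (at x within {0..t ^ 4 * s})"
        using r by (intro has_vector_derivative_within_subset[OF d\<xi>]) auto
    qed
    from has_integral_dilation[OF _ this] that show ?thesis
      unfolding \<eta>_def by (intro integral_unique) auto
  qed
  define M where "M = (L + integral {0..L} (\<lambda>r. (norm (h r))\<^sup>2)) / 2"
  have M0: "0 \<le> M"
    unfolding M_def using \<open>0 < L\<close> integral_nonneg[OF L2_sq_integrable[OF hL]] by auto
  \<comment> \<open>Because \<open>t ^ 4\<close> is the square of \<open>t\<^sup>2\<close>,
    \<open>tangent_modulus\<close> applies with \<open>t\<^sup>2\<close> as
    \<open>\<delta>\<close>.\<close>
  have mod: "norm (\<tau> (t ^ 4 * s) - \<tau> (t ^ 4 * r)) \<le> t\<^sup>2 * M" if "s \<in> {0..L}" "r \<in> {0..L}" "t \<in> {0..1}" for s r t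
  proof (cases "t = 0")
    case False
    then have t: "0 < t\<^sup>2" "t ^ 4 = (t\<^sup>2)\<^sup>2" by (auto simp flip: power_mult)
    have *: "norm (\<tau> (t ^ 4 * b) - \<tau> (t ^ 4 * a)) \<le> t\<^sup>2 * M" if "a \<le> b" "a \<in> {0..L}" "b \<in> {0..L}" for a b
    proof -
      have "t ^ 4 * b - t ^ 4 * a = t ^ 4 * (b - a)" by (simp add: algebra_simps)
      also have "\<dots> \<le> t ^ 4 * L" using that by (intro mult_left_mono) auto
      also have "\<dots> = L * (t\<^sup>2)\<^sup>2" unfolding t(2) by (rule mult.commute)
      finally have "t ^ 4 * b - t ^ 4 * a \<le> L * (t\<^sup>2)\<^sup>2" .
      then show ?thesis
        unfolding M_def using t4[OF that(2) \<open>t \<in> {0..1}\<close>] t4[OF that(3) \<open>t \<in> {0..1}\<close>] that t(1)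
        by (intro tangent_modulus[OF c \<open>0 < L\<close>]) (auto intro: mult_left_mono)
    qed
    show ?thesis
      using *[of s r] *[of r s] that by (cases "s \<le> r") (auto simp: norm_minus_commute)
  qed (use M0 in auto)
  have dev: "norm (s *\<^sub>R \<tau> (t ^ 4 * r0) - \<eta> s t) \<le> s * (t\<^sup>2 * M)" if "s \<in> {0..L}" "r0 \<in> {0..L}" "t \<in> {0..1}" for s r0 t
  proof -
    have "s *\<^sub>R \<tau> (t ^ 4 * r0) - \<eta> s t = integral {0..s} (\<lambda>r. \<tau> (t ^ 4 * r0) - \<tau> (t ^ 4 * r))"
      unfolding \<eta>_def using that iT[OF that(3,1)] by (subst integral_diff) auto
    also have "norm \<dots> \<le> integral {0..s} (\<lambda>r. t\<^sup>2 * M)"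
      using that mod iT[OF that(3,1)] by (intro integral_norm_bound_integral integrable_diff) auto
    also have "\<dots> = s * (t\<^sup>2 * M)" using that by simp
    finally show ?thesis .
  qed
  have \<omega>b: "norm (\<omega> s t) \<le> (4 * L * M) * t" if "s \<in> {0..L}" "t \<in> {0..1}" for s t
  proof (cases "t = 0")
    case False
    then have t: "0 < t" using that by auto
    have "norm (\<omega> s t) = (4 / t) * norm (s *\<^sub>R \<tau> (t ^ 4 * s) - \<eta> s t)"
      unfolding \<omega>_def using t by simp
    also have "\<dots> \<le> (4 / t) * (s * (t\<^sup>2 * M))"
      using dev[of s s t] that t by (intro mult_left_mono) auto
    also have "\<dots> = (4 * M * t) * s" using t by (simp add: power2_eq_square)
    also have "\<dots> \<le> (4 * M * t) * L" using that t M0 by (intro mult_left_mono) auto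
    finally show ?thesis by (simp add: algebra_simps)
  qed (simp add: \<omega>_def)
  have dt: "((\<lambda>u. \<eta> s u) has_vector_derivative \<omega> s t) (at t within {0..1})"
    if s: "s \<in> {0..L}" and t: "t \<in> {0..1}" for s t
  proof (cases "t = 0")
    case True
    have \<eta>0: "\<eta> s 0 = s *\<^sub>R \<tau> 0" unfolding \<eta>_def using s by simp
    have "((\<lambda>u. norm (\<eta> s u - \<eta> s 0 - (u - 0) *\<^sub>R 0) / norm (u - 0)) \<longlongrightarrow> 0) (at 0 within {0..1})"
    proof (rule Lim_null_comparison)
      have "norm (norm (\<eta> s u - \<eta> s 0 - (u - 0) *\<^sub>R 0) / norm (u - 0)) \<le> s * M * u"
        if u: "u \<noteq> 0" "u \<in> {0..1}" for u
      proof -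
        have "norm (\<eta> s u - \<eta> s 0) \<le> s * (u\<^sup>2 * M)"
          using dev[of s 0 u] s u \<open>0 < L\<close> unfolding \<eta>0 by (simp add: norm_minus_commute)
        then show ?thesis
          using u by (simp add: divide_simps power2_eq_square algebra_simps)
      qed
      then show "\<forall>\<^sub>F u in at 0 within {0..1}. norm (norm (\<eta> s u - \<eta> s 0 - (u - 0) *\<^sub>R 0) / norm (u - 0)) \<le> s * M * u"
        unfolding eventually_at_filter by (intro always_eventually allI impI) blast
      have "((\<lambda>u. s * M * u) \<longlongrightarrow> s * M * 0) (at 0 within {0..1})" by (intro tendsto_intros)
      then show "((\<lambda>u. s * M * u) \<longlongrightarrow> 0) (at 0 within {0..1})" by simp
    qed
    then have "((\<lambda>u. \<eta> s u) has_vector_derivative 0) (at 0 within {0..1})"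
      unfolding has_vector_derivative_def has_derivative_iff_norm by (auto intro: bounded_linear_zero)
    then show ?thesis using True by (simp add: \<omega>_def)
  next
    case False
    then have t0: "t \<in> {0<..1}" using t by auto
    have at_eq: "at t within {0..1} = at t within {0<..1}"
      by (rule at_within_nhd[of t "{0<..}"]) (use t0 in auto)
    have dm: "((\<lambda>u. u ^ 4 * s) has_real_derivative 4 * t ^ 3 * s) (at t within {0<..1})"
      by (auto intro!: derivative_eq_intros)
    have "(\<xi> has_vector_derivative \<tau> (t ^ 4 * s)) (at (t ^ 4 * s) within (\<lambda>u. u ^ 4 * s) ` {0<..1})"
      by (rule has_vector_derivative_within_subset[OF d\<xi>]) (use t4 s t in auto)
    from vector_diff_chain_within[OF dm[unfolded has_real_derivative_iff_has_vector_derivative] this]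
    have d1: "((\<lambda>u. \<xi> (u ^ 4 * s) - \<xi> 0) has_vector_derivative (4 * t ^ 3 * s) *\<^sub>R \<tau> (t ^ 4 * s) - 0) (at t within {0<..1})"
      unfolding o_def by (intro has_vector_derivative_diff has_vector_derivative_const) auto
    have d2: "((\<lambda>u. 1 / u ^ 4) has_real_derivative - (4 / t ^ 5)) (at t within {0<..1})"
      using False by (auto intro!: derivative_eq_intros simp: divide_simps eval_nat_numeral)
    have "((\<lambda>u. (1 / u ^ 4) *\<^sub>R (\<xi> (u ^ 4 * s) - \<xi> 0)) has_vector_derivative
       (1 / t ^ 4) *\<^sub>R ((4 * t ^ 3 * s) *\<^sub>R \<tau> (t ^ 4 * s) - 0) + (- (4 / t ^ 5)) *\<^sub>R (\<xi> (t ^ 4 * s) - \<xi> 0)) (at t within {0<..1})"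
      by (rule has_vector_derivative_scaleR[OF d2 d1])
    moreover have "(1 / t ^ 4) *\<^sub>R ((4 * t ^ 3 * s) *\<^sub>R \<tau> (t ^ 4 * s) - 0) + (- (4 / t ^ 5)) *\<^sub>R (\<xi> (t ^ 4 * s) - \<xi> 0) = \<omega> s t"
    proof -
      have "(4 / t ^ 5) = (4 / t) * (1 / t ^ 4)" "(1 / t ^ 4) * (4 * t ^ 3 * s) = (4 / t) * s"
        using False by (simp_all add: field_simps eval_nat_numeral)
      then show ?thesis
        unfolding \<omega>_def \<eta>eq[OF s t0] by (simp add: scaleR_diff_right)
    qed
    ultimately have "((\<lambda>u. (1 / u ^ 4) *\<^sub>R (\<xi> (u ^ 4 * s) - \<xi> 0)) has_vector_derivative \<omega> s t) (at t within {0<..1})"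
      by simp
    then have "((\<lambda>u. \<eta> s u) has_vector_derivative \<omega> s t) (at t within {0<..1})"
      by (rule has_vector_derivative_transform[OF t0, rotated]) (use \<eta>eq s in auto)
    then show ?thesis unfolding at_eq .
  qed
  have c\<eta>: "continuous_on ({0..L} \<times> {0..1}) (\<lambda>p. \<eta> (fst p) (snd p))"
  proof -
    have "continuous_on ({0..L} \<times> {0<..1}) (\<lambda>p. \<xi> (snd p ^ 4 * fst p))"
      by (rule continuous_on_compose2[OF unit_speed_continuous[OF us]]) (use t4 in \<open>auto intro!: continuous_intros\<close>)
    then have "continuous_on ({0..L} \<times> {0<..1}) (\<lambda>p. (1 / snd p ^ 4) *\<^sub>R (\<xi> (snd p ^ 4 * fst p) - \<xi> 0))"
      by (auto intro!: continuous_intros)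
    then have "continuous_on ({0..L} \<times> {0<..1}) (\<lambda>p. \<eta> (fst p) (snd p))"
      by (rule continuous_on_eq) (use \<eta>eq in auto)
    then have "continuous_on ({0..L} \<times> {0<..1}) (\<lambda>p. \<eta> (fst p) (snd p) - fst p *\<^sub>R \<tau> 0)"
      by (intro continuous_intros)
    then have "continuous_on ({0..L} \<times> {0..1}) (\<lambda>p. \<eta> (fst p) (snd p) - fst p *\<^sub>R \<tau> 0)"
    proof (rule continuous_on_extend_by_zero[where G = "\<lambda>s t. \<eta> s t - s *\<^sub>R \<tau> 0" and K = "L * M"])
      fix s t :: real assume st: "s \<in> {0..L}" "t \<in> {0..1}"
      have "norm (\<eta> s t - s *\<^sub>R \<tau> 0) \<le> s * (t\<^sup>2 * M)"
        using dev[of s 0 t] st \<open>0 < L\<close> by (simp add: norm_minus_commute)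
      also have "\<dots> \<le> L * (t * M)"
        using st M0 by (intro mult_mono mult_right_mono) (auto simp: power2_eq_square mult_left_le_one_le)
      finally show "norm (\<eta> s t - s *\<^sub>R \<tau> 0) \<le> L * M * t" by (simp add: algebra_simps)
    qed
    moreover have "continuous_on ({0..L} \<times> {0..1::real}) (\<lambda>p. fst p *\<^sub>R \<tau> 0)"
      by (intro continuous_intros)
    ultimately have "continuous_on ({0..L} \<times> {0..1}) (\<lambda>p. (\<eta> (fst p) (snd p) - fst p *\<^sub>R \<tau> 0) + fst p *\<^sub>R \<tau> 0)"
      by (rule continuous_on_add)
    then show ?thesis by simp
  qed
  have c\<omega>: "continuous_on ({0..L} \<times> {0..1}) (\<lambda>p. \<omega> (fst p) (snd p))"
  proof (rule continuous_on_extend_by_zero[OF _ \<omega>b])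
    have "continuous_on ({0..L} \<times> {0<..1}) (\<lambda>p. \<eta> (fst p) (snd p))" "continuous_on ({0..L} \<times> {0<..1}) (\<lambda>p. \<tau> (snd p ^ 4 * fst p))"
      by (auto intro: continuous_on_subset[OF c\<eta>] continuous_on_subset[OF cT])
    then show "continuous_on ({0..L} \<times> {0<..1}) (\<lambda>p. \<omega> (fst p) (snd p))"
      unfolding \<omega>_def by (auto intro!: continuous_intros)
  qed
  have thk: "thick L \<rho> (\<lambda>s. \<eta> s t) (\<lambda>s. \<tau> (t ^ 4 * s))" if t: "t \<in> {0..1}" for t
  proof (cases "t = 0")
    case True
    have "thick L \<rho> (\<lambda>s. \<eta> s t) (\<lambda>s. \<tau> (t ^ 4 * s)) \<longleftrightarrow> thick L \<rho> (\<lambda>s. s *\<^sub>R \<tau> 0) (\<lambda>s. \<tau> 0)"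
      using True \<open>0 < L\<close> by (intro thick_cong) (auto simp: \<eta>_def)
    then show ?thesis using thick_straight nt \<open>0 < L\<close> by auto
  next
    case False
    then have t0: "t \<in> {0<..1}" using t by auto
    have "thick L \<rho> (\<lambda>s. (1 / t ^ 4) *\<^sub>R (\<xi> (t ^ 4 * s) - \<xi> 0)) (\<lambda>s. \<tau> (t ^ 4 * s))"
      using t0 by (intro thick_zoom[OF \<open>0 < \<rho>\<close> us th \<open>0 < L\<close>]) (auto intro: power_le_one)
    then show ?thesis
      using \<eta>eq t0 \<open>0 < L\<close> by (subst thick_cong[of L _ "\<lambda>s. (1 / t ^ 4) *\<^sub>R (\<xi> (t ^ 4 * s) - \<xi> 0)"]) auto
  qed
  have \<tau>int: "\<tau> (t ^ 4 * s) = \<tau> (t ^ 4 * 0) + integral {0..s} (\<lambda>r. t ^ 4 *\<^sub>R h (t ^ 4 * r))"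
    if s: "s \<in> {0..L}" and t: "t \<in> {0..1}" for s t
  proof (cases "t = 0")
    case False
    then have pos: "0 < t ^ 4" by simp
    have r: "t ^ 4 * s \<in> {0..L}" using t4 that by auto
    have "h integrable_on {0..t ^ 4 * s}" using r by (intro L2_integrable_on[OF hL]) auto
    from has_integral_cmul[OF has_integral_dilation[OF pos integrable_integral[OF this]], of "t ^ 4"]
    have "integral {0..s} (\<lambda>r. t ^ 4 *\<^sub>R h (t ^ 4 * r)) = integral {0..t ^ 4 * s} h"
      using pos by (intro integral_unique) simp
    then show ?thesis using \<tau>h[OF r] by simp
  qed simp
  have "shape_path L 1 \<rho> \<eta> \<omega> (\<lambda>s t. \<tau> (t ^ 4 * s)) (\<lambda>s t. t ^ 4 *\<^sub>R h (t ^ 4 * s))"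
    unfolding shape_path_def
  proof (intro conjI c\<eta> c\<omega> cT; intro ballI conjI)
    fix s t :: real assume s: "s \<in> {0..L}" and t: "t \<in> {0..1}"
    show "((\<lambda>\<sigma>. \<eta> \<sigma> t) has_vector_derivative \<tau> (t ^ 4 * s)) (at s within {0..L})" by (rule ds[OF s t])
    show "((\<lambda>u. \<eta> s u) has_vector_derivative \<omega> s t) (at t within {0..1})" by (rule dt[OF s t])
    show "norm (\<tau> (t ^ 4 * s)) = 1" by (rule nt[OF t4(1)[OF s t]])
    show "\<tau> (t ^ 4 * s) = \<tau> (t ^ 4 * 0) + integral {0..s} (\<lambda>r. t ^ 4 *\<^sub>R h (t ^ 4 * r))" by (rule \<tau>int[OF s t])
  next
    fix t :: real assume t: "t \<in> {0..1}"
    show "(\<lambda>s. t ^ 4 *\<^sub>R h (t ^ 4 * s)) \<in> L2 {0<..<L}"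
      using t by (intro L2_dilation hL \<open>0 < L\<close>) (auto intro: power_le_one)
    show "thick L \<rho> (\<lambda>s. \<eta> s t) (\<lambda>s. \<tau> (t ^ 4 * s))" by (rule thk[OF t])
    show "((\<lambda>u. integral {0..L} (\<lambda>s. (norm (u ^ 4 *\<^sub>R h (u ^ 4 * s) - t ^ 4 *\<^sub>R h (t ^ 4 * s)))\<^sup>2)) \<longlongrightarrow> 0) (at t within {0..1})"
      using t by (intro dilation_continuous[OF hL \<open>0 < L\<close>, where \<mu> = "\<lambda>t. t ^ 4"]) (auto intro!: continuous_intros power_le_one)
  qed
  then show ?thesis unfolding \<eta>_def by blast
qed

text \<open>The segment is centred, so that rotations about the origin are rotations about its
  midpoint.\<close>

definition segment :: "real \<Rightarrow> real \<Rightarrow> real^2" where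
  "segment L s = (s - L / 2) *\<^sub>R axis 1 1"

text \<open>The zoom, read from the straight end, becomes balanced after adding a moving frame,
  whose final position is not under control. Undoing that position by a rigid motion fixes the
  curved end exactly and shifts the uncertainty to the placement of the segment.\<close>

lemma reach_from_segment:
  assumes C: "0 < Ct" "Ct \<le> Cn" and "0 < L" "0 < \<rho>" and c: "curve_data L \<xi> \<tau> h" and th: "thick L \<rho> \<xi> \<tau>"
  shows "\<exists>p \<theta>. reach L \<rho> Ct Cn (\<lambda>s. p + rot \<theta> (segment L s)) \<xi>"
proof -
  define \<eta> where "\<eta> s t = integral {0..s} (\<lambda>r. \<tau> (t ^ 4 * r))" for s t
  obtain \<omega> where sp: "shape_path L 1 \<rho> \<eta> \<omega> (\<lambda>s t. \<tau> (t ^ 4 * s)) (\<lambda>s t. t ^ 4 *\<^sub>R h (t ^ 4 * s))"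
    using zoom_shape_path[OF \<open>0 < L\<close> \<open>0 < \<rho>\<close> c th] unfolding \<eta>_def by blast
  obtain v w where vw: "continuous_on {0..1} v" "continuous_on {0..1} w"
    "\<And>t. t \<in> {0..1} \<Longrightarrow>
      balanced L Ct Cn (\<lambda>s. \<eta> s t) (\<lambda>s. \<tau> (t ^ 4 * s)) (\<lambda>s. v t + \<omega> s t + w t *\<^sub>R (J *v \<eta> s t))"
    using body_velocity_exists[OF C \<open>0 < L\<close> sp] by blast
  define \<theta> where "\<theta> t = integral {0..t} w" for t
  define p where "p t = integral {0..t} (\<lambda>u. rot (\<theta> u) (v u))" for t
  have "\<exists>\<omega> \<tau>' h'. motion L 1 \<rho> Ct Cn (\<lambda>s t. p t + rot (\<theta> t) (\<eta> s t)) \<omega> \<tau>' h'"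
    unfolding p_def \<theta>_def by (rule motion_of_body_velocity[OF sp _ vw]) auto
  then have r0: "reach L \<rho> Ct Cn (\<lambda>s. p 0 + rot (\<theta> 0) (\<eta> s 0)) (\<lambda>s. p 1 + rot (\<theta> 1) (\<eta> s 1))"
    unfolding reach_def by blast
  have e0: "p 0 + rot (\<theta> 0) (\<eta> s 0) = s *\<^sub>R \<tau> 0" if "s \<in> {0..L}" for s
    using that by (simp add: p_def \<theta>_def \<eta>_def)
  have e1: "\<eta> s 1 = \<xi> s - \<xi> 0" if "s \<in> {0..L}" for s
  proof -
    have "(\<tau> has_integral \<xi> s - \<xi> 0) {0..s}"
    proof (rule fundamental_theorem_of_calculus)
      fix x assume "x \<in> {0..s}"
      then have "x \<in> {0..L}" using that by auto
      then have "(\<xi> has_vector_derivative \<tau> x) (at x within {0..L})"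
        using c unfolding curve_data_def unit_speed_def by blast
      then show "(\<xi> has_vector_derivative \<tau> x) (at x within {0..s})"
        by (rule has_vector_derivative_within_subset) (use that in auto)
    qed (use that in auto)
    then show ?thesis by (simp add: \<eta>_def integral_unique)
  qed
  have r: "reach L \<rho> Ct Cn (\<lambda>s. s *\<^sub>R \<tau> 0) (\<lambda>s. p 1 + rot (\<theta> 1) (\<xi> s - \<xi> 0))"
    by (rule reach_cong[OF r0]) (simp_all add: e0 e1)
  \<comment> \<open>This is the translation for which the inverse of the final frame carries the end
    of the motion to \<open>\<xi>\<close> itself.\<close>
  define q where "q = \<xi> 0 - rot (- \<theta> 1) (p 1)"
  have "0 \<in> {0..L}" using \<open>0 < L\<close> by simp
  then have "norm (\<tau> 0) = 1" using c unfolding curve_data_def unit_speed_def by blast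
  moreover obtain \<alpha> where "\<tau> 0 = norm (\<tau> 0) *\<^sub>R rot \<alpha> (axis 2 1)" using polar_e2 by blast
  moreover have "axis 2 1 = rot (pi / 2) (axis 1 1)" by (simp add: vec2_eq_iff rot_comp axis_def)
  ultimately have \<tau>0: "\<tau> 0 = rot (\<alpha> + pi / 2) (axis 1 1)" by simp
  define \<beta> where "\<beta> = - \<theta> 1 + (\<alpha> + pi / 2)"
  from reach_rigid[OF r, of q "- \<theta> 1"]
  have "reach L \<rho> Ct Cn (\<lambda>s. (q + rot \<beta> ((L / 2) *\<^sub>R axis 1 1)) + rot \<beta> (segment L s)) \<xi>"
  proof (rule reach_cong)
    fix s
    show "q + rot (- \<theta> 1) (s *\<^sub>R \<tau> 0) = (q + rot \<beta> ((L / 2) *\<^sub>R axis 1 1)) + rot \<beta> (segment L s)"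
      unfolding \<tau>0 \<beta>_def segment_def rot_rot[symmetric]
      by (simp add: rot_linear_simps scaleR_diff_left)
    show "q + rot (- \<theta> 1) (p 1 + rot (\<theta> 1) (\<xi> s - \<xi> 0)) = \<xi> s"
      by (simp add: q_def rot_linear_simps(1))
  qed
  then show ?thesis by blast
qed

section \<open>Curves with a prescribed tangent, anchored at the midpoint\<close>

text \<open>The primitive vanishes at the midpoint, so that a parity of the tangent under reversal
  of the parameter becomes a symmetry of the curve about the origin.\<close>

definition mid :: "real \<Rightarrow> (real \<Rightarrow> 'a::euclidean_space) \<Rightarrow> real \<Rightarrow> 'a" where
  "mid L h s = integral {0..s} h - integral {0..L / 2} h"

lemma mid_has_vector_derivative:
  assumes "continuous_on {0..L} h" "s \<in> {0..L}"
  shows "(mid L h has_vector_derivative h s) (at s within {0..L})"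
proof -
  have "((\<lambda>u. integral {0..u} h - integral {0..L / 2} h) has_vector_derivative h s - 0) (at s within {0..L})"
    by (intro has_vector_derivative_diff integral_has_vector_derivative[OF assms] has_vector_derivative_const)
  then show ?thesis by (simp add: mid_def[abs_def])
qed

lemma mid_half [simp]: "mid L h (L / 2) = 0"
  by (simp add: mid_def)

lemma mid_linear:
  fixes h :: "real \<Rightarrow> 'a::euclidean_space" and A :: "'a \<Rightarrow> 'b::euclidean_space"
  assumes A: "bounded_linear A" and c: "continuous_on {0..L} h" and "s \<in> {0..L}"
  shows "mid L (\<lambda>r. A (h r)) s = A (mid L h s)"
proof -
  have "integral {0..u} (\<lambda>r. A (h r)) = A (integral {0..u} h)" if "u \<in> {0..L}" for u
    using integral_linear[OF integrable_continuous_real A, of 0 u h] continuous_on_subset[OF c, of "{0..u}"] that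
    by (auto simp: o_def)
  then show ?thesis
    using assms(3) by (simp add: mid_def linear_diff[OF bounded_linear.linear[OF A]])
qed

lemma mid_add:
  assumes "continuous_on {0..L} h" "continuous_on {0..L} k" "s \<in> {0..L}"
  shows "mid L (\<lambda>r. h r + k r) s = mid L h s + mid L k s"
proof -
  have "integral {0..u} (\<lambda>r. h r + k r) = integral {0..u} h + integral {0..u} k" if "u \<in> {0..L}" for u
    using continuous_on_subset[OF assms(1), of "{0..u}"] continuous_on_subset[OF assms(2), of "{0..u}"] that
    by (intro integral_add integrable_continuous_real) auto
  then show ?thesis using assms(3) by (simp add: mid_def)
qed

lemma mid_diff:
  assumes "continuous_on {0..L} h" "continuous_on {0..L} k" "s \<in> {0..L}"
  shows "mid L (\<lambda>r. h r - k r) s = mid L h s - mid L k s"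
proof -
  have "integral {0..u} (\<lambda>r. h r - k r) = integral {0..u} h - integral {0..u} k" if "u \<in> {0..L}" for u
    using continuous_on_subset[OF assms(1), of "{0..u}"] continuous_on_subset[OF assms(2), of "{0..u}"] that
    by (intro integral_diff integrable_continuous_real) auto
  then show ?thesis using assms(3) by (simp add: mid_def)
qed

text \<open>The candidate has to be checked only on an interval around the midpoint, which permits
  computing \<open>mid\<close> on the middle half alone.\<close>

lemma mid_eqI:
  assumes c: "continuous_on {0..L} h" and uv: "0 \<le> u" "u \<le> L / 2" "L / 2 \<le> v" "v \<le> L"
    and G: "\<And>s. s \<in> {u..v} \<Longrightarrow> (G has_vector_derivative h s) (at s within {u..v})"
    and G0: "G (L / 2) = 0" and s: "s \<in> {u..v}"
  shows "mid L h s = G s"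
proof -
  have dd: "((\<lambda>s. mid L h s - G s) has_vector_derivative 0) (at x within {u..v})" if x: "x \<in> {u..v}" for x
  proof -
    have "(mid L h has_vector_derivative h x) (at x within {u..v})"
      by (rule has_vector_derivative_within_subset[OF mid_has_vector_derivative[OF c]]) (use x uv in auto)
    from has_vector_derivative_diff[OF this G[OF x]] show ?thesis by simp
  qed
  obtain k where k: "\<And>s. s \<in> {u..v} \<Longrightarrow> mid L h s - G s = k"
    using has_vector_derivative_zero_constant[OF _ dd] by auto
  have "k = 0" using k[of "L / 2"] uv G0 by simp
  then show ?thesis using k[OF s] by simp
qed

lemma mid_norm_le:
  assumes c: "continuous_on {0..L} h" and s: "s \<in> {0..L}" and "0 \<le> L"
    and B: "\<And>r. r \<in> {0..L} \<Longrightarrow> norm (h r) \<le> B"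
  shows "norm (mid L h s) \<le> B * \<bar>s - L / 2\<bar>"
proof (cases "L / 2 \<le> s")
  case True
  have "h integrable_on {0..s}"
    by (intro integrable_continuous_real continuous_on_subset[OF c]) (use s in auto)
  then have "mid L h s = integral {L / 2..s} h"
    using Henstock_Kurzweil_Integration.integral_combine[of 0 "L / 2" s h] True s
    by (auto simp: mid_def algebra_simps)
  also have "norm \<dots> \<le> B * (s - L / 2)"
    using True s \<open>0 \<le> L\<close> by (intro integral_bound continuous_on_subset[OF c] B) auto
  finally show ?thesis using True by simp
next
  case False
  have "h integrable_on {0..L / 2}"
    by (intro integrable_continuous_real continuous_on_subset[OF c]) (use s False in auto)
  then have "mid L h s = - integral {s..L / 2} h"
    using Henstock_Kurzweil_Integration.integral_combine[of 0 s "L / 2" h] False s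
    by (auto simp: mid_def algebra_simps)
  moreover have "norm (integral {s..L / 2} h) \<le> B * (L / 2 - s)"
    using False s \<open>0 \<le> L\<close> by (intro integral_bound continuous_on_subset[OF c] B) auto
  ultimately show ?thesis using False by simp
qed

text \<open>Reversing the parameter changes the sign of a primitive: a tangent invariant under
  reversal gives a centrally symmetric curve, and a tangent that is reflected gives a mirror
  symmetric one.\<close>

lemma mid_reflect:
  fixes h :: "real \<Rightarrow> 'a::euclidean_space"
  assumes A: "bounded_linear A" and c: "continuous_on {0..L} h" and s: "s \<in> {0..L}" and "0 \<le> L"
    and h: "\<And>r. r \<in> {0..L} \<Longrightarrow> h (L - r) = A (h r)"
  shows "mid L h (L - s) = - A (mid L h s)"
proof -
  have cA: "continuous_on {0..L} (\<lambda>r. A (h r))" by (rule bounded_linear.continuous_on[OF A c])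
  have "mid L (\<lambda>r. A (h r)) s = - mid L h (L - s)"
  proof (rule mid_eqI[OF cA, of 0 L])
    fix r assume r: "r \<in> {0..L}"
    have "((\<lambda>r. L - r) has_vector_derivative - 1) (at r within {0..L})"
      by (auto intro!: derivative_eq_intros)
    moreover have "(mid L h has_vector_derivative h (L - r)) (at (L - r) within (\<lambda>r. L - r) ` {0..L})"
      by (rule has_vector_derivative_within_subset[OF mid_has_vector_derivative[OF c]]) (use r in auto)
    ultimately have "((\<lambda>r. mid L h (L - r)) has_vector_derivative - 1 *\<^sub>R h (L - r)) (at r within {0..L})"
      using vector_diff_chain_within[of "\<lambda>r. L - r" "- 1" r "{0..L}" "mid L h" "h (L - r)"] by (simp add: o_def)
    then have "((\<lambda>r. - mid L h (L - r)) has_vector_derivative - (- 1 *\<^sub>R h (L - r))) (at r within {0..L})"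
      by (rule has_vector_derivative_minus)
    then show "((\<lambda>r. - mid L h (L - r)) has_vector_derivative A (h r)) (at r within {0..L})"
      using h[OF r] by simp
  qed (use s \<open>0 \<le> L\<close> in auto)
  then show ?thesis using mid_linear[OF A c s] by simp
qed

lemma continuous_on_mid:
  fixes H :: "real \<Rightarrow> 'b::t2_space \<Rightarrow> 'a::euclidean_space"
  assumes c: "continuous_on ({0..L} \<times> U) (\<lambda>q. H (fst q) (snd q))" and "0 \<le> L"
  shows "continuous_on ({0..L} \<times> U) (\<lambda>q. mid L (\<lambda>r. H r (snd q)) (fst q))"
proof -
  \<comment> \<open>Substituting \<open>r = s * x\<close> moves the variable upper limit into the
    integrand, so that continuity of integrals over a fixed interval applies.\<close>
  have "continuous_on (({0..L} \<times> U) \<times> cbox 0 1) (\<lambda>(q, x). H (fst q * x) (snd q))"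
    unfolding case_prod_unfold
  proof (rule continuous_on_compose2[OF c, where f = "\<lambda>p. (fst (fst p) * snd p, snd (fst p))", simplified fst_conv snd_conv])
    show "continuous_on (({0..L} \<times> U) \<times> cbox 0 1) (\<lambda>p. (fst (fst p) * snd p, snd (fst p)))"
      by (intro continuous_intros)
    show "(\<lambda>p. (fst (fst p) * snd p, snd (fst p))) ` (({0..L} \<times> U) \<times> cbox 0 1) \<subseteq> {0..L} \<times> U"
      by (auto intro: mult_nonneg_nonneg) (metis mult.commute mult_left_le_one_le order_trans)
  qed
  from integral_continuous_on_param[OF this]
  have "continuous_on ({0..L} \<times> U) (\<lambda>q. fst q *\<^sub>R integral {0..1} (\<lambda>x. H (fst q * x) (snd q)))"
    by (intro continuous_on_scaleR continuous_intros) simp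
  moreover have e: "s *\<^sub>R integral {0..1} (\<lambda>x. H (s * x) t) = integral {0..s} (\<lambda>r. H r t)"
    if "s \<in> {0..L}" "t \<in> U" for s t
  proof (cases "s = 0")
    case False
    have "continuous_on {0..L} (\<lambda>r. H r t)" by (rule continuous_on_slice[OF c that(2)])
    then have "continuous_on {0..s} (\<lambda>r. H r t)" by (rule continuous_on_subset) (use that in auto)
    then have "(\<lambda>r. H r t) integrable_on {0..s}" by (rule integrable_continuous_real)
    from has_integral_dilation[of s "\<lambda>r. H r t" _ 1] integrable_integral[OF this] False that
    have "((\<lambda>x. H (s * x) t) has_integral (1 / s) *\<^sub>R integral {0..s} (\<lambda>r. H r t)) {0..1}" by auto
    then show ?thesis using False by (simp add: integral_unique)
  qed simp
  ultimately have 1: "continuous_on ({0..L} \<times> U) (\<lambda>q. integral {0..fst q} (\<lambda>r. H r (snd q)))"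
    by (rule continuous_on_eq) auto
  have "continuous_on ({0..L} \<times> U) (\<lambda>q. (L / 2, snd q))" by (intro continuous_intros)
  moreover have "(\<lambda>q. (L / 2, snd q)) ` ({0..L} \<times> U) \<subseteq> {0..L} \<times> U" using \<open>0 \<le> L\<close> by auto
  ultimately have "continuous_on ({0..L} \<times> U) (\<lambda>q. integral {0..L / 2} (\<lambda>r. H r (snd q)))"
    using continuous_on_compose2[OF 1] by fastforce
  with 1 show ?thesis unfolding mid_def by (intro continuous_on_diff)
qed

lemma mid_time_derivative:
  fixes H :: "real \<Rightarrow> real \<Rightarrow> 'a::euclidean_space"
  assumes c: "continuous_on ({0..L} \<times> {0..T}) (\<lambda>q. H (fst q) (snd q))"
    and c': "continuous_on ({0..L} \<times> {0..T}) (\<lambda>q. H' (fst q) (snd q))"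
    and d: "\<And>r t. r \<in> {0..L} \<Longrightarrow> t \<in> {0..T} \<Longrightarrow> ((\<lambda>u. H r u) has_vector_derivative H' r t) (at t within {0..T})"
    and s: "s \<in> {0..L}" and t: "t \<in> {0..T}" and "0 \<le> L"
  shows "((\<lambda>u. mid L (\<lambda>r. H r u) s) has_vector_derivative mid L (\<lambda>r. H' r t) s) (at t within {0..T})"
proof -
  have "((\<lambda>u. integral (cbox 0 v) (\<lambda>r. H r u)) has_vector_derivative integral (cbox 0 v) (\<lambda>r. H' r t)) (at t within {0..T})"
    if v: "v \<in> {0..L}" for v
  proof (rule leibniz_rule_vector_derivative)
    fix u r assume "u \<in> {0..T}" "r \<in> cbox 0 v"
    then show "((\<lambda>u. H r u) has_vector_derivative H' r u) (at u within {0..T})" using v by (intro d) auto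
  next
    fix u assume "u \<in> {0..T}"
    then have "continuous_on {0..L} (\<lambda>r. H r u)" by (rule continuous_on_slice[OF c])
    then have "continuous_on (cbox 0 v) (\<lambda>r. H r u)" by (rule continuous_on_subset) (use v in auto)
    then show "(\<lambda>r. H r u) integrable_on cbox 0 v" by (rule integrable_continuous)
  next
    have "continuous_on ({0..T} \<times> cbox 0 v) (\<lambda>p. (snd p, fst p))" by (intro continuous_intros)
    moreover have "(\<lambda>p. (snd p, fst p)) ` ({0..T} \<times> cbox 0 v) \<subseteq> {0..L} \<times> {0..T}" using v by auto
    ultimately show "continuous_on ({0..T} \<times> cbox 0 v) (\<lambda>(u, r). H' r u)"
      using continuous_on_compose2[OF c'] by (fastforce simp: case_prod_unfold)
  qed (use t in auto)
  from has_vector_derivative_diff[OF this[OF s] this[of "L / 2"]] show ?thesis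
    using \<open>0 \<le> L\<close> by (simp add: mid_def[abs_def])
qed

text \<open>A curvature bound that is small against both \<open>1 / L\<close> and
  \<open>1 / \<rho>\<close> makes thickness automatic, so smooth small bending may be prescribed
  freely.\<close>

lemma shape_path_of_tangent:
  assumes "0 < L" "0 < \<rho>"
    and c: "continuous_on ({0..L} \<times> {0..1}) (\<lambda>q. \<tau> (fst q) (snd q))"
    and ch: "continuous_on ({0..L} \<times> {0..1}) (\<lambda>q. h (fst q) (snd q))"
    and c': "continuous_on ({0..L} \<times> {0..1}) (\<lambda>q. \<tau>' (fst q) (snd q))"
    and n: "\<And>s t. s \<in> {0..L} \<Longrightarrow> t \<in> {0..1} \<Longrightarrow> norm (\<tau> s t) = 1"
    and ds: "\<And>s t. s \<in> {0..L} \<Longrightarrow> t \<in> {0..1} \<Longrightarrow> ((\<lambda>\<sigma>. \<tau> \<sigma> t) has_vector_derivative h s t) (at s within {0..L})"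
    and dt: "\<And>s t. s \<in> {0..L} \<Longrightarrow> t \<in> {0..1} \<Longrightarrow> ((\<lambda>u. \<tau> s u) has_vector_derivative \<tau>' s t) (at t within {0..1})"
    and b: "\<And>s t. s \<in> {0..L} \<Longrightarrow> t \<in> {0..1} \<Longrightarrow> norm (h s t) \<le> \<kappa>"
    and \<kappa>: "\<kappa> * L \<le> 1/2" "4 * \<rho> * \<kappa> \<le> 1"
  shows "shape_path L 1 \<rho> (\<lambda>s t. mid L (\<lambda>r. \<tau> r t) s) (\<lambda>s t. mid L (\<lambda>r. \<tau>' r t) s) \<tau> h"
proof -
  have "0 \<le> L" using \<open>0 < L\<close> by simp
  have "norm (h 0 0) \<le> \<kappa>" by (rule b) (use \<open>0 < L\<close> in auto)
  then have \<kappa>0: "0 \<le> \<kappa>" using norm_ge_zero order_trans by blast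
  have c1: "continuous_on {0..L} (\<lambda>s. \<tau> s t)" "continuous_on {0..L} (\<lambda>s. h s t)" if "t \<in> {0..1}" for t
    using that by (auto intro: continuous_on_slice[OF c] continuous_on_slice[OF ch])
  have dm: "((\<lambda>s. mid L (\<lambda>r. \<tau> r t) s) has_vector_derivative \<tau> s t) (at s within {0..L})"
    if "s \<in> {0..L}" "t \<in> {0..1}" for s t
    using mid_has_vector_derivative[OF c1(1)[OF that(2)] that(1)] by simp
  have ftc: "(\<lambda>r. h r t) integrable_on {x..y} \<and> \<tau> y t - \<tau> x t = integral {x..y} (\<lambda>r. h r t)"
    if "0 \<le> x" "x \<le> y" "y \<le> L" "t \<in> {0..1}" for x y t
  proof -
    have "((\<lambda>r. h r t) has_integral \<tau> y t - \<tau> x t) {x..y}"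
      by (rule fundamental_theorem_of_calculus[OF that(2)], rule has_vector_derivative_within_subset[OF ds])
        (use that in auto)
    then show ?thesis by (auto simp: integral_unique has_integral_integrable)
  qed
  have lip0: "norm (\<tau> y t - \<tau> x t) \<le> \<kappa> * (y - x)" if "0 \<le> x" "x \<le> y" "y \<le> L" "t \<in> {0..1}" for x y t
    using ftc[OF that] that
    by (auto intro!: integral_bound b continuous_on_subset[OF c1(2)[OF that(4)]])
  have lip: "norm (\<tau> s t - \<tau> \<sigma> t) \<le> \<kappa> * \<bar>s - \<sigma>\<bar>" if "s \<in> {0..L}" "\<sigma> \<in> {0..L}" "t \<in> {0..1}" for s \<sigma> t
    using lip0[of s \<sigma> t] lip0[of \<sigma> s t] that
    by (cases "s \<le> \<sigma>") (auto simp: norm_minus_commute)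
  show ?thesis
    unfolding shape_path_def
  proof (intro conjI c continuous_on_mid[OF c] continuous_on_mid[OF c'] \<open>0 \<le> L\<close>; intro ballI conjI)
    fix s t :: real assume s: "s \<in> {0..L}" and t: "t \<in> {0..1}"
    show "((\<lambda>\<sigma>. mid L (\<lambda>r. \<tau> r t) \<sigma>) has_vector_derivative \<tau> s t) (at s within {0..L})" by (rule dm[OF s t])
    show "((\<lambda>u. mid L (\<lambda>r. \<tau> r u) s) has_vector_derivative mid L (\<lambda>r. \<tau>' r t) s) (at t within {0..1})"
      by (rule mid_time_derivative[OF c c' dt s t \<open>0 \<le> L\<close>])
    show "norm (\<tau> s t) = 1" by (rule n[OF s t])
    show "\<tau> s t = \<tau> 0 t + integral {0..s} (\<lambda>r. h r t)" using ftc[of 0 s t] s t by (auto simp: algebra_simps)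
  next
    fix t :: real assume t: "t \<in> {0..1}"
    show "(\<lambda>s. h s t) \<in> L2 {0<..<L}" by (rule L2_continuous[OF c1(2)[OF t]])
    have "unit_speed L (mid L (\<lambda>r. \<tau> r t)) (\<lambda>s. \<tau> s t)"
      unfolding unit_speed_def using c1 dm n t by auto
    then show "thick L \<rho> (\<lambda>s. mid L (\<lambda>r. \<tau> r t) s) (\<lambda>s. \<tau> s t)"
      by (rule thick_slowly_turning[OF \<open>0 < \<rho>\<close> _ lip \<kappa>0 \<kappa>]) (use t in auto)
    define I where "I u = integral {0..L} (\<lambda>s. (norm (h s u - h s t))\<^sup>2)" for u
    have "continuous_on ({0..L} \<times> {0..1::real}) (\<lambda>q. h (fst q) t)"
      by (rule continuous_on_reparam[OF ch, of _ "\<lambda>_. t"]) (use t in auto)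
    then have "continuous_on {0..1} I"
      unfolding I_def
      by (intro continuous_on_integral_slice[where f = "\<lambda>s u. (norm (h s u - h s t))\<^sup>2"] continuous_intros ch)
    then have "(I \<longlongrightarrow> I t) (at t within {0..1})" using t unfolding continuous_on_def by blast
    then show "((\<lambda>u. integral {0..L} (\<lambda>s. (norm (h s u - h s t))\<^sup>2)) \<longlongrightarrow> 0) (at t within {0..1})"
      by (simp add: I_def[abs_def])
  qed
qed

lemma integral_odd:
  fixes q :: "real \<Rightarrow> 'a::euclidean_space"
  assumes c: "continuous_on {0..L} q" and o: "\<And>s. s \<in> {0..L} \<Longrightarrow> q (L - s) = - q s" and "0 \<le> L"
  shows "integral {0..L} q = 0"
proof -
  have "(q has_integral integral {0..L} q) (cbox 0 L)"
    using integrable_integral[OF integrable_continuous_real[OF c]] by simp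
  from has_integral_affinity[OF this, of "- 1" L]
  have "((\<lambda>s. q (L - s)) has_integral integral {0..L} q) ((\<lambda>x. L - x) ` {0..L})" by simp
  moreover have "(\<lambda>x. L - x) ` {0..L} = {0..L}" by (auto intro!: image_eqI[of _ _ "L - _"])
  ultimately have "((\<lambda>s. q (L - s)) has_integral integral {0..L} q) {0..L}" by simp
  then have "((\<lambda>s. - q s) has_integral integral {0..L} q) {0..L}"
    by (rule has_integral_eq[rotated]) (use o in auto)
  moreover have "((\<lambda>s. - q s) has_integral - integral {0..L} q) {0..L}"
    by (intro has_integral_neg integrable_integral integrable_continuous_real c)
  ultimately have "integral {0..L} q = - integral {0..L} q" by (rule has_integral_unique)
  then show ?thesis by (simp add: eq_neg_iff_add_eq_0 flip: scaleR_2)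
qed

section \<open>The drift produced by a loop in a two-parameter family of shapes\<close>

text \<open>Only differences from \<open>X 0\<close> enter, so the displacement of the degenerate
  loop need not be computed. Either sign of the difference is covered by closure under
  negation.\<close>

lemma add_closed_continuum:
  fixes S :: "real set" and a0 :: real
  assumes add: "\<And>x y. x \<in> S \<Longrightarrow> y \<in> S \<Longrightarrow> x + y \<in> S" and neg: "\<And>x. x \<in> S \<Longrightarrow> - x \<in> S"
    and c: "continuous_on {0..a0} X" and X: "\<And>a. a \<in> {0..a0} \<Longrightarrow> X a - X 0 \<in> S"
    and a: "a \<in> {0..a0}" "X a \<noteq> X 0"
  shows "x \<in> S"
proof -
  define d where "d = X a - X 0"
  have dS: "d \<noteq> 0" using a by (simp add: d_def)
  have small: "y \<in> S" if "0 \<le> y" "y \<le> \<bar>d\<bar>" for y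
  proof -
    have ca: "continuous_on {0..a} X" using c by (rule continuous_on_subset) (use a in auto)
    show ?thesis
    proof (cases "0 < d")
      case True
      then have "\<exists>u. 0 \<le> u \<and> u \<le> a \<and> X u = X 0 + y"
        using IVT'[of X 0 "X 0 + y" a] ca a that by (auto simp: d_def)
      then show ?thesis using X a by force
    next
      case False
      then have "\<exists>u. 0 \<le> u \<and> u \<le> a \<and> X u = X 0 - y"
        using IVT2'[of X a "X 0 - y" 0] ca a that by (auto simp: d_def)
      then obtain u where "0 \<le> u" "u \<le> a" "X u = X 0 - y" by blast
      then have "- y \<in> S" using X[of u] a by auto
      then show ?thesis using neg by force
    qed
  qed
  have mult: "real (Suc n) * y \<in> S" if "y \<in> S" for n y
  proof (induction n)
    case (Suc n)
    have "real (Suc (Suc n)) * y = real (Suc n) * y + y" by (simp add: algebra_simps)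
    then show ?case using add[OF Suc that] by simp
  qed (use that in simp)
  have nonneg: "y \<in> S" if "0 \<le> y" for y
  proof -
    obtain n :: nat where n: "y / \<bar>d\<bar> \<le> real n" using real_arch_simple by blast
    have "y / \<bar>d\<bar> \<le> real (Suc n)" using n by simp
    then have "y / real (Suc n) \<le> \<bar>d\<bar>" using dS by (simp add: divide_simps mult.commute del: of_nat_Suc)
    then have "y / real (Suc n) \<in> S" using that by (intro small) auto
    from mult[OF this, of n] show ?thesis by (simp del: of_nat_Suc)
  qed
  show ?thesis
    using nonneg[of x] neg[OF nonneg[of "- x"]] by (cases "0 \<le> x") auto
qed

text \<open>A loop \<open>(a x, y)\<close> with \<open>x' = 1 / D(0, y) - mean\<close>: to first order in \<open>a\<close> only the term
  \<open>n x' / D(0, y)\<close> of the drift rate depends on \<open>a\<close>, and it integrates to \<open>n\<close> times the variance of \<open>1 / D(0, y)\<close>.\<close>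

lemma loop_drift:
  fixes Nf Ng D :: "real \<Rightarrow> real \<Rightarrow> real"
  assumes "0 < r"
    and cf: "continuous_on ({-r..r} \<times> {0..r}) (\<lambda>p. Nf (fst p) (snd p))"
    and cg: "continuous_on ({-r..r} \<times> {0..r}) (\<lambda>p. Ng (fst p) (snd p))"
    and cD: "continuous_on ({-r..r} \<times> {0..r}) (\<lambda>p. D (fst p) (snd p))"
    and D0: "\<And>\<alpha> \<beta>. \<alpha> \<in> {-r..r} \<Longrightarrow> \<beta> \<in> {0..r} \<Longrightarrow> 0 < D \<alpha> \<beta>"
    and n: "\<And>\<beta>. \<beta> \<in> {0..r} \<Longrightarrow> Nf 0 \<beta> = n" "n \<noteq> 0"
    and Ng2: "\<And>\<alpha> \<beta>. \<alpha> \<in> {-r..r} \<Longrightarrow> \<beta> \<in> {0..r} \<Longrightarrow> \<bar>Ng \<alpha> \<beta> - Ng 0 \<beta>\<bar> \<le> C * \<alpha>\<^sup>2"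
    and D2: "\<And>\<alpha> \<beta>. \<alpha> \<in> {-r..r} \<Longrightarrow> \<beta> \<in> {0..r} \<Longrightarrow> \<bar>D \<alpha> \<beta> - D 0 \<beta>\<bar> \<le> C * \<alpha>\<^sup>2"
    and D1: "D 0 r \<noteq> D 0 0"
  shows "\<exists>x x' y y' a0. (\<forall>t\<in>{0..1}. (x has_real_derivative x' t) (at t within {0..1})) \<and> continuous_on {0..1} x' \<and>
     (\<forall>t\<in>{0..1}. (y has_real_derivative y' t) (at t within {0..1})) \<and> continuous_on {0..1} y' \<and>
     x 0 = 0 \<and> x 1 = 0 \<and> y 0 = 0 \<and> y 1 = 0 \<and> 0 < a0 \<and>
     (\<forall>a\<in>{0..a0}. \<forall>t\<in>{0..1}. a * x t \<in> {-r..r} \<and> y t \<in> {0..r}) \<and>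
     continuous_on {0..a0} (\<lambda>a. integral {0..1} (\<lambda>t. (a * x' t * Nf (a * x t) (y t) + y' t * Ng (a * x t) (y t)) / D (a * x t) (y t))) \<and>
     (\<exists>a\<in>{0..a0}. integral {0..1} (\<lambda>t. (a * x' t * Nf (a * x t) (y t) + y' t * Ng (a * x t) (y t)) / D (a * x t) (y t)) \<noteq>
       integral {0..1} (\<lambda>t. (0 * x' t * Nf (0 * x t) (y t) + y' t * Ng (0 * x t) (y t)) / D (0 * x t) (y t)))"
proof -
  \<comment> \<open>The second amplitude rises from 0 to its maximum r at time 1/2 and
    returns.\<close>
  define y where "y t = r * (4 * t * (1 - t))" for t
  define y' where "y' t = r * (4 - 8 * t)" for t
  have dy: "(y has_real_derivative y' t) (at t within {0..1})" for t
    unfolding y_def y'_def by (auto intro!: derivative_eq_intros simp: algebra_simps)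
  have cy': "continuous_on {0..1} y'" unfolding y'_def by (intro continuous_intros)
  have cy: "continuous_on {0..1} y" unfolding y_def by (intro continuous_intros)
  have yr: "y t \<in> {0..r}" if "t \<in> {0..1}" for t
  proof -
    have "4 * t * (1 - t) = 1 - (2 * t - 1)\<^sup>2" by (simp add: power2_eq_square algebra_simps)
    then have "4 * t * (1 - t) \<le> 1" by simp
    moreover have "0 \<le> 4 * t * (1 - t)" using that by auto
    ultimately show ?thesis unfolding y_def using \<open>0 < r\<close>
      by (metis atLeastAtMost_iff less_imp_le mult.commute mult_left_le_one_le mult_nonneg_nonneg)
  qed
  define q where "q t = 1 / D 0 (y t)" for t
  have z: "(0::real) \<in> {-r..r}" using \<open>0 < r\<close> by simp
  have cD0: "continuous_on {0..1} (\<lambda>t. D 0 (y t))"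
    by (rule continuous_on_compose2[OF continuous_on_slice2[OF cD z] cy]) (use yr in auto)
  have D0': "D 0 (y t) > 0" if "t \<in> {0..1}" for t using D0[OF z yr[OF that]] .
  have cq: "continuous_on {0..1} q"
    unfolding q_def using D0' by (intro continuous_on_divide continuous_intros cD0) force
  define m where "m = integral {0..1} q"
  \<comment> \<open>Subtracting the mean closes the loop in x. It also makes the integral of
    \<open>m * x' t\<close> vanish, so that pairing \<open>x'\<close> with \<open>q\<close> leaves
    the integral of the square of \<open>x'\<close>.\<close>
  define x' where "x' t = q t - m" for t
  define x where "x t = integral {0..t} x'" for t
  have cx': "continuous_on {0..1} x'" unfolding x'_def by (intro continuous_intros cq)
  have dx: "(x has_real_derivative x' t) (at t within {0..1})" if "t \<in> {0..1}" for t
    unfolding x_def by (rule integral_has_real_derivative[OF cx' that])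
  then have cx: "continuous_on {0..1} x"
    by (meson continuous_on_eq_continuous_within DERIV_continuous)
  have ix': "integral {0..1} x' = 0"
    unfolding x'_def using cq by (subst integral_diff) (auto simp: m_def integrable_continuous_real)
  have "\<exists>B. \<forall>t\<in>{0..1}. \<bar>x t\<bar> \<le> B"
    using compact_imp_bounded[OF compact_continuous_image[OF cx compact_Icc]] by (auto simp: bounded_iff)
  then obtain B0 where "\<And>t. t \<in> {0..1} \<Longrightarrow> \<bar>x t\<bar> \<le> B0" by blast
  define B where "B = max 1 B0"
  have B: "\<bar>x t\<bar> \<le> B" if "t \<in> {0..1}" for t
    using \<open>\<And>t. t \<in> {0..1} \<Longrightarrow> \<bar>x t\<bar> \<le> B0\<close>[OF that] by (simp add: B_def)
  have B1: "1 \<le> B" by (simp add: B_def)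
  \<comment> \<open>For these a the scaled loop stays in the box on which the coefficients are
    controlled.\<close>
  define a0 where "a0 = r / B"
  have a0: "0 < a0" using \<open>0 < r\<close> B1 by (simp add: a0_def)
  have axr: "a * x t \<in> {-r..r}" if "a \<in> {0..a0}" "t \<in> {0..1}" for a t
  proof -
    have "\<bar>a * x t\<bar> \<le> a0 * B" unfolding abs_mult using that B[OF that(2)] B1 by (intro mult_mono) auto
    then show ?thesis using B1 by (auto simp: a0_def abs_le_iff)
  qed
  have cax: "continuous_on ({0..a0} \<times> {0..1}) (\<lambda>p. (fst p * x (snd p), y (snd p)))"
    by (intro continuous_intros continuous_on_snd_comp[OF cx] continuous_on_snd_comp[OF cy])
  have sub: "(\<lambda>p. (fst p * x (snd p), y (snd p))) ` ({0..a0} \<times> {0..1}) \<subseteq> {-r..r} \<times> {0..r}"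
    using axr yr by auto
  have cNf: "continuous_on ({0..a0} \<times> {0..1}) (\<lambda>p. Nf (fst p * x (snd p)) (y (snd p)))"
    and cNg: "continuous_on ({0..a0} \<times> {0..1}) (\<lambda>p. Ng (fst p * x (snd p)) (y (snd p)))"
    and cDD: "continuous_on ({0..a0} \<times> {0..1}) (\<lambda>p. D (fst p * x (snd p)) (y (snd p)))"
    using continuous_on_compose2[OF cf cax sub] continuous_on_compose2[OF cg cax sub] continuous_on_compose2[OF cD cax sub]
    by simp_all
  have DD: "D (fst p * x (snd p)) (y (snd p)) \<noteq> 0" if "p \<in> {0..a0} \<times> {0..1}" for p
    using D0[OF axr yr, of "fst p" "snd p" "snd p"] that by force
  define X where "X a = integral {0..1} (\<lambda>t. (a * x' t * Nf (a * x t) (y t) + y' t * Ng (a * x t) (y t)) / D (a * x t) (y t))" for a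
  \<comment> \<open>The drift splits as \<open>a * P a + R a\<close>: \<open>P\<close> collects the
    forcing by the first mode, and \<open>R\<close> the forcing by the second.\<close>
  define P where "P a = integral {0..1} (\<lambda>t. x' t * Nf (a * x t) (y t) / D (a * x t) (y t))" for a
  define R where "R a = integral {0..1} (\<lambda>t. y' t * Ng (a * x t) (y t) / D (a * x t) (y t))" for a
  have cP2: "continuous_on ({0..a0} \<times> {0..1}) (\<lambda>p. x' (snd p) * Nf (fst p * x (snd p)) (y (snd p)) / D (fst p * x (snd p)) (y (snd p)))"
    and cR2: "continuous_on ({0..a0} \<times> {0..1}) (\<lambda>p. y' (snd p) * Ng (fst p * x (snd p)) (y (snd p)) / D (fst p * x (snd p)) (y (snd p)))"
    using DD by (auto intro!: continuous_on_divide continuous_on_mult cNf cNg cDD continuous_on_snd_comp[OF cx'] continuous_on_snd_comp[OF cy'])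
  have cP: "continuous_on {0..a0} P"
    using integral_continuous_on_param[of "{0..a0}" 0 1 "\<lambda>a t. x' t * Nf (a * x t) (y t) / D (a * x t) (y t)"] cP2
    unfolding P_def by (simp add: case_prod_unfold)
  have cR: "continuous_on {0..a0} R"
    using integral_continuous_on_param[of "{0..a0}" 0 1 "\<lambda>a t. y' t * Ng (a * x t) (y t) / D (a * x t) (y t)"] cR2
    unfolding R_def by (simp add: case_prod_unfold)
  have iP: "(\<lambda>t. x' t * Nf (a * x t) (y t) / D (a * x t) (y t)) integrable_on {0..1}"
    and iR: "(\<lambda>t. y' t * Ng (a * x t) (y t) / D (a * x t) (y t)) integrable_on {0..1}" if "a \<in> {0..a0}" for a
    using continuous_on_slice2[where f = "\<lambda>a t. x' t * Nf (a * x t) (y t) / D (a * x t) (y t)", OF cP2 that]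
      continuous_on_slice2[where f = "\<lambda>a t. y' t * Ng (a * x t) (y t) / D (a * x t) (y t)", OF cR2 that]
    by (auto intro: integrable_continuous_real)
  have XPR: "X a = a * P a + R a" if "a \<in> {0..a0}" for a
  proof -
    have "X a = integral {0..1} (\<lambda>t. a * (x' t * Nf (a * x t) (y t) / D (a * x t) (y t)) + y' t * Ng (a * x t) (y t) / D (a * x t) (y t))"
      unfolding X_def by (simp add: add_divide_distrib mult.assoc)
    also have "\<dots> = a * P a + R a"
      unfolding P_def R_def using iP[OF that] iR[OF that]
      by (subst integral_add) (auto simp: integrable_on_mult_right simp del: times_divide_eq_right)
    finally show ?thesis .
  qed
  have cX: "continuous_on {0..a0} X"
  proof -
    have "continuous_on {0..a0} (\<lambda>a. a * P a + R a)" by (intro continuous_intros cP cR)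
    then show ?thesis by (rule continuous_on_eq) (use XPR in auto)
  qed
  have P0: "P 0 \<noteq> 0"
  proof -
    have cc: "continuous_on {0..1} (\<lambda>t. (x' t)\<^sup>2)" "continuous_on {0..1} (\<lambda>t. m * x' t)" by (intro continuous_intros cx')+
    have "P 0 = integral {0..1} (\<lambda>t. n * ((x' t)\<^sup>2 + m * x' t))"
      unfolding P_def
    proof (rule integral_cong)
      fix t :: real assume t: "t \<in> {0..1}"
      have "x' t * Nf (0 * x t) (y t) / D (0 * x t) (y t) = n * (x' t * q t)"
        using n(1)[OF yr[OF t]] by (simp add: q_def)
      also have "x' t * q t = (x' t)\<^sup>2 + m * x' t" by (simp add: x'_def power2_eq_square algebra_simps)
      finally show "x' t * Nf (0 * x t) (y t) / D (0 * x t) (y t) = n * ((x' t)\<^sup>2 + m * x' t)" .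
    qed
    also have "\<dots> = n * (integral {0..1} (\<lambda>t. (x' t)\<^sup>2) + m * integral {0..1} x')"
      using cc by (simp add: integral_add integrable_continuous_real)
    finally have "P 0 = n * integral {0..1} (\<lambda>t. (x' t)\<^sup>2)" using ix' by simp
    \<comment> \<open>If \<open>x'\<close> vanished identically, \<open>D 0\<close> would be
      constant along the loop. But y passes through 0 and r, where \<open>D 0\<close> takes
      different values.\<close>
    moreover have "integral {0..1} (\<lambda>t. (x' t)\<^sup>2) \<noteq> 0"
    proof
      assume "integral {0..1} (\<lambda>t. (x' t)\<^sup>2) = 0"
      then have "\<forall>t\<in>{0..1}. (x' t)\<^sup>2 = 0"
        using integral_eq_0_iff[of 0 1 "\<lambda>t. (x' t)\<^sup>2"] cc by auto
      then have "x' 0 = 0" "x' (1/2) = 0" by auto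
      then have "q 0 = q (1/2)" by (simp add: x'_def)
      moreover have "y 0 = 0" "y (1/2) = r" by (simp_all add: y_def)
      ultimately show False
        using D1 D0'[of 0] D0'[of "1/2"] by (simp add: q_def)
    qed
    ultimately show ?thesis using n(2) by simp
  qed
  \<comment> \<open>Both the numerator and the denominator differ from their values at amplitude 0
    by a quadratic term, and the denominator is bounded away from 0 on the compact box; so the
    quotient differs quadratically too.\<close>
  have "\<exists>K. \<forall>a\<in>{0..a0}. \<bar>R a - R 0\<bar> \<le> K * a\<^sup>2"
  proof -
    have comp: "compact ({-r..r} \<times> {0..r})" by (intro compact_Times compact_Icc)
    have "\<exists>G. \<forall>p\<in>{-r..r} \<times> {0..r}. \<bar>Ng (fst p) (snd p)\<bar> \<le> G"
      using compact_imp_bounded[OF compact_continuous_image[OF cg comp]] by (auto simp: bounded_iff)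
    then obtain G where G: "\<And>\<alpha> \<beta>. \<alpha> \<in> {-r..r} \<Longrightarrow> \<beta> \<in> {0..r} \<Longrightarrow> \<bar>Ng \<alpha> \<beta>\<bar> \<le> G" by force
    have "continuous_on ({-r..r} \<times> {0..r}) (\<lambda>p. 1 / D (fst p) (snd p))"
      using D0 by (intro continuous_on_divide continuous_intros cD) force
    then have "\<exists>E. \<forall>p\<in>{-r..r} \<times> {0..r}. \<bar>1 / D (fst p) (snd p)\<bar> \<le> E"
      using compact_imp_bounded[OF compact_continuous_image[OF _ comp]] by (fastforce simp: bounded_iff)
    then obtain E where "\<And>\<alpha> \<beta>. \<alpha> \<in> {-r..r} \<Longrightarrow> \<beta> \<in> {0..r} \<Longrightarrow> \<bar>1 / D \<alpha> \<beta>\<bar> \<le> E" by force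
    then have E: "\<And>\<alpha> \<beta>. \<alpha> \<in> {-r..r} \<Longrightarrow> \<beta> \<in> {0..r} \<Longrightarrow> 1 / D \<alpha> \<beta> \<le> E" by (meson abs_le_D1)
    have "0 \<le> G" using G[OF z, of 0] \<open>0 < r\<close> by auto
    have "0 < E" using E[OF z, of 0] D0[OF z, of 0] \<open>0 < r\<close> by (smt (verit) atLeastAtMost_iff divide_pos_pos)
    have "0 \<le> C" using D2[of r 0] \<open>0 < r\<close> by (smt (verit) abs_ge_zero atLeastAtMost_iff mult_neg_pos zero_less_power)
    have key: "\<bar>Ng \<alpha> \<beta> / D \<alpha> \<beta> - Ng 0 \<beta> / D 0 \<beta>\<bar> \<le> (C * E + G * C * E * E) * \<alpha>\<^sup>2"
      if ab: "\<alpha> \<in> {-r..r}" "\<beta> \<in> {0..r}" for \<alpha> \<beta>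
    proof -
      have p: "0 < D \<alpha> \<beta>" "0 < D 0 \<beta>" using D0 ab z by auto
      have "Ng \<alpha> \<beta> / D \<alpha> \<beta> - Ng 0 \<beta> / D 0 \<beta> =
          (Ng \<alpha> \<beta> - Ng 0 \<beta>) * (1 / D \<alpha> \<beta>) + Ng 0 \<beta> * (D 0 \<beta> - D \<alpha> \<beta>) * (1 / D \<alpha> \<beta>) * (1 / D 0 \<beta>)"
        using p by (simp add: field_simps)
      also have "\<bar>\<dots>\<bar> \<le> \<bar>Ng \<alpha> \<beta> - Ng 0 \<beta>\<bar> * (1 / D \<alpha> \<beta>) + \<bar>Ng 0 \<beta>\<bar> * \<bar>D 0 \<beta> - D \<alpha> \<beta>\<bar> * (1 / D \<alpha> \<beta>) * (1 / D 0 \<beta>)"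
        using p by (intro order_trans[OF abs_triangle_ineq]) (simp add: abs_mult)
      also have "\<dots> \<le> (C * \<alpha>\<^sup>2) * E + G * (C * \<alpha>\<^sup>2) * E * E"
        using Ng2[OF ab] G[OF z ab(2)] D2[OF ab] E[OF ab] E[OF z ab(2)] p \<open>0 \<le> G\<close> \<open>0 < E\<close> \<open>0 \<le> C\<close>
        by (intro add_mono mult_mono) (auto simp: abs_minus_commute)
      finally show ?thesis by (simp add: algebra_simps)
    qed
    define K where "K = 4 * r * (C * E + G * C * E * E) * B\<^sup>2"
    have CE: "0 \<le> C * E + G * C * E * E" using \<open>0 \<le> G\<close> \<open>0 < E\<close> \<open>0 \<le> C\<close> by simp
    have "\<bar>R a - R 0\<bar> \<le> K * a\<^sup>2" if a: "a \<in> {0..a0}" for a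
    proof -
      have z0: "0 \<in> {0..a0}" using a0 by simp
      define W where "W t = y' t * Ng (a * x t) (y t) / D (a * x t) (y t) - y' t * Ng (0 * x t) (y t) / D (0 * x t) (y t)" for t
      have eq: "R a - R 0 = integral {0..1} W"
        unfolding R_def W_def[abs_def] by (rule integral_diff[symmetric]) (rule iR[OF a] iR[OF z0])+
      have "norm (integral {0..1} W) \<le> integral {0..1::real} (\<lambda>t. K * a\<^sup>2)"
      proof (rule integral_norm_bound_integral)
        show "W integrable_on {0..1}"
          unfolding W_def[abs_def] by (intro integrable_diff iR a z0)
        fix t :: real assume t: "t \<in> {0..1}"
        have "W t = y' t * (Ng (a * x t) (y t) / D (a * x t) (y t) - Ng 0 (y t) / D 0 (y t))"
          by (simp add: W_def algebra_simps)
        also have "norm \<dots> \<le> (4 * r) * ((C * E + G * C * E * E) * (a * x t)\<^sup>2)"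
          unfolding real_norm_def abs_mult[of "y' t"]
        proof (rule mult_mono)
          have "\<bar>4 - 8 * t\<bar> \<le> 4" using t by auto
          then have "r * \<bar>4 - 8 * t\<bar> \<le> r * 4" using \<open>0 < r\<close> by (intro mult_left_mono) auto
          then show "\<bar>y' t\<bar> \<le> 4 * r" using \<open>0 < r\<close> by (simp add: y'_def abs_mult mult.commute)
          show "\<bar>Ng (a * x t) (y t) / D (a * x t) (y t) - Ng 0 (y t) / D 0 (y t)\<bar> \<le> (C * E + G * C * E * E) * (a * x t)\<^sup>2"
            by (rule key[OF axr[OF a t] yr[OF t]])
        qed (use \<open>0 < r\<close> in auto)
        also have "\<dots> \<le> (4 * r) * ((C * E + G * C * E * E) * (a\<^sup>2 * B\<^sup>2))"
        proof -
          have "(x t)\<^sup>2 \<le> B\<^sup>2" using B[OF t] B1 by (intro power2_le_iff_abs_le[THEN iffD2]) auto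
          then have "(a * x t)\<^sup>2 \<le> a\<^sup>2 * B\<^sup>2" by (simp add: power_mult_distrib mult_left_mono)
          then show ?thesis using CE \<open>0 < r\<close> by (intro mult_left_mono) auto
        qed
        also have "\<dots> = K * a\<^sup>2" by (simp add: K_def)
        finally show "norm (W t) \<le> K * a\<^sup>2" .
      qed (rule integrable_const_ivl)
      then show ?thesis unfolding eq by simp
    qed
    then show ?thesis by blast
  qed
  then obtain K where K: "\<And>a. a \<in> {0..a0} \<Longrightarrow> \<bar>R a - R 0\<bar> \<le> K * a\<^sup>2" by blast
  \<comment> \<open>If the drift were constant in a, then \<open>a * P a\<close> would equal
    \<open>R 0 - R a\<close>, which is quadratic. Hence \<open>P a\<close> would tend to 0,
    contradicting continuity and \<open>P 0 \<noteq> 0\<close>.\<close>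
  have ex: "\<exists>a\<in>{0..a0}. X a \<noteq> X 0"
  proof (rule ccontr)
    assume "\<not> ?thesis"
    then have eq: "X a = X 0" if "a \<in> {0..a0}" for a using that by blast
    have X0: "X 0 = R 0" using XPR[of 0] a0 by simp
    have "\<bar>P a\<bar> \<le> K * a" if a: "a \<in> {0<..a0}" for a
    proof -
      have "a * P a = - (R a - R 0)" using XPR[of a] eq[of a] X0 a by auto
      then have "a * \<bar>P a\<bar> = \<bar>R a - R 0\<bar>" using a by (metis abs_minus_cancel abs_mult abs_of_pos greaterThanAtMost_iff)
      also have "\<dots> \<le> K * a\<^sup>2" using K a by auto
      finally have "a * \<bar>P a\<bar> \<le> a * (K * a)" by (simp add: power2_eq_square algebra_simps)
      then show ?thesis using a by simp
    qed
    moreover have "(P \<longlongrightarrow> P 0) (at 0 within {0..a0})" using cP a0 by (auto simp: continuous_on_def)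
    moreover have "((\<lambda>a. K * a) \<longlongrightarrow> K * 0) (at 0 within {0..a0})" by (intro tendsto_intros)
    then have "((\<lambda>a. K * a) \<longlongrightarrow> 0) (at 0 within {0..a0})" by simp
    then have "(P \<longlongrightarrow> 0) (at 0 within {0..a0})"
      by (rule Lim_null_comparison[rotated])
        (use calculation(1) in \<open>auto simp: eventually_at_filter intro!: always_eventually\<close>)
    moreover have "at 0 within {0..a0} \<noteq> bot"
      using a0 by (simp add: trivial_limit_within islimpt_Icc)
    ultimately have "P 0 = 0" using tendsto_unique by blast
    then show False using P0 by simp
  qed
  have e: "x 0 = 0" "x 1 = 0" "y 0 = 0" "y 1 = 0"
    using ix' by (simp_all add: x_def y_def)
  show ?thesis
    using dx cx' dy cy' e a0 axr yr cX ex unfolding X_def by blast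
qed

section \<open>Two families of small shape changes\<close>

lemma axis_comp [simp]: "(axis 1 1 :: real^2) $ 1 = 1" "(axis 1 1 :: real^2) $ 2 = 0"
  "(axis 2 1 :: real^2) $ 1 = 0" "(axis 2 1 :: real^2) $ 2 = 1"
  by (simp_all add: axis_def)

lemma sin_half_sq_le: "(sin (x / 2))\<^sup>2 \<le> (x / 2 :: real)\<^sup>2"
  using power_mono[OF abs_sin_x_le_abs_x[of "x / 2"] abs_ge_zero, of 2] by (simp only: power2_abs)

lemma one_minus_cos_le: "1 - cos (x::real) \<le> x\<^sup>2"
proof -
  have "cos x = 1 - 2 * (sin (x / 2))\<^sup>2" using cos_double_sin[of "x / 2"] by simp
  moreover note sin_half_sq_le[of x]
  moreover have "(x / 2)\<^sup>2 = x\<^sup>2 / 4" by (simp add: power_divide)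
  ultimately show ?thesis using zero_le_power2[of x] by linarith
qed

lemma abs_sin_diff_le: "\<bar>sin x - x\<bar> \<le> (x::real)\<^sup>2"
proof -
  have *: "\<bar>sin x - x\<bar> \<le> x\<^sup>2" if "0 \<le> x" for x :: real
  proof (cases "x = 0")
    case False
    then have "0 < x" using that by simp
    then obtain z where z: "0 < z" "z < x" "sin x - sin 0 = (x - 0) * cos z"
      using MVT2[of 0 x sin cos] DERIV_sin by blast
    have "\<bar>sin x - x\<bar> = x * (1 - cos z)"
      using z \<open>0 < x\<close> by (simp add: algebra_simps)
    moreover have "1 - cos z \<le> x"
    proof (cases "x \<le> 1")
      case True
      have "z\<^sup>2 \<le> z * 1" unfolding power2_eq_square using z True by (intro mult_left_mono) auto
      then show ?thesis using one_minus_cos_le[of z] z by simp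
    next
      case False
      obtain w where w: "0 < w" "w < z" "cos z - cos 0 = (z - 0) * - sin w"
        using MVT2[of 0 z cos "\<lambda>x. - sin x"] DERIV_cos z by blast
      have "z * sin w \<le> z * 1" using z by (intro mult_left_mono) auto
      moreover have "cos z - 1 = - (z * sin w)" using w by simp
      ultimately show ?thesis using z by linarith
    qed
    ultimately show ?thesis using \<open>0 < x\<close> by (simp add: power2_eq_square)
  qed simp
  show ?thesis
  proof (cases "0 \<le> x")
    case False
    then show ?thesis using *[of "- x"] by simp
  qed (rule *)
qed

text \<open>The tangent at a small angle is the first axis plus the angle times the normal, up to a
  quadratic error; this is the source of the first-order shape expansion.\<close>

lemma rot_e1_expansion: "norm (rot x (axis 1 1) - axis 1 1 - x *\<^sub>R axis 2 1) \<le> 2 * x\<^sup>2"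
proof -
  have "rot x (axis 1 1) - axis 1 1 - x *\<^sub>R axis 2 1 = (cos x - 1) *\<^sub>R axis 1 1 + (sin x - x) *\<^sub>R axis 2 1"
    by (simp add: vec2_eq_iff rot_comp)
  also have "norm \<dots> \<le> norm ((cos x - 1) *\<^sub>R (axis 1 1 :: real^2)) + norm ((sin x - x) *\<^sub>R (axis 2 1 :: real^2))"
    by (rule norm_triangle_ineq)
  also have "\<dots> \<le> x\<^sup>2 + x\<^sup>2"
    using one_minus_cos_le[of x] abs_sin_diff_le[of x] by (intro add_mono) (auto simp: abs_le_iff)
  finally show ?thesis by simp
qed

lemma rot_e1_diff: "norm (rot x (axis 1 1) - axis 1 1) \<le> \<bar>x\<bar>"
proof -
  have "(norm (rot x (axis 1 1) - axis 1 1))\<^sup>2 = (cos x - 1)\<^sup>2 + (sin x)\<^sup>2"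
    unfolding norm2_sq by (simp add: rot_comp)
  also have "\<dots> = 2 * (1 - cos x)"
    using sin_cos_squared_add[of x] by (simp add: power2_eq_square algebra_simps)
  also have "\<dots> \<le> x\<^sup>2"
  proof -
    have "cos x = 1 - 2 * (sin (x / 2))\<^sup>2" using cos_double_sin[of "x / 2"] by simp
    moreover note sin_half_sq_le[of x]
    ultimately show ?thesis by (simp add: power_divide)
  qed
  also have "\<dots> = \<bar>x\<bar>\<^sup>2" by simp
  finally show ?thesis by (rule power2_le_imp_le) simp
qed

lemma norm_drag_le:
  assumes "0 < Ct" "Ct < Cn" "norm \<tau> = 1"
  shows "norm (drag Ct Cn \<tau> v) \<le> 2 * Cn * norm v"
proof -
  have "\<bar>\<tau> \<bullet> v\<bar> \<le> norm v" using Cauchy_Schwarz_ineq2[of \<tau> v] assms by simp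
  then have "(Cn - Ct) * \<bar>\<tau> \<bullet> v\<bar> \<le> Cn * norm v" using assms by (intro mult_mono) auto
  moreover have "norm (drag Ct Cn \<tau> v) \<le> Cn * norm v + (Cn - Ct) * \<bar>\<tau> \<bullet> v\<bar>"
    unfolding drag_def using assms norm_triangle_ineq4[of "Cn *\<^sub>R v" "((Cn - Ct) * (\<tau> \<bullet> v)) *\<^sub>R \<tau>"]
    by (simp add: abs_mult)
  ultimately show ?thesis by linarith
qed

lemma drag_inner_self:
  "drag Ct Cn \<tau> v \<bullet> v = Cn * (norm v)\<^sup>2 - (Cn - Ct) * (\<tau> \<bullet> v)\<^sup>2"
  unfolding drag_def power2_norm_eq_inner inner_diff_left
  by (simp add: power2_eq_square inner_commute)

lemma integral_diff_bound:
  fixes p q :: "real \<Rightarrow> real"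
  assumes "continuous_on {0..L} p" "continuous_on {0..L} q" "0 \<le> L"
    and "\<And>s. s \<in> {0..L} \<Longrightarrow> \<bar>p s - q s\<bar> \<le> B"
  shows "\<bar>integral {0..L} p - integral {0..L} q\<bar> \<le> B * L"
proof -
  have "integral {0..L} p - integral {0..L} q = integral {0..L} (\<lambda>s. p s - q s)"
    using assms by (intro integral_diff[symmetric] integrable_continuous_real)
  moreover have "norm (integral {0..L} (\<lambda>s. p s - q s)) \<le> B * (L - 0)"
    using assms by (intro integral_bound continuous_intros) auto
  ultimately show ?thesis by simp
qed

text \<open>The shapes have the tangent angle \<open>\<alpha> f + \<beta> g\<close>, where \<open>f\<close>, the derivative of \<open>F\<close>, lives on the middle half of the
  interval and \<open>g\<close> on the two outer quarters, both of parity \<open>\<epsilon>\<close>. At \<open>\<alpha> = 0\<close>,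
  bending with \<open>f\<close> exerts a force or torque that does not depend on \<open>\<beta>\<close>, whereas \<open>g\<close> changes the resistance.\<close>

locale gait =
  fixes L \<rho> Ct Cn \<epsilon> :: real and F f f' g g' :: "real \<Rightarrow> real"
  assumes L0: "0 < L" and \<rho>0: "0 < \<rho>" and C0: "0 < Ct" "Ct < Cn" and eps: "\<epsilon> = 1 \<or> \<epsilon> = - 1"
    and dF: "\<And>s. (F has_real_derivative f s) (at s)"
    and df: "\<And>s. (f has_real_derivative f' s) (at s)"
    and dg: "\<And>s. (g has_real_derivative g' s) (at s)"
    and cf': "continuous_on UNIV f'" and cg': "continuous_on UNIV g'"
    and f_sym: "\<And>s. f (L - s) = \<epsilon> * f s" and g_sym: "\<And>s. g (L - s) = \<epsilon> * g s"
    and inner: "\<And>s. \<bar>s - L / 2\<bar> \<le> L / 4 \<Longrightarrow> g s = 0"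
    and outer: "\<And>s. \<bar>s - L / 2\<bar> \<ge> L / 4 \<Longrightarrow> f s = 0 \<and> F s = 0"
    and F_mid: "F (L / 2) = 0"
    and g_mono: "\<And>s. s \<in> {L / 2..L} \<Longrightarrow> 0 \<le> g s \<and> g s \<le> g L" and g_end: "0 < g L"
    and F_pos: "\<And>s. \<epsilon> = 1 \<Longrightarrow> 0 \<le> F s * (s - L / 2)" "\<And>s. \<epsilon> = - 1 \<Longrightarrow> 0 \<le> F s"
    and F_nz: "F (5 * L / 8) \<noteq> 0"
begin

definition tang :: "real \<times> real \<Rightarrow> real \<Rightarrow> real^2" where
  "tang p s = rot (fst p * f s + snd p * g s) (axis 1 1)"

definition shape :: "real \<times> real \<Rightarrow> real \<Rightarrow> real^2" where
  "shape p = mid L (tang p)"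

text \<open>\<open>velf\<close> and \<open>velg\<close> are the partial derivatives of
  \<open>shape\<close> in the first and the second amplitude.\<close>

definition velf :: "real \<times> real \<Rightarrow> real \<Rightarrow> real^2" where
  "velf p = mid L (\<lambda>r. f r *\<^sub>R (J *v tang p r))"

definition velg :: "real \<times> real \<Rightarrow> real \<Rightarrow> real^2" where
  "velg p = mid L (\<lambda>r. g r *\<^sub>R (J *v tang p r))"

lemma cF: "continuous_on S F"
  by (rule DERIV_continuous_on[OF has_field_derivative_at_within[OF dF]])

lemma cf: "continuous_on S f"
  by (rule DERIV_continuous_on[OF has_field_derivative_at_within[OF df]])

lemma cg: "continuous_on S g"
  by (rule DERIV_continuous_on[OF has_field_derivative_at_within[OF dg]])

lemma L_nonneg: "0 \<le> L" using L0 by simp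

lemma norm_tang [simp]: "norm (tang p s) = 1"
  by (simp add: tang_def)

lemma continuous_on_fst_comp:
  "continuous_on A h \<Longrightarrow> continuous_on (A \<times> B) (\<lambda>p. h (fst p))"
  by (rule continuous_on_compose2[of A h]) (auto intro: continuous_on_fst)

lemma continuous_tang2: "continuous_on ({0..L} \<times> UNIV) (\<lambda>q. tang (snd q) (fst q))"
  unfolding tang_def
  by (intro continuous_on_rot continuous_on_add continuous_on_mult continuous_on_fst_comp[OF cf] continuous_on_fst_comp[OF cg]
      continuous_on_fst continuous_on_snd continuous_on_id continuous_on_const)

lemma continuous_shape2: "continuous_on ({0..L} \<times> UNIV) (\<lambda>q. shape (snd q) (fst q))"
  unfolding shape_def by (rule continuous_on_mid[OF continuous_tang2 L_nonneg])

lemma continuous_velf2: "continuous_on ({0..L} \<times> UNIV) (\<lambda>q. velf (snd q) (fst q))"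
  unfolding velf_def
  by (rule continuous_on_mid[where H = "\<lambda>r p. f r *\<^sub>R (J *v tang p r)", OF _ L_nonneg])
    (intro continuous_on_scaleR continuous_on_J continuous_on_fst_comp[OF cf] continuous_tang2)

lemma continuous_velg2: "continuous_on ({0..L} \<times> UNIV) (\<lambda>q. velg (snd q) (fst q))"
  unfolding velg_def
  by (rule continuous_on_mid[where H = "\<lambda>r p. g r *\<^sub>R (J *v tang p r)", OF _ L_nonneg])
    (intro continuous_on_scaleR continuous_on_J continuous_on_fst_comp[OF cg] continuous_tang2)

lemma continuous_tang: "continuous_on {0..L} (tang p)"
  using continuous_on_slice[of "{0..L}" UNIV "\<lambda>s p. tang p s" p] continuous_tang2 by simp

lemma continuous_shape: "continuous_on {0..L} (shape p)"
  using continuous_on_slice[of "{0..L}" UNIV "\<lambda>s p. shape p s" p] continuous_shape2 by simp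

lemma continuous_velf: "continuous_on {0..L} (velf p)"
  using continuous_on_slice[of "{0..L}" UNIV "\<lambda>s p. velf p s" p] continuous_velf2 by simp

lemma continuous_velg: "continuous_on {0..L} (velg p)"
  using continuous_on_slice[of "{0..L}" UNIV "\<lambda>s p. velg p s" p] continuous_velg2 by simp

lemma inner_iff: "\<bar>s - L / 2\<bar> \<le> L / 4 \<longleftrightarrow> s \<in> {L / 4..3 * L / 4}"
  unfolding abs_le_iff atLeastAtMost_iff by arith

lemma tang_inner: "\<bar>s - L / 2\<bar> \<le> L / 4 \<Longrightarrow> tang (\<alpha>, \<beta>) s = rot (\<alpha> * f s) (axis 1 1)"
  by (simp add: tang_def inner)

lemma tang_outer: "\<bar>s - L / 2\<bar> \<ge> L / 4 \<Longrightarrow> tang (\<alpha>, \<beta>) s = tang (0, \<beta>) s"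
  by (simp add: tang_def outer)

lemma tang_base: "\<bar>s - L / 2\<bar> \<le> L / 4 \<Longrightarrow> tang (0, \<beta>) s = axis 1 1"
  by (simp add: tang_inner)

lemma inner_or_outer: "\<bar>s - L / 2\<bar> \<le> L / 4 \<or> \<bar>s - L / 2\<bar> \<ge> L / 4"
  by linarith

text \<open>With \<open>\<alpha> = 0\<close> only the outer quarters bend, and the anchoring at the
  midpoint keeps the middle half on the first axis whatever \<open>\<beta>\<close> is.\<close>

lemma shape_base:
  assumes "\<bar>s - L / 2\<bar> \<le> L / 4"
  shows "shape (0, \<beta>) s = (s - L / 2) *\<^sub>R axis 1 1"
  unfolding shape_def
proof (rule mid_eqI[OF continuous_tang, of "L / 4" "3 * L / 4"])
  fix x assume x: "x \<in> {L / 4..3 * L / 4}"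
  have "((\<lambda>s. (s - L / 2) *\<^sub>R axis 1 1) has_vector_derivative axis 1 1) (at x within {L / 4..3 * L / 4})"
    by (auto intro!: derivative_eq_intros)
  then show "((\<lambda>s. (s - L / 2) *\<^sub>R axis 1 1) has_vector_derivative tang (0, \<beta>) x) (at x within {L / 4..3 * L / 4})"
  proof -
    have "\<bar>x - L / 2\<bar> \<le> L / 4" using x by (simp only: inner_iff)
    then show ?thesis using \<open>(_ has_vector_derivative axis 1 1) _\<close> by (simp add: tang_base)
  qed
qed (use assms[unfolded inner_iff] L0 in auto)

lemma shape_straight:
  assumes "s \<in> {0..L}"
  shows "shape (0, 0) s = segment L s"
  unfolding shape_def segment_def
proof (rule mid_eqI[OF continuous_tang, of 0 L])
  fix x
  have "((\<lambda>s. (s - L / 2) *\<^sub>R axis 1 1) has_vector_derivative axis 1 1) (at x within {0..L})"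
    by (auto intro!: derivative_eq_intros)
  then show "((\<lambda>s. (s - L / 2) *\<^sub>R axis 1 1) has_vector_derivative tang (0, 0) x) (at x within {0..L})"
    by (simp add: tang_def)
qed (use assms L0 in auto)

lemma mid_F:
  assumes "s \<in> {0..L}"
  shows "mid L (\<lambda>r. (c * f r) *\<^sub>R v) s = (c * F s) *\<^sub>R (v::real^2)"
proof (rule mid_eqI[of L _ 0 L])
  show "continuous_on {0..L} (\<lambda>r. (c * f r) *\<^sub>R v)" by (intro continuous_intros cf)
  fix x
  have "((\<lambda>s. c * F s) has_real_derivative c * f x) (at x within {0..L})"
    by (rule DERIV_cmult[OF has_field_derivative_at_within[OF dF]])
  then show "((\<lambda>s. (c * F s) *\<^sub>R v) has_vector_derivative (c * f x) *\<^sub>R v) (at x within {0..L})"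
    using has_vector_derivative_scaleR[of "\<lambda>s. c * F s" "c * f x" x "{0..L}" "\<lambda>_. v" 0] by simp
qed (use assms L0 F_mid in auto)

text \<open>Where f is nonzero the tangent is the first axis for every \<open>\<beta>\<close>, so
  the mode f displaces points along the normal by the primitive \<open>F\<close>. Since
  \<open>F\<close> vanishes on the outer quarters, these are not moved at all, and the velocity does
  not depend on \<open>\<beta>\<close>.\<close>

lemma velf_base:
  assumes "s \<in> {0..L}"
  shows "velf (0, \<beta>) s = F s *\<^sub>R axis 2 1"
proof -
  have eq: "f r *\<^sub>R (J *v tang (0, \<beta>) r) = (1 * f r) *\<^sub>R axis 2 1" for r
    using inner_or_outer[of r] tang_base[of r \<beta>] outer[of r] by (auto simp: vec2_eq_iff)
  show ?thesis unfolding velf_def eq using mid_F[OF assms, of 1 "axis 2 1"] by simp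
qed

text \<open>The first amplitude changes the tangent only where g vanishes.\<close>

lemma velg_indep: "velg (\<alpha>, \<beta>) = velg (0, \<beta>)"
proof -
  have eq: "g r *\<^sub>R (J *v tang (\<alpha>, \<beta>) r) = g r *\<^sub>R (J *v tang (0, \<beta>) r)" for r
    using inner_or_outer[of r] tang_outer[of r \<alpha> \<beta>] inner[of r] by auto
  show ?thesis unfolding velg_def eq ..
qed

lemma velg_inner:
  assumes "\<bar>s - L / 2\<bar> \<le> L / 4"
  shows "velg p s = 0"
  unfolding velg_def
proof (rule mid_eqI[of L _ "L / 4" "3 * L / 4"])
  show "continuous_on {0..L} (\<lambda>r. g r *\<^sub>R (J *v tang p r))" by (intro continuous_intros cg continuous_tang)
  fix x assume "x \<in> {L / 4..3 * L / 4}"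
  then have "g x = 0" by (intro inner) (simp only: inner_iff)
  then show "((\<lambda>s. 0) has_vector_derivative g x *\<^sub>R (J *v tang p x)) (at x within {L / 4..3 * L / 4})" by simp
qed (use assms[unfolded inner_iff] L0 in auto)

lemma norm_shape_le: "s \<in> {0..L} \<Longrightarrow> norm (shape p s) \<le> \<bar>s - L / 2\<bar>"
  unfolding shape_def using mid_norm_le[OF continuous_tang _ L_nonneg, of s p 1] by simp

lemma norm_shape_le': "s \<in> {0..L} \<Longrightarrow> norm (shape p s) \<le> L"
  using norm_shape_le[of s p] by (auto simp: abs_le_iff)

lemma shape_derivative: "s \<in> {0..L} \<Longrightarrow> (shape p has_vector_derivative tang p s) (at s within {0..L})"
  unfolding shape_def by (rule mid_has_vector_derivative[OF continuous_tang])

text \<open>The last bound on the curvature is the one that thickness requires, half of it being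
  granted to each mode. The bound \<open>r * g L \<le> 1\<close> keeps the angle at the end of the
  curve in a range where the sine is positive.\<close>

lemma small_box:
  obtains r where "0 < r" "r * g L \<le> 1" "r \<le> 1"
    "\<And>\<alpha> \<beta> s. \<alpha> \<in> {-r..r} \<Longrightarrow> \<beta> \<in> {0..r} \<Longrightarrow> s \<in> {0..L} \<Longrightarrow>
      \<bar>\<alpha> * f' s + \<beta> * g' s\<bar> \<le> min (1 / (2 * L)) (1 / (4 * \<rho>))"
proof -
  have "\<exists>K. \<forall>s\<in>{0..L}. \<bar>f' s\<bar> \<le> K" "\<exists>K. \<forall>s\<in>{0..L}. \<bar>g' s\<bar> \<le> K"
    using compact_imp_bounded[OF compact_continuous_image[OF continuous_on_subset[OF cf'] compact_Icc, of 0 L]]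
      compact_imp_bounded[OF compact_continuous_image[OF continuous_on_subset[OF cg'] compact_Icc, of 0 L]]
    by (auto simp: bounded_iff)
  then obtain K1 K2 where K1: "\<And>s. s \<in> {0..L} \<Longrightarrow> \<bar>f' s\<bar> \<le> K1" and K2: "\<And>s. s \<in> {0..L} \<Longrightarrow> \<bar>g' s\<bar> \<le> K2"
    by blast
  define K where "K = max 1 (max K1 K2)"
  define \<kappa> where "\<kappa> = min (1 / (2 * L)) (1 / (4 * \<rho>))"
  have \<kappa>: "0 < \<kappa>" using L0 \<rho>0 by (simp add: \<kappa>_def)
  have K: "1 \<le> K" by (simp add: K_def)
  define r where "r = Min {1, 1 / g L, \<kappa> / (2 * K)}"
  have r: "0 < r" "r \<le> 1" "r \<le> 1 / g L" "r \<le> \<kappa> / (2 * K)"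
    unfolding r_def using g_end \<kappa> K by (auto simp: )
  show ?thesis
  proof (rule that[OF r(1) _ r(2)])
    show "r * g L \<le> 1" using r g_end by (simp add: field_simps)
    fix \<alpha> \<beta> s assume h: "\<alpha> \<in> {-r..r}" "\<beta> \<in> {0..r}" "s \<in> {0..L}"
    have "\<bar>\<alpha> * f' s\<bar> \<le> r * K" unfolding abs_mult
      using h K1[OF h(3)] r by (intro mult_mono) (auto simp: K_def)
    moreover have "\<bar>\<beta> * g' s\<bar> \<le> r * K" unfolding abs_mult
      using h K2[OF h(3)] r by (intro mult_mono) (auto simp: K_def)
    moreover have "r * K \<le> \<kappa> / 2" using r(4) K by (simp add: field_simps)
    ultimately show "\<bar>\<alpha> * f' s + \<beta> * g' s\<bar> \<le> min (1 / (2 * L)) (1 / (4 * \<rho>))"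
      unfolding \<kappa>_def[symmetric] by linarith
  qed
qed

lemma gait_shape_path:
  assumes r: "\<And>\<alpha> \<beta> s. \<alpha> \<in> {-r..r} \<Longrightarrow> \<beta> \<in> {0..r} \<Longrightarrow> s \<in> {0..L} \<Longrightarrow>
      \<bar>\<alpha> * f' s + \<beta> * g' s\<bar> \<le> min (1 / (2 * L)) (1 / (4 * \<rho>))"
    and xr: "\<And>t. t \<in> {0..1} \<Longrightarrow> x t \<in> {-r..r} \<and> y t \<in> {0..r}"
    and dx: "\<And>t. t \<in> {0..1} \<Longrightarrow> (x has_real_derivative x' t) (at t within {0..1})"
    and dy: "\<And>t. t \<in> {0..1} \<Longrightarrow> (y has_real_derivative y' t) (at t within {0..1})"
    and cx': "continuous_on {0..1} x'" and cy': "continuous_on {0..1} y'"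
  shows "shape_path L 1 \<rho> (\<lambda>s t. shape (x t, y t) s)
    (\<lambda>s t. mid L (\<lambda>r. (x' t * f r + y' t * g r) *\<^sub>R (J *v tang (x t, y t) r)) s)
    (\<lambda>s t. tang (x t, y t) s) (\<lambda>s t. (x t * f' s + y t * g' s) *\<^sub>R (J *v tang (x t, y t) s))"
proof -
  have cx: "continuous_on {0..1} x" and cy: "continuous_on {0..1} y"
    using dx dy by (meson continuous_on_eq_continuous_within DERIV_continuous)+
  note ci = continuous_on_snd_comp[OF cx] continuous_on_snd_comp[OF cy] continuous_on_snd_comp[OF cx']
    continuous_on_snd_comp[OF cy'] continuous_on_fst_comp[OF cf] continuous_on_fst_comp[OF cg]
    continuous_on_fst_comp[OF continuous_on_subset[OF cf' subset_UNIV]]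
    continuous_on_fst_comp[OF continuous_on_subset[OF cg' subset_UNIV]]
  have ct: "continuous_on ({0..L} \<times> {0..1}) (\<lambda>q. tang (x (snd q), y (snd q)) (fst q))"
    unfolding tang_def fst_conv snd_conv by (intro continuous_on_rot continuous_on_add continuous_on_mult continuous_on_const ci)
  have tang_deriv: "((\<lambda>u. rot (k u) (axis 1 1)) has_vector_derivative k' *\<^sub>R (J *v rot (k u0) (axis 1 1))) (at u0 within S)"
    if "(k has_real_derivative k') (at u0 within S)" for k k' u0 S
    using rot_has_vector_derivative[OF that has_vector_derivative_const[of "axis 1 1"]]
    by (simp add: rot_linear_simps J_rot)
  show ?thesis
    unfolding shape_def
  proof (rule shape_path_of_tangent[where \<kappa> = "min (1 / (2 * L)) (1 / (4 * \<rho>))", OF L0 \<rho>0 ct])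
    show "continuous_on ({0..L} \<times> {0..1}) (\<lambda>q. (x (snd q) * f' (fst q) + y (snd q) * g' (fst q)) *\<^sub>R (J *v tang (x (snd q), y (snd q)) (fst q)))"
      "continuous_on ({0..L} \<times> {0..1}) (\<lambda>q. (x' (snd q) * f (fst q) + y' (snd q) * g (fst q)) *\<^sub>R (J *v tang (x (snd q), y (snd q)) (fst q)))"
      by (intro continuous_on_scaleR continuous_on_add continuous_on_mult ci continuous_on_J ct)+
    fix s t :: real assume s: "s \<in> {0..L}" and t: "t \<in> {0..1}"
    show "norm (tang (x t, y t) s) = 1" by simp
    have "((\<lambda>\<sigma>. x t * f \<sigma> + y t * g \<sigma>) has_real_derivative x t * f' s + y t * g' s) (at s within {0..L})"
      by (intro DERIV_add DERIV_cmult has_field_derivative_at_within[OF df] has_field_derivative_at_within[OF dg])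
    from tang_deriv[OF this]
    show "((\<lambda>\<sigma>. tang (x t, y t) \<sigma>) has_vector_derivative (x t * f' s + y t * g' s) *\<^sub>R (J *v tang (x t, y t) s)) (at s within {0..L})"
      by (simp add: tang_def)
    have "((\<lambda>u. x u * f s + y u * g s) has_real_derivative x' t * f s + y' t * g s) (at t within {0..1})"
      by (intro DERIV_add DERIV_cmult_right dx dy t)
    from tang_deriv[OF this]
    show "((\<lambda>u. tang (x u, y u) s) has_vector_derivative (x' t * f s + y' t * g s) *\<^sub>R (J *v tang (x t, y t) s)) (at t within {0..1})"
      by (simp add: tang_def)
    show "norm ((x t * f' s + y t * g' s) *\<^sub>R (J *v tang (x t, y t) s)) \<le> min (1 / (2 * L)) (1 / (4 * \<rho>))"
      using r[of "x t" "y t" s] xr[OF t] s by simp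
  next
    have "min (1 / (2 * L)) (1 / (4 * \<rho>)) * L \<le> 1 / (2 * L) * L" using L0 by (intro mult_right_mono) auto
    then show "min (1 / (2 * L)) (1 / (4 * \<rho>)) * L \<le> 1 / 2" using L0 by simp
    have "4 * \<rho> * min (1 / (2 * L)) (1 / (4 * \<rho>)) \<le> 4 * \<rho> * (1 / (4 * \<rho>))" using \<rho>0 by (intro mult_left_mono) auto
    then show "4 * \<rho> * min (1 / (2 * L)) (1 / (4 * \<rho>)) \<le> 1" using \<rho>0 by simp
  qed
qed

lemma mid_velocity:
  assumes "s \<in> {0..L}"
  shows "mid L (\<lambda>r. (a * f r + b * g r) *\<^sub>R (J *v tang p r)) s = a *\<^sub>R velf p s + b *\<^sub>R velg p s"
proof -
  have c: "continuous_on {0..L} (\<lambda>r. f r *\<^sub>R (J *v tang p r))" "continuous_on {0..L} (\<lambda>r. g r *\<^sub>R (J *v tang p r))"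
    by (intro continuous_intros cf cg continuous_tang)+
  have "mid L (\<lambda>r. (a * f r + b * g r) *\<^sub>R (J *v tang p r)) s =
      mid L (\<lambda>r. a *\<^sub>R (f r *\<^sub>R (J *v tang p r)) + b *\<^sub>R (g r *\<^sub>R (J *v tang p r))) s"
    by (simp add: scaleR_add_left)
  also have "\<dots> = mid L (\<lambda>r. a *\<^sub>R (f r *\<^sub>R (J *v tang p r))) s + mid L (\<lambda>r. b *\<^sub>R (g r *\<^sub>R (J *v tang p r))) s"
    by (intro mid_add continuous_intros c assms)
  also have "\<dots> = a *\<^sub>R velf p s + b *\<^sub>R velg p s"
    unfolding velf_def velg_def
    using mid_linear[OF bounded_linear_scaleR_right c(1) assms, of a] mid_linear[OF bounded_linear_scaleR_right c(2) assms, of b]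
    by simp
  finally show ?thesis .
qed

lemma continuous_form:
  assumes "continuous_on ({0..L} \<times> UNIV) (\<lambda>q. h (snd q) (fst q))" "continuous_on ({0..L} \<times> UNIV) (\<lambda>q. k (snd q) (fst q))"
  shows "continuous_on S (\<lambda>p. integral {0..L} (\<lambda>s. drag Ct Cn (tang p s) (h p s) \<bullet> k p s))"
proof -
  have "continuous_on UNIV (\<lambda>p. integral {0..L} (\<lambda>s. drag Ct Cn (tang p s) (h p s) \<bullet> k p s))"
    by (rule continuous_on_integral_slice[where f = "\<lambda>s p. drag Ct Cn (tang p s) (h p s) \<bullet> k p s"])
      (intro continuous_intros continuous_tang2 assms)
  then show ?thesis by (rule continuous_on_subset) simp
qed

lemma bounds:
  obtains K where "1 \<le> K" "\<And>s. s \<in> {0..L} \<Longrightarrow> \<bar>f s\<bar> \<le> K" "\<And>s. s \<in> {0..L} \<Longrightarrow> \<bar>F s\<bar> \<le> K" "\<And>s. s \<in> {0..L} \<Longrightarrow> \<bar>g s\<bar> \<le> K"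
proof -
  have "\<exists>K. \<forall>s\<in>{0..L}. \<bar>h s\<bar> \<le> K" if "continuous_on {0..L} h" for h :: "real \<Rightarrow> real"
    using compact_imp_bounded[OF compact_continuous_image[OF that compact_Icc]] by (auto simp: bounded_iff)
  from this[OF cf] this[OF cF] this[OF cg]
  obtain K1 K2 K3 where "\<And>s. s \<in> {0..L} \<Longrightarrow> \<bar>f s\<bar> \<le> K1" "\<And>s. s \<in> {0..L} \<Longrightarrow> \<bar>F s\<bar> \<le> K2" "\<And>s. s \<in> {0..L} \<Longrightarrow> \<bar>g s\<bar> \<le> K3"
    by blast
  then show ?thesis using that[of "max 1 (max K1 (max K2 K3))"] by (force simp: le_max_iff_disj)
qed

lemma tang_end: "tang (0, r) L \<bullet> (J *v tang (0, r) s) = sin (r * g L - r * g s)"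
  by (simp add: tang_def inner_2 rot_comp sin_diff algebra_simps)

end

section \<open>Symmetric shapes: reduction of the balance to one scalar equation\<close>

definition flip :: "real^2 \<Rightarrow> real^2" where
  "flip v = (\<chi> i. if i = 2 then - v $ i else v $ i)"

lemma flip_comp [simp]: "flip v $ 1 = v $ 1" "flip v $ 2 = - v $ 2"
  by (simp_all add: flip_def)

lemma bounded_linear_flip: "bounded_linear flip"
  by (rule linear_conv_bounded_linear[THEN iffD1]) (auto intro!: linearI simp: vec2_eq_iff)

text \<open>The map \<open>- flip\<close> is the mirror image in the second axis. Drag does not
  change when the tangent is replaced by its negative, so \<open>flip\<close> of the tangent serves
  as well as its mirror image.\<close>

lemma drag_flip: "drag Ct Cn (flip \<tau>) (- flip v) = - flip (drag Ct Cn \<tau> v)"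
  by (simp add: vec2_eq_iff drag_def inner_2 algebra_simps)

lemma drag_minus: "drag Ct Cn \<tau> (- v) = - drag Ct Cn \<tau> v"
  by (simp add: drag_def)

lemma drag_0 [simp]: "drag Ct Cn \<tau> 0 = 0"
  by (simp add: drag_def)

context gait
begin

definition spin :: "real \<times> real \<Rightarrow> real \<Rightarrow> real^2" where
  "spin p s = J *v shape p s"

definition lift :: "real \<times> real \<Rightarrow> real \<Rightarrow> real^2" where
  "lift p s = axis 2 1"

text \<open>This is the generalised force along the field k that is exerted by the velocity h; for
  rigid fields it is an entry of the resistance matrix.\<close>

definition form :: "(real \<times> real \<Rightarrow> real \<Rightarrow> real^2) \<Rightarrow> (real \<times> real \<Rightarrow> real \<Rightarrow> real^2) \<Rightarrow> real \<times> real \<Rightarrow> real" where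
  "form k h p = integral {0..L} (\<lambda>s. drag Ct Cn (tang p s) (h p s) \<bullet> k p s)"

lemma continuous_spin2: "continuous_on ({0..L} \<times> UNIV) (\<lambda>q. spin (snd q) (fst q))"
  unfolding spin_def by (intro continuous_on_J continuous_shape2)

lemma continuous_spin: "continuous_on {0..L} (spin p)"
  unfolding spin_def by (intro continuous_on_J continuous_shape)

lemma continuous_on_form:
  assumes "continuous_on ({0..L} \<times> UNIV) (\<lambda>q. h (snd q) (fst q))" "continuous_on ({0..L} \<times> UNIV) (\<lambda>q. k (snd q) (fst q))"
  shows "continuous_on S (form k h)"
  unfolding form_def by (rule continuous_form[OF assms])

text \<open>A closed loop of amplitudes begins and ends with the straight segment, so its only
  effect is the displacement of the frame.\<close>

lemma loop_reach:
  assumes r: "\<And>\<alpha> \<beta> s. \<alpha> \<in> {-r..r} \<Longrightarrow> \<beta> \<in> {0..r} \<Longrightarrow> s \<in> {0..L} \<Longrightarrow>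
      \<bar>\<alpha> * f' s + \<beta> * g' s\<bar> \<le> min (1 / (2 * L)) (1 / (4 * \<rho>))"
    and xr: "\<And>t. t \<in> {0..1} \<Longrightarrow> x t \<in> {-r..r} \<and> y t \<in> {0..r}"
    and dx: "\<And>t. t \<in> {0..1} \<Longrightarrow> (x has_real_derivative x' t) (at t within {0..1})"
    and dy: "\<And>t. t \<in> {0..1} \<Longrightarrow> (y has_real_derivative y' t) (at t within {0..1})"
    and cx': "continuous_on {0..1} x'" and cy': "continuous_on {0..1} y'"
    and ends: "x 0 = 0" "x 1 = 0" "y 0 = 0" "y 1 = 0"
    and cv: "continuous_on {0..1} v" and cw: "continuous_on {0..1} w"
    and bal: "\<And>t. t \<in> {0..1} \<Longrightarrow> balanced L Ct Cn (shape (x t, y t)) (tang (x t, y t))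
      (\<lambda>s. v t + (x' t *\<^sub>R velf (x t, y t) s + y' t *\<^sub>R velg (x t, y t) s) + w t *\<^sub>R spin (x t, y t) s)"
  shows "reach L \<rho> Ct Cn (segment L)
    (\<lambda>s. integral {0..1} (\<lambda>u. rot (integral {0..u} w) (v u)) + rot (integral {0..1} w) (segment L s))"
proof -
  note sp = gait_shape_path[OF r xr dx dy cx' cy']
  have "balanced L Ct Cn (\<lambda>s. shape (x t, y t) s) (\<lambda>s. tang (x t, y t) s)
      (\<lambda>s. v t + mid L (\<lambda>r. (x' t * f r + y' t * g r) *\<^sub>R (J *v tang (x t, y t) r)) s + w t *\<^sub>R (J *v shape (x t, y t) s))"
    if t: "t \<in> {0..1}" for t
    by (rule iffD1[OF balanced_cong bal[OF t]]) (simp_all add: mid_velocity spin_def)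
  from motion_of_body_velocity[OF sp _ cv cw this]
  have "\<exists>\<omega> \<tau>' h'. motion L 1 \<rho> Ct Cn (\<lambda>s t. integral {0..t} (\<lambda>u. rot (integral {0..u} w) (v u)) +
      rot (integral {0..t} w) (shape (x t, y t) s)) \<omega> \<tau>' h'" by simp
  then have r0: "reach L \<rho> Ct Cn
      (\<lambda>s. integral {0..0} (\<lambda>u. rot (integral {0..u} w) (v u)) + rot (integral {0..0} w) (shape (x 0, y 0) s))
      (\<lambda>s. integral {0..1} (\<lambda>u. rot (integral {0..u} w) (v u)) + rot (integral {0..1} w) (shape (x 1, y 1) s))"
    unfolding reach_def by blast
  show ?thesis
    by (rule reach_cong[OF r0]) (simp_all add: ends shape_straight)
qed

lemma tang_reflect: "tang p (L - s) = (if \<epsilon> = 1 then tang p s else flip (tang p s))"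
proof -
  have "fst p * f (L - s) + snd p * g (L - s) = \<epsilon> * (fst p * f s + snd p * g s)"
    by (simp add: f_sym g_sym algebra_simps)
  then show ?thesis
    using eps unfolding tang_def by (auto simp: vec2_eq_iff rot_comp simp del: minus_add_distrib)
qed

text \<open>Angles of even parity give centrally symmetric shapes, which can only rotate.\<close>

lemma balanced_spin:
  assumes e: "\<epsilon> = 1" and eq: "a * form spin velf p + b * form spin velg p + w * form spin spin p = 0"
  shows "balanced L Ct Cn (shape p) (tang p) (\<lambda>s. 0 + (a *\<^sub>R velf p s + b *\<^sub>R velg p s) + w *\<^sub>R spin p s)"
proof -
  define U where "U s = a *\<^sub>R velf p s + b *\<^sub>R velg p s + w *\<^sub>R spin p s" for s
  have cU: "continuous_on {0..L} U"
    unfolding U_def by (intro continuous_intros continuous_velf continuous_velg continuous_spin)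
  have tr: "tang p (L - s) = tang p s" for s using tang_reflect[of p s] e by simp
  have odd: "shape p (L - s) = - shape p s" "velf p (L - s) = - velf p s" "velg p (L - s) = - velg p s"
    if "s \<in> {0..L}" for s
    unfolding shape_def velf_def velg_def
    by (rule mid_reflect[OF bounded_linear_ident _ that L_nonneg];
        (intro continuous_intros continuous_tang cf cg)?; simp add: tr f_sym g_sym e)+
  have Uodd: "U (L - s) = - U s" if "s \<in> {0..L}" for s
    using odd[OF that] by (simp add: U_def spin_def J_linear_simps)
  \<comment> \<open>The tangent is even and the velocity odd about the midpoint, so the total force
    cancels and only the torque equation is left, which is the assumed scalar equation.\<close>
  have "integral {0..L} (\<lambda>s. drag Ct Cn (tang p s) (U s)) = 0"
    by (rule integral_odd[OF _ _ L_nonneg]) (auto intro!: continuous_intros continuous_tang cU simp: tr Uodd drag_minus)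
  moreover have "integral {0..L} (\<lambda>s. drag Ct Cn (tang p s) (U s) \<bullet> (J *v shape p s)) = 0"
  proof -
    have "integral {0..L} (\<lambda>s. drag Ct Cn (tang p s) (U s) \<bullet> (J *v shape p s)) =
        integral {0..L} (\<lambda>s. a * (drag Ct Cn (tang p s) (velf p s) \<bullet> spin p s) +
          b * (drag Ct Cn (tang p s) (velg p s) \<bullet> spin p s) + w * (drag Ct Cn (tang p s) (spin p s) \<bullet> spin p s))"
      by (simp add: U_def drag_add drag_scaleR inner_add_left spin_def)
    also have "\<dots> = a * form spin velf p + b * form spin velg p + w * form spin spin p"
      unfolding form_def
      by (rule integral_linear_combination)
        (intro integrable_continuous_real continuous_intros continuous_tang continuous_velf continuous_velg continuous_spin)+
    finally show ?thesis using eq by simp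
  qed
  ultimately show ?thesis unfolding balanced_def U_def by simp
qed

text \<open>Angles of odd parity give shapes that are symmetric with respect to the normal of the straight
  segment, and these can only move along that normal.\<close>

lemma balanced_lift:
  assumes e: "\<epsilon> = - 1" and eq: "a * form lift velf p + b * form lift velg p + u * form lift lift p = 0"
  shows "balanced L Ct Cn (shape p) (tang p)
    (\<lambda>s. u *\<^sub>R axis 2 1 + (a *\<^sub>R velf p s + b *\<^sub>R velg p s) + 0 *\<^sub>R spin p s)"
proof -
  define U where "U s = a *\<^sub>R velf p s + b *\<^sub>R velg p s + u *\<^sub>R lift p s" for s
  have cU: "continuous_on {0..L} U"
    unfolding U_def lift_def by (intro continuous_intros continuous_velf continuous_velg)
  have tr: "tang p (L - s) = flip (tang p s)" for s using tang_reflect[of p s] e by simp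
  have refl: "shape p (L - s) = - flip (shape p s)" "velf p (L - s) = - flip (velf p s)" "velg p (L - s) = - flip (velg p s)"
    if "s \<in> {0..L}" for s
    unfolding shape_def velf_def velg_def
    by (rule mid_reflect[OF bounded_linear_flip _ that L_nonneg];
        (intro continuous_intros continuous_tang cf cg)?; simp add: tr f_sym g_sym e vec2_eq_iff)+
  have Ur: "U (L - s) = - flip (U s)" if "s \<in> {0..L}" for s
    using refl[OF that] by (simp add: U_def lift_def vec2_eq_iff)
  define d where "d s = drag Ct Cn (tang p s) (U s)" for s
  have cd: "continuous_on {0..L} d" unfolding d_def by (intro continuous_intros continuous_tang cU)
  have dr: "d (L - s) = - flip (d s)" if "s \<in> {0..L}" for s
    unfolding d_def tr Ur[OF that] by (rule drag_flip)
  \<comment> \<open>Mirror symmetry cancels the force along the first axis, and likewise the torque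
    below. The force along the second axis is the assumed scalar equation.\<close>
  have "integral {0..L} (\<lambda>s. d s $ 1) = 0"
    by (rule integral_odd[OF _ _ L_nonneg]) (auto intro!: continuous_intros cd simp: dr)
  moreover have "integral {0..L} (\<lambda>s. d s $ 2) = 0"
  proof -
    have "integral {0..L} (\<lambda>s. d s $ 2) =
        integral {0..L} (\<lambda>s. a * (drag Ct Cn (tang p s) (velf p s) \<bullet> lift p s) +
          b * (drag Ct Cn (tang p s) (velg p s) \<bullet> lift p s) + u * (drag Ct Cn (tang p s) (lift p s) \<bullet> lift p s))"
      by (simp add: d_def U_def drag_add drag_scaleR inner_2 lift_def)
    also have "\<dots> = a * form lift velf p + b * form lift velg p + u * form lift lift p"
      unfolding form_def lift_def
      by (rule integral_linear_combination)
        (intro integrable_continuous_real continuous_intros continuous_tang continuous_velf continuous_velg)+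
    finally show ?thesis using eq by simp
  qed
  ultimately have "integral {0..L} d = 0"
    using integrable_continuous_real[OF cd] by (simp add: vec2_eq_iff integral_component_eq_cart)
  moreover have "integral {0..L} (\<lambda>s. d s \<bullet> (J *v shape p s)) = 0"
    by (rule integral_odd[OF _ _ L_nonneg])
      (auto intro!: continuous_intros cd continuous_shape simp: dr refl inner_2)
  ultimately show ?thesis unfolding balanced_def d_def U_def lift_def by (simp add: add.commute)
qed

text \<open>The quadratic remainder of the tangent is present only in the middle half; integrating
  it from the midpoint costs at most a factor \<open>L\<close>, uniformly in
  \<open>\<beta>\<close>.\<close>

lemma shape_expansion:
  assumes K: "\<And>s. s \<in> {0..L} \<Longrightarrow> \<bar>f s\<bar> \<le> K" and s: "s \<in> {0..L}"
  shows "norm (shape (\<alpha>, \<beta>) s - shape (0, \<beta>) s - (\<alpha> * F s) *\<^sub>R axis 2 1) \<le> 2 * K\<^sup>2 * L * \<alpha>\<^sup>2"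
proof -
  define H where "H r = tang (\<alpha>, \<beta>) r - tang (0, \<beta>) r - (\<alpha> * f r) *\<^sub>R axis 2 1" for r
  have c: "continuous_on {0..L} (tang (\<alpha>, \<beta>))" "continuous_on {0..L} (tang (0, \<beta>))" "continuous_on {0..L} (\<lambda>r. (\<alpha> * f r) *\<^sub>R (axis 2 1 :: real^2))"
    by (intro continuous_tang continuous_intros cf)+
  have cH: "continuous_on {0..L} H" unfolding H_def by (intro continuous_on_diff c)
  have "norm (H r) \<le> 2 * K\<^sup>2 * \<alpha>\<^sup>2" if r: "r \<in> {0..L}" for r
  proof (cases "\<bar>r - L / 2\<bar> \<le> L / 4")
    case True
    have "H r = rot (\<alpha> * f r) (axis 1 1) - axis 1 1 - (\<alpha> * f r) *\<^sub>R axis 2 1"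
      by (simp add: H_def tang_inner[OF True])
    then have "norm (H r) \<le> 2 * (\<alpha> * f r)\<^sup>2" using rot_e1_expansion by simp
    also have "(\<alpha> * f r)\<^sup>2 \<le> \<alpha>\<^sup>2 * K\<^sup>2"
      using K[OF r] unfolding power_mult_distrib
      by (intro mult_left_mono power2_le_iff_abs_le[THEN iffD2]) auto
    finally show ?thesis by (simp add: algebra_simps)
  next
    case False
    then have "H r = 0" unfolding H_def using tang_outer[of r \<alpha> \<beta>] outer[of r] by simp
    then show ?thesis by simp
  qed
  from mid_norm_le[OF cH s L_nonneg this]
  have "norm (mid L H s) \<le> 2 * K\<^sup>2 * \<alpha>\<^sup>2 * \<bar>s - L / 2\<bar>" .
  also have "\<dots> \<le> 2 * K\<^sup>2 * \<alpha>\<^sup>2 * L"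
    using s by (intro mult_left_mono) (auto simp: abs_le_iff)
  finally have "norm (mid L H s) \<le> 2 * K\<^sup>2 * L * \<alpha>\<^sup>2" by (simp add: algebra_simps)
  moreover have "mid L H s = shape (\<alpha>, \<beta>) s - shape (0, \<beta>) s - (\<alpha> * F s) *\<^sub>R axis 2 1"
    unfolding H_def shape_def
    using mid_diff[OF continuous_on_diff[OF c(1,2)] c(3) s] mid_diff[OF c(1,2) s] mid_F[OF s, of \<alpha> "axis 2 1"] by simp
  ultimately show ?thesis by simp
qed

text \<open>No term linear in \<open>\<alpha>\<close> survives. In the middle half the straight base
  shape lies along the first axis, orthogonal to the first-order displacement, and its rotation
  field has no tangential part, so that the square of the perturbed tangential part is quadratic. In
  the outer quarters tangent and \<open>velg\<close> are unchanged and the displacement itself is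
  quadratic.\<close>

lemma spin_estimates:
  assumes "1 \<le> K" and Kf: "\<And>s. s \<in> {0..L} \<Longrightarrow> \<bar>f s\<bar> \<le> K" and KF: "\<And>s. s \<in> {0..L} \<Longrightarrow> \<bar>F s\<bar> \<le> K"
    and Kg: "\<And>s. s \<in> {0..L} \<Longrightarrow> \<bar>g s\<bar> \<le> K"
  obtains C where
    "\<And>\<alpha> \<beta> s. \<alpha> \<in> {-1..1} \<Longrightarrow> s \<in> {0..L} \<Longrightarrow>
      \<bar>drag Ct Cn (tang (\<alpha>, \<beta>) s) (spin (\<alpha>, \<beta>) s) \<bullet> spin (\<alpha>, \<beta>) s -
       drag Ct Cn (tang (0, \<beta>) s) (spin (0, \<beta>) s) \<bullet> spin (0, \<beta>) s\<bar> \<le> C * \<alpha>\<^sup>2"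
    "\<And>\<alpha> \<beta> s. \<alpha> \<in> {-1..1} \<Longrightarrow> s \<in> {0..L} \<Longrightarrow>
      \<bar>drag Ct Cn (tang (\<alpha>, \<beta>) s) (velg (\<alpha>, \<beta>) s) \<bullet> spin (\<alpha>, \<beta>) s -
       drag Ct Cn (tang (0, \<beta>) s) (velg (0, \<beta>) s) \<bullet> spin (0, \<beta>) s\<bar> \<le> C * \<alpha>\<^sup>2"
proof -
  \<comment> \<open>\<open>K1\<close> is the constant of the quadratic remainder in
    \<open>shape_expansion\<close>, and \<open>M\<close> bounds the whole displacement per unit of
    \<open>\<bar>\<alpha>\<bar>\<close>. \<open>Ca\<close> adds the bound for the middle half to
    that for the outer quarters, to serve both cases.\<close>
  define K1 where "K1 = 2 * K\<^sup>2 * L"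
  define M where "M = K1 + K"
  define Ca where "Ca = Cn * (2 * L * K1 + M\<^sup>2) + Cn * ((K * L + M)\<^sup>2 + 2 * L * K1)"
  define Cb where "Cb = 2 * Cn * (K * L) * K1"
  have K1: "0 \<le> K1" using L0 by (simp add: K1_def)
  have M: "0 \<le> M" "K1 \<le> M" using K1 \<open>1 \<le> K\<close> by (auto simp: M_def)
  have ca: "0 \<le> Ca" unfolding Ca_def using C0 K1 L0 by (intro add_nonneg_nonneg mult_nonneg_nonneg) auto
  have cb: "0 \<le> Cb" unfolding Cb_def using C0 K1 L0 \<open>1 \<le> K\<close> by auto
  have main: "\<bar>drag Ct Cn (tang (\<alpha>, \<beta>) s) (spin (\<alpha>, \<beta>) s) \<bullet> spin (\<alpha>, \<beta>) s -
       drag Ct Cn (tang (0, \<beta>) s) (spin (0, \<beta>) s) \<bullet> spin (0, \<beta>) s\<bar> \<le> Ca * \<alpha>\<^sup>2 \<and>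
      \<bar>drag Ct Cn (tang (\<alpha>, \<beta>) s) (velg (\<alpha>, \<beta>) s) \<bullet> spin (\<alpha>, \<beta>) s -
       drag Ct Cn (tang (0, \<beta>) s) (velg (0, \<beta>) s) \<bullet> spin (0, \<beta>) s\<bar> \<le> Cb * \<alpha>\<^sup>2"
    if \<alpha>: "\<alpha> \<in> {-1..1}" and s: "s \<in> {0..L}" for \<alpha> \<beta> s
  proof -
    define e where "e = shape (\<alpha>, \<beta>) s - shape (0, \<beta>) s - (\<alpha> * F s) *\<^sub>R axis 2 1"
    define X where "X = shape (0, \<beta>) s"
    define d where "d = e + (\<alpha> * F s) *\<^sub>R axis 2 1"
    define \<tau> where "\<tau> = tang (\<alpha>, \<beta>) s"
    define \<tau>0 where "\<tau>0 = tang (0, \<beta>) s"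
    have sh: "shape (\<alpha>, \<beta>) s = X + d" by (simp add: d_def X_def e_def)
    have nX: "norm X \<le> L" "norm (X + d) \<le> L"
      using norm_shape_le'[OF s, of "(0, \<beta>)"] norm_shape_le'[OF s, of "(\<alpha>, \<beta>)", unfolded sh] by (simp_all add: X_def)
    have n\<tau>: "norm \<tau> = 1" "norm \<tau>0 = 1" by (simp_all add: \<tau>_def \<tau>0_def)
    have ne: "norm e \<le> K1 * \<alpha>\<^sup>2"
      using shape_expansion[OF Kf s, of \<alpha> \<beta>] by (simp add: e_def K1_def)
    have "\<alpha>\<^sup>2 = \<bar>\<alpha>\<bar> * \<bar>\<alpha>\<bar>" by (simp add: power2_eq_square flip: abs_mult)
    also have "\<dots> \<le> \<bar>\<alpha>\<bar> * 1" using \<alpha> by (intro mult_left_mono) (auto simp: abs_le_iff)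
    finally have a1: "\<alpha>\<^sup>2 \<le> \<bar>\<alpha>\<bar>" by simp
    have nd: "norm d \<le> M * \<bar>\<alpha>\<bar>"
    proof -
      have "norm d \<le> norm e + \<bar>\<alpha>\<bar> * \<bar>F s\<bar>"
        unfolding d_def using norm_triangle_ineq[of e "(\<alpha> * F s) *\<^sub>R axis 2 1"] by (simp add: abs_mult)
      also have "\<dots> \<le> K1 * \<bar>\<alpha>\<bar> + \<bar>\<alpha>\<bar> * K"
        using ne a1 K1 KF[OF s] by (intro add_mono mult_left_mono order_trans[OF ne]) auto
      finally show ?thesis by (simp add: M_def algebra_simps)
    qed
    have nd2: "(norm d)\<^sup>2 \<le> M\<^sup>2 * \<alpha>\<^sup>2"
      using power_mono[OF nd norm_ge_zero, of 2] by (simp add: power_mult_distrib)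
    \<comment> \<open>The product \<open>F s * (X \<bullet> axis 2 1)\<close> vanishes everywhere:
      outside the middle half because of \<open>F\<close>, inside because the base shape is on the
      first axis. Hence only the quadratic remainder \<open>e\<close> pairs with
      \<open>X\<close>.\<close>
    have Xd: "\<bar>X \<bullet> d\<bar> \<le> L * (K1 * \<alpha>\<^sup>2)"
    proof -
      have "F s * (X \<bullet> axis 2 1) = 0"
        using inner_or_outer[of s] outer[of s] shape_base[of s \<beta>] by (auto simp: X_def inner_2)
      then have "X \<bullet> d = X \<bullet> e" by (simp add: d_def inner_add_right)
      also have "\<bar>\<dots>\<bar> \<le> norm X * norm e" by (rule Cauchy_Schwarz_ineq2)
      also have "\<dots> \<le> L * (K1 * \<alpha>\<^sup>2)" using nX ne L0 by (intro mult_mono) auto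
      finally show ?thesis .
    qed
    have sq: "\<bar>(norm (X + d))\<^sup>2 - (norm X)\<^sup>2\<bar> \<le> (2 * L * K1 + M\<^sup>2) * \<alpha>\<^sup>2"
    proof -
      have "(norm (X + d))\<^sup>2 - (norm X)\<^sup>2 = 2 * (X \<bullet> d) + (norm d)\<^sup>2"
        unfolding power2_norm_eq_inner by (simp add: inner_simps inner_commute)
      then have "\<bar>(norm (X + d))\<^sup>2 - (norm X)\<^sup>2\<bar> \<le> 2 * \<bar>X \<bullet> d\<bar> + (norm d)\<^sup>2"
        using zero_le_power2[of "norm d"] by arith
      also have "\<dots> \<le> 2 * (L * (K1 * \<alpha>\<^sup>2)) + M\<^sup>2 * \<alpha>\<^sup>2" using Xd nd2 by linarith
      finally show ?thesis by (simp add: algebra_simps)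
    qed
    have nJ: "\<bar>v \<bullet> (J *v z)\<bar> \<le> norm v * norm z" for v z
      using Cauchy_Schwarz_ineq2[of v "J *v z"] by simp
    have tw: "\<bar>(\<tau> \<bullet> (J *v (X + d)))\<^sup>2 - (\<tau>0 \<bullet> (J *v X))\<^sup>2\<bar> \<le> ((K * L + M)\<^sup>2 + 2 * L * K1) * \<alpha>\<^sup>2"
    proof (cases "\<bar>s - L / 2\<bar> \<le> L / 4")
      case True
      have t0: "\<tau>0 = axis 1 1" unfolding \<tau>0_def by (rule tang_base[OF True])
      have z0: "\<tau>0 \<bullet> (J *v X) = 0"
        unfolding t0 X_def shape_base[OF True] by (simp add: inner_2)
      have "norm (\<tau> - \<tau>0) \<le> \<bar>\<alpha> * f s\<bar>"
        unfolding t0 \<tau>_def tang_inner[OF True] by (rule rot_e1_diff)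
      also have "\<dots> \<le> K * \<bar>\<alpha>\<bar>" using mult_left_mono[OF Kf[OF s] abs_ge_zero[of \<alpha>]] by (simp add: abs_mult mult.commute)
      finally have dt: "norm (\<tau> - \<tau>0) \<le> K * \<bar>\<alpha>\<bar>" .
      have "\<tau> \<bullet> (J *v (X + d)) = (\<tau> - \<tau>0) \<bullet> (J *v (X + d)) + \<tau>0 \<bullet> (J *v d)"
        using z0 by (simp add: inner_simps J_linear_simps)
      then have "\<bar>\<tau> \<bullet> (J *v (X + d))\<bar> \<le> norm (\<tau> - \<tau>0) * norm (X + d) + norm \<tau>0 * norm d"
        using nJ[of "\<tau> - \<tau>0" "X + d"] nJ[of \<tau>0 d] by linarith
      also have "\<dots> \<le> (K * \<bar>\<alpha>\<bar>) * L + 1 * (M * \<bar>\<alpha>\<bar>)"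
        using dt nX nd n\<tau> \<open>1 \<le> K\<close> by (intro add_mono mult_mono) auto
      finally have "\<bar>\<tau> \<bullet> (J *v (X + d))\<bar> \<le> (K * L + M) * \<bar>\<alpha>\<bar>" by (simp add: algebra_simps)
      then have "(\<tau> \<bullet> (J *v (X + d)))\<^sup>2 \<le> (K * L + M)\<^sup>2 * \<alpha>\<^sup>2"
        using power_mono[of "\<bar>\<tau> \<bullet> (J *v (X + d))\<bar>" "(K * L + M) * \<bar>\<alpha>\<bar>" 2] by (simp add: power_mult_distrib)
      moreover have "0 \<le> 2 * L * K1 * \<alpha>\<^sup>2" using L0 K1 by simp
      ultimately have "(\<tau> \<bullet> (J *v (X + d)))\<^sup>2 \<le> (K * L + M)\<^sup>2 * \<alpha>\<^sup>2 + 2 * L * K1 * \<alpha>\<^sup>2"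
        by linarith
      then show ?thesis unfolding z0 distrib_right by simp
    next
      case False
      then have tt: "\<tau> = \<tau>0" "d = e" using tang_outer[of s \<alpha> \<beta>] outer[of s] by (simp_all add: \<tau>_def \<tau>0_def d_def)
      \<comment> \<open>A difference of squares is used here: one factor is quadratic in
        \<open>\<alpha>\<close>, the other is bounded by twice the length.\<close>
      have "(\<tau> \<bullet> (J *v (X + d)))\<^sup>2 - (\<tau>0 \<bullet> (J *v X))\<^sup>2 = (\<tau> \<bullet> (J *v e)) * (\<tau> \<bullet> (J *v (X + d)) + \<tau> \<bullet> (J *v X))"
        unfolding tt by (simp add: inner_simps J_linear_simps power2_eq_square algebra_simps)
      also have "\<bar>\<dots>\<bar> \<le> (K1 * \<alpha>\<^sup>2) * (L + L)"
        unfolding abs_mult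
      proof (rule mult_mono)
        show "\<bar>\<tau> \<bullet> (J *v e)\<bar> \<le> K1 * \<alpha>\<^sup>2" using nJ[of \<tau> e] n\<tau> ne by simp
        show "\<bar>\<tau> \<bullet> (J *v (X + d)) + \<tau> \<bullet> (J *v X)\<bar> \<le> L + L"
          using nJ[of \<tau> "X + d"] nJ[of \<tau> X] n\<tau> nX by (intro order_trans[OF abs_triangle_ineq] add_mono) auto
      qed (use K1 in auto)
      also have "\<dots> \<le> ((K * L + M)\<^sup>2 + 2 * L * K1) * \<alpha>\<^sup>2" by (simp add: algebra_simps)
      finally show ?thesis .
    qed
    have "\<bar>drag Ct Cn (tang (\<alpha>, \<beta>) s) (spin (\<alpha>, \<beta>) s) \<bullet> spin (\<alpha>, \<beta>) s -
       drag Ct Cn (tang (0, \<beta>) s) (spin (0, \<beta>) s) \<bullet> spin (0, \<beta>) s\<bar> =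
      \<bar>Cn * ((norm (X + d))\<^sup>2 - (norm X)\<^sup>2) - (Cn - Ct) * ((\<tau> \<bullet> (J *v (X + d)))\<^sup>2 - (\<tau>0 \<bullet> (J *v X))\<^sup>2)\<bar>"
      unfolding drag_inner_self spin_def sh X_def[symmetric] \<tau>_def[symmetric] \<tau>0_def[symmetric] norm_J
      by (rule arg_cong[where f = abs]) (simp add: algebra_simps)
    also have "\<dots> \<le> Cn * \<bar>(norm (X + d))\<^sup>2 - (norm X)\<^sup>2\<bar> + (Cn - Ct) * \<bar>(\<tau> \<bullet> (J *v (X + d)))\<^sup>2 - (\<tau>0 \<bullet> (J *v X))\<^sup>2\<bar>"
      using C0 by (intro order_trans[OF abs_triangle_ineq4]) (simp add: abs_mult)
    also have "\<dots> \<le> Cn * ((2 * L * K1 + M\<^sup>2) * \<alpha>\<^sup>2) + Cn * (((K * L + M)\<^sup>2 + 2 * L * K1) * \<alpha>\<^sup>2)"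
      using C0 sq tw by (intro add_mono mult_mono) auto
    also have "\<dots> = Ca * \<alpha>\<^sup>2" by (simp add: Ca_def algebra_simps)
    finally have p1: "\<bar>drag Ct Cn (tang (\<alpha>, \<beta>) s) (spin (\<alpha>, \<beta>) s) \<bullet> spin (\<alpha>, \<beta>) s -
       drag Ct Cn (tang (0, \<beta>) s) (spin (0, \<beta>) s) \<bullet> spin (0, \<beta>) s\<bar> \<le> Ca * \<alpha>\<^sup>2" .
    have p2: "\<bar>drag Ct Cn (tang (\<alpha>, \<beta>) s) (velg (\<alpha>, \<beta>) s) \<bullet> spin (\<alpha>, \<beta>) s -
       drag Ct Cn (tang (0, \<beta>) s) (velg (0, \<beta>) s) \<bullet> spin (0, \<beta>) s\<bar> \<le> Cb * \<alpha>\<^sup>2"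
    proof (cases "\<bar>s - L / 2\<bar> \<le> L / 4")
      case True
      then show ?thesis using cb by (simp add: velg_inner)
    next
      case False
      then have tt: "\<tau> = \<tau>0" "d = e" using tang_outer[of s \<alpha> \<beta>] outer[of s] by (simp_all add: \<tau>_def \<tau>0_def d_def)
      have c: "continuous_on {0..L} (\<lambda>r. g r *\<^sub>R (J *v tang (0, \<beta>) r))" by (intro continuous_intros cg continuous_tang)
      have "norm (velg (0, \<beta>) s) \<le> K * \<bar>s - L / 2\<bar>"
        unfolding velg_def by (rule mid_norm_le[OF c s L_nonneg]) (simp add: Kg)
      also have "\<dots> \<le> K * L" using s \<open>1 \<le> K\<close> by (intro mult_left_mono) (auto simp: abs_le_iff)
      finally have "2 * Cn * norm (velg (0, \<beta>) s) \<le> 2 * Cn * (K * L)" using C0 by (intro mult_left_mono) auto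
      then have nv: "norm (drag Ct Cn \<tau>0 (velg (0, \<beta>) s)) \<le> 2 * Cn * (K * L)"
        using norm_drag_le[OF C0 n\<tau>(2), of "velg (0, \<beta>) s"] by linarith
      have "drag Ct Cn (tang (\<alpha>, \<beta>) s) (velg (\<alpha>, \<beta>) s) \<bullet> spin (\<alpha>, \<beta>) s -
         drag Ct Cn (tang (0, \<beta>) s) (velg (0, \<beta>) s) \<bullet> spin (0, \<beta>) s = drag Ct Cn \<tau>0 (velg (0, \<beta>) s) \<bullet> (J *v e)"
        unfolding velg_indep[of \<alpha>] spin_def sh X_def[symmetric] \<tau>_def[symmetric] \<tau>0_def[symmetric] tt
        by (simp add: J_linear_simps inner_add_right)
      also have "\<bar>\<dots>\<bar> \<le> norm (drag Ct Cn \<tau>0 (velg (0, \<beta>) s)) * norm e" by (rule nJ)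
      also have "\<dots> \<le> 2 * Cn * (K * L) * (K1 * \<alpha>\<^sup>2)"
        using nv ne C0 L0 \<open>1 \<le> K\<close> by (intro mult_mono) auto
      finally show ?thesis by (simp add: Cb_def mult.assoc)
    qed
    show ?thesis using p1 p2 by blast
  qed
  show ?thesis
  proof (rule that[of "Ca + Cb"])
    fix \<alpha> \<beta> s :: real assume h: "\<alpha> \<in> {-1..1}" "s \<in> {0..L}"
    have "Ca * \<alpha>\<^sup>2 \<le> (Ca + Cb) * \<alpha>\<^sup>2" "Cb * \<alpha>\<^sup>2 \<le> (Ca + Cb) * \<alpha>\<^sup>2"
      using ca cb by (auto intro!: mult_right_mono)
    then show "\<bar>drag Ct Cn (tang (\<alpha>, \<beta>) s) (spin (\<alpha>, \<beta>) s) \<bullet> spin (\<alpha>, \<beta>) s -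
       drag Ct Cn (tang (0, \<beta>) s) (spin (0, \<beta>) s) \<bullet> spin (0, \<beta>) s\<bar> \<le> (Ca + Cb) * \<alpha>\<^sup>2"
      "\<bar>drag Ct Cn (tang (\<alpha>, \<beta>) s) (velg (\<alpha>, \<beta>) s) \<bullet> spin (\<alpha>, \<beta>) s -
       drag Ct Cn (tang (0, \<beta>) s) (velg (0, \<beta>) s) \<bullet> spin (0, \<beta>) s\<bar> \<le> (Ca + Cb) * \<alpha>\<^sup>2"
      using main[OF h, of \<beta>] by linarith+
  qed
qed

end

section \<open>Loops with non-constant displacement\<close>

lemma integral_pos:
  fixes h :: "real \<Rightarrow> real"
  assumes c: "continuous_on {a..b} h" and "a < b" and nn: "\<And>s. s \<in> {a..b} \<Longrightarrow> 0 \<le> h s"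
    and s: "s \<in> {a..b}" "h s \<noteq> 0"
  shows "0 < integral {a..b} h"
proof -
  have "integral {a..b} h \<noteq> 0"
    using integral_eq_0_iff[OF c \<open>a < b\<close>] nn s by auto
  moreover have "0 \<le> integral {a..b} h" using nn by (intro integral_nonneg integrable_continuous_real c) auto
  ultimately show ?thesis by simp
qed

context gait
begin

lemma continuous_integrand:
  assumes "continuous_on {0..L} (h p)" "continuous_on {0..L} (k p)"
  shows "continuous_on {0..L} (\<lambda>s. drag Ct Cn (tang p s) (h p s) \<bullet> k p s)"
  by (intro continuous_on_inner continuous_on_drag continuous_tang assms)

text \<open>Here \<open>k\<close> is \<open>spin\<close> or \<open>lift\<close>, \<open>u\<close> is
  the speed along \<open>k\<close> that solves the scalar balance during an admissible closed loop,
  and \<open>d\<close> is the total displacement, an angle or a height. Both gaits use the same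
  construction of loops in this form.\<close>

definition drifts :: "(real \<times> real \<Rightarrow> real \<Rightarrow> real^2) \<Rightarrow> real \<Rightarrow> bool" where
  "drifts k d \<longleftrightarrow> (\<exists>r x x' y y' u.
      (\<forall>\<alpha>\<in>{-r..r}. \<forall>\<beta>\<in>{0..r}. \<forall>s\<in>{0..L}. \<bar>\<alpha> * f' s + \<beta> * g' s\<bar> \<le> min (1 / (2 * L)) (1 / (4 * \<rho>))) \<and>
      (\<forall>t\<in>{0..1}. x t \<in> {-r..r} \<and> y t \<in> {0..r}) \<and>
      (\<forall>t\<in>{0..1}. (x has_real_derivative x' t) (at t within {0..1})) \<and>
      (\<forall>t\<in>{0..1}. (y has_real_derivative y' t) (at t within {0..1})) \<and>
      continuous_on {0..1} x' \<and> continuous_on {0..1} y' \<and> x 0 = 0 \<and> x 1 = 0 \<and> y 0 = 0 \<and> y 1 = 0 \<and>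
      continuous_on {0..1} u \<and> integral {0..1} u = d \<and>
      (\<forall>t\<in>{0..1}. x' t * form k velf (x t, y t) + y' t * form k velg (x t, y t) + u t * form k k (x t, y t) = 0))"

text \<open>The pointwise quadratic estimates integrate over the curve to the constant
  \<open>C * L\<close> of \<open>loop_drift\<close>. The displacements are the negatives of the
  integrals there, because u is obtained by solving the scalar balance.\<close>

lemma loop_exists:
  assumes ck2: "continuous_on ({0..L} \<times> UNIV) (\<lambda>q. k (snd q) (fst q))"
    and ck: "\<And>p. continuous_on {0..L} (k p)"
    and pos: "\<And>p. 0 < form k k p"
    and n: "\<And>\<beta>. form k velf (0, \<beta>) = n" "n \<noteq> 0"
    and D2: "\<And>\<alpha> \<beta> s. \<alpha> \<in> {-1..1} \<Longrightarrow> s \<in> {0..L} \<Longrightarrow>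
      \<bar>drag Ct Cn (tang (\<alpha>, \<beta>) s) (k (\<alpha>, \<beta>) s) \<bullet> k (\<alpha>, \<beta>) s - drag Ct Cn (tang (0, \<beta>) s) (k (0, \<beta>) s) \<bullet> k (0, \<beta>) s\<bar> \<le> C * \<alpha>\<^sup>2"
    and G2: "\<And>\<alpha> \<beta> s. \<alpha> \<in> {-1..1} \<Longrightarrow> s \<in> {0..L} \<Longrightarrow>
      \<bar>drag Ct Cn (tang (\<alpha>, \<beta>) s) (velg (\<alpha>, \<beta>) s) \<bullet> k (\<alpha>, \<beta>) s - drag Ct Cn (tang (0, \<beta>) s) (velg (0, \<beta>) s) \<bullet> k (0, \<beta>) s\<bar> \<le> C * \<alpha>\<^sup>2"
    and D1: "\<And>r. 0 < r \<Longrightarrow> r * g L \<le> 1 \<Longrightarrow> form k k (0, r) \<noteq> form k k (0, 0)"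
  shows "\<exists>X (a0::real). continuous_on {0..a0} X \<and> (\<exists>a\<in>{0..a0}. X a \<noteq> X 0) \<and>
    (\<forall>a\<in>{0..a0}. drifts k (X a))"
proof -
  obtain r where r: "0 < r" "r * g L \<le> 1" "r \<le> 1"
    and box: "\<And>\<alpha> \<beta> s. \<alpha> \<in> {-r..r} \<Longrightarrow> \<beta> \<in> {0..r} \<Longrightarrow> s \<in> {0..L} \<Longrightarrow>
      \<bar>\<alpha> * f' s + \<beta> * g' s\<bar> \<le> min (1 / (2 * L)) (1 / (4 * \<rho>))"
    by (rule small_box) blast
  have c: "continuous_on S (form k velf)" "continuous_on S (form k velg)" "continuous_on S (form k k)" for S
    by (intro continuous_on_form ck2 continuous_velf2 continuous_velg2)+
  have c2: "continuous_on S (\<lambda>p. form k velf (fst p, snd p))" "continuous_on S (\<lambda>p. form k velg (fst p, snd p))"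
    "continuous_on S (\<lambda>p. form k k (fst p, snd p))" for S
    using c by simp_all
  have e1: "\<bar>form k velg (\<alpha>, \<beta>) - form k velg (0, \<beta>)\<bar> \<le> C * L * \<alpha>\<^sup>2" if "\<alpha> \<in> {-r..r}" "\<beta> \<in> {0..r}" for \<alpha> \<beta>
  proof -
    have "\<alpha> \<in> {-1..1}" using that r by auto
    then have "\<bar>integral {0..L} (\<lambda>s. drag Ct Cn (tang (\<alpha>, \<beta>) s) (velg (\<alpha>, \<beta>) s) \<bullet> k (\<alpha>, \<beta>) s) -
        integral {0..L} (\<lambda>s. drag Ct Cn (tang (0, \<beta>) s) (velg (0, \<beta>) s) \<bullet> k (0, \<beta>) s)\<bar> \<le> (C * \<alpha>\<^sup>2) * L"
      by (intro integral_diff_bound continuous_integrand continuous_velg ck L_nonneg G2)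
    then show ?thesis unfolding form_def by (simp only: mult.assoc mult.commute[of L])
  qed
  have e2: "\<bar>form k k (\<alpha>, \<beta>) - form k k (0, \<beta>)\<bar> \<le> C * L * \<alpha>\<^sup>2" if "\<alpha> \<in> {-r..r}" "\<beta> \<in> {0..r}" for \<alpha> \<beta>
  proof -
    have "\<alpha> \<in> {-1..1}" using that r by auto
    then have "\<bar>integral {0..L} (\<lambda>s. drag Ct Cn (tang (\<alpha>, \<beta>) s) (k (\<alpha>, \<beta>) s) \<bullet> k (\<alpha>, \<beta>) s) -
        integral {0..L} (\<lambda>s. drag Ct Cn (tang (0, \<beta>) s) (k (0, \<beta>) s) \<bullet> k (0, \<beta>) s)\<bar> \<le> (C * \<alpha>\<^sup>2) * L"
      by (intro integral_diff_bound continuous_integrand  ck L_nonneg D2)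
    then show ?thesis unfolding form_def by (simp only: mult.assoc mult.commute[of L])
  qed
  define Y where "Y x x' y y' a = integral {0..1} (\<lambda>t. (a * x' t * form k velf (a * x t, y t) + y' t * form k velg (a * x t, y t)) / form k k (a * x t, y t))"
    for x x' y y' :: "real \<Rightarrow> real" and a
  from loop_drift[of r "\<lambda>\<alpha> \<beta>. form k velf (\<alpha>, \<beta>)" "\<lambda>\<alpha> \<beta>. form k velg (\<alpha>, \<beta>)" "\<lambda>\<alpha> \<beta>. form k k (\<alpha>, \<beta>)" n "C * L",
    OF r(1) c2 pos n e1 e2 D1[OF r(1,2)]]
  obtain x x' y y' a0 where dx: "\<And>t. t \<in> {0..1} \<Longrightarrow> (x has_real_derivative x' t) (at t within {0..1})" and cx': "continuous_on {0..1} x'"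
    and dy: "\<And>t. t \<in> {0..1} \<Longrightarrow> (y has_real_derivative y' t) (at t within {0..1})" and cy': "continuous_on {0..1} y'"
    and ends: "x 0 = 0" "x 1 = 0" "y 0 = 0" "y 1 = 0" and a0: "0 < a0"
    and inb: "\<And>a t. a \<in> {0..a0} \<Longrightarrow> t \<in> {0..1} \<Longrightarrow> a * x t \<in> {-r..r} \<and> y t \<in> {0..r}"
    and cY: "continuous_on {0..a0} (Y x x' y y')" and nz: "\<exists>a\<in>{0..a0}. Y x x' y y' a \<noteq> Y x x' y y' 0"
    unfolding Y_def[abs_def] by blast
  have cx: "continuous_on {0..1} x" and cy: "continuous_on {0..1} y"
    using dx dy by (meson continuous_on_eq_continuous_within DERIV_continuous)+
  define X where "X a = - Y x x' y y' a" for a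
  show ?thesis
  proof (intro exI[of _ X] exI[of _ a0] conjI ballI)
    show "continuous_on {0..a0} X" unfolding X_def by (intro continuous_on_minus cY)
    show "\<exists>a\<in>{0..a0}. X a \<noteq> X 0" using nz by (simp add: X_def)
    fix a assume a: "a \<in> {0..a0}"
    define u where "u t = - ((a * x' t * form k velf (a * x t, y t) + y' t * form k velg (a * x t, y t)) / form k k (a * x t, y t))" for t
    have cp: "continuous_on {0..1} (\<lambda>t. (a * x t, y t))" by (intro continuous_on_Pair continuous_on_mult continuous_on_const cx cy)
    have cc: "continuous_on {0..1} (\<lambda>t. F' (a * x t, y t))" if "continuous_on UNIV F'" for F' :: "real \<times> real \<Rightarrow> real"
      by (rule continuous_on_compose2[OF that cp]) simp
    have cu: "continuous_on {0..1} u" unfolding u_def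
      using pos by (intro continuous_on_minus continuous_on_divide continuous_on_add continuous_on_mult continuous_on_const cx' cy' cc c)
        (metis less_irrefl)
    have i: "integral {0..1} u = X a" unfolding u_def Y_def X_def by (rule integral_neg)
    have b: "a * x' t * form k velf (a * x t, y t) + y' t * form k velg (a * x t, y t) + u t * form k k (a * x t, y t) = 0" for t
      using pos[of "(a * x t, y t)"] by (simp add: u_def)
    have dax: "((\<lambda>t. a * x t) has_real_derivative a * x' t) (at t within {0..1})" if "t \<in> {0..1}" for t
      by (rule DERIV_cmult[OF dx[OF that]])
    have cax: "continuous_on {0..1} (\<lambda>t. a * x' t)" by (intro continuous_on_mult continuous_on_const cx')
    have e0: "a * x 0 = 0" "a * x 1 = 0" using ends by simp_all
    show "drifts k (X a)"
      unfolding drifts_def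
      by (intro exI[of _ r] exI[of _ "\<lambda>t. a * x t"] exI[of _ "\<lambda>t. a * x' t"] exI[of _ y] exI[of _ y'] exI[of _ u]
          conjI ballI; (rule box dax dy cax cy' e0 ends cu i b inb[OF a, THEN conjunct1] inb[OF a, THEN conjunct2]; assumption))
  qed
qed

lemma lift_positive: "0 < form lift lift p"
proof -
  have "Ct \<le> drag Ct Cn (tang p s) (lift p s) \<bullet> lift p s" for s
    using drag_coercive[of Ct Cn "tang p s" "lift p s"] C0 by (simp add: lift_def)
  then have "0 < drag Ct Cn (tang p s) (lift p s) \<bullet> lift p s" for s
    using C0 by (meson less_le_trans)
  moreover have "continuous_on {0..L} (\<lambda>s. drag Ct Cn (tang p s) (lift p s) \<bullet> lift p s)"
    by (intro continuous_integrand) (simp_all add: lift_def[abs_def])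
  ultimately show ?thesis unfolding form_def
    by (intro integral_pos[OF _ L0, of _ 0]) (use L0 in \<open>auto simp: less_imp_le less_imp_neq[symmetric] simp flip: \<close>)
qed

lemma spin_positive: "0 < form spin spin p"
proof -
  define q where "q s = drag Ct Cn (tang p s) (spin p s) \<bullet> spin p s" for s
  have q: "Ct * (norm (shape p s))\<^sup>2 \<le> q s" for s
    using drag_coercive[of Ct Cn "tang p s" "spin p s"] C0 by (simp add: q_def spin_def)
  have q0: "0 \<le> q s" for s
  proof -
    have "0 \<le> Ct * (norm (shape p s))\<^sup>2" using C0 by simp
    then show ?thesis using q[of s] by linarith
  qed
  have "\<exists>s\<in>{0..L}. q s \<noteq> 0"
  proof (rule ccontr)
    assume "\<not> ?thesis"
    then have z: "shape p s = 0" if "s \<in> {0..L}" for s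
      using q[of s] that C0 by (auto simp: mult_le_0_iff)
    have "0 \<in> {0..L}" using L0 by simp
    then have "(shape p has_vector_derivative 0) (at 0 within {0..L})"
      by (intro has_vector_derivative_transform[OF _ _ has_vector_derivative_const[of 0]]) (use z in auto)
    then have "tang p 0 = 0"
      using vector_derivative_unique_within_closed_interval[of 0 L 0 "shape p" "tang p 0" 0] shape_derivative[of 0 p] L0 by simp
    then show False using norm_tang[of p 0] by simp
  qed
  moreover have "continuous_on {0..L} q"
    unfolding q_def by (intro continuous_integrand continuous_spin)
  ultimately show ?thesis
    unfolding form_def q_def[symmetric] using integral_pos[OF _ L0, of q] q0 by blast
qed

text \<open>The tangential component of the rotation field at the end of the bent curve is the
  quantity through which bending the outer quarters is seen to lower the rotational
  resistance.\<close>

lemma tang_end_integral: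
  "tang (0, r) L \<bullet> spin (0, r) L = integral {L / 2..L} (\<lambda>s. sin (r * g L - r * g s))"
proof -
  define h where "h s = sin (r * g L - r * g s)" for s
  have ch: "continuous_on S h" for S unfolding h_def by (intro continuous_intros cg)
  have b: "bounded_linear (\<lambda>v. tang (0, r) L \<bullet> (J *v v))"
    by (rule bounded_linear_compose[OF bounded_linear_inner_right bounded_linear_J])
  have L: "L \<in> {0..L}" using L0 by simp
  have "tang (0, r) L \<bullet> spin (0, r) L = mid L (\<lambda>s. tang (0, r) L \<bullet> (J *v tang (0, r) s)) L"
    unfolding spin_def shape_def by (rule mid_linear[OF b continuous_tang L, symmetric])
  also have "\<dots> = mid L h L" unfolding tang_end h_def ..
  also have "\<dots> = integral {L / 2..L} h"
    using Henstock_Kurzweil_Integration.integral_combine[of 0 "L / 2" L h] L0 integrable_continuous_real[OF ch, of 0 L]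
    by (simp add: mid_def)
  finally show ?thesis by (simp add: h_def[abs_def])
qed

lemma small_angle_pos: "0 < x \<Longrightarrow> x \<le> 1 \<Longrightarrow> 0 < sin (x::real)"
  using pi_gt3 by (intro sin_gt_zero) auto

text \<open>Since g grows from 0 at the midpoint to its largest value at the end, the angles in the
  integrand lie between 0 and 1. At the midpoint the sine is strictly positive.\<close>

lemma tang_end_positive:
  assumes "0 < r" "r * g L \<le> 1"
  shows "0 < tang (0, r) L \<bullet> spin (0, r) L"
  unfolding tang_end_integral
proof (rule integral_pos)
  show "continuous_on {L / 2..L} (\<lambda>s. sin (r * g L - r * g s))" by (intro continuous_intros cg)
  show "0 \<le> sin (r * g L - r * g s)" if "s \<in> {L / 2..L}" for s
  proof -
    have "0 \<le> r * g s" "r * g s \<le> r * g L" using g_mono[OF that] assms by (auto intro: mult_left_mono)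
    then show ?thesis using assms pi_gt3 by (intro sin_ge_zero) auto
  qed
  have "g (L / 2) = 0" using L0 by (intro inner) simp
  moreover have "0 < r * g L" using assms g_end by simp
  ultimately show "sin (r * g L - r * g (L / 2)) \<noteq> 0"
    using small_angle_pos[of "r * g L"] assms by simp
qed (use L0 in auto)

lemma rotation_gait:
  assumes e: "\<epsilon> = 1"
  shows "\<exists>X (a0::real). continuous_on {0..a0} X \<and> (\<exists>a\<in>{0..a0}. X a \<noteq> X 0) \<and>
    (\<forall>a\<in>{0..a0}. reach L \<rho> Ct Cn (segment L) (\<lambda>s. rot (X a) (segment L s)))"
proof -
  obtain K where K: "1 \<le> K" "\<And>s. s \<in> {0..L} \<Longrightarrow> \<bar>f s\<bar> \<le> K" "\<And>s. s \<in> {0..L} \<Longrightarrow> \<bar>F s\<bar> \<le> K" "\<And>s. s \<in> {0..L} \<Longrightarrow> \<bar>g s\<bar> \<le> K"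
    by (rule bounds) blast
  obtain C where C: "\<And>\<alpha> \<beta> s. \<alpha> \<in> {-1..1} \<Longrightarrow> s \<in> {0..L} \<Longrightarrow>
      \<bar>drag Ct Cn (tang (\<alpha>, \<beta>) s) (spin (\<alpha>, \<beta>) s) \<bullet> spin (\<alpha>, \<beta>) s -
       drag Ct Cn (tang (0, \<beta>) s) (spin (0, \<beta>) s) \<bullet> spin (0, \<beta>) s\<bar> \<le> C * \<alpha>\<^sup>2"
    "\<And>\<alpha> \<beta> s. \<alpha> \<in> {-1..1} \<Longrightarrow> s \<in> {0..L} \<Longrightarrow>
      \<bar>drag Ct Cn (tang (\<alpha>, \<beta>) s) (velg (\<alpha>, \<beta>) s) \<bullet> spin (\<alpha>, \<beta>) s -
       drag Ct Cn (tang (0, \<beta>) s) (velg (0, \<beta>) s) \<bullet> spin (0, \<beta>) s\<bar> \<le> C * \<alpha>\<^sup>2"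
    using spin_estimates[OF K] by blast
  define n where "n = integral {0..L} (\<lambda>s. Cn * (F s * (s - L / 2)))"
  have nf: "form spin velf (0, \<beta>) = n" for \<beta>
    unfolding form_def n_def
  proof (rule integral_cong)
    fix s assume s: "s \<in> {0..L}"
    show "drag Ct Cn (tang (0, \<beta>) s) (velf (0, \<beta>) s) \<bullet> spin (0, \<beta>) s = Cn * (F s * (s - L / 2))"
      using inner_or_outer[of s]
    proof
      assume "\<bar>s - L / 2\<bar> \<le> L / 4"
      then show ?thesis
        unfolding velf_base[OF s] spin_def by (simp add: tang_base shape_base drag_def inner_2)
    next
      assume "\<bar>s - L / 2\<bar> \<ge> L / 4"
      then show ?thesis unfolding velf_base[OF s] by (simp add: outer)
    qed
  qed
  \<comment> \<open>The primitive \<open>F\<close> has the sign of the lever arm, so the torque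
    exerted by the first mode does not cancel.\<close>
  have "0 < n"
    unfolding n_def
  proof (rule integral_pos[of _ _ _ "5 * L / 8"])
    show "continuous_on {0..L} (\<lambda>s. Cn * (F s * (s - L / 2)))" by (intro continuous_intros cF)
    show "Cn * (F (5 * L / 8) * (5 * L / 8 - L / 2)) \<noteq> 0" using F_nz C0 L0 by simp
  qed (use L0 C0 F_pos(1)[OF e] in auto)
  \<comment> \<open>Bending brings points no farther from the midpoint and gives the rotation field
    a tangential part, where the drag coefficient is the smaller \<open>Ct\<close>. Both effects
    lower the resistance, the second one strictly at the end \<open>L\<close>.\<close>
  have D1: "form spin spin (0, r) \<noteq> form spin spin (0, 0)" if r: "0 < r" "r * g L \<le> 1" for r
  proof -
    define q where "q p s = drag Ct Cn (tang p s) (spin p s) \<bullet> spin p s" for p s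
    have cq: "continuous_on {0..L} (q p)" for p
      unfolding q_def by (intro continuous_integrand continuous_spin)
    have q00: "q (0, 0) s = Cn * (s - L / 2)\<^sup>2" if "s \<in> {0..L}" for s
      using shape_straight[OF that]
      by (simp add: q_def spin_def segment_def tang_def drag_def inner_2 power2_eq_square)
    have qr: "q (0, r) s = Cn * (norm (shape (0, r) s))\<^sup>2 - (Cn - Ct) * (tang (0, r) s \<bullet> spin (0, r) s)\<^sup>2" for s
      unfolding q_def drag_inner_self by (simp add: spin_def)
    have sq: "Cn * (norm (shape (0, r) s))\<^sup>2 \<le> Cn * (s - L / 2)\<^sup>2" if "s \<in> {0..L}" for s
      using norm_shape_le[OF that, of "(0, r)"] C0
      by (intro mult_left_mono) (auto simp: abs_le_square_iff[symmetric])
    have "0 < integral {0..L} (\<lambda>s. q (0, 0) s - q (0, r) s)"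
    proof (rule integral_pos[of _ _ _ L])
      show "continuous_on {0..L} (\<lambda>s. q (0, 0) s - q (0, r) s)" by (intro continuous_on_diff cq)
      show "0 \<le> q (0, 0) s - q (0, r) s" if "s \<in> {0..L}" for s
      proof -
        have "0 \<le> (Cn - Ct) * (tang (0, r) s \<bullet> spin (0, r) s)\<^sup>2" using C0 by simp
        then show ?thesis unfolding q00[OF that] qr using sq[OF that] by linarith
      qed
      have "0 < (Cn - Ct) * (tang (0, r) L \<bullet> spin (0, r) L)\<^sup>2"
        using tang_end_positive[OF r] C0 by simp
      moreover have "L \<in> {0..L}" using L0 by simp
      ultimately show "q (0, 0) L - q (0, r) L \<noteq> 0"
        using sq[of L] q00[of L] qr[of L] by linarith
    qed (use L0 in auto)
    moreover have "integral {0..L} (\<lambda>s. q (0, 0) s - q (0, r) s) = form spin spin (0, 0) - form spin spin (0, r)"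
      unfolding form_def q_def[symmetric] by (intro integral_diff integrable_continuous_real cq)
    ultimately show ?thesis by linarith
  qed
  have nz: "n \<noteq> 0" using \<open>0 < n\<close> by simp
  have "\<exists>X (a0::real). continuous_on {0..a0} X \<and> (\<exists>a\<in>{0..a0}. X a \<noteq> X 0) \<and> (\<forall>a\<in>{0..a0}. drifts spin (X a))"
    by (rule loop_exists[of spin n C, OF continuous_spin2 continuous_spin spin_positive nf nz C D1])
  then obtain X and a0 :: real where "continuous_on {0..a0} X" "\<exists>a\<in>{0..a0}. X a \<noteq> X 0" and
    ex: "\<forall>a\<in>{0..a0}. drifts spin (X a)"
    by (elim exE conjE) (rule that; assumption)
  moreover have "reach L \<rho> Ct Cn (segment L) (\<lambda>s. rot (X a) (segment L s))" if a: "a \<in> {0..a0}" for a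
  proof -
    have "drifts spin (X a)" using ex a by blast
    then obtain r x x' y y' u where
      h: "\<forall>\<alpha>\<in>{-r..r}. \<forall>\<beta>\<in>{0..r}. \<forall>s\<in>{0..L}. \<bar>\<alpha> * f' s + \<beta> * g' s\<bar> \<le> min (1 / (2 * L)) (1 / (4 * \<rho>))"
      "\<forall>t\<in>{0..1}. x t \<in> {-r..r} \<and> y t \<in> {0..r}"
      "\<forall>t\<in>{0..1}. (x has_real_derivative x' t) (at t within {0..1})"
      "\<forall>t\<in>{0..1}. (y has_real_derivative y' t) (at t within {0..1})"
      and h': "continuous_on {0..1} x'" "continuous_on {0..1} y'" "x 0 = 0" "x 1 = 0" "y 0 = 0" "y 1 = 0"
      and u: "continuous_on {0..1} u" "integral {0..1} u = X a"
      and eq: "\<forall>t\<in>{0..1}. x' t * form spin velf (x t, y t) + y' t * form spin velg (x t, y t) + u t * form spin spin (x t, y t) = 0"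
      unfolding drifts_def by (elim exE conjE) (rule that; assumption)
    have "reach L \<rho> Ct Cn (segment L)
        (\<lambda>s. integral {0..1} (\<lambda>v. rot (integral {0..v} u) 0) + rot (integral {0..1} u) (segment L s))"
      by (rule loop_reach[OF h[rule_format] h' continuous_on_const u(1) balanced_spin[OF e eq[rule_format]]])
    then show ?thesis by (simp add: rot_linear_simps u)
  qed
  ultimately show ?thesis by blast
qed

text \<open>The field \<open>lift\<close> does not depend on the shape, and only the normal
  component of the tangent enters its resistance. At \<open>\<alpha> = 0\<close> this component is 0
  in the middle half, so its square changes by at most a multiple of
  \<open>\<alpha>\<^sup>2\<close>.\<close>

lemma lift_gait:
  assumes e: "\<epsilon> = - 1"
  shows "\<exists>X (a0::real). continuous_on {0..a0} X \<and> (\<exists>a\<in>{0..a0}. X a \<noteq> X 0) \<and>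
    (\<forall>a\<in>{0..a0}. reach L \<rho> Ct Cn (segment L) (\<lambda>s. X a *\<^sub>R axis 2 1 + segment L s))"
proof -
  obtain K where K: "1 \<le> K" "\<And>s. s \<in> {0..L} \<Longrightarrow> \<bar>f s\<bar> \<le> K"
    by (rule bounds) blast
  define C where "C = (Cn - Ct) * K\<^sup>2"
  have C: "0 \<le> C" using C0 by (simp add: C_def)
  have self: "drag Ct Cn (tang p s) (lift p s) \<bullet> lift p s = Cn - (Cn - Ct) * (tang p s $ 2)\<^sup>2" for p s
    unfolding drag_inner_self by (simp add: lift_def inner_2)
  have D2: "\<bar>drag Ct Cn (tang (\<alpha>, \<beta>) s) (lift (\<alpha>, \<beta>) s) \<bullet> lift (\<alpha>, \<beta>) s -
       drag Ct Cn (tang (0, \<beta>) s) (lift (0, \<beta>) s) \<bullet> lift (0, \<beta>) s\<bar> \<le> C * \<alpha>\<^sup>2"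
    if s: "s \<in> {0..L}" for \<alpha> \<beta> s
    using inner_or_outer[of s]
  proof
    assume i: "\<bar>s - L / 2\<bar> \<le> L / 4"
    have "\<bar>sin (\<alpha> * f s)\<bar> \<le> \<bar>\<alpha>\<bar> * K"
      using abs_sin_x_le_abs_x[of "\<alpha> * f s"] mult_left_mono[OF K(2)[OF s] abs_ge_zero[of \<alpha>]] by (simp add: abs_mult)
    then have "(sin (\<alpha> * f s))\<^sup>2 \<le> \<alpha>\<^sup>2 * K\<^sup>2"
      using power_mono[of "\<bar>sin (\<alpha> * f s)\<bar>" "\<bar>\<alpha>\<bar> * K" 2] by (simp add: power_mult_distrib)
    then have "(Cn - Ct) * (sin (\<alpha> * f s))\<^sup>2 \<le> (Cn - Ct) * (\<alpha>\<^sup>2 * K\<^sup>2)" using C0 by (intro mult_left_mono) auto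
    moreover have "0 \<le> (Cn - Ct) * (sin (\<alpha> * f s))\<^sup>2" using C0 by simp
    ultimately show ?thesis
      unfolding self unfolding tang_inner[OF i] by (simp add: rot_comp C_def mult.assoc mult.commute[of "K\<^sup>2"])
  next
    assume "\<bar>s - L / 2\<bar> \<ge> L / 4"
    from tang_outer[OF this, of \<alpha> \<beta>] show ?thesis unfolding self using C by simp
  qed
  have G2: "\<bar>drag Ct Cn (tang (\<alpha>, \<beta>) s) (velg (\<alpha>, \<beta>) s) \<bullet> lift (\<alpha>, \<beta>) s -
       drag Ct Cn (tang (0, \<beta>) s) (velg (0, \<beta>) s) \<bullet> lift (0, \<beta>) s\<bar> \<le> C * \<alpha>\<^sup>2" for \<alpha> \<beta> s
    using inner_or_outer[of s]
  proof
    assume "\<bar>s - L / 2\<bar> \<le> L / 4"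
    then show ?thesis using C by (simp add: velg_inner)
  next
    assume "\<bar>s - L / 2\<bar> \<ge> L / 4"
    from tang_outer[OF this, of \<alpha> \<beta>] velg_indep[of \<alpha> \<beta>] show ?thesis using C by (simp add: lift_def)
  qed
  define n where "n = integral {0..L} (\<lambda>s. Cn * F s)"
  have nf: "form lift velf (0, \<beta>) = n" for \<beta>
    unfolding form_def n_def
  proof (rule integral_cong)
    fix s assume s: "s \<in> {0..L}"
    show "drag Ct Cn (tang (0, \<beta>) s) (velf (0, \<beta>) s) \<bullet> lift (0, \<beta>) s = Cn * F s"
      using inner_or_outer[of s]
    proof
      assume "\<bar>s - L / 2\<bar> \<le> L / 4"
      then show ?thesis
        unfolding velf_base[OF s] lift_def by (simp add: tang_base drag_def inner_2)
    next
      assume "\<bar>s - L / 2\<bar> \<ge> L / 4"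
      then show ?thesis unfolding velf_base[OF s] by (simp add: outer)
    qed
  qed
  have "0 < n"
    unfolding n_def
  proof (rule integral_pos[of _ _ _ "5 * L / 8"])
    show "continuous_on {0..L} (\<lambda>s. Cn * F s)" by (intro continuous_intros cF)
  qed (use L0 C0 F_pos(2)[OF e] F_nz in auto)
  \<comment> \<open>A straight segment moving along its normal meets the largest coefficient
    \<open>Cn\<close> everywhere; tilting the outer quarters reduces it by \<open>Cn - Ct\<close>
    times the square of a sine.\<close>
  have D1: "form lift lift (0, r) \<noteq> form lift lift (0, 0)" if r: "0 < r" "r * g L \<le> 1" for r
  proof -
    define q where "q p s = drag Ct Cn (tang p s) (lift p s) \<bullet> lift p s" for p s
    have cq: "continuous_on {0..L} (q p)" for p
      unfolding q_def by (intro continuous_integrand) (simp_all add: lift_def[abs_def])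
    have d: "q (0, 0) s - q (0, r) s = (Cn - Ct) * (sin (r * g s))\<^sup>2" for s
      unfolding q_def self by (simp add: tang_def rot_comp)
    have "0 < integral {0..L} (\<lambda>s. q (0, 0) s - q (0, r) s)"
    proof (rule integral_pos[of _ _ _ L])
      show "continuous_on {0..L} (\<lambda>s. q (0, 0) s - q (0, r) s)" by (intro continuous_on_diff cq)
      show "0 \<le> q (0, 0) s - q (0, r) s" for s unfolding d using C0 by simp
      have "0 < sin (r * g L)" using r g_end by (intro small_angle_pos) auto
      then show "q (0, 0) L - q (0, r) L \<noteq> 0" unfolding d using C0 by simp
    qed (use L0 in auto)
    moreover have "integral {0..L} (\<lambda>s. q (0, 0) s - q (0, r) s) = form lift lift (0, 0) - form lift lift (0, r)"
      unfolding form_def q_def[symmetric] by (intro integral_diff integrable_continuous_real cq)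
    ultimately show ?thesis by linarith
  qed
  have cl: "continuous_on ({0..L} \<times> UNIV) (\<lambda>q. lift (snd q) (fst q))" "continuous_on {0..L} (lift p)" for p
    by (simp_all add: lift_def[abs_def])
  have nz: "n \<noteq> 0" using \<open>0 < n\<close> by simp
  have "\<exists>X (a0::real). continuous_on {0..a0} X \<and> (\<exists>a\<in>{0..a0}. X a \<noteq> X 0) \<and> (\<forall>a\<in>{0..a0}. drifts lift (X a))"
    by (rule loop_exists[of lift n C, OF cl lift_positive nf nz D2 G2 D1])
  then obtain X and a0 :: real where "continuous_on {0..a0} X" "\<exists>a\<in>{0..a0}. X a \<noteq> X 0" and
    ex: "\<forall>a\<in>{0..a0}. drifts lift (X a)"
    by (elim exE conjE) (rule that; assumption)
  moreover have "reach L \<rho> Ct Cn (segment L) (\<lambda>s. X a *\<^sub>R axis 2 1 + segment L s)" if a: "a \<in> {0..a0}" for a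
  proof -
    have "drifts lift (X a)" using ex a by blast
    then obtain r x x' y y' u where
      h: "\<forall>\<alpha>\<in>{-r..r}. \<forall>\<beta>\<in>{0..r}. \<forall>s\<in>{0..L}. \<bar>\<alpha> * f' s + \<beta> * g' s\<bar> \<le> min (1 / (2 * L)) (1 / (4 * \<rho>))"
      "\<forall>t\<in>{0..1}. x t \<in> {-r..r} \<and> y t \<in> {0..r}"
      "\<forall>t\<in>{0..1}. (x has_real_derivative x' t) (at t within {0..1})"
      "\<forall>t\<in>{0..1}. (y has_real_derivative y' t) (at t within {0..1})"
      and h': "continuous_on {0..1} x'" "continuous_on {0..1} y'" "x 0 = 0" "x 1 = 0" "y 0 = 0" "y 1 = 0"
      and u: "continuous_on {0..1} u" "integral {0..1} u = X a"
      and eq: "\<forall>t\<in>{0..1}. x' t * form lift velf (x t, y t) + y' t * form lift velg (x t, y t) + u t * form lift lift (x t, y t) = 0"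
      unfolding drifts_def by (elim exE conjE) (rule that; assumption)
    have cu: "continuous_on {0..1} (\<lambda>t. u t *\<^sub>R (axis 2 1 :: real^2))" by (intro continuous_intros u)
    have "reach L \<rho> Ct Cn (segment L)
        (\<lambda>s. integral {0..1} (\<lambda>v. rot (integral {0..v} (\<lambda>_. 0)) (u v *\<^sub>R axis 2 1)) + rot (integral {0..1::real} (\<lambda>_. 0)) (segment L s))"
      by (rule loop_reach[where w = "\<lambda>_. 0" and v = "\<lambda>t. u t *\<^sub>R axis 2 1", OF h[rule_format] h' cu continuous_on_const balanced_lift[OF e eq[rule_format]]])
    moreover have "integral {0..1} (\<lambda>v. u v *\<^sub>R (axis 2 1 :: real^2)) = X a *\<^sub>R axis 2 1"
      using integral_linear[OF integrable_continuous_real[OF u(1)] bounded_linear_scaleR_left, of "axis 2 1"] u(2)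
      by (simp add: o_def)
    ultimately show ?thesis by simp
  qed
  ultimately show ?thesis by blast
qed

end

section \<open>Explicit bending functions for the two gaits\<close>

lemma max_sq_derivative: "((\<lambda>x. (max 0 x)\<^sup>2) has_real_derivative 2 * max 0 x) (at (x::real))"
  using ramp_derivative[of 0 1 x UNIV] by simp

lemma max_cube_derivative: "((\<lambda>x. (max 0 x) ^ 3) has_real_derivative 3 * (max 0 x)\<^sup>2) (at (x::real))"
proof -
  have d: "((\<lambda>x. (max 0 x)\<^sup>2 * x) has_real_derivative 2 * max 0 x * x + 1 * (max 0 x)\<^sup>2) (at x)"
    by (rule DERIV_mult[OF max_sq_derivative DERIV_ident])
  have f: "(\<lambda>x. (max 0 x)\<^sup>2 * x) = (\<lambda>x::real. (max 0 x) ^ 3)"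
    by (auto simp: max_def fun_eq_iff power2_eq_square power3_eq_cube)
  have e: "2 * max 0 x * x + 1 * (max 0 x)\<^sup>2 = 3 * (max 0 x)\<^sup>2"
    by (auto simp: max_def power2_eq_square)
  show ?thesis using d unfolding e f .
qed

text \<open>With \<open>z = s - L / 2\<close>, the choice is \<open>F = z * m^3\<close> and
  \<open>g = M^2\<close>, where m and \<open>M\<close> are the positive parts of
  \<open>P - z\<^sup>2\<close> and \<open>z\<^sup>2 - P\<close>. The cube makes \<open>F\<close>
  twice and the square makes g once continuously differentiable. The factor z makes f, as the
  derivative of an odd function, even.\<close>

lemma reach_rotated_segment:
  assumes pos: "0 < L" "0 < \<rho>" "0 < Ct" "Ct < Cn"
  shows "\<exists>X (a0::real). continuous_on {0..a0} X \<and> (\<exists>a\<in>{0..a0}. X a \<noteq> X 0) \<and>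
    (\<forall>a\<in>{0..a0}. reach L \<rho> Ct Cn (segment L) (\<lambda>s. rot (X a) (segment L s)))"
proof -
  define P where "P = (L / 4)\<^sup>2"
  define m where "m z = max 0 (P - z\<^sup>2)" for z
  define M where "M z = max 0 (z\<^sup>2 - P)" for z
  have dm3: "((\<lambda>s. m (s - L / 2) ^ 3) has_real_derivative - 6 * (s - L / 2) * (m (s - L / 2))\<^sup>2) (at s)" for s
    unfolding m_def
    by (rule DERIV_chain2[OF max_cube_derivative, THEN DERIV_cong]) (auto intro!: derivative_eq_intros)
  have dm2: "((\<lambda>s. (m (s - L / 2))\<^sup>2) has_real_derivative - 4 * (s - L / 2) * m (s - L / 2)) (at s)" for s
    unfolding m_def
    by (rule DERIV_chain2[OF max_sq_derivative, THEN DERIV_cong]) (auto intro!: derivative_eq_intros)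
  have dM2: "((\<lambda>s. (M (s - L / 2))\<^sup>2) has_real_derivative 4 * (s - L / 2) * M (s - L / 2)) (at s)" for s
    unfolding M_def
    by (rule DERIV_chain2[OF max_sq_derivative, THEN DERIV_cong]) (auto intro!: derivative_eq_intros)
  have sq: "\<bar>z\<bar> \<le> L / 4 \<longleftrightarrow> z\<^sup>2 \<le> P" "L / 4 \<le> \<bar>z\<bar> \<longleftrightarrow> P \<le> z\<^sup>2" for z
    using pos abs_le_square_iff[of z "L / 4"] abs_le_square_iff[of "L / 4" z] by (auto simp: P_def)
  have even: "m (- z) = m z" "M (- z) = M z" for z by (simp_all add: m_def M_def)
  have refl: "L - s - L / 2 = - (s - L / 2)" for s by simp
  have d1: "((\<lambda>s. (s - L / 2)) has_real_derivative 1) (at s)" for s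
    by (auto intro!: derivative_eq_intros)
  have d2: "((\<lambda>s. 6 * (s - L / 2)\<^sup>2) has_real_derivative 12 * (s - L / 2)) (at s)" for s
    by (auto intro!: derivative_eq_intros)
  have poly1: "1 * m ^ 3 + - 6 * z * m\<^sup>2 * z = m ^ 3 - 6 * z\<^sup>2 * m\<^sup>2" for z m :: real
    by algebra
  have poly2: "- 6 * z * m\<^sup>2 - (12 * z * m\<^sup>2 + - 4 * z * m * (6 * z\<^sup>2)) = - 18 * z * m\<^sup>2 + 24 * z ^ 3 * m" for z m :: real
    by algebra
  interpret gait L \<rho> Ct Cn 1
    "\<lambda>s. (s - L / 2) * m (s - L / 2) ^ 3"
    "\<lambda>s. m (s - L / 2) ^ 3 - 6 * (s - L / 2)\<^sup>2 * (m (s - L / 2))\<^sup>2"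
    "\<lambda>s. - 18 * (s - L / 2) * (m (s - L / 2))\<^sup>2 + 24 * (s - L / 2) ^ 3 * m (s - L / 2)"
    "\<lambda>s. (M (s - L / 2))\<^sup>2" "\<lambda>s. 4 * (s - L / 2) * M (s - L / 2)"
  proof
    fix s
    show "((\<lambda>s. (s - L / 2) * m (s - L / 2) ^ 3) has_real_derivative
        m (s - L / 2) ^ 3 - 6 * (s - L / 2)\<^sup>2 * (m (s - L / 2))\<^sup>2) (at s)"
      by (rule DERIV_cong[OF DERIV_mult[OF d1 dm3]]) (rule poly1)
    show "((\<lambda>s. m (s - L / 2) ^ 3 - 6 * (s - L / 2)\<^sup>2 * (m (s - L / 2))\<^sup>2) has_real_derivative
        - 18 * (s - L / 2) * (m (s - L / 2))\<^sup>2 + 24 * (s - L / 2) ^ 3 * m (s - L / 2)) (at s)"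
      by (rule DERIV_cong[OF DERIV_diff[OF dm3 DERIV_mult[OF d2 dm2]]]) (rule poly2)
    show "((\<lambda>s. (M (s - L / 2))\<^sup>2) has_real_derivative 4 * (s - L / 2) * M (s - L / 2)) (at s)" by (rule dM2)
  next
    show "continuous_on UNIV (\<lambda>s. - 18 * (s - L / 2) * (m (s - L / 2))\<^sup>2 + 24 * (s - L / 2) ^ 3 * m (s - L / 2))"
      "continuous_on UNIV (\<lambda>s. 4 * (s - L / 2) * M (s - L / 2))"
      unfolding m_def M_def by (intro continuous_intros)+
  next
    fix s assume "s \<in> {L / 2..L}"
    then have "(s - L / 2)\<^sup>2 \<le> (L - L / 2)\<^sup>2" by (intro power_mono) auto
    then have "M (s - L / 2) \<le> M (L - L / 2)" by (auto simp: M_def)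
    then show "0 \<le> (M (s - L / 2))\<^sup>2 \<and> (M (s - L / 2))\<^sup>2 \<le> (M (L - L / 2))\<^sup>2"
      by (auto simp: M_def intro!: power_mono)
  next
    have "P < (L - L / 2)\<^sup>2" using pos by (simp add: P_def power2_eq_square)
    then show "0 < (M (L - L / 2))\<^sup>2" by (simp add: M_def)
    have "0 < m (5 * L / 8 - L / 2)" using pos by (simp add: m_def P_def power2_eq_square field_simps)
    then show "(5 * L / 8 - L / 2) * m (5 * L / 8 - L / 2) ^ 3 \<noteq> 0" using pos by simp
  next
    fix s
    show "0 \<le> (s - L / 2) * m (s - L / 2) ^ 3 * (s - L / 2)"
      using mult_nonneg_nonneg[of "m (s - L / 2) ^ 3" "(s - L / 2)\<^sup>2"]
      by (simp add: m_def power2_eq_square mult_ac)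
  qed (use pos sq in \<open>auto simp: refl even m_def M_def power2_commute[of "L / 2"]\<close>)
  show ?thesis by (rule rotation_gait) simp
qed

text \<open>The same cut-offs are used with opposite parity: \<open>F = z^2 * m^3\<close> and
  \<open>g = z * M^2\<close> for \<open>z = s - L / 2\<close>. The factor \<open>z^2\<close> makes
  \<open>F\<close> vanish at the midpoint, where shapes are anchored, and keeps it nonnegative, so
  that the normal force does not cancel.\<close>

lemma reach_lifted_segment:
  assumes pos: "0 < L" "0 < \<rho>" "0 < Ct" "Ct < Cn"
  shows "\<exists>X (a0::real). continuous_on {0..a0} X \<and> (\<exists>a\<in>{0..a0}. X a \<noteq> X 0) \<and>
    (\<forall>a\<in>{0..a0}. reach L \<rho> Ct Cn (segment L) (\<lambda>s. X a *\<^sub>R axis 2 1 + segment L s))"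
proof -
  define P where "P = (L / 4)\<^sup>2"
  define m where "m z = max 0 (P - z\<^sup>2)" for z
  define M where "M z = max 0 (z\<^sup>2 - P)" for z
  have dm3: "((\<lambda>s. m (s - L / 2) ^ 3) has_real_derivative - 6 * (s - L / 2) * (m (s - L / 2))\<^sup>2) (at s)" for s
    unfolding m_def
    by (rule DERIV_chain2[OF max_cube_derivative, THEN DERIV_cong]) (auto intro!: derivative_eq_intros)
  have dm2: "((\<lambda>s. (m (s - L / 2))\<^sup>2) has_real_derivative - 4 * (s - L / 2) * m (s - L / 2)) (at s)" for s
    unfolding m_def
    by (rule DERIV_chain2[OF max_sq_derivative, THEN DERIV_cong]) (auto intro!: derivative_eq_intros)
  have dM2: "((\<lambda>s. (M (s - L / 2))\<^sup>2) has_real_derivative 4 * (s - L / 2) * M (s - L / 2)) (at s)" for s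
    unfolding M_def
    by (rule DERIV_chain2[OF max_sq_derivative, THEN DERIV_cong]) (auto intro!: derivative_eq_intros)
  have sq: "\<bar>z\<bar> \<le> L / 4 \<longleftrightarrow> z\<^sup>2 \<le> P" "L / 4 \<le> \<bar>z\<bar> \<longleftrightarrow> P \<le> z\<^sup>2" for z
    using pos abs_le_square_iff[of z "L / 4"] abs_le_square_iff[of "L / 4" z] by (auto simp: P_def)
  have even: "m (- z) = m z" "M (- z) = M z" for z by (simp_all add: m_def M_def)
  have refl: "L - s - L / 2 = - (s - L / 2)" for s by simp
  have d0: "((\<lambda>s. (s - L / 2)) has_real_derivative 1) (at s)" for s
    by (auto intro!: derivative_eq_intros)
  have d1: "((\<lambda>s. 2 * (s - L / 2)) has_real_derivative 2) (at s)" for s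
    by (auto intro!: derivative_eq_intros)
  have d2: "((\<lambda>s. (s - L / 2)\<^sup>2) has_real_derivative 2 * (s - L / 2)) (at s)" for s
    by (auto intro!: derivative_eq_intros)
  have d3: "((\<lambda>s. 6 * (s - L / 2) ^ 3) has_real_derivative 18 * (s - L / 2)\<^sup>2) (at s)" for s
    by (auto intro!: derivative_eq_intros)
  have poly1: "2 * z * m ^ 3 + - 6 * z * m\<^sup>2 * z\<^sup>2 = 2 * z * m ^ 3 - 6 * z ^ 3 * m\<^sup>2" for z m :: real
    by algebra
  have poly2: "2 * m ^ 3 + - 6 * z * m\<^sup>2 * (2 * z) - (18 * z\<^sup>2 * m\<^sup>2 + - 4 * z * m * (6 * z ^ 3)) =
      2 * m ^ 3 - 30 * z\<^sup>2 * m\<^sup>2 + 24 * z ^ 4 * m" for z m :: real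
    by algebra
  have poly3: "1 * M\<^sup>2 + 4 * z * M * z = M\<^sup>2 + 4 * z\<^sup>2 * M" for z M :: real
    by algebra
  interpret gait L \<rho> Ct Cn "- 1"
    "\<lambda>s. (s - L / 2)\<^sup>2 * m (s - L / 2) ^ 3"
    "\<lambda>s. 2 * (s - L / 2) * m (s - L / 2) ^ 3 - 6 * (s - L / 2) ^ 3 * (m (s - L / 2))\<^sup>2"
    "\<lambda>s. 2 * m (s - L / 2) ^ 3 - 30 * (s - L / 2)\<^sup>2 * (m (s - L / 2))\<^sup>2 + 24 * (s - L / 2) ^ 4 * m (s - L / 2)"
    "\<lambda>s. (s - L / 2) * (M (s - L / 2))\<^sup>2" "\<lambda>s. (M (s - L / 2))\<^sup>2 + 4 * (s - L / 2)\<^sup>2 * M (s - L / 2)"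
  proof
    fix s
    show "((\<lambda>s. (s - L / 2)\<^sup>2 * m (s - L / 2) ^ 3) has_real_derivative
        2 * (s - L / 2) * m (s - L / 2) ^ 3 - 6 * (s - L / 2) ^ 3 * (m (s - L / 2))\<^sup>2) (at s)"
      by (rule DERIV_cong[OF DERIV_mult[OF d2 dm3]]) (rule poly1)
    show "((\<lambda>s. 2 * (s - L / 2) * m (s - L / 2) ^ 3 - 6 * (s - L / 2) ^ 3 * (m (s - L / 2))\<^sup>2) has_real_derivative
        2 * m (s - L / 2) ^ 3 - 30 * (s - L / 2)\<^sup>2 * (m (s - L / 2))\<^sup>2 + 24 * (s - L / 2) ^ 4 * m (s - L / 2)) (at s)"
      by (rule DERIV_cong[OF DERIV_diff[OF DERIV_mult[OF d1 dm3] DERIV_mult[OF d3 dm2]]]) (rule poly2)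
    show "((\<lambda>s. (s - L / 2) * (M (s - L / 2))\<^sup>2) has_real_derivative (M (s - L / 2))\<^sup>2 + 4 * (s - L / 2)\<^sup>2 * M (s - L / 2)) (at s)"
      by (rule DERIV_cong[OF DERIV_mult[OF d0 dM2]]) (rule poly3)
  next
    show "continuous_on UNIV (\<lambda>s. 2 * m (s - L / 2) ^ 3 - 30 * (s - L / 2)\<^sup>2 * (m (s - L / 2))\<^sup>2 + 24 * (s - L / 2) ^ 4 * m (s - L / 2))"
      "continuous_on UNIV (\<lambda>s. (M (s - L / 2))\<^sup>2 + 4 * (s - L / 2)\<^sup>2 * M (s - L / 2))"
      unfolding m_def M_def by (intro continuous_intros)+
  next
    fix s assume s: "s \<in> {L / 2..L}"
    then have "(s - L / 2)\<^sup>2 \<le> (L - L / 2)\<^sup>2" by (intro power_mono) auto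
    then have "M (s - L / 2) \<le> M (L - L / 2)" by (auto simp: M_def)
    then have "(M (s - L / 2))\<^sup>2 \<le> (M (L - L / 2))\<^sup>2" by (auto simp: M_def intro!: power_mono)
    then show "0 \<le> (s - L / 2) * (M (s - L / 2))\<^sup>2 \<and> (s - L / 2) * (M (s - L / 2))\<^sup>2 \<le> (L - L / 2) * (M (L - L / 2))\<^sup>2"
      using s by (intro conjI mult_nonneg_nonneg mult_mono) auto
  next
    have "P < (L - L / 2)\<^sup>2" using pos by (simp add: P_def power2_eq_square)
    then have "0 < (M (L - L / 2))\<^sup>2" by (simp add: M_def)
    then show "0 < (L - L / 2) * (M (L - L / 2))\<^sup>2" using pos by simp
    have "0 < m (5 * L / 8 - L / 2)" using pos by (simp add: m_def P_def power2_eq_square field_simps)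
    then show "(5 * L / 8 - L / 2)\<^sup>2 * m (5 * L / 8 - L / 2) ^ 3 \<noteq> 0" using pos by simp
  next
    fix s
    show "0 \<le> (s - L / 2)\<^sup>2 * m (s - L / 2) ^ 3" by (simp add: m_def)
  next
    fix s
    show "2 * (L - s - L / 2) * m (L - s - L / 2) ^ 3 - 6 * (L - s - L / 2) ^ 3 * (m (L - s - L / 2))\<^sup>2 =
        - 1 * (2 * (s - L / 2) * m (s - L / 2) ^ 3 - 6 * (s - L / 2) ^ 3 * (m (s - L / 2))\<^sup>2)"
      unfolding refl even by algebra
    show "(L - s - L / 2) * (M (L - s - L / 2))\<^sup>2 = - 1 * ((s - L / 2) * (M (s - L / 2))\<^sup>2)"
      unfolding refl even by algebra
  qed (use pos sq in \<open>auto simp: refl even m_def M_def power2_commute[of "L / 2"]\<close>)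
  show ?thesis by (rule lift_gait) simp
qed

section \<open>Rigid copies of the straight segment\<close>

lemma reach_any_rotation:
  assumes pos: "0 < L" "0 < \<rho>" "0 < Ct" "Ct < Cn"
  shows "reach L \<rho> Ct Cn (segment L) (\<lambda>s. rot \<theta> (segment L s))"
proof -
  \<comment> \<open>The attainable angles form an additive group: a motion can be repeated from any
    rotated copy, and reversed, because the balance is invariant.\<close>
  define S where "S = {\<theta>. reach L \<rho> Ct Cn (segment L) (\<lambda>s. rot \<theta> (segment L s))}"
  have mv: "reach L \<rho> Ct Cn (\<lambda>s. rot x (segment L s)) (\<lambda>s. rot (x + y) (segment L s))" if "y \<in> S" for x y
    using reach_rigid[of L \<rho> Ct Cn "segment L" "\<lambda>s. rot y (segment L s)" 0 x] that by (simp add: S_def)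
  have add: "x + y \<in> S" if "x \<in> S" "y \<in> S" for x y
    using reach_trans[OF _ mv[OF that(2), of x] pos(1)] that(1) by (simp add: S_def)
  have neg: "- x \<in> S" if "x \<in> S" for x
    using reach_sym[OF mv[OF that, of "- x"]] by (simp add: S_def)
  from reach_rotated_segment[OF pos] obtain X and a0 :: real
    where X0: "continuous_on {0..a0} X" "\<exists>a\<in>{0..a0}. X a \<noteq> X 0" and
      X1: "\<forall>a\<in>{0..a0}. reach L \<rho> Ct Cn (segment L) (\<lambda>s. rot (X a) (segment L s))"
    by (elim exE conjE) (rule that; assumption)
  have X: "X a \<in> S" if "a \<in> {0..a0}" for a
    using X1 that by (simp add: S_def del: atLeastAtMost_iff)
  have "X a - X 0 \<in> S" if "a \<in> {0..a0}" for a
    using add[OF X[OF that] neg[OF X[of 0]]] that by auto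
  then have "\<theta> \<in> S" using X0(2) add_closed_continuum[OF add neg X0(1)] by blast
  then show ?thesis by (simp add: S_def)
qed

lemma reach_any_lift:
  assumes pos: "0 < L" "0 < \<rho>" "0 < Ct" "Ct < Cn"
  shows "reach L \<rho> Ct Cn (segment L) (\<lambda>s. u *\<^sub>R axis 2 1 + segment L s)"
proof -
  define S where "S = {u. reach L \<rho> Ct Cn (segment L) (\<lambda>s. u *\<^sub>R axis 2 1 + segment L s)}"
  have mv: "reach L \<rho> Ct Cn (\<lambda>s. x *\<^sub>R axis 2 1 + segment L s) (\<lambda>s. (x + y) *\<^sub>R axis 2 1 + segment L s)" if "y \<in> S" for x y
    using reach_rigid[of L \<rho> Ct Cn "segment L" "\<lambda>s. y *\<^sub>R axis 2 1 + segment L s" "x *\<^sub>R axis 2 1" 0] that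
    by (simp add: S_def scaleR_add_left add.assoc)
  have add: "x + y \<in> S" if "x \<in> S" "y \<in> S" for x y
    using reach_trans[OF _ mv[OF that(2), of x] pos(1)] that(1) by (simp add: S_def)
  have neg: "- x \<in> S" if "x \<in> S" for x
    using reach_sym[OF mv[OF that, of "- x"]] by (simp add: S_def)
  from reach_lifted_segment[OF pos] obtain X and a0 :: real
    where X0: "continuous_on {0..a0} X" "\<exists>a\<in>{0..a0}. X a \<noteq> X 0" and
      X1: "\<forall>a\<in>{0..a0}. reach L \<rho> Ct Cn (segment L) (\<lambda>s. X a *\<^sub>R axis 2 1 + segment L s)"
    by (elim exE conjE) (rule that; assumption)
  have X: "X a \<in> S" if "a \<in> {0..a0}" for a
    using X1 that by (simp add: S_def del: atLeastAtMost_iff)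
  have "X a - X 0 \<in> S" if "a \<in> {0..a0}" for a
    using add[OF X[OF that] neg[OF X[of 0]]] that by auto
  then have "u \<in> S" using X0(2) add_closed_continuum[OF add neg X0(1)] by blast
  then show ?thesis by (simp add: S_def)
qed

text \<open>Only translations along the normal are available, so the segment is first turned until
  its normal points along p, then moved by \<open>norm p\<close>, then turned to the final
  angle.\<close>

lemma reach_any_placement:
  assumes pos: "0 < L" "0 < \<rho>" "0 < Ct" "Ct < Cn"
  shows "reach L \<rho> Ct Cn (segment L) (\<lambda>s. p + rot \<theta> (segment L s))"
proof -
  obtain \<alpha> where \<alpha>: "p = norm p *\<^sub>R rot \<alpha> (axis 2 1)" using polar_e2 by blast
  have 1: "reach L \<rho> Ct Cn (segment L) (\<lambda>s. rot \<alpha> (segment L s))" by (rule reach_any_rotation[OF pos])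
  have 2: "reach L \<rho> Ct Cn (\<lambda>s. rot \<alpha> (segment L s)) (\<lambda>s. p + rot \<alpha> (segment L s))"
    using reach_rigid[OF reach_any_lift[OF pos, of "norm p"], of 0 \<alpha>]
    by (simp add: rot_linear_simps flip: \<alpha>)
  have 3: "reach L \<rho> Ct Cn (\<lambda>s. p + rot \<alpha> (segment L s)) (\<lambda>s. p + rot \<theta> (segment L s))"
    using reach_rigid[OF reach_any_rotation[OF pos, of "\<theta> - \<alpha>"], of p \<alpha>] by simp
  show ?thesis by (rule reach_trans[OF reach_trans[OF 1 2 pos(1)] 3 pos(1)])
qed

lemma reach_between_thick_curves:
  assumes pos: "0 < L" "0 < \<rho>" "0 < Ct" "Ct < Cn"
    and A: "curve_data L A \<tau> h" "thick L \<rho> A \<tau>" and B: "curve_data L B \<tau>' h'" "thick L \<rho> B \<tau>'"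
  shows "reach L \<rho> Ct Cn A B"
proof -
  have C: "Ct \<le> Cn" using pos by simp
  obtain p \<theta> where a: "reach L \<rho> Ct Cn (\<lambda>s. p + rot \<theta> (segment L s)) A"
    using reach_from_segment[OF pos(3) C pos(1,2) A] by blast
  obtain p' \<theta>' where b: "reach L \<rho> Ct Cn (\<lambda>s. p' + rot \<theta>' (segment L s)) B"
    using reach_from_segment[OF pos(3) C pos(1,2) B] by blast
  have "reach L \<rho> Ct Cn A (segment L)"
    by (rule reach_trans[OF reach_sym[OF a] reach_sym[OF reach_any_placement[OF pos]] pos(1)])
  moreover have "reach L \<rho> Ct Cn (segment L) B"
    by (rule reach_trans[OF reach_any_placement[OF pos] b pos(1)])
  ultimately show ?thesis by (rule reach_trans[OF _ _ pos(1)])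
qed

section \<open>Sobolev functions of one variable\<close>

text \<open>\<open>C_k\<close> for functions of one variable, in a form for which products are easy to handle.\<close>

primrec diff_upto :: "nat \<Rightarrow> (real \<Rightarrow> real) \<Rightarrow> bool" where
  "diff_upto 0 f \<longleftrightarrow> continuous_on UNIV f"
| "diff_upto (Suc k) f \<longleftrightarrow> (\<exists>f'. (\<forall>x. (f has_real_derivative f' x) (at x)) \<and> diff_upto k f')"

lemma diff_upto_Suc: "diff_upto (Suc k) f \<Longrightarrow> diff_upto k f"
proof (induction k arbitrary: f)
  case 0
  then obtain f' where "\<And>x. (f has_real_derivative f' x) (at x)" by auto
  then have "continuous_on UNIV f" by (rule DERIV_continuous_on[OF has_field_derivative_at_within])
  then show ?case by simp
next
  case (Suc k)
  then show ?case by (metis diff_upto.simps(2))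
qed

lemma diff_upto_cmult: "diff_upto k f \<Longrightarrow> diff_upto k (\<lambda>x. c * f x)"
proof (induction k arbitrary: f)
  case 0
  then show ?case by (simp add: continuous_on_mult_left)
next
  case (Suc k)
  then obtain f' where "\<And>x. (f has_real_derivative f' x) (at x)" "diff_upto k f'" by auto
  then show ?case using Suc.IH[of f'] by (auto intro!: exI[of _ "\<lambda>x. c * f' x"] DERIV_cmult)
qed

lemma diff_upto_add: "diff_upto k f \<Longrightarrow> diff_upto k g \<Longrightarrow> diff_upto k (\<lambda>x. f x + g x)"
proof (induction k arbitrary: f g)
  case 0
  then show ?case by (simp add: continuous_on_add)
next
  case (Suc k)
  obtain f' where f: "\<And>x. (f has_real_derivative f' x) (at x)" "diff_upto k f'" using Suc.prems(1) by auto
  obtain g' where g: "\<And>x. (g has_real_derivative g' x) (at x)" "diff_upto k g'" using Suc.prems(2) by auto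
  show ?case
    using Suc.IH[OF f(2) g(2)] f(1) g(1) by (auto intro!: exI[of _ "\<lambda>x. f' x + g' x"] DERIV_add)
qed

lemma diff_upto_mult: "diff_upto k f \<Longrightarrow> diff_upto k g \<Longrightarrow> diff_upto k (\<lambda>x. f x * g x)"
proof (induction k arbitrary: f g)
  case 0
  then show ?case by (simp add: continuous_on_mult)
next
  case (Suc k)
  obtain f' where f: "\<And>x. (f has_real_derivative f' x) (at x)" "diff_upto k f'" using Suc.prems(1) by auto
  obtain g' where g: "\<And>x. (g has_real_derivative g' x) (at x)" "diff_upto k g'" using Suc.prems(2) by auto
  have "diff_upto k (\<lambda>x. f' x * g x + g' x * f x)"
    by (rule diff_upto_add[OF Suc.IH[OF f(2) diff_upto_Suc[OF Suc.prems(2)]] Suc.IH[OF g(2) diff_upto_Suc[OF Suc.prems(1)]]])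
  then show ?case
    unfolding diff_upto.simps
    by (intro exI[of _ "\<lambda>x. f' x * g x + g' x * f x"] conjI allI DERIV_mult[OF f(1) g(1)])
qed

lemma diff_upto_affine: "diff_upto k f \<Longrightarrow> diff_upto k (\<lambda>x. f (c * x + d))"
proof (induction k arbitrary: f)
  case 0
  then show ?case by (auto intro!: continuous_on_compose2[of UNIV f] continuous_intros)
next
  case (Suc k)
  then obtain f' where f: "\<And>x. (f has_real_derivative f' x) (at x)" "diff_upto k f'" by auto
  have "((\<lambda>x. f (c * x + d)) has_real_derivative f' (c * x + d) * c) (at x)" for x
    by (rule DERIV_chain2[OF f(1)]) (auto intro!: derivative_eq_intros)
  then have "((\<lambda>x. f (c * x + d)) has_real_derivative c * f' (c * x + d)) (at x)" for x
    by (rule DERIV_cong) (rule mult.commute)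
  moreover have "diff_upto k (\<lambda>x. c * f' (c * x + d))" by (rule diff_upto_cmult[OF Suc.IH[OF f(2)]])
  ultimately show ?case
    unfolding diff_upto.simps by (intro exI[of _ "\<lambda>x. c * f' (c * x + d)"] conjI allI)
qed

lemma frechet_derivative_real:
  fixes f :: "real \<Rightarrow> real"
  assumes "(f has_real_derivative d) (at x)"
  shows "frechet_derivative f (at x) v = v * d"
proof -
  have "(f has_derivative (*) d) (at x)" using assms by (simp add: has_field_derivative_def)
  then have "(*) d = frechet_derivative f (at x)" by (rule frechet_derivative_at)
  then show ?thesis by (metis mult.commute)
qed

lemma diff_upto_imp_C_k: "diff_upto k f \<Longrightarrow> C_k k f"
proof (induction k arbitrary: f)
  case 0
  then show ?case by simp
next
  case (Suc k)
  then obtain f' where f: "\<And>x. (f has_real_derivative f' x) (at x)" "diff_upto k f'" by auto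
  have "f differentiable at x" for x using f(1) real_differentiable_def by blast
  moreover have "C_k k (\<lambda>x. frechet_derivative f (at x) v)" for v
    unfolding frechet_derivative_real[OF f(1)] by (rule Suc.IH[OF diff_upto_cmult[OF f(2)]])
  ultimately show ?case by simp
qed

section \<open>Smooth cut-off functions\<close>

definition expcut :: "nat \<Rightarrow> real \<Rightarrow> real" where
  "expcut n x = (if 0 < x then exp (- inverse x) * inverse x ^ n else 0)"

lemma expcut_tendsto: "(expcut n \<longlongrightarrow> 0) (at 0)"
proof -
  have "((\<lambda>x. inverse x ^ n / exp (inverse x)) \<longlongrightarrow> 0) (at_right (0::real))"
    by (rule filterlim_compose[OF tendsto_power_div_exp_0 filterlim_inverse_at_top_right])
  moreover have "eventually (\<lambda>x. inverse x ^ n / exp (inverse x) = expcut n x) (at_right (0::real))"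
    by (rule eventually_at_rightI[of 0 1]) (auto simp: expcut_def exp_minus field_simps)
  ultimately have "(expcut n \<longlongrightarrow> 0) (at_right 0)" by (rule Lim_transform_eventually)
  moreover have "(expcut n \<longlongrightarrow> 0) (at_left 0)"
    by (rule tendsto_eventually, rule eventually_at_leftI[of "-1"]) (auto simp: expcut_def)
  ultimately show ?thesis by (simp add: filterlim_split_at)
qed

text \<open>The family indexed by n is closed under differentiation up to linear combinations, which
  makes smoothness of all orders an induction. Flatness at 0 comes from the exponential beating
  every power.\<close>

lemma expcut_derivative:
  "(expcut n has_real_derivative expcut (n + 2) x - real n * expcut (n + 1) x) (at x)"
proof -
  consider "x < 0" | "x = 0" | "0 < x" by linarith
  then show ?thesis
  proof cases
    case 1
    have "(expcut n has_real_derivative 0) (at x)"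
      by (rule has_field_derivative_transform_within_open[of "\<lambda>_. 0" 0 x "{..<0}"]) (use 1 in \<open>auto simp: expcut_def\<close>)
    then show ?thesis using 1 by (simp add: expcut_def)
  next
    case 2
    have "((\<lambda>y. (expcut n y - expcut n 0) / (y - 0)) \<longlongrightarrow> 0) (at 0)"
      by (rule Lim_transform_eventually[OF expcut_tendsto[of "Suc n"]])
        (auto simp: expcut_def eventually_at field_simps intro!: exI[of _ 1])
    then show ?thesis using 2 by (simp add: expcut_def has_field_derivative_iff)
  next
    case 3
    have e: "((\<lambda>x. exp (- inverse x)) has_real_derivative exp (- inverse x) * (inverse x)\<^sup>2) (at x)"
      by (rule DERIV_cong[OF DERIV_chain2[OF DERIV_exp DERIV_minus[OF DERIV_inverse]]]) (use 3 in \<open>auto simp: power2_eq_square\<close>)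
    have p: "((\<lambda>x. inverse x ^ n) has_real_derivative - (real n * inverse x ^ (n + 1))) (at x)"
      by (rule DERIV_cong[OF DERIV_power[OF DERIV_inverse]]) (use 3 in \<open>cases n; simp add: mult_ac\<close>)+
    have "((\<lambda>x. exp (- inverse x) * inverse x ^ n) has_real_derivative expcut (n + 2) x - real n * expcut (n + 1) x) (at x)"
      by (rule DERIV_cong[OF DERIV_mult[OF e p]]) (use 3 in \<open>simp add: expcut_def power_add power2_eq_square algebra_simps\<close>)
    then show ?thesis
      by (rule has_field_derivative_transform_within_open[of _ _ x "{0<..}"]) (use 3 in \<open>auto simp: expcut_def\<close>)
  qed
qed

lemma diff_upto_expcut: "diff_upto k (expcut n)"
proof (induction k arbitrary: n)
  case 0
  show ?case by (auto intro!: DERIV_continuous_on[OF has_field_derivative_at_within[OF expcut_derivative]])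
next
  case (Suc k)
  have "diff_upto k (\<lambda>x. expcut (n + 2) x + (- real n) * expcut (n + 1) x)"
    by (intro diff_upto_add diff_upto_cmult Suc.IH)
  then show ?case using expcut_derivative[of n]
    by (auto intro!: exI[of _ "\<lambda>x. expcut (n + 2) x - real n * expcut (n + 1) x"])
qed

lemma expcut_bounds: "0 \<le> expcut 0 x" "expcut 0 x \<le> 1"
  by (simp_all add: expcut_def)

lemma expcut_limit:
  "(\<lambda>n. expcut 0 (real (Suc n) * x)) \<longlonglongrightarrow> (if 0 < x then 1 else 0)"
proof (cases "0 < x")
  case True
  have "(\<lambda>n. exp (- (inverse (real (Suc n)) * inverse x))) \<longlonglongrightarrow> exp (- (0 * inverse x))"
    by (intro tendsto_intros LIMSEQ_inverse_real_of_nat)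
  then show ?thesis using True by (simp add: expcut_def del: of_nat_Suc)
next
  case False
  then have "\<not> 0 < real (Suc n) * x" for n by (simp add: zero_less_mult_iff del: of_nat_Suc)
  then show ?thesis using False by (simp add: expcut_def del: of_nat_Suc)
qed

definition bump :: "real \<Rightarrow> real \<Rightarrow> (real \<Rightarrow> real) \<Rightarrow> bool" where
  "bump a b \<psi> \<longleftrightarrow> (\<forall>k. diff_upto k \<psi>) \<and> (\<forall>x. x \<notin> {a..b} \<longrightarrow> \<psi> x = 0)"

lemma bump_continuous: "bump a b \<psi> \<Longrightarrow> continuous_on S \<psi>"
  unfolding bump_def using diff_upto.simps(1) continuous_on_subset subset_UNIV by blast

lemma bump_test_function:
  assumes "bump a b \<psi>" "0 < a" "b < L"
  shows "test_function {0<..<L} \<psi>"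
proof -
  have s: "{x. \<psi> x \<noteq> 0} \<subseteq> {a..b}" using assms unfolding bump_def by blast
  then have "closure {x. \<psi> x \<noteq> 0} \<subseteq> {a..b}" by (rule closure_minimal) simp
  moreover have "{a..b} \<subseteq> {0<..<L}" using assms by auto
  moreover have "bounded {x. \<psi> x \<noteq> 0}" using s bounded_subset bounded_closed_interval by blast
  ultimately show ?thesis
    using assms diff_upto_imp_C_k unfolding test_function_def bump_def by auto
qed

text \<open>These smooth functions supported in \<open>[a, b]\<close> tend to 1 in the interior as n
  grows and so approximate the indicator of the interval.\<close>

definition plateau :: "real \<Rightarrow> real \<Rightarrow> nat \<Rightarrow> real \<Rightarrow> real" where
  "plateau a b n x = expcut 0 (real (Suc n) * (x - a)) * expcut 0 (real (Suc n) * (b - x))"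

lemma bump_plateau: "bump a b (plateau a b n)"
  unfolding bump_def
proof (intro conjI allI impI)
  have e: "plateau a b n = (\<lambda>x. expcut 0 (real (Suc n) * x + (- real (Suc n) * a)) * expcut 0 ((- real (Suc n)) * x + real (Suc n) * b))"
    by (simp add: plateau_def[abs_def] algebra_simps)
  show "diff_upto k (plateau a b n)" for k
    unfolding e by (intro diff_upto_mult diff_upto_affine diff_upto_expcut)
  fix x assume "x \<notin> {a..b}"
  then have "real (Suc n) * (x - a) \<le> 0 \<or> real (Suc n) * (b - x) \<le> 0"
    by (auto simp: mult_le_0_iff simp del: of_nat_Suc)
  then show "plateau a b n x = 0" by (auto simp: plateau_def expcut_def simp del: of_nat_Suc)
qed

lemma plateau_bounds: "0 \<le> plateau a b n x" "plateau a b n x \<le> 1"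
  using expcut_bounds by (simp_all add: plateau_def mult_le_one)

lemma plateau_pos: "a < x \<Longrightarrow> x < b \<Longrightarrow> 0 < plateau a b n x"
  by (simp add: plateau_def expcut_def zero_less_mult_iff del: of_nat_Suc)

lemma plateau_limit: "a < x \<Longrightarrow> x < b \<Longrightarrow> (\<lambda>n. plateau a b n x) \<longlonglongrightarrow> 1"
  using tendsto_mult[OF expcut_limit[of "x - a"] expcut_limit[of "b - x"]] by (simp add: plateau_def)

section \<open>Testing against smooth functions of compact support\<close>

lemma absolutely_integrable_scaleR:
  fixes f :: "real \<Rightarrow> 'a::euclidean_space"
  assumes "continuous_on {a..b} \<psi>" "f absolutely_integrable_on {a..b}"
  shows "(\<lambda>x. \<psi> x *\<^sub>R f x) absolutely_integrable_on {a..b}"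
proof (rule absolutely_integrable_bounded_measurable_product[OF _ _ _ _ assms(2), of "(*\<^sub>R)" \<psi>])
  show "bilinear ((*\<^sub>R) :: real \<Rightarrow> 'a \<Rightarrow> 'a)"
    by (simp add: bilinear_conv_bounded_bilinear bounded_bilinear_scaleR)
  show "\<psi> \<in> borel_measurable (lebesgue_on {a..b})"
    by (rule continuous_imp_measurable_on_sets_lebesgue[OF assms(1)]) simp
  show "bounded (\<psi> ` {a..b})"
    by (intro compact_imp_bounded compact_continuous_image assms) simp
qed simp

text \<open>The weight vanishes on the symmetric difference of the two sets. This converts the
  Lebesgue integrals of \<open>has_weak_deriv\<close> into gauge integrals over compact
  sets.\<close>

lemma set_lebesgue_integral_support:
  fixes f :: "'b::euclidean_space \<Rightarrow> 'a::euclidean_space"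
  assumes z: "\<And>x. x \<in> U - S \<Longrightarrow> \<phi> x = 0" "\<And>x. x \<in> S - U \<Longrightarrow> \<phi> x = (0::real)"
    and i: "(\<lambda>x. \<phi> x *\<^sub>R f x) absolutely_integrable_on S"
  shows "(\<lambda>x. \<phi> x *\<^sub>R f x) absolutely_integrable_on U"
    "(LINT x:U|lebesgue. \<phi> x *\<^sub>R f x) = integral S (\<lambda>x. \<phi> x *\<^sub>R f x)"
proof -
  have e: "(\<lambda>x. indicator U x *\<^sub>R (\<phi> x *\<^sub>R f x)) = (\<lambda>x. indicator S x *\<^sub>R (\<phi> x *\<^sub>R f x))"
    using z by (fastforce simp: indicator_def)
  show "(\<lambda>x. \<phi> x *\<^sub>R f x) absolutely_integrable_on U"
    using i unfolding set_integrable_def e .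
  show "(LINT x:U|lebesgue. \<phi> x *\<^sub>R f x) = integral S (\<lambda>x. \<phi> x *\<^sub>R f x)"
    using set_lebesgue_integral_eq_integral(2)[OF i] unfolding set_lebesgue_integral_def e by simp
qed

lemma locally_integrable_Icc:
  fixes f :: "real \<Rightarrow> 'a::euclidean_space"
  shows "locally_integrable {0<..<L} f \<Longrightarrow> 0 < a \<Longrightarrow> b < L \<Longrightarrow> f absolutely_integrable_on {a..b}"
  unfolding locally_integrable_def
  by (elim allE[of _ "{a..b}"] impE) auto

lemma bump_pairing:
  fixes f :: "real \<Rightarrow> 'a::euclidean_space"
  assumes "locally_integrable {0<..<L} f" "0 < a" "b < L" "bump a b \<psi>"
  shows "(\<lambda>x. \<psi> x *\<^sub>R f x) absolutely_integrable_on {0<..<L}"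
    "(LINT x:{0<..<L}|lebesgue. \<psi> x *\<^sub>R f x) = integral {a..b} (\<lambda>x. \<psi> x *\<^sub>R f x)"
proof -
  have i: "(\<lambda>x. \<psi> x *\<^sub>R f x) absolutely_integrable_on {a..b}"
    by (intro absolutely_integrable_scaleR bump_continuous[OF assms(4)] locally_integrable_Icc[OF assms(1-3)])
  have z: "\<And>x. x \<in> {0<..<L} - {a..b} \<Longrightarrow> \<psi> x = 0" "\<And>x. x \<in> {a..b} - {0<..<L} \<Longrightarrow> \<psi> x = 0"
    using assms unfolding bump_def by auto
  show "(\<lambda>x. \<psi> x *\<^sub>R f x) absolutely_integrable_on {0<..<L}"
    "(LINT x:{0<..<L}|lebesgue. \<psi> x *\<^sub>R f x) = integral {a..b} (\<lambda>x. \<psi> x *\<^sub>R f x)"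
    by (rule set_lebesgue_integral_support[OF z i]; assumption)+
qed

text \<open>Plateaus as test functions show that f has integral 0 over every compact subinterval. By
  differentiation of the integral almost everywhere, f is then 0 almost everywhere.\<close>

lemma fundamental_lemma:
  fixes f :: "real \<Rightarrow> 'a::euclidean_space"
  assumes f: "locally_integrable {0<..<L} f"
    and z: "\<And>a b \<psi>. 0 < a \<Longrightarrow> a < b \<Longrightarrow> b < L \<Longrightarrow> bump a b \<psi> \<Longrightarrow> (LINT x:{0<..<L}|lebesgue. \<psi> x *\<^sub>R f x) = 0"
  shows "\<exists>N. negligible N \<and> (\<forall>x\<in>{0<..<L} - N. f x = 0)"
proof -
  have z0: "integral {a..b} f = 0" if ab: "0 < a" "a \<le> b" "b < L" for a b
  proof (cases "a = b")
    case False
    have fi: "f absolutely_integrable_on {a..b}" by (rule locally_integrable_Icc[OF f]) (use ab in auto)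
    have "(\<lambda>n. integral {a..b} (\<lambda>x. plateau a b n x *\<^sub>R f x)) \<longlonglongrightarrow> integral {a..b} f"
    proof (rule dominated_convergence_ae[of "{a, b}"])
      show "(\<lambda>x. plateau a b n x *\<^sub>R f x) integrable_on {a..b}" for n
        by (intro set_lebesgue_integral_eq_integral(1) absolutely_integrable_scaleR bump_continuous[OF bump_plateau] fi)
      show "(\<lambda>x. norm (f x)) integrable_on {a..b}" using fi absolutely_integrable_on_def by blast
      show "norm (plateau a b n x *\<^sub>R f x) \<le> norm (f x)" for n x
        using plateau_bounds[of a b n x] by (simp add: mult_left_le_one_le)
      show "(\<lambda>n. plateau a b n x *\<^sub>R f x) \<longlonglongrightarrow> f x" if "x \<in> {a..b} - {a, b}" for x
        using tendsto_scaleR[OF plateau_limit[of a x b] tendsto_const[of "f x"]] that by auto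
    qed simp
    moreover have "integral {a..b} (\<lambda>x. plateau a b n x *\<^sub>R f x) = 0" for n
      using z[OF ab(1) _ ab(3) bump_plateau[of a b n]] bump_pairing(2)[OF f ab(1,3) bump_plateau[of a b n]] ab False by simp
    ultimately show ?thesis by (simp add: LIMSEQ_const_iff)
  qed simp
  have "\<exists>N. negligible N \<and> (\<forall>x\<in>{a<..<b} - N. f x = 0)" if ab: "0 < a" "b < L" for a b
  proof -
    define F where "F x = (if x \<in> {a..b} then f x else 0)" for x
    have fi: "f integrable_on {a..b}"
      by (intro set_lebesgue_integral_eq_integral(1) locally_integrable_Icc[OF f] ab)
    then have "F integrable_on UNIV" unfolding F_def by (simp only: integrable_restrict_UNIV)
    then have "F integrable_on cbox c d" for c d by (rule integrable_on_subcbox) simp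
    then obtain N where N: "negligible N" "\<And>x e. x \<notin> N \<Longrightarrow> 0 < e \<Longrightarrow> \<exists>d>0. \<forall>h. 0 < h \<and> h < d \<longrightarrow>
        norm (integral (cbox x (x + h *\<^sub>R One)) F /\<^sub>R h ^ DIM(real) - F x) < e"
      using integrable_ccontinuous_explicit[of F] by blast
    have "f x = 0" if x: "x \<in> {a<..<b} - N" for x
    proof (rule ccontr)
      assume "f x \<noteq> 0"
      then obtain d where d: "0 < d" "\<And>h. 0 < h \<Longrightarrow> h < d \<Longrightarrow>
          norm (integral (cbox x (x + h *\<^sub>R One)) F /\<^sub>R h ^ DIM(real) - F x) < norm (f x)"
        using N(2)[of x "norm (f x)"] x by auto
      define h where "h = min (d / 2) (b - x)"
      have h: "0 < h" "h < d" "x + h \<le> b" using d x by (auto simp: h_def)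
      have "integral {x..x + h} F = integral {x..x + h} f"
        by (rule integral_cong) (use x h in \<open>auto simp: F_def\<close>)
      also have "\<dots> = 0" by (rule z0) (use x h ab in auto)
      finally show False using d(2)[OF h(1,2)] x by (simp add: F_def)
    qed
    then show ?thesis using N(1) by blast
  qed
  \<comment> \<open>The interval is exhausted by countably many compactly contained ones, each with
    its own null set; the first of them are empty, which does no harm.\<close>
  then have ex: "\<exists>N. \<forall>n. negligible (N n) \<and> (\<forall>x\<in>{L / real (n + 1)<..<L - L / real (n + 1)} - N n. f x = 0)" if "0 < L"
    by (intro choice allI) (use that in auto)
  show ?thesis
  proof (cases "0 < L")
    case True
    obtain N where N: "\<And>n. negligible (N n)"
      "\<And>n x. x \<in> {L / real (n + 1)<..<L - L / real (n + 1)} - N n \<Longrightarrow> f x = 0"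
    proof -
      obtain N where "\<forall>n. negligible (N n) \<and> (\<forall>x\<in>{L / real (n + 1)<..<L - L / real (n + 1)} - N n. f x = 0)"
        using ex[OF True] by blast
      then show thesis by (intro that[of N]) blast+
    qed
    have "f x = 0" if x: "x \<in> {0<..<L} - (\<Union>n. N n)" for x
    proof -
      have "0 < min x (L - x) / L" using x True by simp
      then obtain n where "inverse (real (Suc n)) < min x (L - x) / L" using reals_Archimedean by blast
      then have "L / real (n + 1) < min x (L - x)" using True by (simp add: field_simps)
      then show ?thesis using N(2)[of x n] x by auto
    qed
    then show ?thesis using negligible_Union_nat[of N] N(1) by blast
  qed (auto intro: exI[of _ "{}"])
qed

section \<open>Primitives and weak derivatives\<close>

lemma test_function_on_interval:
  assumes "0 < L" "test_function {0<..<L} \<phi>"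
  obtains a b \<phi>' where "0 < a" "b < L" "\<And>x. x \<notin> {a..b} \<Longrightarrow> \<phi> x = 0 \<and> \<phi>' x = 0"
    "\<And>x. (\<phi> has_real_derivative \<phi>' x) (at x)" "continuous_on UNIV \<phi>'" "\<And>x. frechet_derivative \<phi> (at x) 1 = \<phi>' x"
proof -
  define K where "K = closure {x. \<phi> x \<noteq> 0}"
  have K: "compact K" "K \<subseteq> {0<..<L}" and C: "C_k 1 \<phi>" using assms unfolding test_function_def K_def by blast+
  define \<phi>' where "\<phi>' x = frechet_derivative \<phi> (at x) 1" for x
  have d: "\<phi> differentiable at x" for x using C by simp
  have c: "continuous_on UNIV \<phi>'" using C by (simp add: \<phi>'_def[abs_def])
  have D: "(\<phi> has_real_derivative \<phi>' x) (at x)" for x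
  proof -
    obtain D where "(\<phi> has_real_derivative D) (at x)" using d real_differentiable_def by blast
    then show ?thesis using frechet_derivative_real[of \<phi> D x 1] by (simp add: \<phi>'_def)
  qed
  obtain a b where ab: "0 < a" "b < L" "K \<subseteq> {a..b}"
  proof (cases "K = {}")
    case True
    then show thesis using that[of "L / 2" "L / 2"] assms by simp
  next
    case False
    obtain a b where "a \<in> K" "b \<in> K" "\<And>x. x \<in> K \<Longrightarrow> a \<le> x \<and> x \<le> b"
      using compact_attains_inf[OF K(1) False] compact_attains_sup[OF K(1) False] by metis
    then have "0 < a" "b < L" "K \<subseteq> {a..b}" using K(2) by auto
    then show thesis by (rule that)
  qed
  have "\<phi> x = 0 \<and> \<phi>' x = 0" if x: "x \<notin> {a..b}" for x
  proof -
    have z: "\<phi> y = 0" if "y \<in> - {a..b}" for y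
      using that ab(3) closure_subset[of "{x. \<phi> x \<noteq> 0}"] unfolding K_def by blast
    have "(\<phi> has_real_derivative 0) (at x)"
      by (rule has_field_derivative_transform_within_open[of "\<lambda>_. 0" 0 x "- {a..b}"]) (use x z in auto)
    then show ?thesis using z x DERIV_unique[OF D] by auto
  qed
  then show thesis by (rule that[OF ab(1,2) _ D c]) (assumption, rule \<phi>'_def[symmetric])
qed

text \<open>For a continuous h this is the product rule and the fundamental theorem of calculus. A
  square integrable h is replaced by a continuous g close to it, and the defect \<open>D\<close>
  turns out to be smaller than any positive number.\<close>

lemma integral_by_parts_primitive:
  fixes \<tau> h :: "real \<Rightarrow> real^2"
  assumes L: "0 < L" and h: "h \<in> L2 {0<..<L}" and \<tau>: "\<And>s. s \<in> {0..L} \<Longrightarrow> \<tau> s = c + integral {0..s} h"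
    and d: "\<And>x. (\<phi> has_real_derivative \<phi>' x) (at x)" and c\<phi>': "continuous_on UNIV \<phi>'"
    and z: "\<phi> 0 = 0" "\<phi> L = 0"
  shows "integral {0..L} (\<lambda>s. \<phi>' s *\<^sub>R \<tau> s) = - integral {0..L} (\<lambda>s. \<phi> s *\<^sub>R h s)"
proof -
  have c\<phi>: "continuous_on S \<phi>" for S
    by (rule DERIV_continuous_on[OF has_field_derivative_at_within[OF d]])
  have cp: "continuous_on S \<phi>'" for S by (rule continuous_on_subset[OF c\<phi>']) simp
  obtain K where K: "0 \<le> K" "\<And>x. x \<in> {0..L} \<Longrightarrow> \<bar>\<phi> x\<bar> \<le> K \<and> \<bar>\<phi>' x\<bar> \<le> K"
  proof -
    have "bounded (\<phi> ` {0..L})" "bounded (\<phi>' ` {0..L})"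
      by (intro compact_imp_bounded compact_continuous_image c\<phi> cp compact_Icc)+
    then obtain a b where "\<forall>x\<in>{0..L}. \<bar>\<phi> x\<bar> \<le> a" "\<forall>x\<in>{0..L}. \<bar>\<phi>' x\<bar> \<le> b"
      unfolding bounded_iff by (auto simp: real_norm_def)
    then show thesis by (intro that[of "max 0 (max a b)"]) force+
  qed
  define D where "D = integral {0..L} (\<lambda>s. \<phi>' s *\<^sub>R \<tau> s) + integral {0..L} (\<lambda>s. \<phi> s *\<^sub>R h s)"
  have hi: "h integrable_on {0..s}" if "s \<in> {0..L}" for s using L2_integrable_on[OF h] that by auto
  have c\<tau>: "continuous_on {0..L} \<tau>"
  proof -
    have "continuous_on {0..L} (\<lambda>s. c + integral {0..s} h)"
      by (intro continuous_intros indefinite_integral_continuous_1 hi) (use L in auto)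
    then show ?thesis by (rule continuous_on_eq) (metis \<tau>)
  qed
  have smooth: "integral {0..L} (\<lambda>s. \<phi>' s *\<^sub>R (c + integral {0..s} g)) + integral {0..L} (\<lambda>s. \<phi> s *\<^sub>R g s) = 0"
    if cg: "continuous_on UNIV g" for g :: "real \<Rightarrow> real^2"
  proof -
    have cgS: "continuous_on S g" for S by (rule continuous_on_subset[OF cg]) simp
    have cG: "continuous_on {0..L} (\<lambda>s. c + integral {0..s} g)"
      by (intro continuous_intros indefinite_integral_continuous_1 integrable_continuous_real cgS)
    have "((\<lambda>s. \<phi> s *\<^sub>R (c + integral {0..s} g)) has_vector_derivative
        \<phi> s *\<^sub>R g s + \<phi>' s *\<^sub>R (c + integral {0..s} g)) (at s within {0..L})" if "s \<in> {0..L}" for s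
    proof (rule has_vector_derivative_scaleR)
      show "(\<phi> has_real_derivative \<phi>' s) (at s within {0..L})" by (rule has_field_derivative_at_within[OF d])
      show "((\<lambda>s. c + integral {0..s} g) has_vector_derivative g s) (at s within {0..L})"
        using has_vector_derivative_add[OF has_vector_derivative_const[of c] integral_has_vector_derivative[OF cgS that]] by simp
    qed
    then have "((\<lambda>s. \<phi> s *\<^sub>R g s + \<phi>' s *\<^sub>R (c + integral {0..s} g)) has_integral
        \<phi> L *\<^sub>R (c + integral {0..L} g) - \<phi> 0 *\<^sub>R (c + integral {0..0} g)) {0..L}"
      using L by (intro fundamental_theorem_of_calculus) auto
    then have "integral {0..L} (\<lambda>s. \<phi> s *\<^sub>R g s + \<phi>' s *\<^sub>R (c + integral {0..s} g)) = 0"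
      using z by (simp add: integral_unique)
    moreover have "integral {0..L} (\<lambda>s. \<phi> s *\<^sub>R g s + \<phi>' s *\<^sub>R (c + integral {0..s} g)) =
        integral {0..L} (\<lambda>s. \<phi> s *\<^sub>R g s) + integral {0..L} (\<lambda>s. \<phi>' s *\<^sub>R (c + integral {0..s} g))"
      by (intro integral_add integrable_continuous_real continuous_on_scaleR c\<phi> cp cgS cG)
    ultimately show ?thesis by (simp add: add.commute)
  qed
  have bound: "norm D \<le> (K * (L + 1)\<^sup>2) * \<delta>" if \<delta>: "0 < \<delta>" for \<delta>
  proof -
    obtain g where cg: "continuous_on UNIV g" and g: "integral {0..L} (\<lambda>x. (norm (h x - g x))\<^sup>2) < \<delta>\<^sup>2"
      using L2_approx_continuous[OF h, of "\<delta>\<^sup>2"] \<delta> by auto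
    have cgS: "continuous_on S g" for S by (rule continuous_on_subset[OF cg]) simp
    define d where "d s = h s - g s" for s
    have dL: "d \<in> L2 {0<..<L}" unfolding d_def by (intro L2_diff h L2_continuous cgS)
    have dai: "d absolutely_integrable_on {0..L}" by (rule L2_absolutely_integrable[OF dL])
    have dn: "(\<lambda>s. norm (d s)) integrable_on {0..L}" using dai absolutely_integrable_on_def by blast
    have dni: "(\<lambda>s. norm (d s)) integrable_on {0..s}" "d integrable_on {0..s}" if "s \<in> {0..L}" for s
      using integrable_subinterval_real[OF dn] L2_integrable_on[OF dL] that by auto
    define A where "A = integral {0..L} (\<lambda>s. norm (d s))"
    \<comment> \<open>The L1 norm of the error is bounded through
      \<open>norm (d s) \<le> \<delta> + (norm (d s))\<^sup>2 / \<delta>\<close>; with a squared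
      error below \<open>\<delta>\<^sup>2\<close> both terms are of order
      \<open>\<delta>\<close>.\<close>
    have "A \<le> integral {0..L} (\<lambda>s. \<delta> + (norm (d s))\<^sup>2 / \<delta>)"
      unfolding A_def
    proof (rule integral_le[OF dn])
      show "(\<lambda>s. \<delta> + (norm (d s))\<^sup>2 / \<delta>) integrable_on {0..L}"
        by (intro integrable_add integrable_on_divide L2_sq_integrable[OF dL]) auto
      fix s
      have "0 \<le> (norm (d s) - \<delta>)\<^sup>2" by simp
      then have "2 * \<delta> * norm (d s) \<le> \<delta>\<^sup>2 + (norm (d s))\<^sup>2" by (simp add: power2_eq_square algebra_simps)
      moreover have "0 \<le> \<delta> * norm (d s)" using \<delta> by simp
      ultimately have "\<delta> * norm (d s) \<le> \<delta>\<^sup>2 + (norm (d s))\<^sup>2" by linarith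
      then show "norm (d s) \<le> \<delta> + (norm (d s))\<^sup>2 / \<delta>" using \<delta> by (simp add: field_simps power2_eq_square)
    qed
    also have "\<dots> = L * \<delta> + integral {0..L} (\<lambda>s. (norm (d s))\<^sup>2) / \<delta>"
      using L by (subst integral_add) (auto intro: integrable_on_divide L2_sq_integrable[OF dL])
    also have "\<dots> \<le> L * \<delta> + \<delta>\<^sup>2 / \<delta>"
      using g \<delta> by (intro add_left_mono divide_right_mono) (auto simp: d_def)
    finally have A: "A \<le> (L + 1) * \<delta>" using \<delta> by (simp add: power2_eq_square algebra_simps)
    have Gd: "\<tau> s - (c + integral {0..s} g) = integral {0..s} d" if "s \<in> {0..L}" for s
      unfolding d_def \<tau>[OF that] by (simp add: integral_diff hi[OF that] integrable_continuous_real cgS)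
    have cG: "continuous_on {0..L} (\<lambda>s. c + integral {0..s} g)"
      by (intro continuous_intros indefinite_integral_continuous_1 integrable_continuous_real cgS)
    have nG: "norm (integral {0..s} d) \<le> A" if "s \<in> {0..L}" for s
    proof -
      have "norm (integral {0..s} d) \<le> integral {0..s} (\<lambda>s. norm (d s))"
        by (rule integral_norm_bound_integral[OF dni(2,1)[OF that]]) simp
      also have "\<dots> \<le> A" unfolding A_def by (rule integral_subset_le[OF _ dni(1)[OF that] dn]) (use that in auto)
      finally show ?thesis .
    qed
    have ad: "(\<lambda>s. \<phi> s *\<^sub>R d s) absolutely_integrable_on {0..L}" by (intro absolutely_integrable_scaleR c\<phi> dai)
    have ah: "(\<lambda>s. \<phi> s *\<^sub>R h s) absolutely_integrable_on {0..L}"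
      by (intro absolutely_integrable_scaleR c\<phi> L2_absolutely_integrable h)
    have "D = integral {0..L} (\<lambda>s. \<phi>' s *\<^sub>R (\<tau> s - (c + integral {0..s} g))) + integral {0..L} (\<lambda>s. \<phi> s *\<^sub>R d s)"
    proof -
      have "integral {0..L} (\<lambda>s. \<phi>' s *\<^sub>R (\<tau> s - (c + integral {0..s} g))) =
          integral {0..L} (\<lambda>s. \<phi>' s *\<^sub>R \<tau> s) - integral {0..L} (\<lambda>s. \<phi>' s *\<^sub>R (c + integral {0..s} g))"
        unfolding scaleR_diff_right by (intro integral_diff integrable_continuous_real continuous_on_scaleR cp c\<tau> cG)
      moreover have "integral {0..L} (\<lambda>s. \<phi> s *\<^sub>R d s) = integral {0..L} (\<lambda>s. \<phi> s *\<^sub>R h s) - integral {0..L} (\<lambda>s. \<phi> s *\<^sub>R g s)"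
        unfolding d_def scaleR_diff_right
        by (intro integral_diff set_lebesgue_integral_eq_integral(1)[OF ah] integrable_continuous_real continuous_on_scaleR c\<phi> cgS)
      ultimately show ?thesis using smooth[OF cg] unfolding D_def by (simp add: algebra_simps add_eq_0_iff)
    qed
    also have "norm \<dots> \<le> K * A * L + K * A"
    proof (rule order_trans[OF norm_triangle_ineq], rule add_mono)
      have "norm (integral {0..L} (\<lambda>s. \<phi>' s *\<^sub>R (\<tau> s - (c + integral {0..s} g)))) \<le> K * A * (L - 0)"
      proof (rule integral_bound)
        show "continuous_on {0..L} (\<lambda>s. \<phi>' s *\<^sub>R (\<tau> s - (c + integral {0..s} g)))"
          by (intro continuous_on_scaleR cp continuous_on_diff c\<tau> cG)
        show "norm (\<phi>' s *\<^sub>R (\<tau> s - (c + integral {0..s} g))) \<le> K * A" if "s \<in> {0..L}" for s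
          unfolding Gd[OF that] using K nG[OF that] that by (auto intro!: mult_mono)
      qed (use L in auto)
      then show "norm (integral {0..L} (\<lambda>s. \<phi>' s *\<^sub>R (\<tau> s - (c + integral {0..s} g)))) \<le> K * A * L" by simp
      have "norm (integral {0..L} (\<lambda>s. \<phi> s *\<^sub>R d s)) \<le> integral {0..L} (\<lambda>s. K * norm (d s))"
        by (rule integral_norm_bound_integral[OF set_lebesgue_integral_eq_integral(1)[OF ad]])
          (use K in \<open>auto intro: integrable_on_mult_right dn mult_right_mono\<close>)
      then show "norm (integral {0..L} (\<lambda>s. \<phi> s *\<^sub>R d s)) \<le> K * A" by (simp add: A_def)
    qed
    also have "\<dots> = (K * (L + 1)) * A" by (simp add: algebra_simps)
    also have "\<dots> \<le> (K * (L + 1)) * ((L + 1) * \<delta>)" using K L by (intro mult_left_mono A) auto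
    finally show ?thesis by (simp add: power2_eq_square mult_ac)
  qed
  have "norm D \<le> 0 + e" if "0 < e" for e
  proof -
    define C where "C = K * (L + 1)\<^sup>2"
    have C: "0 \<le> C" using K by (simp add: C_def)
    have "norm D \<le> C * (e / (C + 1))" unfolding C_def by (rule bound) (use C that in \<open>auto simp: C_def\<close>)
    also have "\<dots> \<le> e" using C that by (simp add: field_simps)
    finally show ?thesis by simp
  qed
  then have "norm D \<le> 0" by (rule field_le_epsilon)
  then show ?thesis by (simp add: D_def add_eq_0_iff2)
qed

lemma L2_locally_integrable:
  fixes f :: "real \<Rightarrow> real^2"
  assumes "f \<in> L2 {0<..<L}"
  shows "locally_integrable {0<..<L} f"
  unfolding locally_integrable_def
proof (intro allI impI)
  fix K assume K: "compact K \<and> K \<subseteq> {0<..<L}"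
  then have "K \<subseteq> {0..L}" by (meson greaterThanLessThan_subseteq_atLeastAtMost_iff order_refl subset_trans)
  moreover have "K \<in> sets lebesgue" using K by (simp add: borel_compact)
  ultimately show "f absolutely_integrable_on K"
    by (intro set_integrable_subset[OF L2_absolutely_integrable[OF assms]])
qed

lemma primitive_has_weak_deriv:
  fixes \<tau> h :: "real \<Rightarrow> real^2"
  assumes L: "0 < L" and h: "h \<in> L2 {0<..<L}" and \<tau>: "\<And>s. s \<in> {0..L} \<Longrightarrow> \<tau> s = c + integral {0..s} h"
  shows "continuous_on {0..L} \<tau>" "has_weak_deriv {0<..<L} 1 \<tau> h"
proof -
  have hi: "h integrable_on {0..s}" if "s \<in> {0..L}" for s using L2_integrable_on[OF h] that by auto
  have "continuous_on {0..L} (\<lambda>s. c + integral {0..s} h)"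
    by (intro continuous_intros indefinite_integral_continuous_1 hi) (use L in auto)
  then show c\<tau>: "continuous_on {0..L} \<tau>" by (rule continuous_on_eq) (metis \<tau>)
  show "has_weak_deriv {0<..<L} 1 \<tau> h"
    unfolding has_weak_deriv_def
  proof (intro conjI allI impI L2_locally_integrable h L2_continuous c\<tau>)
    fix \<phi> assume t: "test_function {0<..<L} \<phi>"
    obtain a b \<phi>' where ab: "0 < a" "b < L"
      and s: "\<And>x. x \<notin> {a..b} \<Longrightarrow> \<phi> x = 0 \<and> \<phi>' x = 0"
      and d: "\<And>x. (\<phi> has_real_derivative \<phi>' x) (at x)" and c': "continuous_on UNIV \<phi>'"
      and f: "\<And>x. frechet_derivative \<phi> (at x) 1 = \<phi>' x" by (rule test_function_on_interval[OF L t]) blast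
    have c\<phi>: "continuous_on {0..L} \<phi>" by (rule DERIV_continuous_on[OF has_field_derivative_at_within[OF d]])
    have "(LINT x:{0<..<L}|lebesgue. \<phi>' x *\<^sub>R \<tau> x) = integral {0..L} (\<lambda>x. \<phi>' x *\<^sub>R \<tau> x)"
      by (rule set_lebesgue_integral_support(2))
        (use ab s in \<open>auto intro!: absolutely_integrable_scaleR[OF continuous_on_subset[OF c'] absolutely_integrable_continuous_real[OF c\<tau>]]\<close>)
    moreover have "(LINT x:{0<..<L}|lebesgue. \<phi> x *\<^sub>R h x) = integral {0..L} (\<lambda>x. \<phi> x *\<^sub>R h x)"
      by (rule set_lebesgue_integral_support(2))
        (use ab s in \<open>auto intro!: absolutely_integrable_scaleR[OF c\<phi> L2_absolutely_integrable[OF h]]\<close>)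
    moreover have "integral {0..L} (\<lambda>s. \<phi>' s *\<^sub>R \<tau> s) = - integral {0..L} (\<lambda>s. \<phi> s *\<^sub>R h s)"
      by (rule integral_by_parts_primitive[OF L h \<tau> d c']) (use ab s in auto)
    ultimately show "(LINT x:{0<..<L}|lebesgue. frechet_derivative \<phi> (at x) 1 *\<^sub>R \<tau> x) = - (LINT x:{0<..<L}|lebesgue. \<phi> x *\<^sub>R h x)"
      unfolding f by simp
  qed
qed

lemma integral_support:
  fixes f :: "real \<Rightarrow> 'a::euclidean_space"
  assumes "\<And>x. x \<in> S - T \<Longrightarrow> f x = 0" "\<And>x. x \<in> T - S \<Longrightarrow> f x = 0"
  shows "integral S f = integral T f"
proof (rule integral_spike_set)
  have "{x \<in> S - T. f x \<noteq> 0} = {}" "{x \<in> T - S. f x \<noteq> 0} = {}" using assms by blast+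
  then show "negligible {x \<in> S - T. f x \<noteq> 0}" "negligible {x \<in> T - S. f x \<noteq> 0}" by (simp_all only: negligible_empty)
qed

lemma locally_integrable_diff:
  "locally_integrable U f \<Longrightarrow> locally_integrable U g \<Longrightarrow> locally_integrable U (\<lambda>x. f x - g x)"
  unfolding locally_integrable_def by (auto intro: set_integral_diff(1))

lemma weak_deriv_unique:
  fixes f g g' :: "real \<Rightarrow> 'a::euclidean_space"
  assumes g: "has_weak_deriv {0<..<L} 1 f g" and g': "has_weak_deriv {0<..<L} 1 f g'"
  shows "\<exists>N. negligible N \<and> (\<forall>x\<in>{0<..<L} - N. g' x = g x)"
proof -
  have l: "locally_integrable {0<..<L} g" "locally_integrable {0<..<L} g'"
    using g g' unfolding has_weak_deriv_def by blast+
  have "\<exists>N. negligible N \<and> (\<forall>x\<in>{0<..<L} - N. g' x - g x = 0)"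
  proof (rule fundamental_lemma[OF locally_integrable_diff[OF l(2,1)]])
    fix a b \<psi> assume ab: "0 < a" "a < b" "b < L" and \<psi>: "bump a b \<psi>"
    have t: "test_function {0<..<L} \<psi>" by (rule bump_test_function[OF \<psi> ab(1,3)])
    have "(LINT x:{0<..<L}|lebesgue. \<psi> x *\<^sub>R g' x) = (LINT x:{0<..<L}|lebesgue. \<psi> x *\<^sub>R g x)"
    proof -
      have "(LINT x:{0<..<L}|lebesgue. frechet_derivative \<psi> (at x) 1 *\<^sub>R f x) = - (LINT x:{0<..<L}|lebesgue. \<psi> x *\<^sub>R g x)"
        "(LINT x:{0<..<L}|lebesgue. frechet_derivative \<psi> (at x) 1 *\<^sub>R f x) = - (LINT x:{0<..<L}|lebesgue. \<psi> x *\<^sub>R g' x)"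
        using g g' t unfolding has_weak_deriv_def by blast+
      then show ?thesis by simp
    qed
    then show "(LINT x:{0<..<L}|lebesgue. \<psi> x *\<^sub>R (g' x - g x)) = 0"
      using set_integral_diff(2)[OF bump_pairing(1)[OF l(2) ab(1,3) \<psi>] bump_pairing(1)[OF l(1) ab(1,3) \<psi>]]
      by (simp add: scaleR_diff_right)
  qed
  then show ?thesis by simp
qed

text \<open>This is the lemma of du Bois-Reymond. A bump minus the multiple of a fixed bump with the
  same integral has a primitive of compact support, which is an admissible test function. So D acts
  on every bump like the constant c, and the fundamental lemma applies to the difference.\<close>

lemma weak_deriv_zero_imp_const:
  fixes D :: "real \<Rightarrow> 'a::euclidean_space"
  assumes L: "0 < L" and D: "locally_integrable {0<..<L} D"
    and z: "\<And>\<phi>. test_function {0<..<L} \<phi> \<Longrightarrow> (LINT x:{0<..<L}|lebesgue. frechet_derivative \<phi> (at x) 1 *\<^sub>R D x) = 0"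
  shows "\<exists>c N. negligible N \<and> (\<forall>x\<in>{0<..<L} - N. D x = c)"
proof -
  define a0 b0 where "a0 = L / 3" and "b0 = 2 * L / 3"
  have ab0: "0 < a0" "a0 < b0" "b0 < L" using L by (auto simp: a0_def b0_def)
  define \<psi>0 where "\<psi>0 = plateau a0 b0 0"
  have \<psi>0: "bump a0 b0 \<psi>0" unfolding \<psi>0_def by (rule bump_plateau)
  define I0 where "I0 = integral {0..L} \<psi>0"
  have "0 < I0" unfolding I0_def
  proof (rule integral_pos)
    show "continuous_on {0..L} \<psi>0" by (rule bump_continuous[OF \<psi>0])
    show "\<psi>0 ((a0 + b0) / 2) \<noteq> 0" unfolding \<psi>0_def using ab0 by (intro less_imp_neq[symmetric] plateau_pos) auto
    show "(a0 + b0) / 2 \<in> {0..L}" using ab0 by auto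
    show "0 \<le> \<psi>0 x" for x by (simp add: \<psi>0_def plateau_bounds)
  qed (rule L)
  \<comment> \<open>The constant is the average of D weighted by the fixed bump.\<close>
  define c where "c = (LINT x:{0<..<L}|lebesgue. \<psi>0 x *\<^sub>R D x) /\<^sub>R I0"
  have lc: "locally_integrable {0<..<L} (\<lambda>_. c)"
    unfolding locally_integrable_def
    by (auto intro!: absolutely_integrable_on_const lmeasurable_compact)
  have "\<exists>N. negligible N \<and> (\<forall>x\<in>{0<..<L} - N. D x - c = 0)"
  proof (rule fundamental_lemma[OF locally_integrable_diff[OF D lc]])
    fix a b \<psi> assume ab: "0 < a" "a < b" "b < L" and \<psi>: "bump a b \<psi>"
    define I where "I = integral {0..L} \<psi>"
    define k where "k = I / I0"
    define a' b' where "a' = min a a0" and "b' = max b b0"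
    have ab': "0 < a'" "a' < b'" "b' < L" using ab ab0 by (auto simp: a'_def b'_def)
    define \<theta> where "\<theta> x = \<psi> x + (- k) * \<psi>0 x" for x
    have \<theta>: "bump a' b' \<theta>"
      unfolding bump_def
    proof (intro conjI allI impI)
      show "diff_upto j \<theta>" for j
        unfolding \<theta>_def[abs_def] using \<psi> \<psi>0 by (intro diff_upto_add diff_upto_cmult) (simp_all add: bump_def)
      fix x assume "x \<notin> {a'..b'}"
      then have "x \<notin> {a..b}" "x \<notin> {a0..b0}" by (auto simp: a'_def b'_def)
      then have "\<psi> x = 0" "\<psi>0 x = 0" using \<psi> \<psi>0 unfolding bump_def by blast+
      then show "\<theta> x = 0" by (simp add: \<theta>_def)
    qed
    have c\<theta>: "continuous_on S \<theta>" for S by (rule bump_continuous[OF \<theta>])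
    have "integral {0..L} \<theta> = I + integral {0..L} (\<lambda>x. (- k) * \<psi>0 x)"
      unfolding \<theta>_def[abs_def] I_def
      by (intro integral_add integrable_continuous_real continuous_on_mult_left bump_continuous[OF \<psi>] bump_continuous[OF \<psi>0])
    also have "integral {0..L} (\<lambda>x. (- k) * \<psi>0 x) = (- k) * I0" unfolding I0_def by (rule integral_mult_right)
    finally have \<theta>0: "integral {0..L} \<theta> = 0" using \<open>0 < I0\<close> by (simp add: k_def)
    define \<phi> where "\<phi> x = integral {0..x} \<theta>" for x
    have out: "\<theta> x = 0" if "x \<notin> {a'..b'}" for x using \<theta> that unfolding bump_def by blast
    have low: "\<phi> x = 0" if "x < a'" for x
    proof -
      have "\<phi> x = integral {0..x} (\<lambda>_. 0)" unfolding \<phi>_def by (rule integral_cong) (use that out in auto)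
      then show ?thesis by simp
    qed
    have high: "\<phi> x = 0" if "b' < x" for x
    proof -
      have "\<phi> x = integral {0..L} \<theta>" unfolding \<phi>_def by (rule integral_support) (use that ab' in \<open>auto intro: out\<close>)
      then show ?thesis using \<theta>0 by simp
    qed
    have d\<phi>: "(\<phi> has_real_derivative \<theta> x) (at x)" for x
    proof (cases "0 < x")
      case True
      have "(\<phi> has_real_derivative \<theta> x) (at x within {0..x + 1})"
        unfolding \<phi>_def by (rule integral_has_real_derivative[OF c\<theta>]) (use True in auto)
      moreover have "at x within {0..x + 1} = at x" by (rule at_within_Icc_at) (use True in auto)
      ultimately show ?thesis by simp
    next
      case False
      have "(\<phi> has_real_derivative 0) (at x)"
        by (rule has_field_derivative_transform_within_open[of "\<lambda>_. 0" 0 x "{..<a'}"]) (use False ab' low in auto)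
      then show ?thesis using out[of x] False ab' by auto
    qed
    have "diff_upto k \<phi>" for k
    proof (cases k)
      case 0
      then show ?thesis using DERIV_continuous_on[OF has_field_derivative_at_within[OF d\<phi>]] by simp
    next
      case (Suc m)
      have "diff_upto m \<theta>" using \<theta> unfolding bump_def by blast
      then show ?thesis unfolding Suc diff_upto.simps using d\<phi> by blast
    qed
    then have "bump a' b' \<phi>" unfolding bump_def using low high by auto
    then have "test_function {0<..<L} \<phi>" by (rule bump_test_function[OF _ ab'(1,3)])
    from z[OF this] have zD: "(LINT x:{0<..<L}|lebesgue. \<theta> x *\<^sub>R D x) = 0"
      by (simp add: frechet_derivative_real[OF d\<phi>])
    note p = bump_pairing(1)[OF D ab(1,3) \<psi>] and p0 = bump_pairing(1)[OF D ab0(1,3) \<psi>0] and pc = bump_pairing(1)[OF lc ab(1,3) \<psi>]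
    have "(LINT x:{0<..<L}|lebesgue. \<theta> x *\<^sub>R D x) =
        (LINT x:{0<..<L}|lebesgue. \<psi> x *\<^sub>R D x - k *\<^sub>R (\<psi>0 x *\<^sub>R D x))"
      by (simp add: \<theta>_def scaleR_diff_left)
    also have "\<dots> = (LINT x:{0<..<L}|lebesgue. \<psi> x *\<^sub>R D x) - k *\<^sub>R (LINT x:{0<..<L}|lebesgue. \<psi>0 x *\<^sub>R D x)"
      using set_integral_diff(2)[OF p set_integrable_scaleR_right[OF p0, of k]] by (simp only: set_integral_scaleR_right)
    finally have 1: "(LINT x:{0<..<L}|lebesgue. \<psi> x *\<^sub>R D x) = I *\<^sub>R c"
      using zD \<open>0 < I0\<close> by (simp add: k_def c_def divide_inverse)
    have "(LINT x:{0<..<L}|lebesgue. \<psi> x *\<^sub>R c) = integral {a..b} (\<lambda>x. \<psi> x *\<^sub>R c)"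
      by (rule bump_pairing(2)[OF lc ab(1,3) \<psi>])
    also have "\<dots> = integral {0..L} (\<lambda>x. \<psi> x *\<^sub>R c)"
      by (rule integral_support) (use \<psi> ab in \<open>auto simp: bump_def\<close>)
    also have "\<dots> = I *\<^sub>R c"
      using integral_linear[OF integrable_continuous_real[OF bump_continuous[OF \<psi>]] bounded_linear_scaleR_left, of 0 L c]
      by (simp add: o_def I_def)
    finally have 2: "(LINT x:{0<..<L}|lebesgue. \<psi> x *\<^sub>R c) = I *\<^sub>R c" .
    show "(LINT x:{0<..<L}|lebesgue. \<psi> x *\<^sub>R (D x - c)) = 0"
      using set_integral_diff(2)[OF p pc] 1 2 by (simp add: scaleR_diff_right)
  qed
  then show ?thesis by auto
qed

text \<open>The difference of f and the primitive of g has weak derivative 0.\<close>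

lemma has_weak_deriv_primitive:
  fixes f g :: "real \<Rightarrow> real^2"
  assumes L: "0 < L" and g: "g \<in> L2 {0<..<L}" and w: "has_weak_deriv {0<..<L} 1 f g"
  shows "\<exists>c N. negligible N \<and> (\<forall>x\<in>{0<..<L} - N. f x = c + integral {0..x} g)"
proof -
  define G where "G s = integral {0..s} g" for s
  have wG: "has_weak_deriv {0<..<L} 1 G g" by (rule primitive_has_weak_deriv(2)[OF L g, of _ 0]) (simp add: G_def)
  have lf: "locally_integrable {0<..<L} f" and lG: "locally_integrable {0<..<L} G"
    using w wG unfolding has_weak_deriv_def by blast+
  have "\<exists>c N. negligible N \<and> (\<forall>x\<in>{0<..<L} - N. f x - G x = c)"
  proof (rule weak_deriv_zero_imp_const[OF L locally_integrable_diff[OF lf lG]])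
    fix \<phi> assume t: "test_function {0<..<L} \<phi>"
    obtain a b \<phi>' where ab: "0 < a" "b < L"
      and s: "\<And>x. x \<notin> {a..b} \<Longrightarrow> \<phi> x = 0 \<and> \<phi>' x = 0" and c': "continuous_on UNIV \<phi>'"
      and f: "\<And>x. frechet_derivative \<phi> (at x) 1 = \<phi>' x" by (rule test_function_on_interval[OF L t]) blast
    have i: "(\<lambda>x. \<phi>' x *\<^sub>R k x) absolutely_integrable_on {0<..<L}" if "locally_integrable {0<..<L} k" for k :: "real \<Rightarrow> real^2"
      by (rule set_lebesgue_integral_support(1)[of _ "{a..b}"])
        (use ab s in \<open>auto intro!: absolutely_integrable_scaleR continuous_on_subset[OF c'] locally_integrable_Icc[OF that]\<close>)
    have "(LINT x:{0<..<L}|lebesgue. \<phi>' x *\<^sub>R f x) = (LINT x:{0<..<L}|lebesgue. \<phi>' x *\<^sub>R G x)"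
    proof -
      have "(LINT x:{0<..<L}|lebesgue. frechet_derivative \<phi> (at x) 1 *\<^sub>R f x) = - (LINT x:{0<..<L}|lebesgue. \<phi> x *\<^sub>R g x)"
        "(LINT x:{0<..<L}|lebesgue. frechet_derivative \<phi> (at x) 1 *\<^sub>R G x) = - (LINT x:{0<..<L}|lebesgue. \<phi> x *\<^sub>R g x)"
        using w wG t unfolding has_weak_deriv_def by blast+
      then show ?thesis unfolding f by simp
    qed
    then show "(LINT x:{0<..<L}|lebesgue. frechet_derivative \<phi> (at x) 1 *\<^sub>R (f x - G x)) = 0"
      using set_integral_diff(2)[OF i[OF lf] i[OF lG]] by (simp add: f scaleR_diff_right)
  qed
  then obtain c N where "negligible N" "\<And>x. x \<in> {0<..<L} - N \<Longrightarrow> f x - G x = c" by blast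
  then show ?thesis by (intro exI[of _ c] exI[of _ N]) (auto simp: G_def algebra_simps)
qed

lemma continuous_ae_eq:
  fixes f g :: "real \<Rightarrow> real^2"
  assumes L: "0 < L" and c: "continuous_on {0..L} f" "continuous_on {0..L} g"
    and N: "negligible N" "\<And>x. x \<in> {0<..<L} - N \<Longrightarrow> f x = g x" and s: "s \<in> {0..L}"
  shows "f s = g s"
proof (rule ccontr)
  assume "f s \<noteq> g s"
  then have "0 < integral {0..L} (\<lambda>x. norm (f x - g x))"
    by (intro integral_pos[OF _ L _ s]) (auto intro!: continuous_intros c)
  moreover have "integral {0..L} (\<lambda>x. norm (f x - g x)) = integral {0..L} (\<lambda>_. 0)"
    by (rule integral_spike[of "N \<union> {0, L}"]) (use N in auto)
  ultimately show False by simp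
qed

text \<open>The second weak derivative makes the first one equal almost everywhere to a continuous
  primitive, and integrating once more gives \<open>\<xi>\<close> itself by continuity. Hence this
  primitive is the classical derivative, one-sided at the ends, and agrees with
  \<open>sderiv\<close>.\<close>

lemma H2_curve_data:
  assumes L: "0 < L" and \<xi>: "\<xi> \<in> H2_curves L" and u: "\<And>s. s \<in> {0..L} \<Longrightarrow> norm (sderiv L \<xi> s) = 1"
  shows "\<exists>\<tau> h. curve_data L \<xi> \<tau> h"
proof -
  obtain g h where gh: "g \<in> L2 {0<..<L}" "h \<in> L2 {0<..<L}" and w: "has_weak_deriv {0<..<L} 1 \<xi> g" "has_weak_deriv {0<..<L} 1 g h"
    using \<xi> unfolding H2_curves_def H2_def by blast
  have c\<xi>: "continuous_on {0..L} \<xi>" using \<xi> unfolding H2_curves_def by blast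
  obtain c N where N: "negligible N" "\<And>x. x \<in> {0<..<L} - N \<Longrightarrow> g x = c + integral {0..x} h"
    using has_weak_deriv_primitive[OF L gh(2) w(2)] by blast
  define \<tau> where "\<tau> s = c + integral {0..s} h" for s
  have c\<tau>: "continuous_on {0..L} \<tau>" by (rule primitive_has_weak_deriv(1)[OF L gh(2), of _ c]) (simp add: \<tau>_def)
  obtain d M where M: "negligible M" "\<And>x. x \<in> {0<..<L} - M \<Longrightarrow> \<xi> x = d + integral {0..x} g"
    using has_weak_deriv_primitive[OF L gh(1) w(1)] by blast
  have ig: "integral {0..x} g = integral {0..x} \<tau>" if "x \<in> {0..L}" for x
    by (rule integral_spike[of "N \<union> {0, L}"]) (use N that in \<open>auto simp: \<tau>_def\<close>)
  have cT: "continuous_on {0..L} (\<lambda>x. d + integral {0..x} \<tau>)"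
    by (intro continuous_intros indefinite_integral_continuous_1 integrable_continuous_real c\<tau>)
  have \<xi>e: "d + integral {0..s} \<tau> = \<xi> s" if "s \<in> {0..L}" for s
    by (rule continuous_ae_eq[OF L cT c\<xi> M(1) _ that]) (simp add: M(2) ig)
  have d\<xi>: "(\<xi> has_vector_derivative \<tau> s) (at s within {0..L})" if s: "s \<in> {0..L}" for s
  proof -
    have "((\<lambda>s. d + integral {0..s} \<tau>) has_vector_derivative \<tau> s) (at s within {0..L})"
      using has_vector_derivative_add[OF has_vector_derivative_const[of d] integral_has_vector_derivative[OF c\<tau> s]] by simp
    then show ?thesis by (rule has_vector_derivative_transform[OF s, rotated]) (simp add: \<xi>e)
  qed
  have "unit_speed L \<xi> \<tau>"
    unfolding unit_speed_def
  proof (intro conjI ballI c\<tau> d\<xi>)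
    fix s assume "s \<in> {0..L}"
    then show "norm (\<tau> s) = 1" using u[of s] sderiv_eq[OF L _ d\<xi>] by simp
  qed
  then have "curve_data L \<xi> \<tau> h" unfolding curve_data_def using gh(2) by (simp add: \<tau>_def)
  then show ?thesis by blast
qed

lemma L2_norm_ae_eq:
  fixes f g :: "real \<Rightarrow> real^2"
  assumes f: "f \<in> L2 {0<..<L}" and N: "negligible N" "\<And>x. x \<in> {0<..<L} - N \<Longrightarrow> g x = f x"
  shows "L2_norm {0<..<L} g = L2_norm {0<..<L} f"
proof -
  have "integrable (lebesgue_on {0<..<L}) (\<lambda>x. (norm (f x))\<^sup>2)" using f by (simp add: L2_def)
  then have i: "(\<lambda>x. (norm (f x))\<^sup>2) absolutely_integrable_on {0<..<L}"
    by (simp add: integrable_restrict_space set_integrable_def)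
  then have "(\<lambda>x. (norm (g x))\<^sup>2) absolutely_integrable_on {0<..<L}"
    by (rule absolutely_integrable_spike[OF _ N(1)]) (simp add: N(2))
  then have "integrable (lebesgue_on {0<..<L}) (\<lambda>x. (norm (g x))\<^sup>2)"
    by (simp add: integrable_restrict_space set_integrable_def)
  then have "(LINT x|lebesgue_on {0<..<L}. (norm (g x))\<^sup>2) = integral {0<..<L} (\<lambda>x. (norm (g x))\<^sup>2)"
    by (rule lebesgue_integral_eq_integral) simp
  also have "\<dots> = integral {0<..<L} (\<lambda>x. (norm (f x))\<^sup>2)"
    by (rule integral_spike[OF N(1)]) (simp add: N(2))
  also have "\<dots> = (LINT x|lebesgue_on {0<..<L}. (norm (f x))\<^sup>2)"
    using f by (intro lebesgue_integral_eq_integral[symmetric]) (simp_all add: L2_def)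
  finally show ?thesis by (simp add: L2_norm_def)
qed

lemma has_weak_deriv_weak_deriv: "has_weak_deriv {0<..<L} 1 f g \<Longrightarrow> has_weak_deriv {0<..<L} 1 f (weak_deriv L f)"
  unfolding weak_deriv_def by (rule someI[of "has_weak_deriv {0<..<L} 1 f" g])

text \<open>\<open>H2_norm\<close> is built from arbitrarily chosen weak derivatives. The chosen
  first derivative \<open>w\<close> agrees with \<open>\<tau>\<close> only almost everywhere, so it
  must be shown that h is a weak derivative of \<open>w\<close> before the second choice can be
  identified.\<close>

lemma primitive_twice_H2:
  fixes \<xi> \<tau> h :: "real \<Rightarrow> real^2"
  assumes L: "0 < L" and d: "\<And>s. s \<in> {0..L} \<Longrightarrow> (\<xi> has_vector_derivative \<tau> s) (at s within {0..L})"
    and \<tau>: "\<And>s. s \<in> {0..L} \<Longrightarrow> \<tau> s = \<tau> 0 + integral {0..s} h" and h: "h \<in> L2 {0<..<L}"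
  shows "\<xi> \<in> H2_curves L"
    "(H2_norm L \<xi>)\<^sup>2 = integral {0..L} (\<lambda>s. (norm (\<xi> s))\<^sup>2) + integral {0..L} (\<lambda>s. (norm (\<tau> s))\<^sup>2) + integral {0..L} (\<lambda>s. (norm (h s))\<^sup>2)"
proof -
  have c\<tau>: "continuous_on {0..L} \<tau>" and w\<tau>: "has_weak_deriv {0<..<L} 1 \<tau> h"
    using primitive_has_weak_deriv[OF L h \<tau>] by blast+
  have \<tau>L: "\<tau> \<in> L2 {0<..<L}" by (rule L2_continuous[OF c\<tau>])
  have "\<xi> s = \<xi> 0 + integral {0..s} \<tau>" if s: "s \<in> {0..L}" for s
  proof -
    have "(\<tau> has_integral \<xi> s - \<xi> 0) {0..s}"
      using s by (intro fundamental_theorem_of_calculus has_vector_derivative_within_subset[OF d]) auto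
    then show ?thesis by (simp add: integral_unique)
  qed
  from primitive_has_weak_deriv[OF L \<tau>L this]
  have c\<xi>: "continuous_on {0..L} \<xi>" and w\<xi>: "has_weak_deriv {0<..<L} 1 \<xi> \<tau>" by blast+
  have \<xi>L: "\<xi> \<in> L2 {0<..<L}" by (rule L2_continuous[OF c\<xi>])
  show "\<xi> \<in> H2_curves L" unfolding H2_curves_def H2_def using \<xi>L \<tau>L h w\<xi> w\<tau> c\<xi> by blast
  define w where "w = weak_deriv L \<xi>"
  have ww: "has_weak_deriv {0<..<L} 1 \<xi> w" unfolding w_def by (rule has_weak_deriv_weak_deriv[OF w\<xi>])
  obtain N where N: "negligible N" "\<And>x. x \<in> {0<..<L} - N \<Longrightarrow> w x = \<tau> x"
    using weak_deriv_unique[OF w\<xi> ww] by blast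
  have "has_weak_deriv {0<..<L} 1 w h"
    unfolding has_weak_deriv_def
  proof (intro conjI allI impI)
    show "locally_integrable {0<..<L} w" "locally_integrable {0<..<L} h"
      using ww w\<tau> unfolding has_weak_deriv_def by blast+
    fix \<phi> assume t: "test_function {0<..<L} \<phi>"
    obtain a b \<phi>' where ab: "0 < a" "b < L"
      and s: "\<And>x. x \<notin> {a..b} \<Longrightarrow> \<phi> x = 0 \<and> \<phi>' x = 0" and c': "continuous_on UNIV \<phi>'"
      and f: "\<And>x. frechet_derivative \<phi> (at x) 1 = \<phi>' x" by (rule test_function_on_interval[OF L t]) blast
    have i: "(LINT x:{0<..<L}|lebesgue. \<phi>' x *\<^sub>R k x) = integral {a..b} (\<lambda>x. \<phi>' x *\<^sub>R k x)"
      if "locally_integrable {0<..<L} k" for k :: "real \<Rightarrow> real^2"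
      by (rule set_lebesgue_integral_support(2))
        (use ab s in \<open>auto intro!: absolutely_integrable_scaleR continuous_on_subset[OF c'] locally_integrable_Icc[OF that]\<close>)
    have "integral {a..b} (\<lambda>x. \<phi>' x *\<^sub>R w x) = integral {a..b} (\<lambda>x. \<phi>' x *\<^sub>R \<tau> x)"
      by (rule integral_spike[OF N(1)]) (use N(2) ab in auto)
    then have e: "(LINT x:{0<..<L}|lebesgue. \<phi>' x *\<^sub>R w x) = (LINT x:{0<..<L}|lebesgue. \<phi>' x *\<^sub>R \<tau> x)"
      using ww w\<tau> unfolding has_weak_deriv_def by (simp add: i)
    then show "(LINT x:{0<..<L}|lebesgue. frechet_derivative \<phi> (at x) 1 *\<^sub>R w x) = - (LINT x:{0<..<L}|lebesgue. \<phi> x *\<^sub>R h x)"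
    proof -
      have "(LINT x:{0<..<L}|lebesgue. frechet_derivative \<phi> (at x) 1 *\<^sub>R \<tau> x) = - (LINT x:{0<..<L}|lebesgue. \<phi> x *\<^sub>R h x)"
        using w\<tau> t unfolding has_weak_deriv_def by blast
      then show ?thesis unfolding f using e by simp
    qed
  qed
  note wh = this
  define k where "k = weak_deriv L w"
  have wk: "has_weak_deriv {0<..<L} 1 w k" unfolding k_def by (rule has_weak_deriv_weak_deriv[OF wh])
  obtain M where M: "negligible M" "\<And>x. x \<in> {0<..<L} - M \<Longrightarrow> k x = h x"
    using weak_deriv_unique[OF wh wk] by blast
  have "L2_norm {0<..<L} w = L2_norm {0<..<L} \<tau>" "L2_norm {0<..<L} k = L2_norm {0<..<L} h"
    by (rule L2_norm_ae_eq[OF \<tau>L N], assumption, rule L2_norm_ae_eq[OF h M], assumption)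
  then have "(H2_norm L \<xi>)\<^sup>2 = (L2_norm {0<..<L} \<xi>)\<^sup>2 + (L2_norm {0<..<L} \<tau>)\<^sup>2 + (L2_norm {0<..<L} h)\<^sup>2"
    unfolding H2_norm_def w_def[symmetric] k_def[symmetric] by simp
  then show "(H2_norm L \<xi>)\<^sup>2 = integral {0..L} (\<lambda>s. (norm (\<xi> s))\<^sup>2) + integral {0..L} (\<lambda>s. (norm (\<tau> s))\<^sup>2) + integral {0..L} (\<lambda>s. (norm (h s))\<^sup>2)"
    unfolding L2_norm_sq[OF \<xi>L] L2_norm_sq[OF \<tau>L] L2_norm_sq[OF h] .
qed

section \<open>Self-propelled motions belong to the space of admissible motions\<close>

lemma open_rectangle_facts:
  fixes f :: "real \<times> real \<Rightarrow> 'a::euclidean_space"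
  assumes "continuous_on ({0..L} \<times> {0..T}) f" "S \<in> sets lebesgue" "S \<subseteq> {0..L} \<times> {0..T}"
  shows "f absolutely_integrable_on S"
proof -
  have "f absolutely_integrable_on cbox (0, 0) (L, T)"
    using assms(1) by (intro absolutely_integrable_continuous) (simp add: cbox_Pair_eq)
  then show ?thesis by (rule set_integrable_subset) (use assms in \<open>auto simp: cbox_Pair_eq\<close>)
qed

lemma frechet_derivative_zero_outside:
  fixes \<phi> :: "'a::euclidean_space \<Rightarrow> real"
  assumes "x \<notin> closure {x. \<phi> x \<noteq> 0}"
  shows "frechet_derivative \<phi> (at x) v = 0"
proof -
  have z: "\<phi> y = 0" if "y \<in> - closure {x. \<phi> x \<noteq> 0}" for y
  proof (rule ccontr)
    assume "\<phi> y \<noteq> 0"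
    then have "y \<in> closure {x. \<phi> x \<noteq> 0}" by (intro subsetD[OF closure_subset]) simp
    then show False using that by simp
  qed
  have "(\<phi> has_derivative (\<lambda>_. 0)) (at x)"
  proof (rule has_derivative_transform_within_open[of "\<lambda>_. 0"])
    show "open (- closure {x. \<phi> x \<noteq> 0})" by (rule open_Compl[OF closed_closure])
    show "x \<in> - closure {x. \<phi> x \<noteq> 0}" using assms by simp
    show "0 = \<phi> y" if "y \<in> - closure {x. \<phi> x \<noteq> 0}" for y using z[OF that] by simp
  qed (rule has_derivative_const)
  then have "(\<lambda>_. 0) = frechet_derivative \<phi> (at x)" by (rule frechet_derivative_at)
  then show ?thesis by metis
qed

text \<open>By Fubini it suffices to integrate by parts in time on each line of constant s, where
  the test function vanishes at both ends.\<close>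

lemma has_L2_time_deriv_C1:
  fixes \<eta> \<omega> :: "real \<Rightarrow> real \<Rightarrow> real^2"
  assumes L: "0 < L" and T: "0 < T"
    and c: "continuous_on ({0..L} \<times> {0..T}) (\<lambda>p. \<eta> (fst p) (snd p))" "continuous_on ({0..L} \<times> {0..T}) (\<lambda>p. \<omega> (fst p) (snd p))"
    and d: "\<And>s t. s \<in> {0..L} \<Longrightarrow> t \<in> {0..T} \<Longrightarrow> ((\<lambda>u. \<eta> s u) has_vector_derivative \<omega> s t) (at t within {0..T})"
  shows "has_L2_time_deriv L T \<eta> \<omega>"
proof -
  define R where "R = {0..L} \<times> {0..T}"
  define U where "U = {0<..<L} \<times> {0<..<T}"
  have R: "R = cbox (0, 0) (L, T)" by (simp add: R_def cbox_Pair_eq)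
  have c\<eta>: "continuous_on R (\<lambda>p. \<eta> (fst p) (snd p))" and c\<omega>: "continuous_on R (\<lambda>p. \<omega> (fst p) (snd p))"
    using c by (simp_all add: R_def)
  have UR: "U \<subseteq> R" by (auto simp: U_def R_def)
  have Um: "U \<in> sets lebesgue" unfolding U_def by (simp add: borel_open open_Times)
  have K: "K \<in> sets lebesgue" "K \<subseteq> R" if "compact K \<and> K \<subseteq> U" for K
    using that UR by (auto simp: borel_compact)
  have l: "locally_integrable U f" if "continuous_on R f" for f :: "real \<times> real \<Rightarrow> real^2"
    unfolding locally_integrable_def using open_rectangle_facts[of L T f] K that unfolding R_def by blast
  have "(\<lambda>p. \<omega> (fst p) (snd p)) \<in> borel_measurable (lebesgue_on U)"
    by (rule continuous_imp_measurable_on_sets_lebesgue[OF continuous_on_subset[OF c\<omega> UR] Um])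
  moreover have "(\<lambda>p. (norm (\<omega> (fst p) (snd p)))\<^sup>2) absolutely_integrable_on U"
    using c\<omega> Um UR unfolding R_def by (intro open_rectangle_facts continuous_on_power continuous_on_norm)
  ultimately have "(\<lambda>p. \<omega> (fst p) (snd p)) \<in> L2 U"
    using Um by (simp add: L2_def integrable_restrict_space set_integrable_def)
  moreover have "has_weak_deriv U (0, 1) (\<lambda>p. \<eta> (fst p) (snd p)) (\<lambda>p. \<omega> (fst p) (snd p))"
    unfolding has_weak_deriv_def
  proof (intro conjI allI impI l c\<eta> c\<omega>)
    fix \<phi> :: "real \<times> real \<Rightarrow> real" assume t: "test_function U \<phi>"
    then have C: "C_k 1 \<phi>" and S: "closure {x. \<phi> x \<noteq> 0} \<subseteq> U" unfolding test_function_def by blast+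
    define \<phi>' where "\<phi>' x = frechet_derivative \<phi> (at x) (0, 1)" for x
    have D: "(\<phi> has_derivative frechet_derivative \<phi> (at x)) (at x)" for x
      using C unfolding One_nat_def C_k.simps frechet_derivative_works by blast
    have c': "continuous_on X \<phi>'" for X
      using C unfolding One_nat_def C_k.simps \<phi>'_def[abs_def] by (meson continuous_on_subset subset_UNIV)
    have c\<phi>: "continuous_on X \<phi>" for X
      using D by (meson continuous_at_imp_continuous_on has_derivative_continuous)
    have z: "\<phi> x = 0" "\<phi>' x = 0" if "x \<notin> U" for x
      using that S closure_subset[of "{x. \<phi> x \<noteq> 0}"] frechet_derivative_zero_outside[of x \<phi>] unfolding \<phi>'_def by blast+
    define P where "P p = \<phi>' p *\<^sub>R \<eta> (fst p) (snd p)" for p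
    define Q where "Q p = \<phi> p *\<^sub>R \<omega> (fst p) (snd p)" for p
    have cP: "continuous_on R P" and cQ: "continuous_on R Q"
      unfolding P_def Q_def by (intro continuous_on_scaleR c' c\<phi> c\<eta> c\<omega>)+
    have Rm: "R \<in> sets lebesgue" unfolding R by simp
    have "(LINT x:U|lebesgue. \<phi>' x *\<^sub>R \<eta> (fst x) (snd x)) = integral R P"
      unfolding P_def
      by (rule set_lebesgue_integral_support(2))
        (use UR z open_rectangle_facts[OF cP[unfolded R_def] Rm] in \<open>auto simp: P_def[abs_def] R_def\<close>)
    moreover have "(LINT x:U|lebesgue. \<phi> x *\<^sub>R \<omega> (fst x) (snd x)) = integral R Q"
      unfolding Q_def
      by (rule set_lebesgue_integral_support(2))
        (use UR z open_rectangle_facts[OF cQ[unfolded R_def] Rm] in \<open>auto simp: Q_def[abs_def] R_def\<close>)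
    moreover have "integral R P + integral R Q = 0"
    proof -
      have "integral R P + integral R Q = integral R (\<lambda>p. P p + Q p)"
        unfolding R using cP cQ by (intro integral_add[symmetric] integrable_continuous) (simp_all add: R)
      also have "\<dots> = integral (cbox 0 L) (\<lambda>s. integral (cbox 0 T) (\<lambda>t. P (s, t) + Q (s, t)))"
        unfolding R using cP cQ by (intro integral_prod_continuous continuous_on_add) (simp_all add: R)
      also have "\<dots> = integral (cbox 0 L) (\<lambda>s. 0)"
      proof (rule integral_cong)
        fix s assume s: "s \<in> cbox 0 L"
        have "((\<lambda>t. \<phi> (s, t) *\<^sub>R \<eta> s t) has_vector_derivative \<phi> (s, t) *\<^sub>R \<omega> s t + \<phi>' (s, t) *\<^sub>R \<eta> s t) (at t within {0..T})"
          if t: "t \<in> {0..T}" for t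
        proof (rule has_vector_derivative_scaleR)
          have "((\<lambda>t. (s, t)) has_derivative (\<lambda>h. (0, h))) (at t)"
            by (intro derivative_eq_intros) auto
          then have "((\<lambda>t. \<phi> (s, t)) has_derivative (\<lambda>h. frechet_derivative \<phi> (at (s, t)) (0, h))) (at t)"
            by (rule has_derivative_compose[OF _ D])
          moreover have "frechet_derivative \<phi> (at (s, t)) (0, h) = \<phi>' (s, t) * h" for h
          proof -
            have "linear (frechet_derivative \<phi> (at (s, t)))" by (rule has_derivative_linear[OF D])
            from linear_scale[OF this, of h "(0, 1)"] show ?thesis by (simp add: \<phi>'_def mult.commute)
          qed
          ultimately have "((\<lambda>t. \<phi> (s, t)) has_real_derivative \<phi>' (s, t)) (at t)"
            by (simp add: has_field_derivative_def)
          then show "((\<lambda>t. \<phi> (s, t)) has_real_derivative \<phi>' (s, t)) (at t within {0..T})"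
            by (rule has_field_derivative_at_within)
          show "((\<lambda>t. \<eta> s t) has_vector_derivative \<omega> s t) (at t within {0..T})"
            using d[of s t] s t by simp
        qed
        then have "((\<lambda>t. \<phi> (s, t) *\<^sub>R \<omega> s t + \<phi>' (s, t) *\<^sub>R \<eta> s t) has_integral
            \<phi> (s, T) *\<^sub>R \<eta> s T - \<phi> (s, 0) *\<^sub>R \<eta> s 0) {0..T}"
          using T by (intro fundamental_theorem_of_calculus) auto
        moreover have "\<phi> (s, T) = 0" "\<phi> (s, 0) = 0" by (intro z; simp add: U_def)+
        ultimately show "integral (cbox 0 T) (\<lambda>t. P (s, t) + Q (s, t)) = 0"
          by (simp add: P_def Q_def add.commute integral_unique)
      qed
      finally show ?thesis by simp
    qed
    ultimately show "(LINT x:U|lebesgue. frechet_derivative \<phi> (at x) (0, 1) *\<^sub>R \<eta> (fst x) (snd x)) =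
        - (LINT x:U|lebesgue. \<phi> x *\<^sub>R \<omega> (fst x) (snd x))"
      unfolding \<phi>'_def[symmetric] by (simp add: add_eq_0_iff2)
  qed
  ultimately show ?thesis
    unfolding has_L2_time_deriv_def U_def case_prod_beta' by blast
qed

lemma H2_norm_nonneg: "0 \<le> H2_norm L f"
  unfolding H2_norm_def by simp

text \<open>For the curvature only the norm of differences in time is known to tend to 0. This gives
  a bound near each time, and compactness makes it global.\<close>

lemma locally_bounded_imp_bounded:
  fixes n :: "real \<Rightarrow> real"
  assumes "0 \<le> T" and "\<And>t. t \<in> {0..T} \<Longrightarrow> \<exists>d>0. \<exists>M. \<forall>u\<in>{0..T}. \<bar>u - t\<bar> < d \<longrightarrow> n u \<le> M"
  shows "\<exists>M. \<forall>u\<in>{0..T}. n u \<le> M"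
proof -
  define P where "P a b \<longleftrightarrow> (\<exists>M. \<forall>u\<in>{0..T}. a \<le> u \<and> u \<le> b \<longrightarrow> n u \<le> M)" for a b
  have "P 0 T"
  proof (rule Bolzano[OF assms(1)])
    fix a b c assume "P a b" "P b c"
    then obtain M M' where M: "\<forall>u\<in>{0..T}. a \<le> u \<and> u \<le> b \<longrightarrow> n u \<le> M" "\<forall>u\<in>{0..T}. b \<le> u \<and> u \<le> c \<longrightarrow> n u \<le> M'"
      unfolding P_def by blast
    show "P a c" unfolding P_def
    proof (intro exI ballI impI)
      fix u assume "u \<in> {0..T}" "a \<le> u \<and> u \<le> c"
      then show "n u \<le> max M M'" using M by (cases "u \<le> b") (auto simp: le_max_iff_disj)
    qed
  next
    fix x assume "0 \<le> x" "x \<le> T"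
    then have "x \<in> {0..T}" by simp
    from assms(2)[OF this] obtain d M where "0 < d" "\<forall>u\<in>{0..T}. \<bar>u - x\<bar> < d \<longrightarrow> n u \<le> M" by blast
    then show "\<exists>d>0. \<forall>a b. a \<le> x \<and> x \<le> b \<and> b - a < d \<longrightarrow> P a b"
      unfolding P_def by (intro exI[of _ d] conjI allI impI exI[of _ M] ballI) auto
  qed
  then show ?thesis unfolding P_def by auto
qed

text \<open>The core is continuity of the path in time with values in \<open>H2\<close>, since the
  squared norm of a difference is the sum of three integrals that tend to 0. Boundedness follows by
  compactness, and strong measurability by sampling the path on finer and finer grids.\<close>

lemma shape_path_X1:
  assumes L: "0 < L" and T: "0 < T" and sp: "shape_path L T \<rho> \<eta> \<omega> \<tau> h"
  shows "\<eta> \<in> X1_space L T" "has_L2_time_deriv L T \<eta> \<omega>"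
proof -
  have c\<eta>: "continuous_on ({0..L} \<times> {0..T}) (\<lambda>p. \<eta> (fst p) (snd p))"
    and c\<omega>: "continuous_on ({0..L} \<times> {0..T}) (\<lambda>p. \<omega> (fst p) (snd p))"
    and c\<tau>: "continuous_on ({0..L} \<times> {0..T}) (\<lambda>p. \<tau> (fst p) (snd p))"
    using sp unfolding shape_path_def by blast+
  have ds: "((\<lambda>\<sigma>. \<eta> \<sigma> t) has_vector_derivative \<tau> s t) (at s within {0..L})"
    and dt: "((\<lambda>u. \<eta> s u) has_vector_derivative \<omega> s t) (at t within {0..T})"
    and n1: "norm (\<tau> s t) = 1" and \<tau>: "\<tau> s t = \<tau> 0 t + integral {0..s} (\<lambda>r. h r t)"
    if "s \<in> {0..L}" "t \<in> {0..T}" for s t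
    using sp that unfolding shape_path_def by blast+
  have hL: "(\<lambda>s. h s t) \<in> L2 {0<..<L}"
    and hc: "((\<lambda>u. integral {0..L} (\<lambda>s. (norm (h s u - h s t))\<^sup>2)) \<longlongrightarrow> 0) (at t within {0..T})"
    if "t \<in> {0..T}" for t
    using sp that unfolding shape_path_def by blast+
  show td: "has_L2_time_deriv L T \<eta> \<omega>" by (rule has_L2_time_deriv_C1[OF L T c\<eta> c\<omega> dt])
  have h2: "(\<lambda>s. \<eta> s t) \<in> H2_curves L" if t: "t \<in> {0..T}" for t
    by (rule primitive_twice_H2(1)[OF L ds[OF _ t] \<tau>[OF _ t] hL[OF t]])
  have H2t: "(\<lambda>s. \<eta> s t) \<in> H2 L" if t: "t \<in> {0..T}" for t using h2[OF t] unfolding H2_curves_def by blast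
  have slice0: "((\<lambda>u. integral {0..L} (\<lambda>s. (norm (f s u - f s t))\<^sup>2)) \<longlongrightarrow> 0) (at t within {0..T})"
    if f: "continuous_on ({0..L} \<times> {0..T}) (\<lambda>p. f (fst p) (snd p))" and t: "t \<in> {0..T}" for f :: "real \<Rightarrow> real \<Rightarrow> real^2" and t
  proof -
    have "continuous_on ({0..L} \<times> {0..T}) (\<lambda>p. f (fst p) t)"
      by (rule continuous_on_compose2[OF continuous_on_slice[OF f t]]) (auto intro: continuous_intros)
    then have "continuous_on {0..T} (\<lambda>u. integral {0..L} (\<lambda>s. (norm (f s u - f s t))\<^sup>2))"
      by (intro continuous_on_integral_slice continuous_on_power continuous_on_norm continuous_on_diff f)
    then have "((\<lambda>u. integral {0..L} (\<lambda>s. (norm (f s u - f s t))\<^sup>2)) \<longlongrightarrow> integral {0..L} (\<lambda>s. (norm (f s t - f s t))\<^sup>2)) (at t within {0..T})"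
      using t unfolding continuous_on_def by blast
    then show ?thesis by simp
  qed
  \<comment> \<open>This is the distance in \<open>H2\<close> of the configurations at the times t
    and u. The difference of two configurations is again a twice repeated primitive, so its norm can
    be computed.\<close>
  define N where "N t u = H2_norm L (\<lambda>s. \<eta> s u - \<eta> s t)" for t u
  have N: "N t u = sqrt (integral {0..L} (\<lambda>s. (norm (\<eta> s u - \<eta> s t))\<^sup>2) + integral {0..L} (\<lambda>s. (norm (\<tau> s u - \<tau> s t))\<^sup>2)
      + integral {0..L} (\<lambda>s. (norm (h s u - h s t))\<^sup>2))" if t: "t \<in> {0..T}" and u: "u \<in> {0..T}" for t u
  proof -
    have "\<tau> s u - \<tau> s t = (\<tau> 0 u - \<tau> 0 t) + integral {0..s} (\<lambda>r. h r u - h r t)" if s: "s \<in> {0..L}" for s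
    proof -
      have "integral {0..s} (\<lambda>r. h r u - h r t) = integral {0..s} (\<lambda>r. h r u) - integral {0..s} (\<lambda>r. h r t)"
        using s by (intro integral_diff L2_integrable_on[OF hL[OF u]] L2_integrable_on[OF hL[OF t]]) auto
      then show ?thesis using \<tau>[OF s u] \<tau>[OF s t] by simp
    qed
    from primitive_twice_H2(2)[OF L has_vector_derivative_diff[OF ds[OF _ u] ds[OF _ t]] this L2_diff[OF hL[OF u] hL[OF t]]]
    have "(N t u)\<^sup>2 = integral {0..L} (\<lambda>s. (norm (\<eta> s u - \<eta> s t))\<^sup>2) + integral {0..L} (\<lambda>s. (norm (\<tau> s u - \<tau> s t))\<^sup>2)
      + integral {0..L} (\<lambda>s. (norm (h s u - h s t))\<^sup>2)" by (simp add: N_def)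
    then show ?thesis using H2_norm_nonneg unfolding N_def by (metis real_sqrt_unique)
  qed
  have Nlim: "(N t \<longlongrightarrow> 0) (at t within {0..T})" if t: "t \<in> {0..T}" for t
  proof -
    have "((\<lambda>u. sqrt (integral {0..L} (\<lambda>s. (norm (\<eta> s u - \<eta> s t))\<^sup>2) + integral {0..L} (\<lambda>s. (norm (\<tau> s u - \<tau> s t))\<^sup>2)
      + integral {0..L} (\<lambda>s. (norm (h s u - h s t))\<^sup>2))) \<longlongrightarrow> sqrt (0 + 0 + 0)) (at t within {0..T})"
      by (intro tendsto_real_sqrt tendsto_add slice0 c\<eta> c\<tau> hc t)
    moreover have "eventually (\<lambda>u. sqrt (integral {0..L} (\<lambda>s. (norm (\<eta> s u - \<eta> s t))\<^sup>2) + integral {0..L} (\<lambda>s. (norm (\<tau> s u - \<tau> s t))\<^sup>2)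
      + integral {0..L} (\<lambda>s. (norm (h s u - h s t))\<^sup>2)) = N t u) (at t within {0..T})"
      by (simp add: eventually_at_filter N[OF t])
    ultimately show ?thesis using Lim_transform_eventually by fastforce
  qed
  have N0: "N t t = 0" if "t \<in> {0..T}" for t using N[OF that that] by simp
  have bounded: "\<exists>M. \<forall>u\<in>{0..T}. H2_norm L (\<lambda>s. \<eta> s u) \<le> M"
  proof -
    define n where "n f u = integral {0..L} (\<lambda>s. (norm (f s u))\<^sup>2)" for f :: "real \<Rightarrow> real \<Rightarrow> real^2" and u
    have e: "H2_norm L (\<lambda>s. \<eta> s u) = sqrt (n \<eta> u + n \<tau> u + n h u)" if u: "u \<in> {0..T}" for u
      using primitive_twice_H2(2)[OF L ds[OF _ u] \<tau>[OF _ u] hL[OF u]] H2_norm_nonneg unfolding n_def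
      by (metis real_sqrt_unique)
    have cb: "\<exists>M. \<forall>u\<in>{0..T}. n f u \<le> M" if f: "continuous_on ({0..L} \<times> {0..T}) (\<lambda>p. f (fst p) (snd p))" for f
    proof -
      have "continuous_on {0..T} (n f)"
        unfolding n_def by (intro continuous_on_integral_slice continuous_on_power continuous_on_norm f)
      then have "bounded (n f ` {0..T})" by (intro compact_imp_bounded compact_continuous_image) auto
      then obtain a where "\<forall>x\<in>n f ` {0..T}. norm x \<le> a" unfolding bounded_iff by blast
      then show ?thesis by (intro exI[of _ a]) (auto simp: abs_le_iff)
    qed
    obtain A where A: "\<And>u. u \<in> {0..T} \<Longrightarrow> n \<eta> u \<le> A" using cb[OF c\<eta>] by blast
    obtain B where B: "\<And>u. u \<in> {0..T} \<Longrightarrow> n \<tau> u \<le> B" using cb[OF c\<tau>] by blast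
    have "\<exists>C. \<forall>u\<in>{0..T}. n h u \<le> C"
    proof (rule locally_bounded_imp_bounded)
      fix t assume t: "t \<in> {0..T}"
      have "eventually (\<lambda>u. integral {0..L} (\<lambda>s. (norm (h s u - h s t))\<^sup>2) < 1) (at t within {0..T})"
        using order_tendstoD(2)[OF hc[OF t], of 1] by simp
      then obtain d where d: "0 < d" "\<And>u. u \<in> {0..T} \<Longrightarrow> u \<noteq> t \<Longrightarrow> \<bar>u - t\<bar> < d \<Longrightarrow> integral {0..L} (\<lambda>s. (norm (h s u - h s t))\<^sup>2) < 1"
        unfolding eventually_at by (auto simp: dist_real_def)
      have "n h u \<le> 2 * 1 + 2 * n h t" if u: "u \<in> {0..T}" "\<bar>u - t\<bar> < d" for u
      proof -
        have i: "(\<lambda>s. (norm (h s u - h s t))\<^sup>2) integrable_on {0..L}" by (intro L2_sq_integrable L2_diff hL u t)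
        have j: "(\<lambda>s. (norm (h s t))\<^sup>2) integrable_on {0..L}" by (intro L2_sq_integrable hL t)
        have "n h u \<le> integral {0..L} (\<lambda>s. 2 * (norm (h s u - h s t))\<^sup>2 + 2 * (norm (h s t))\<^sup>2)"
          unfolding n_def
        proof (rule integral_le)
          show "(\<lambda>s. (norm (h s u))\<^sup>2) integrable_on {0..L}" by (intro L2_sq_integrable hL u)
          show "(\<lambda>s. 2 * (norm (h s u - h s t))\<^sup>2 + 2 * (norm (h s t))\<^sup>2) integrable_on {0..L}"
            by (intro integrable_add integrable_on_mult_right i j)
          show "(norm (h s u))\<^sup>2 \<le> 2 * (norm (h s u - h s t))\<^sup>2 + 2 * (norm (h s t))\<^sup>2" for s
            using norm_add_sq_le[of "h s u - h s t" "h s t"] by simp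
        qed
        also have "\<dots> = 2 * integral {0..L} (\<lambda>s. (norm (h s u - h s t))\<^sup>2) + 2 * n h t"
          unfolding n_def by (subst integral_add) (simp_all add: i j integrable_on_mult_right)
        also have "\<dots> \<le> 2 * 1 + 2 * n h t"
          using d(2)[OF u(1) _ u(2)] by (cases "u = t") auto
        finally show ?thesis .
      qed
      then show "\<exists>d>0. \<exists>M. \<forall>u\<in>{0..T}. \<bar>u - t\<bar> < d \<longrightarrow> n h u \<le> M" using d(1) by blast
    qed (use T in simp)
    then obtain C where C: "\<And>u. u \<in> {0..T} \<Longrightarrow> n h u \<le> C" by blast
    have "H2_norm L (\<lambda>s. \<eta> s u) \<le> sqrt (A + B + C)" if "u \<in> {0..T}" for u
      unfolding e[OF that] using A[OF that] B[OF that] C[OF that] by simp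
    then show ?thesis by blast
  qed
  have sm: "strongly_measurable_H2 L T \<eta>"
  proof -
    \<comment> \<open>Times are rounded down to a grid of mesh \<open>T / real (Suc n)\<close>, so
      that the sampled path takes finitely many values.\<close>
    define \<kappa> where "\<kappa> n t = real_of_int \<lfloor>real (Suc n) / T * t\<rfloor> * (T / real (Suc n))" for n t
    have \<kappa>: "\<kappa> n t \<in> {0..T}" "\<bar>\<kappa> n t - t\<bar> \<le> T * inverse (real (Suc n))" if t: "t \<in> {0<..<T}" for n t
    proof -
      define q where "q = T / real (Suc n)"
      have q: "0 < q" using T by (simp add: q_def)
      define x where "x = real (Suc n) / T * t"
      have x: "0 \<le> x" "x * q = t" using t T by (auto simp: x_def q_def)
      have "real_of_int \<lfloor>x\<rfloor> * q \<le> x * q" "(x - 1) * q \<le> real_of_int \<lfloor>x\<rfloor> * q"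
        using q by (intro mult_right_mono; linarith)+
      moreover have "0 \<le> real_of_int \<lfloor>x\<rfloor> * q" using q x by simp
      ultimately have "0 \<le> \<kappa> n t" "\<kappa> n t \<le> t" "t - q \<le> \<kappa> n t"
        unfolding \<kappa>_def x_def[symmetric] q_def[symmetric] using x by (simp_all add: left_diff_distrib)
      then show "\<kappa> n t \<in> {0..T}" "\<bar>\<kappa> n t - t\<bar> \<le> T * inverse (real (Suc n))" using t by (auto simp: q_def divide_inverse)
    qed
    define S where "S n t = (\<lambda>s. \<eta> s (\<kappa> n t))" for n t
    show ?thesis
      unfolding strongly_measurable_H2_def
    proof (intro exI[of _ S] conjI allI)
      fix n
      show "S n ` {0<..<T} \<subseteq> H2 L" unfolding S_def using H2t \<kappa> by blast
      \<comment> \<open>The upper bound \<open>int (Suc n)\<close> is generous; only finiteness of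
        the set of grid indices matters.\<close>
      have fl: "\<lfloor>real (Suc n) / T * t\<rfloor> \<in> {0..int (Suc n)}" if "t \<in> {0<..<T}" for t
      proof -
        have "0 \<le> real (Suc n) / T * t" using that T by simp
        moreover have "real (Suc n) * (t / T) \<le> real (Suc n) * 1" using that T by (intro mult_left_mono) auto
        ultimately have "0 \<le> real (Suc n) / T * t" "real (Suc n) / T * t \<le> real (Suc n)" by simp_all
        then show ?thesis by (auto simp: floor_le_iff simp del: of_nat_Suc)
      qed
      define g where "g j = (\<lambda>s. \<eta> s (real_of_int j * (T / real (Suc n))))" for j
      have Sg: "S n t = g \<lfloor>real (Suc n) / T * t\<rfloor>" for t by (simp add: S_def g_def \<kappa>_def)
      have "S n ` {0<..<T} \<subseteq> g ` {0..int (Suc n)}" using fl unfolding Sg by blast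
      then show "finite (S n ` {0<..<T})" by (rule finite_subset) simp
      fix u
      have "(\<lambda>t. \<lfloor>real (Suc n) / T * t\<rfloor>) \<in> measurable borel (count_space UNIV)" by measurable
      then have "(\<lambda>t. \<lfloor>real (Suc n) / T * t\<rfloor>) -` {j. g j = u} \<inter> space borel \<in> sets borel"
        by (rule measurable_sets) simp
      then have "{0<..<T} \<inter> ((\<lambda>t. \<lfloor>real (Suc n) / T * t\<rfloor>) -` {j. g j = u}) \<in> sets borel" by (intro sets.Int) simp_all
      moreover have "{t \<in> {0<..<T}. S n t = u} = {0<..<T} \<inter> ((\<lambda>t. \<lfloor>real (Suc n) / T * t\<rfloor>) -` {j. g j = u})"
        unfolding Sg by blast
      ultimately show "{t \<in> {0<..<T}. S n t = u} \<in> sets lebesgue" by simp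
    next
      show "AE t in lebesgue_on {0<..<T}. (\<lambda>n. H2_norm L (\<lambda>s. S n t s - \<eta> s t)) \<longlonglongrightarrow> 0"
      proof (rule AE_I2)
        fix t assume "t \<in> space (lebesgue_on {0<..<T})"
        then have t: "t \<in> {0<..<T}" by simp
        then have t': "t \<in> {0..T}" by simp
        have "(\<lambda>n. \<kappa> n t - t) \<longlonglongrightarrow> 0"
        proof (rule Lim_null_comparison)
          show "eventually (\<lambda>n. norm (\<kappa> n t - t) \<le> T * inverse (real (Suc n))) sequentially"
            using \<kappa>(2)[OF t] by (simp del: of_nat_Suc)
          show "(\<lambda>n. T * inverse (real (Suc n))) \<longlonglongrightarrow> 0"
            using tendsto_mult[OF tendsto_const[of T] LIMSEQ_inverse_real_of_nat] by simp
        qed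
        then have k: "(\<lambda>n. \<kappa> n t) \<longlonglongrightarrow> t" by (rule LIM_zero_cancel)
        have "continuous (at t within {0..T}) (N t)"
          unfolding continuous_within using Nlim[OF t'] N0[OF t'] by simp
        then have "(\<forall>n. \<kappa> n t \<in> {0..T}) \<and> (\<lambda>n. \<kappa> n t) \<longlonglongrightarrow> t \<longrightarrow> (N t \<circ> (\<lambda>n. \<kappa> n t)) \<longlonglongrightarrow> N t t"
          unfolding continuous_within_sequentially by (rule spec)
        then have "(N t \<circ> (\<lambda>n. \<kappa> n t)) \<longlonglongrightarrow> N t t"
          using k \<kappa>(1)[OF t] by simp
        then show "(\<lambda>n. H2_norm L (\<lambda>s. S n t s - \<eta> s t)) \<longlonglongrightarrow> 0"
          using N0[OF t'] by (simp add: o_def N_def S_def)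
      qed
    qed
  qed
  have L2c: "((\<lambda>t. L2_norm {0<..<L} (\<lambda>s. \<eta> s t - \<eta> s t\<^sub>0)) \<longlongrightarrow> 0) (at t\<^sub>0 within {0..T})" if t: "t\<^sub>0 \<in> {0..T}" for t\<^sub>0
  proof -
    have "L2_norm {0<..<L} (\<lambda>s. \<eta> s u - \<eta> s t\<^sub>0) = sqrt (integral {0..L} (\<lambda>s. (norm (\<eta> s u - \<eta> s t\<^sub>0))\<^sup>2))" if u: "u \<in> {0..T}" for u
    proof -
      have "(\<lambda>s. \<eta> s u - \<eta> s t\<^sub>0) \<in> L2 {0<..<L}"
        by (intro L2_continuous continuous_on_diff continuous_on_slice[OF c\<eta>] u t)
      then show ?thesis by (intro real_sqrt_unique[symmetric] L2_norm_sq) (simp_all add: L2_norm_def)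
    qed
    then have "eventually (\<lambda>u. sqrt (integral {0..L} (\<lambda>s. (norm (\<eta> s u - \<eta> s t\<^sub>0))\<^sup>2)) = L2_norm {0<..<L} (\<lambda>s. \<eta> s u - \<eta> s t\<^sub>0)) (at t\<^sub>0 within {0..T})"
      by (simp add: eventually_at_filter)
    moreover have "((\<lambda>u. sqrt (integral {0..L} (\<lambda>s. (norm (\<eta> s u - \<eta> s t\<^sub>0))\<^sup>2))) \<longlongrightarrow> sqrt 0) (at t\<^sub>0 within {0..T})"
      by (intro tendsto_real_sqrt slice0 c\<eta> t)
    ultimately show ?thesis using Lim_transform_eventually by fastforce
  qed
  have "\<eta> \<in> Linfty_H2 L T"
  proof -
    obtain M where "\<And>u. u \<in> {0..T} \<Longrightarrow> H2_norm L (\<lambda>s. \<eta> s u) \<le> M" using bounded by blast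
    then show ?thesis
      unfolding Linfty_H2_def using sm H2t by (auto intro!: AE_I2 exI[of _ M])
  qed
  then have "\<eta> \<in> X_space L T" unfolding X_space_def using td L2c h2 by blast
  moreover have "norm (sderiv L (\<lambda>\<sigma>. \<eta> \<sigma> t) s) = 1" if "s \<in> {0..L}" "t \<in> {0..T}" for s t
    using sderiv_eq[OF L that(1) ds[OF that]] n1[OF that] by simp
  ultimately show "\<eta> \<in> X1_space L T" unfolding X1_space_def by blast
qed

section \<open>The balance in its stated form\<close>

lemma outer_mult: "outer a b *v v = (b \<bullet> v) *\<^sub>R a"
  by (simp add: vec2_eq_iff matrix_vector_mult_def outer_def sum_2 inner_2 algebra_simps)

lemma K_mat_drag:
  assumes "sderiv L (\<lambda>\<sigma>. \<eta> \<sigma> t) s = \<tau>" "norm \<tau> = 1"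
  shows "K_mat Ct Cn L \<eta> s t *v v = drag Ct Cn \<tau> v"
proof -
  have e: "((J *v \<tau>) \<bullet> v) *\<^sub>R (J *v \<tau>) = v - (\<tau> \<bullet> v) *\<^sub>R \<tau>"
    using orthonormal_expansion[OF assms(2), of v] by (metis add_diff_cancel_left')
  have "K_mat Ct Cn L \<eta> s t *v v = Ct *\<^sub>R ((\<tau> \<bullet> v) *\<^sub>R \<tau>) + Cn *\<^sub>R (((J *v \<tau>) \<bullet> v) *\<^sub>R (J *v \<tau>))"
    by (simp add: K_mat_def Let_def assms(1) matrix_vector_mult_add_rdistrib scaleR_matrix_vector_assoc[symmetric] outer_mult)
  then show ?thesis unfolding e by (simp add: drag_def algebra_simps)
qed

theorem theorem4p1:
  fixes L T C\<^sub>\<tau> C\<^sub>\<nu> \<rho> :: real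
    and \<eta>_in \<eta>_fin :: "real \<Rightarrow> real^2"
  assumes "0 < L" and "0 < T"
    and "0 < C\<^sub>\<tau>" and "C\<^sub>\<tau> < C\<^sub>\<nu>" and "0 < \<rho>"
    and "\<eta>_in \<in> H2_curves L" and "\<eta>_fin \<in> H2_curves L"
    and "\<And>s. s \<in> {0..L} \<Longrightarrow> norm (sderiv L \<eta>_in s) = 1"
    and "\<And>s. s \<in> {0..L} \<Longrightarrow> norm (sderiv L \<eta>_fin s) = 1"
    and "two_disks L \<rho> \<eta>_in" and "two_disks L \<rho> \<eta>_fin"
  shows "\<exists>\<eta> \<in> X1_space L T. \<exists>\<omega>. has_L2_time_deriv L T \<eta> \<omega> \<and>
           (AE t in lebesgue_on {0..T}.
              has_bochner_integral (lebesgue_on {0..L})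
                (\<lambda>s. K_mat C\<^sub>\<tau> C\<^sub>\<nu> L \<eta> s t *v \<omega> s t) 0 \<and>
              has_bochner_integral (lebesgue_on {0..L})
                (\<lambda>s. (K_mat C\<^sub>\<tau> C\<^sub>\<nu> L \<eta> s t *v \<omega> s t) \<bullet> (J *v \<eta> s t)) 0) \<and>
           (\<forall>s\<in>{0..L}. \<eta> s 0 = \<eta>_in s \<and> \<eta> s T = \<eta>_fin s) \<and>
           (\<forall>t\<in>{0..T}. two_disks L \<rho> (\<lambda>s. \<eta> s t))"
proof -
  note L = assms(1) and T = assms(2) and \<rho> = assms(5)
  obtain \<tau>1 h1 where 1: "curve_data L \<eta>_in \<tau>1 h1" using H2_curve_data[OF L assms(6,8)] by blast
  obtain \<tau>2 h2 where 2: "curve_data L \<eta>_fin \<tau>2 h2" using H2_curve_data[OF L assms(7,9)] by blast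
  have "thick L \<rho> \<eta>_in \<tau>1" by (rule two_disks_imp_thick[OF L \<rho> _ assms(10)]) (use 1 in \<open>simp add: curve_data_def\<close>)
  moreover have "thick L \<rho> \<eta>_fin \<tau>2" by (rule two_disks_imp_thick[OF L \<rho> _ assms(11)]) (use 2 in \<open>simp add: curve_data_def\<close>)
  ultimately have "reach L \<rho> C\<^sub>\<tau> C\<^sub>\<nu> \<eta>_in \<eta>_fin"
    by (rule reach_between_thick_curves[OF L \<rho> assms(3,4) 1 _ 2])
  then obtain \<xi> w \<tau>0 h0 where m0: "motion L 1 \<rho> C\<^sub>\<tau> C\<^sub>\<nu> \<xi> w \<tau>0 h0" and ends: "\<And>s. s \<in> {0..L} \<Longrightarrow> \<xi> s 0 = \<eta>_in s \<and> \<xi> s 1 = \<eta>_fin s"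
    unfolding reach_def by blast
  \<comment> \<open>Unit time is stretched to the prescribed duration; the balance is homogeneous in
    the velocity.\<close>
  have "((\<lambda>t. t / T) has_vector_derivative 1 / T) (at t within {0..T})" for t
    using T by (auto intro!: derivative_eq_intros simp: has_real_derivative_iff_has_vector_derivative[symmetric])
  from motion_reparam[OF m0 _ this continuous_on_const]
  obtain \<eta> \<omega> \<tau> h where m: "motion L T \<rho> C\<^sub>\<tau> C\<^sub>\<nu> \<eta> \<omega> \<tau> h" and \<eta>: "\<eta> = (\<lambda>s t. \<xi> s (t / T))"
    using T by auto
  have sp: "shape_path L T \<rho> \<eta> \<omega> \<tau> h" using m unfolding motion_def by blast
  have us: "unit_speed L (\<lambda>s. \<eta> s t) (\<lambda>s. \<tau> s t)" if "t \<in> {0..T}" for t by (rule shape_path_unit_speed[OF sp that])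
  have b: "has_bochner_integral (lebesgue_on {0..L}) (\<lambda>s. K_mat C\<^sub>\<tau> C\<^sub>\<nu> L \<eta> s t *v \<omega> s t) 0 \<and>
      has_bochner_integral (lebesgue_on {0..L}) (\<lambda>s. (K_mat C\<^sub>\<tau> C\<^sub>\<nu> L \<eta> s t *v \<omega> s t) \<bullet> (J *v \<eta> s t)) 0"
    if t: "t \<in> {0..T}" for t
  proof -
    have K: "K_mat C\<^sub>\<tau> C\<^sub>\<nu> L \<eta> s t *v \<omega> s t = drag C\<^sub>\<tau> C\<^sub>\<nu> (\<tau> s t) (\<omega> s t)" if s: "s \<in> {0..L}" for s
      using us[OF t] s by (intro K_mat_drag sderiv_eq[OF L s]) (auto simp: unit_speed_def)
    have c: "continuous_on {0..L} (\<lambda>s. \<eta> s t)" "continuous_on {0..L} (\<lambda>s. \<omega> s t)" "continuous_on {0..L} (\<lambda>s. \<tau> s t)"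
      using sp t unfolding shape_path_def by (blast intro: continuous_on_slice)+
    \<comment> \<open>The integrands are continuous in s, so a vanishing gauge integral gives the
      Bochner statement, including integrability.\<close>
    have i: "has_bochner_integral (lebesgue_on {0..L}) f 0" if "continuous_on {0..L} f" "integral {0..L} f = 0" for f :: "real \<Rightarrow> real"
      using continuous_imp_integrable_real[OF that(1)] that(2) by (simp add: has_bochner_integral_iff lebesgue_integral_eq_integral)
    have i2: "has_bochner_integral (lebesgue_on {0..L}) f 0" if "continuous_on {0..L} f" "integral {0..L} f = 0" for f :: "real \<Rightarrow> real^2"
      using continuous_imp_integrable_real[OF that(1)] that(2) by (simp add: has_bochner_integral_iff lebesgue_integral_eq_integral)
    have bal: "balanced L C\<^sub>\<tau> C\<^sub>\<nu> (\<lambda>s. \<eta> s t) (\<lambda>s. \<tau> s t) (\<lambda>s. \<omega> s t)" using m t unfolding motion_def by blast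
    have cd: "continuous_on {0..L} (\<lambda>s. drag C\<^sub>\<tau> C\<^sub>\<nu> (\<tau> s t) (\<omega> s t))" by (intro continuous_on_drag c)
    have cm: "continuous_on {0..L} (\<lambda>s. drag C\<^sub>\<tau> C\<^sub>\<nu> (\<tau> s t) (\<omega> s t) \<bullet> (J *v \<eta> s t))"
      by (intro continuous_on_inner cd continuous_on_J c)
    have "integral {0..L} (\<lambda>s. K_mat C\<^sub>\<tau> C\<^sub>\<nu> L \<eta> s t *v \<omega> s t) = integral {0..L} (\<lambda>s. drag C\<^sub>\<tau> C\<^sub>\<nu> (\<tau> s t) (\<omega> s t))"
      "integral {0..L} (\<lambda>s. (K_mat C\<^sub>\<tau> C\<^sub>\<nu> L \<eta> s t *v \<omega> s t) \<bullet> (J *v \<eta> s t)) =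
       integral {0..L} (\<lambda>s. drag C\<^sub>\<tau> C\<^sub>\<nu> (\<tau> s t) (\<omega> s t) \<bullet> (J *v \<eta> s t))"
      by (rule integral_cong, simp add: K)+
    then have "integral {0..L} (\<lambda>s. K_mat C\<^sub>\<tau> C\<^sub>\<nu> L \<eta> s t *v \<omega> s t) = 0"
      "integral {0..L} (\<lambda>s. (K_mat C\<^sub>\<tau> C\<^sub>\<nu> L \<eta> s t *v \<omega> s t) \<bullet> (J *v \<eta> s t)) = 0"
      using bal unfolding balanced_def by simp_all
    moreover have "continuous_on {0..L} (\<lambda>s. K_mat C\<^sub>\<tau> C\<^sub>\<nu> L \<eta> s t *v \<omega> s t)"
      by (rule continuous_on_eq[OF cd]) (simp add: K)
    moreover have "continuous_on {0..L} (\<lambda>s. (K_mat C\<^sub>\<tau> C\<^sub>\<nu> L \<eta> s t *v \<omega> s t) \<bullet> (J *v \<eta> s t))"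
      by (rule continuous_on_eq[OF cm]) (simp add: K)
    ultimately show ?thesis
      using i i2 by blast
  qed
  have "two_disks L \<rho> (\<lambda>s. \<eta> s t)" if t: "t \<in> {0..T}" for t
    by (rule thick_imp_two_disks[OF L \<rho> us[OF t]]) (use sp t in \<open>auto simp: shape_path_def\<close>)
  moreover have "\<eta> s 0 = \<eta>_in s \<and> \<eta> s T = \<eta>_fin s" if "s \<in> {0..L}" for s
    using ends[OF that] T by (simp add: \<eta>)
  \<comment> \<open>The constructed motion is in balance at every time, in particular almost
    everywhere.\<close>
  moreover have "AE t in lebesgue_on {0..T}. has_bochner_integral (lebesgue_on {0..L}) (\<lambda>s. K_mat C\<^sub>\<tau> C\<^sub>\<nu> L \<eta> s t *v \<omega> s t) 0 \<and>
      has_bochner_integral (lebesgue_on {0..L}) (\<lambda>s. (K_mat C\<^sub>\<tau> C\<^sub>\<nu> L \<eta> s t *v \<omega> s t) \<bullet> (J *v \<eta> s t)) 0"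
    by (rule AE_I2) (simp add: b)
  ultimately show ?thesis using shape_path_X1[OF L T sp] by blast
qed

end
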